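(* Suppose that there are exactly two outgoing arcs, $\mathcal O=\{h_1,h_2\}$. Let $\gamma_{h_1j}\in(0,1)$ and $\gamma_{h_2j}=1-\gamma_{h_1j}$ for $j\in\mathcal I$. Then there exists $k_0>0$ such that for each $k\in(0,k_0)$ there exist $K_{ih_1}>0$, $i\in\mathcal I$, such that, for the symmetric family $\{K_{ij}\}_{i,j\in\mathcal M}$ with these values of $K_{ih_1}=K_{h_1i}$, with $K_{ih_2}=K_{h_2i}=k$ for $i\in\mathcal I$, and with $K_{ij}=0$ whenever $i\ne j$ and $i,j\in\mathcal I$ or $i,j\in\mathcal O$, the limit of the vanishing viscosity approximation satisfies $$\lambda_iu_i(0,t)=\sum_{j\in\mathcal I}\gamma_{ij}\lambda_ju_j(L_j,t)\qquad\text{for } i=h_1,h_2.$$ That is: for every $u_0\in BV(\mathcal A)$, every $B_i\in\mathbb R$ ($i\in\mathcal I$), every decreasing sequence $\epsilon_n\to0$ of positive numbers, every admissible approximation $\{u_0^{\epsilon_n}\}$ of $u_0$ and every $T>0$, the solutions $u^{\epsilon_n}$ of the parabolic problems $(P_n)$ with these $K_{ij}$ converge in $L^1(\mathcal A\times(0,T))$ to the solution of the transport problem $(H_\gamma)$ with the given $\gamma_{ij}$.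
   Context: Network. $\mathcal M=\{1,\dots,m\}$ is the disjoint union of two nonempty sets $\mathcal I$ (arcs incoming in the inner node $N$) and $\mathcal O$ (arcs outgoing from $N$). For $i\in\mathcal M$, $L_i>0$, $I_i=(0,L_i)$, $\lambda_i>0$. For a function $f_i$ on $I_i$ (with traces), $f_i(N)$ means $f_i(L_i)$ if $i\in\mathcal I$ and $f_i(0)$ if $i\in\mathcal O$. Set $\beta_i=1$ if $i\in\mathcal I$, $\beta_i=-1$ if $i\in\mathcal O$. (The diagonal values $K_{ii}\ge 0$ play no role.) Spaces. $L^p(\mathcal A)$, $W^{k,p}(\mathcal A)$, $BV(\mathcal A)$, $L^1(\mathcal A\times(0,T))$, $BV(\mathcal A\times(0,T))$ denote the $m$-tuples $f=(f_1,\dots,f_m)$ with $f_i$ in $L^p(I_i)$, $W^{k,p}(I_i)$, $BV(I_i)$, $L^1(I_i\times(0,T))$, $BV(I_i\times(0,T))$ respectively, with norm $\|f\|=\sum_{i\in\mathcal M}\|f_i\|$. Admissible approximation of $u_0$ (for given $K_{ij}$, $B_i$, $\epsilon_n$): a sequence $\{u_0^{\epsilon_n}\}$ with $u_0^{\epsilon_n}\in W^{2,1}(\mathcal A)$, $u^{\epsilon_n}_{0i}(0)=B_i$ for $i\in\mathcal I$, $\beta_i\big(-\lambda_i u_{0i}^{\epsilon_n}(N)+\epsilon_n (u_{0i}^{\epsilon_n})_x(N)\big)=\sum_{j\in\mathcal M}K_{ij}\big(u^{\epsilon_n}_{0j}(N)-u^{\epsilon_n}_{0i}(N)\big)$ for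 $i\in\mathcal M$, such that $u_0^{\epsilon_n}\to u_0$ in $L^1(\mathcal A)$, $\|(u_0^{\epsilon_n})_x\|_{L^1(\mathcal A)}$ is bounded by a quantity depending on $\|u_0\|_{BV(\mathcal A)}$ and independent of $n$, and $\epsilon_n\|u_0^{\epsilon_n}\|_{W^{2,1}(\mathcal A)}$ is bounded independently of $n$. Problem $(P_n)$: find $u^{\epsilon_n}\in C([0,+\infty);W^{2,1}(\mathcal A))\cap C^1([0,+\infty);L^1(\mathcal A))$ with, for all $i\in\mathcal M$ and $t>0$, $$(u_i^{\epsilon_n})_t=-\lambda_i (u_i^{\epsilon_n})_x+\epsilon_n (u_i^{\epsilon_n})_{xx}\ \text{ in } I_i,\qquad u_i^{\epsilon_n}(x,0)=u_{0i}^{\epsilon_n}(x),$$ $$\beta_i\big(-\lambda_i u_i^{\epsilon_n}(N,t)+\epsilon_n (u_i^{\epsilon_n})_x(N,t)\big)=\sum_{j\in\mathcal M}K_{ij}\big(u_j^{\epsilon_n}(N,t)-u_i^{\epsilon_n}(N,t)\big),$$ $$u_i^{\epsilon_n}(0,t)=B_i\ (i\in\mathcal I),\qquad u_i^{\epsilon_n}(L_i,t)=u_{0i}^{\epsilon_n}(L_i)\ (i\in\mathcal O).$$ (This problem has a unique solution.) Problem $(H_\gamma)$: $u_{i,t}=-\lambda_i u_{i,x}$ in $I_i$ ($i\in\mathcal M$), $u_i(x,0)=u_{0i}(x)$, $u_i(0,t)=B_i$ for $i\in\mathcal I$, $\lambda_i u_i(0,t)=\sum_{j\in\mathcal I}\gamma_{ij}\lambda_j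 u_j(L_j,t)$ for $i\in\mathcal O$. A solution on $(0,T)$ is a function $u\in BV(\mathcal A\times(0,T))$ such that for all $\phi_i\in C^1_0([0,L_i)\times[0,T))$ (compactly supported), $$\int_0^T\!\!\int_{I_i}u_i(\phi_{i,t}+\lambda_i\phi_{i,x})\,dx\,dt+\int_{I_i}u_{0i}(x)\phi_i(x,0)\,dx=-\lambda_iB_i\int_0^T\phi_i(0,t)\,dt,\quad i\in\mathcal I,$$ $$\int_0^T\!\!\int_{I_i}u_i(\phi_{i,t}+\lambda_i\phi_{i,x})\,dx\,dt+\int_{I_i}u_{0i}(x)\phi_i(x,0)\,dx=-\int_0^T\phi_i(0,t)\sum_{j\in\mathcal I}\gamma_{ij}\lambda_ju_j(L_j,t)\,dt,\quad i\in\mathcal O,$$ where $u_j(L_j,\cdot)$ is the trace of the $BV$ function $u_j$. (Such a solution exists and is unique.) *)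

theory Defs
  imports "HOL-Analysis.Analysis"
begin

section \<open>Function spaces\<close>

text \<open>
  Elements of Lebesgue, Sobolev and \<open>BV\<close> spaces are represented by arbitrary measurable
  representatives; all notions below are invariant under changes on null sets.
\<close>

definition L1 :: "'a::euclidean_space set \<Rightarrow> ('a \<Rightarrow> real) \<Rightarrow> bool" where
  "L1 \<Omega> f \<longleftrightarrow> set_integrable lborel \<Omega> f"

definition L1_norm :: "'a::euclidean_space set \<Rightarrow> ('a \<Rightarrow> real) \<Rightarrow> real" where
  "L1_norm \<Omega> f = (LINT z:\<Omega>|lborel. \<bar>f z\<bar>)"

text \<open>
  \<open>\<phi>\<close> is continuously differentiable on \<open>S\<close> with Frechet derivative \<open>D\<close>, and has compact
  support in \<open>S\<close>. The set \<open>S\<close> need not be open: for \<open>S = [0,L) \<times> [0,T)\<close> the function \<open>\<phi>\<close>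
  need not vanish on the sides \<open>x = 0\<close> and \<open>t = 0\<close>. Values outside \<open>S\<close> are irrelevant.
\<close>

definition C1_compact_support ::
  "'a::euclidean_space set \<Rightarrow> ('a \<Rightarrow> 'b::euclidean_space) \<Rightarrow> ('a \<Rightarrow> 'a \<Rightarrow> 'b) \<Rightarrow> bool" where
  "C1_compact_support S \<phi> D \<longleftrightarrow>
     (\<forall>z\<in>S. (\<phi> has_derivative D z) (at z within S)) \<and>
     (\<forall>v. continuous_on S (\<lambda>z. D z v)) \<and>
     (\<exists>C. compact C \<and> C \<subseteq> S \<and> (\<forall>z\<in>S - C. \<phi> z = 0))"

text \<open>\<open>BV(\<Omega>)\<close> for open \<open>\<Omega>\<close>: integrable functions of finite total variation, where the total
  variation is the supremum of the integrals of \<open>f div \<phi>\<close> over test fields with \<open>|\<phi>| \<le> 1\<close>.\<close>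

definition BV :: "'a::euclidean_space set \<Rightarrow> ('a \<Rightarrow> real) \<Rightarrow> bool" where
  "BV \<Omega> f \<longleftrightarrow> L1 \<Omega> f \<and>
     bdd_above {LINT z:\<Omega>|lborel. f z * (\<Sum>b\<in>Basis. D z b \<bullet> b) | (\<phi> :: 'a \<Rightarrow> 'a) D.
       C1_compact_support \<Omega> \<phi> D \<and> (\<forall>z\<in>\<Omega>. norm (\<phi> z) \<le> 1)}"

text \<open>
  The trace at a boundary point \<open>p\<close>: the number \<open>c\<close> such that the integral of \<open>|f - c|\<close> over
  \<open>B(p,r) \<inter> \<Omega>\<close> is of smaller order than \<open>r\<close> to the power of the dimension, which is the order of
  the measure of \<open>B(p,r) \<inter> \<Omega>\<close> for the domains considered here (intervals and rectangles).
  It exists for almost every boundary point if \<open>f \<in> BV(\<Omega>)\<close>. On an interval, for \<open>f\<close> in \<open>W\<^sup>1\<^sup>,\<^sup>1\<close>,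
  it is the value at the end point \<open>p\<close> of the continuous representative of \<open>f\<close>.
\<close>

definition bdry_trace :: "'a::euclidean_space set \<Rightarrow> ('a \<Rightarrow> real) \<Rightarrow> 'a \<Rightarrow> real" where
  "bdry_trace \<Omega> f p = (THE c.
     ((\<lambda>r. (LINT z:(ball p r \<inter> \<Omega>)|lborel. \<bar>f z - c\<bar>) / r ^ DIM('a)) \<longlongrightarrow> 0) (at_right 0))"

definition is_weak_deriv :: "real set \<Rightarrow> (real \<Rightarrow> real) \<Rightarrow> (real \<Rightarrow> real) \<Rightarrow> bool" where
  "is_weak_deriv \<Omega> f g \<longleftrightarrow> L1 \<Omega> f \<and> L1 \<Omega> g \<and>
     (\<forall>\<phi> D. C1_compact_support \<Omega> \<phi> D \<longrightarrow>
        (LINT x:\<Omega>|lborel. f x * D x 1) = - (LINT x:\<Omega>|lborel. g x * \<phi> x))"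

text \<open>Unique up to null sets, so the choice of a representative does not matter.\<close>

definition weak_deriv :: "real set \<Rightarrow> (real \<Rightarrow> real) \<Rightarrow> real \<Rightarrow> real" where
  "weak_deriv \<Omega> f = (SOME g. is_weak_deriv \<Omega> f g)"

definition W21 :: "real set \<Rightarrow> (real \<Rightarrow> real) \<Rightarrow> bool" where
  "W21 \<Omega> f \<longleftrightarrow> (\<exists>g h. is_weak_deriv \<Omega> f g \<and> is_weak_deriv \<Omega> g h)"

definition W21_norm :: "real set \<Rightarrow> (real \<Rightarrow> real) \<Rightarrow> real" where
  "W21_norm \<Omega> f = L1_norm \<Omega> f + L1_norm \<Omega> (weak_deriv \<Omega> f)
     + L1_norm \<Omega> (weak_deriv \<Omega> (weak_deriv \<Omega> f))"

text \<open>Curves \<open>[0,\<infinity>) \<rightarrow> X\<close>, \<open>t \<mapsto> U t\<close>, for \<open>X = L\<^sup>1(\<Omega>)\<close> and \<open>X = W\<^sup>2\<^sup>,\<^sup>1(\<Omega>)\<close>.\<close>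

definition C0_L1 :: "real set \<Rightarrow> (real \<Rightarrow> real \<Rightarrow> real) \<Rightarrow> bool" where
  "C0_L1 \<Omega> U \<longleftrightarrow> (\<forall>t\<ge>0. L1 \<Omega> (U t)) \<and>
     (\<forall>t\<ge>0. ((\<lambda>s. L1_norm \<Omega> (\<lambda>x. U s x - U t x)) \<longlongrightarrow> 0) (at t within {0..}))"

definition C0_W21 :: "real set \<Rightarrow> (real \<Rightarrow> real \<Rightarrow> real) \<Rightarrow> bool" where
  "C0_W21 \<Omega> U \<longleftrightarrow> (\<forall>t\<ge>0. W21 \<Omega> (U t)) \<and>
     (\<forall>t\<ge>0. ((\<lambda>s. W21_norm \<Omega> (\<lambda>x. U s x - U t x)) \<longlongrightarrow> 0) (at t within {0..}))"

text \<open>\<open>U\<close> is a \<open>C\<^sup>1\<close> curve in \<open>L\<^sup>1(\<Omega>)\<close> with derivative \<open>V\<close>.\<close>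

definition C1_L1 :: "real set \<Rightarrow> (real \<Rightarrow> real \<Rightarrow> real) \<Rightarrow> (real \<Rightarrow> real \<Rightarrow> real) \<Rightarrow> bool" where
  "C1_L1 \<Omega> U V \<longleftrightarrow> C0_L1 \<Omega> U \<and> C0_L1 \<Omega> V \<and>
     (\<forall>t\<ge>0. ((\<lambda>s. L1_norm \<Omega> (\<lambda>x. (U s x - U t x) / (s - t) - V t x)) \<longlongrightarrow> 0) (at t within {0..}))"

text \<open>Convergence in \<open>L\<^sup>1\<close> of tuples indexed by \<open>A\<close>, the \<open>i\<close>-th entry living on \<open>\<Omega> i\<close>.\<close>

definition L1_tendsto ::
  "nat set \<Rightarrow> (nat \<Rightarrow> 'a::euclidean_space set) \<Rightarrow> (nat \<Rightarrow> nat \<Rightarrow> 'a \<Rightarrow> real) \<Rightarrow> (nat \<Rightarrow> 'a \<Rightarrow> real) \<Rightarrow> bool"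
  where
  "L1_tendsto A \<Omega> f g \<longleftrightarrow> (\<forall>i\<in>A. (\<forall>n. L1 (\<Omega> i) (f n i)) \<and> L1 (\<Omega> i) (g i)) \<and>
     (\<lambda>n. \<Sum>i\<in>A. L1_norm (\<Omega> i) (\<lambda>z. f n i z - g i z)) \<longlonglongrightarrow> 0"


section \<open>The network problems\<close>

text \<open>
  Parameters: \<open>Inc\<close>, \<open>Out\<close> the sets of incoming and outgoing arcs; \<open>L\<close> lengths; \<open>vel\<close> the speeds \<open>\<lambda>\<^sub>i\<close>;
  \<open>K\<close> transmission coefficients; \<open>B\<close> boundary data (used on \<open>Inc\<close> only); \<open>\<gamma>\<close> distribution
  coefficients. Functions on an arc times a time interval take pairs \<open>(x,t)\<close>.
\<close>

abbreviation edge :: "(nat \<Rightarrow> real) \<Rightarrow> nat \<Rightarrow> real set" where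
  "edge L i \<equiv> {0<..<L i}"

definition node :: "nat set \<Rightarrow> (nat \<Rightarrow> real) \<Rightarrow> nat \<Rightarrow> real" where
  "node Inc L i = (if i \<in> Inc then L i else 0)"

definition orient :: "nat set \<Rightarrow> nat \<Rightarrow> real" where
  "orient Inc i = (if i \<in> Inc then 1 else -1)"

text \<open>The condition \<open>\<beta>\<^sub>i(-\<lambda>\<^sub>i f\<^sub>i(N) + \<epsilon> (f\<^sub>i)\<^sub>x(N)) = \<Sum>\<^sub>j K\<^sub>i\<^sub>j (f\<^sub>j(N) - f\<^sub>i(N))\<close> on all arcs.\<close>

definition transmission ::
  "nat set \<Rightarrow> nat set \<Rightarrow> (nat \<Rightarrow> real) \<Rightarrow> (nat \<Rightarrow> real) \<Rightarrow> (nat \<Rightarrow> nat \<Rightarrow> real) \<Rightarrow> real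
    \<Rightarrow> (nat \<Rightarrow> real \<Rightarrow> real) \<Rightarrow> bool" where
  "transmission Inc Out L vel K \<epsilon> f \<longleftrightarrow> (\<forall>i\<in>Inc \<union> Out.
     orient Inc i * (- vel i * bdry_trace (edge L i) (f i) (node Inc L i)
        + \<epsilon> * bdry_trace (edge L i) (weak_deriv (edge L i) (f i)) (node Inc L i))
     = (\<Sum>j\<in>Inc \<union> Out. K i j *
         (bdry_trace (edge L j) (f j) (node Inc L j) - bdry_trace (edge L i) (f i) (node Inc L i))))"

text \<open>
  \<open>v n\<close> is the \<open>n\<close>-th approximation of \<open>u0\<close>. As \<open>u0\<close> is fixed, a bound independent of \<open>n\<close>
  by a quantity depending on the \<open>BV\<close> norm of \<open>u0\<close> is a bound by a constant.
\<close>

definition admissible_approx ::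
  "nat set \<Rightarrow> nat set \<Rightarrow> (nat \<Rightarrow> real) \<Rightarrow> (nat \<Rightarrow> real) \<Rightarrow> (nat \<Rightarrow> nat \<Rightarrow> real) \<Rightarrow> (nat \<Rightarrow> real)
    \<Rightarrow> (nat \<Rightarrow> real) \<Rightarrow> (nat \<Rightarrow> real \<Rightarrow> real) \<Rightarrow> (nat \<Rightarrow> nat \<Rightarrow> real \<Rightarrow> real) \<Rightarrow> bool" where
  "admissible_approx Inc Out L vel K B \<epsilon> u0 v \<longleftrightarrow>
     (\<forall>n. (\<forall>i\<in>Inc \<union> Out. W21 (edge L i) (v n i)) \<and>
          (\<forall>i\<in>Inc. bdry_trace (edge L i) (v n i) 0 = B i) \<and>
          transmission Inc Out L vel K (\<epsilon> n) (v n)) \<and>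
     L1_tendsto (Inc \<union> Out) (edge L) v u0 \<and>
     (\<exists>C. \<forall>n. (\<Sum>i\<in>Inc \<union> Out. L1_norm (edge L i) (weak_deriv (edge L i) (v n i))) \<le> C) \<and>
     (\<exists>C. \<forall>n. \<epsilon> n * (\<Sum>i\<in>Inc \<union> Out. W21_norm (edge L i) (v n i)) \<le> C)"

text \<open>
  Problem \<open>(P\<^sub>n)\<close> with initial datum \<open>v\<close>. A curve with values in \<open>L\<^sup>1\<close> is regarded as a function
  of \<open>(x,t)\<close>; this requires the representatives at different times to be chosen such that
  \<open>u i\<close> is jointly measurable, which is always possible.
\<close>

definition solves_parabolic ::
  "nat set \<Rightarrow> nat set \<Rightarrow> (nat \<Rightarrow> real) \<Rightarrow> (nat \<Rightarrow> real) \<Rightarrow> (nat \<Rightarrow> nat \<Rightarrow> real) \<Rightarrow> (nat \<Rightarrow> real)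
    \<Rightarrow> real \<Rightarrow> (nat \<Rightarrow> real \<Rightarrow> real) \<Rightarrow> (nat \<Rightarrow> real \<times> real \<Rightarrow> real) \<Rightarrow> bool" where
  "solves_parabolic Inc Out L vel K B \<epsilon> v u \<longleftrightarrow>
     (\<forall>i\<in>Inc \<union> Out.
        set_borel_measurable lborel (edge L i \<times> {0<..}) (u i) \<and>
        C0_W21 (edge L i) (\<lambda>t x. u i (x, t)) \<and>
        (\<exists>V. C1_L1 (edge L i) (\<lambda>t x. u i (x, t)) V \<and>
           (\<forall>t>0. AE x in lborel. x \<in> edge L i \<longrightarrow>
              V t x = - vel i * weak_deriv (edge L i) (\<lambda>x. u i (x, t)) x
                + \<epsilon> * weak_deriv (edge L i) (weak_deriv (edge L i) (\<lambda>x. u i (x, t))) x)) \<and>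
        (AE x in lborel. x \<in> edge L i \<longrightarrow> u i (x, 0) = v i x)) \<and>
     (\<forall>t>0. transmission Inc Out L vel K \<epsilon> (\<lambda>i x. u i (x, t)) \<and>
        (\<forall>i\<in>Inc. bdry_trace (edge L i) (\<lambda>x. u i (x, t)) 0 = B i) \<and>
        (\<forall>i\<in>Out. bdry_trace (edge L i) (\<lambda>x. u i (x, t)) (L i) = bdry_trace (edge L i) (v i) (L i)))"

text \<open>
  Problem \<open>(H\<^sub>\<gamma>)\<close> on \<open>(0,T)\<close>. Here \<open>D (x,t) (1,0)\<close> and \<open>D (x,t) (0,1)\<close> are the partial
  derivatives of the test function in \<open>x\<close> and in \<open>t\<close>.
\<close>

definition solves_transport ::
  "nat set \<Rightarrow> nat set \<Rightarrow> (nat \<Rightarrow> real) \<Rightarrow> (nat \<Rightarrow> real) \<Rightarrow> (nat \<Rightarrow> nat \<Rightarrow> real) \<Rightarrow> (nat \<Rightarrow> real)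
    \<Rightarrow> (nat \<Rightarrow> real \<Rightarrow> real) \<Rightarrow> real \<Rightarrow> (nat \<Rightarrow> real \<times> real \<Rightarrow> real) \<Rightarrow> bool" where
  "solves_transport Inc Out L vel \<gamma> B u0 T u \<longleftrightarrow>
     (\<forall>i\<in>Inc \<union> Out. BV (edge L i \<times> {0<..<T}) (u i)) \<and>
     (\<forall>i\<in>Inc. \<forall>\<phi> D. C1_compact_support ({0..<L i} \<times> {0..<T}) \<phi> D \<longrightarrow>
        (LINT z:(edge L i \<times> {0<..<T})|lborel. u i z * (D z (0, 1) + vel i * D z (1, 0)))
          + (LINT x:edge L i|lborel. u0 i x * \<phi> (x, 0))
        = - vel i * B i * (LINT t:{0<..<T}|lborel. \<phi> (0, t))) \<and>
     (\<forall>i\<in>Out. \<forall>\<phi> D. C1_compact_support ({0..<L i} \<times> {0..<T}) \<phi> D \<longrightarrow>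
        (LINT z:(edge L i \<times> {0<..<T})|lborel. u i z * (D z (0, 1) + vel i * D z (1, 0)))
          + (LINT x:edge L i|lborel. u0 i x * \<phi> (x, 0))
        = - (LINT t:{0<..<T}|lborel. \<phi> (0, t) *
              (\<Sum>j\<in>Inc. \<gamma> i j * vel j * bdry_trace (edge L j \<times> {0<..<T}) (u j) (L j, t))))"

end

theory Submission
  imports Defs
begin

text \<open>
  The viscous problem contracts the distance in \<open>L\<^sup>1\<close>: Kato's inequality on each arc reduces this to the
  node, where symmetry and nonnegativity of the \<open>K\<^sub>i\<^sub>j\<close> suffice. A function which satisfies the viscous
  problem up to a small residual is therefore close to the solution. Such a function is
  \<open>P\<^sub>i(t - x/\<lambda>\<^sub>i)\<close>, a smooth solution of the transport problem, plus a multiple of \<open>exp(\<lambda>\<^sub>i(x - L\<^sub>i)/\<epsilon>)\<close>.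
  This boundary layer has \<open>L\<^sup>1\<close> norm \<open>O(\<epsilon>)\<close> and no flux to leading order, so that on the incoming arcs
  it makes the value at the node free while the flux \<open>f\<^sub>i = \<lambda>\<^sub>i P\<^sub>i(t - L\<^sub>i/\<lambda>\<^sub>i)\<close> stays; on the outgoing arcs it
  adjusts the Dirichlet datum. As \<open>\<epsilon> \<rightarrow> 0\<close> the transmission conditions thus become linear equations
  for the node values \<open>W\<^sub>i\<close>: \<open>-f\<^sub>i = \<Sum>\<^sub>j K\<^sub>i\<^sub>j (W\<^sub>j - W\<^sub>i)\<close> for incoming and \<open>\<lambda>\<^sub>i W\<^sub>i = \<Sum>\<^sub>j K\<^sub>i\<^sub>j (W\<^sub>j - W\<^sub>i)\<close> for
  outgoing arcs. For small \<open>k\<close> the \<open>K\<^sub>j\<^sub>h\<^sub>1\<close> can be chosen such that their solution satisfies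
  \<open>\<lambda>\<^sub>i W\<^sub>i = \<Sum>\<^sub>j \<gamma>\<^sub>i\<^sub>j f\<^sub>j\<close>. Data of bounded variation are approximated in \<open>L\<^sup>1\<close> by smooth profiles.
\<close>

section \<open>Smooth approximation in \<open>L\<^sup>1\<close> of an interval\<close>

text \<open>No compactness of the viscous solutions is used. For fixed smooth data an explicit
  competitor gives an error of order eps with a constant depending on the smoothing, so eps tends to
  0 first and the smoothing parameter afterwards. The obstacle is the low regularity: viscous
  solutions are C^1 curves in L^1 with node conditions at positive times. Hence the error is tested
  with its own sign at one time against a backward difference quotient, and the result is integrated
  by a left Dini argument. Layers sit at the outlets because characteristics leave there; at the
  inlet of an outgoing arc the value is carried inwards, so the node value is that of the limit. The
  coupling is one-way: the fluxes f_j come from the incoming arcs alone and the node values depend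
  linearly on them, so the limit is explicit. There BV data enter as differences of bounded monotone
  functions, which give traces at the node for all but countably many times.\<close>

lemma DERIV_max_power:
  fixes x :: real
  shows "((\<lambda>x. (max 0 x) ^ Suc (Suc n)) has_real_derivative real (Suc (Suc n)) * (max 0 x) ^ Suc n) (at x)"
proof -
  consider "x < 0" | "x > 0" | "x = 0" by linarith
  then show ?thesis
  proof cases
    case 1
    have "((\<lambda>x. 0) has_real_derivative real (Suc (Suc n)) * (max 0 x) ^ Suc n) (at x)"
      using 1 by (auto simp: max_def)
    then show ?thesis
      by (rule has_field_derivative_transform_within_open[where S = "{..<0}"]) (use 1 in \<open>auto simp: max_def\<close>)
  next
    case 2
    have "((\<lambda>x. x ^ Suc (Suc n)) has_real_derivative real (Suc (Suc n)) * x ^ Suc n) (at x)"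
      using DERIV_pow[of "Suc (Suc n)" x] by simp
    then have "((\<lambda>x. x ^ Suc (Suc n)) has_real_derivative real (Suc (Suc n)) * (max 0 x) ^ Suc n) (at x)"
      using 2 by (simp add: max_def)
    then show ?thesis
      by (rule has_field_derivative_transform_within_open[where S = "{0<..}"]) (use 2 in \<open>auto simp: max_def\<close>)
  next
    case 3
    have "((\<lambda>y. (max 0 y ^ Suc (Suc n)) / y) \<longlongrightarrow> 0) (at (0::real))"
    proof (rule Lim_null_comparison[where g = "\<lambda>y. \<bar>y\<bar> ^ Suc n"])
      have "norm (max 0 y ^ Suc (Suc n) / y) \<le> \<bar>y\<bar> ^ Suc n" for y :: real
      proof (cases "y \<le> 0")
        case True
        then have "max 0 y = 0" by simp
        then show ?thesis by (simp del: power_Suc)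
      qed (auto simp: max_def)
      then show "\<forall>\<^sub>F y in at (0::real). norm (max 0 y ^ Suc (Suc n) / y) \<le> \<bar>y\<bar> ^ Suc n"
        by simp
      have "((\<lambda>y::real. \<bar>y\<bar> ^ Suc n) \<longlongrightarrow> \<bar>0\<bar> ^ Suc n) (at 0)"
        by (intro tendsto_intros)
      then show "((\<lambda>y::real. \<bar>y\<bar> ^ Suc n) \<longlongrightarrow> 0) (at 0)" by simp
    qed
    then show ?thesis unfolding 3 has_field_derivative_iff by simp
  qed
qed

text \<open>The primitive of the quadratic cardinal B-spline with knots 0, 1, 2, 3: the numbers 1,
  -3, 3, -1 are the coefficients of the third difference, which turns x^3/6 into the constant 1
  beyond the last knot. Two derivatives are continuous, and the first one serves again as mollifying
  kernel.\<close>

definition spline_step :: "real \<Rightarrow> real" where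
  "spline_step x = ((max 0 x)^3 - 3 * (max 0 (x-1))^3 + 3 * (max 0 (x-2))^3 - (max 0 (x-3))^3) / 6"

definition spline_step1 :: "real \<Rightarrow> real" where
  "spline_step1 x = ((max 0 x)^2 - 3 * (max 0 (x-1))^2 + 3 * (max 0 (x-2))^2 - (max 0 (x-3))^2) / 2"

definition spline_step2 :: "real \<Rightarrow> real" where
  "spline_step2 x = max 0 x - 3 * max 0 (x-1) + 3 * max 0 (x-2) - max 0 (x-3)"

lemma DERIV_max_cube: "((\<lambda>x. (max 0 (x - c)) ^ 3) has_real_derivative 3 * (max 0 (x - c)) ^ 2) (at x)" for x c :: real
proof -
  have "((\<lambda>x. x - c) has_real_derivative 1) (at x)" by (auto intro!: derivative_eq_intros)
  then show ?thesis
    using DERIV_chain2[where f = "\<lambda>x. (max 0 x) ^ Suc (Suc 1)" and g = "\<lambda>x. x - c", OF DERIV_max_power[of 1 "x - c"], of 1 UNIV]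
    by (simp add: eval_nat_numeral)
qed

lemma DERIV_max_square: "((\<lambda>x. (max 0 (x - c)) ^ 2) has_real_derivative 2 * (max 0 (x - c))) (at x)" for x c :: real
proof -
  have "((\<lambda>x. x - c) has_real_derivative 1) (at x)" by (auto intro!: derivative_eq_intros)
  then show ?thesis
    using DERIV_chain2[where f = "\<lambda>x. (max 0 x) ^ Suc (Suc 0)" and g = "\<lambda>x. x - c", OF DERIV_max_power[of 0 "x - c"], of 1 UNIV]
    by (simp add: eval_nat_numeral)
qed

lemma DERIV_spline_step: "(spline_step has_real_derivative spline_step1 x) (at x)"
  unfolding spline_step_def[abs_def] spline_step1_def
  by (rule DERIV_cong[OF DERIV_cdivide[OF DERIV_diff[OF DERIV_add[OF DERIV_diff[OF
        DERIV_max_cube[of 0 x, unfolded diff_0_right]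
        DERIV_cmult[OF DERIV_max_cube[of 1 x], of 3]] DERIV_cmult[OF DERIV_max_cube[of 2 x], of 3]]
        DERIV_max_cube[of 3 x]], of 6]]) (simp add: field_simps)

lemma DERIV_spline_step1: "(spline_step1 has_real_derivative spline_step2 x) (at x)"
  unfolding spline_step1_def[abs_def] spline_step2_def
  by (rule DERIV_cong[OF DERIV_cdivide[OF DERIV_diff[OF DERIV_add[OF DERIV_diff[OF
        DERIV_max_square[of 0 x, unfolded diff_0_right]
        DERIV_cmult[OF DERIV_max_square[of 1 x], of 3]] DERIV_cmult[OF DERIV_max_square[of 2 x], of 3]]
        DERIV_max_square[of 3 x]], of 2]]) (simp add: field_simps)

lemma continuous_spline_step2: "continuous_on S spline_step2"
  unfolding spline_step2_def[abs_def] by (intro continuous_intros)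

lemma continuous_spline_step1: "continuous_on S spline_step1"
  unfolding spline_step1_def[abs_def] by (intro continuous_intros) auto

lemma spline_step_left: "x \<le> 0 \<Longrightarrow> spline_step x = 0"
  by (simp add: spline_step_def max_def)

lemma spline_step_right: "x \<ge> 3 \<Longrightarrow> spline_step x = 1"
  by (auto simp: spline_step_def max_def field_simps power3_eq_cube)

lemma spline_step1_left: "x \<le> 0 \<Longrightarrow> spline_step1 x = 0"
  by (simp add: spline_step1_def max_def)

lemma spline_step1_right: "x \<ge> 3 \<Longrightarrow> spline_step1 x = 0"
  by (auto simp: spline_step1_def max_def field_simps power2_eq_square)

lemma spline_step1_nonneg: "spline_step1 x \<ge> 0"
proof -
  consider "x \<le> 0" | "0 < x" "x \<le> 1" | "1 < x" "x \<le> 2" | "2 < x" "x \<le> 3" | "3 < x" by linarith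
  then show ?thesis
  proof cases
    case 3
    then have "x\<^sup>2 - 3 * (x-1)\<^sup>2 = 3/2 - 2 * (x - 3/2)\<^sup>2" by (simp add: power2_eq_square field_simps)
    moreover have "(x - 3/2)\<^sup>2 \<le> (1/2)\<^sup>2" using 3 by (intro abs_le_square_iff[THEN iffD1]) (simp add: abs_if)
    ultimately show ?thesis using 3 by (simp add: spline_step1_def max_def power2_eq_square)
  next
    case 4
    then have "x\<^sup>2 - 3 * (x-1)\<^sup>2 + 3 * (x-2)\<^sup>2 = (3 - x)\<^sup>2" by (simp add: power2_eq_square field_simps)
    then show ?thesis using 4 by (simp add: spline_step1_def max_def)
  qed (auto simp: spline_step1_def max_def power2_eq_square algebra_simps)
qed

lemma spline_step_mono: "x \<le> y \<Longrightarrow> spline_step x \<le> spline_step y"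
  by (rule DERIV_nonneg_imp_nondecreasing) (use DERIV_spline_step spline_step1_nonneg in blast)+

lemma spline_step_bounds: "0 \<le> spline_step x" "spline_step x \<le> 1"
  using spline_step_mono[of 0 x] spline_step_left[of 0] spline_step_left[of x]
    spline_step_mono[of x 3] spline_step_right[of 3] spline_step_right[of x]
  by (cases "x \<le> 0"; cases "x \<le> 3"; auto)+

text \<open>The regularity used by the error analysis: the second derivative of a profile produces
  the residual \<open>eps\<close> P'' of the viscous equation, and it controls backward difference
  quotients in time uniformly in space.\<close>

definition C2b :: "(real \<Rightarrow> real) \<Rightarrow> bool" where
  "C2b p \<longleftrightarrow> (\<exists>p1 p2 M. (\<forall>x. (p has_real_derivative p1 x) (at x)) \<and>
     (\<forall>x. (p1 has_real_derivative p2 x) (at x)) \<and> continuous_on UNIV p2 \<and>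
     (\<forall>x. \<bar>p x\<bar> \<le> M \<and> \<bar>p1 x\<bar> \<le> M \<and> \<bar>p2 x\<bar> \<le> M))"

lemma C2bE:
  assumes "C2b p"
  obtains p1 p2 M where "\<And>x. (p has_real_derivative p1 x) (at x)" "\<And>x. (p1 has_real_derivative p2 x) (at x)"
    "continuous_on UNIV p2" "\<And>x. \<bar>p x\<bar> \<le> M" "\<And>x. \<bar>p1 x\<bar> \<le> M" "\<And>x. \<bar>p2 x\<bar> \<le> M"
  using assms unfolding C2b_def by blast

lemma C2bI:
  assumes "\<And>x. (p has_real_derivative p1 x) (at x)" "\<And>x. (p1 has_real_derivative p2 x) (at x)"
    "continuous_on UNIV p2" "\<And>x. \<bar>p x\<bar> \<le> M0" "\<And>x. \<bar>p1 x\<bar> \<le> M1" "\<And>x. \<bar>p2 x\<bar> \<le> M2"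
  shows "C2b p"
  unfolding C2b_def
proof (intro exI conjI allI)
  fix x
  show "\<bar>p x\<bar> \<le> max M0 (max M1 M2)" "\<bar>p1 x\<bar> \<le> max M0 (max M1 M2)" "\<bar>p2 x\<bar> \<le> max M0 (max M1 M2)"
    using assms(4-6)[of x] by auto
qed (use assms in auto)

lemma C2b_bounded: "C2b p \<Longrightarrow> \<exists>M. \<forall>x. \<bar>p x\<bar> \<le> M"
  unfolding C2b_def by (elim exE conjE) (rule exI, blast)

lemma C2b_const: "C2b (\<lambda>x. c)"
  by (rule C2bI[where ?p1.0 = "\<lambda>_. 0" and ?p2.0 = "\<lambda>_. 0" and ?M0.0 = "\<bar>c\<bar>" and ?M1.0 = 0 and ?M2.0 = 0]) auto

lemma C2b_add:
  assumes "C2b p" "C2b q" shows "C2b (\<lambda>x. p x + q x)"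
proof -
  obtain p1 p2 M where p: "\<And>x. (p has_real_derivative p1 x) (at x)" "\<And>x. (p1 has_real_derivative p2 x) (at x)"
    "continuous_on UNIV p2" "\<And>x. \<bar>p x\<bar> \<le> M" "\<And>x. \<bar>p1 x\<bar> \<le> M" "\<And>x. \<bar>p2 x\<bar> \<le> M"
    using C2bE[OF assms(1)] by metis
  obtain q1 q2 N where q: "\<And>x. (q has_real_derivative q1 x) (at x)" "\<And>x. (q1 has_real_derivative q2 x) (at x)"
    "continuous_on UNIV q2" "\<And>x. \<bar>q x\<bar> \<le> N" "\<And>x. \<bar>q1 x\<bar> \<le> N" "\<And>x. \<bar>q2 x\<bar> \<le> N"
    using C2bE[OF assms(2)] by metis
  show ?thesis
  proof (rule C2bI[where ?p1.0 = "\<lambda>x. p1 x + q1 x" and ?p2.0 = "\<lambda>x. p2 x + q2 x"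
        and ?M0.0 = "M + N" and ?M1.0 = "M + N" and ?M2.0 = "M + N"])
  qed (use p q in \<open>auto intro!: derivative_eq_intros continuous_intros order.trans[OF abs_triangle_ineq] add_mono\<close>)
qed

lemma C2b_mult:
  assumes "C2b p" "C2b q" shows "C2b (\<lambda>x. p x * q x)"
proof -
  obtain p1 p2 M where p: "\<And>x. (p has_real_derivative p1 x) (at x)" "\<And>x. (p1 has_real_derivative p2 x) (at x)"
    "continuous_on UNIV p2" "\<And>x. \<bar>p x\<bar> \<le> M" "\<And>x. \<bar>p1 x\<bar> \<le> M" "\<And>x. \<bar>p2 x\<bar> \<le> M"
    using C2bE[OF assms(1)] by metis
  obtain q1 q2 N where q: "\<And>x. (q has_real_derivative q1 x) (at x)" "\<And>x. (q1 has_real_derivative q2 x) (at x)"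
    "continuous_on UNIV q2" "\<And>x. \<bar>q x\<bar> \<le> N" "\<And>x. \<bar>q1 x\<bar> \<le> N" "\<And>x. \<bar>q2 x\<bar> \<le> N"
    using C2bE[OF assms(2)] by metis
  have b: "\<bar>u * v\<bar> \<le> M * N" if "\<bar>u\<bar> \<le> M" "\<bar>v\<bar> \<le> N" for u v
    using that by (simp add: abs_mult mult_mono)
  have cont: "continuous_on UNIV f" if "\<And>x. (f has_real_derivative f' x) (at x)" for f f' :: "real \<Rightarrow> real"
    using that by (meson DERIV_isCont continuous_at_imp_continuous_on)
  show ?thesis
  proof (rule C2bI[where ?p1.0 = "\<lambda>x. p1 x * q x + p x * q1 x" and
        ?p2.0 = "\<lambda>x. (p2 x * q x + p1 x * q1 x) + (p1 x * q1 x + p x * q2 x)"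
        and ?M0.0 = "M * N" and ?M1.0 = "M * N + M * N" and ?M2.0 = "(M * N + M * N) + (M * N + M * N)"])
    show "continuous_on UNIV (\<lambda>x. (p2 x * q x + p1 x * q1 x) + (p1 x * q1 x + p x * q2 x))"
      using p q cont[OF p(1)] cont[OF p(2)] cont[OF q(1)] cont[OF q(2)] by (intro continuous_intros)
    show "((\<lambda>x. p x * q x) has_real_derivative p1 x * q x + p x * q1 x) (at x)" for x
      by (rule derivative_eq_intros p q | simp)+
    show "((\<lambda>x. p1 x * q x + p x * q1 x) has_real_derivative
        (p2 x * q x + p1 x * q1 x) + (p1 x * q1 x + p x * q2 x)) (at x)" for x
      by (rule derivative_eq_intros p q | simp)+
  qed (intro b p q order.trans[OF abs_triangle_ineq] add_mono)+
qed

lemma C2b_affine: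
  assumes "C2b p" shows "C2b (\<lambda>x. p (a * x + b))"
proof -
  obtain p1 p2 M where p: "\<And>x. (p has_real_derivative p1 x) (at x)" "\<And>x. (p1 has_real_derivative p2 x) (at x)"
    "continuous_on UNIV p2" "\<And>x. \<bar>p x\<bar> \<le> M" "\<And>x. \<bar>p1 x\<bar> \<le> M" "\<And>x. \<bar>p2 x\<bar> \<le> M"
    using C2bE[OF assms(1)] by metis
  have aff: "((\<lambda>x. a * x + b) has_real_derivative a) (at x)" for x
    by (auto intro!: derivative_eq_intros)
  show ?thesis
  proof (rule C2bI[where ?p1.0 = "\<lambda>x. a * p1 (a * x + b)" and ?p2.0 = "\<lambda>x. a * (a * p2 (a * x + b))"
        and ?M0.0 = "M" and ?M1.0 = "\<bar>a\<bar> * M" and ?M2.0 = "\<bar>a\<bar> * (\<bar>a\<bar> * M)"])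
    show "((\<lambda>x. p (a * x + b)) has_real_derivative a * p1 (a * x + b)) (at x)" for x
      using DERIV_chain2[OF p(1) aff] by (metis mult.commute)
    show "((\<lambda>x. a * p1 (a * x + b)) has_real_derivative a * (a * p2 (a * x + b))) (at x)" for x
      using DERIV_cmult[OF DERIV_chain2[OF p(2) aff], of a] by (simp only: mult.commute[of a])
    show "continuous_on UNIV (\<lambda>x. a * (a * p2 (a * x + b)))"
      by (intro continuous_intros continuous_on_compose2[OF p(3)]) auto
  qed (use p in \<open>auto simp: abs_mult intro!: mult_left_mono\<close>)
qed

lemma C2b_cmult: "C2b p \<Longrightarrow> C2b (\<lambda>x. c * p x)"
  using C2b_mult[OF C2b_const[of c]] by simp

lemma C2b_sum: "(\<And>i. i \<in> A \<Longrightarrow> C2b (f i)) \<Longrightarrow> C2b (\<lambda>x. \<Sum>i\<in>A. f i x)"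
  by (induction A rule: infinite_finite_induct) (auto intro: C2b_const C2b_add)

lemma C2b_continuous: "C2b p \<Longrightarrow> continuous_on S p"
  by (meson C2bE DERIV_isCont continuous_at_imp_continuous_on)

lemma C2b_borel: "C2b p \<Longrightarrow> p \<in> borel_measurable borel"
  by (intro borel_measurable_continuous_onI C2b_continuous)

lemma C2b_spline_step: "C2b spline_step"
proof (rule C2bI[OF DERIV_spline_step DERIV_spline_step1 continuous_spline_step2])
  show "\<bar>spline_step x\<bar> \<le> 1" for x using spline_step_bounds[of x] by simp
  \<comment> \<open>On [0,3] each truncated square is at most 9 and the absolute values of the four
    coefficients add up to 8; any finite bound would do.\<close>
  show "\<bar>spline_step1 x\<bar> \<le> 9 * 8" for x
  proof (cases "0 \<le> x \<and> x \<le> 3")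
    case True
    have m: "\<bar>max 0 (x - c)\<bar> \<le> 3" if "c \<ge> 0" for c using True that by (auto simp: max_def)
    have sq: "(max 0 (x - c))\<^sup>2 \<le> 3\<^sup>2" if "c \<ge> 0" for c using m[OF that] by (intro power_mono) auto
    have aux: "\<bar>(a - 3 * b + 3 * c - d) / 2\<bar> \<le> 9 * 8"
      if "a \<le> 9" "b \<le> 9" "c \<le> 9" "d \<le> 9" "0 \<le> a" "0 \<le> b" "0 \<le> c" "0 \<le> d" for a b c d :: real
      using that by (auto simp: abs_le_iff field_simps)
    from sq[of 0] sq[of 1] sq[of 2] sq[of 3]
    have "(max 0 x)\<^sup>2 \<le> 9" "(max 0 (x - 1))\<^sup>2 \<le> 9" "(max 0 (x - 2))\<^sup>2 \<le> 9" "(max 0 (x - 3))\<^sup>2 \<le> 9"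
      by simp_all
    then show ?thesis
      using zero_le_power2[of "max 0 x"] zero_le_power2[of "max 0 (x-1)"] zero_le_power2[of "max 0 (x-2)"]
        zero_le_power2[of "max 0 (x-3)"]
      unfolding spline_step1_def by (intro aux)
  qed (use spline_step1_left[of x] spline_step1_right[of x] in auto)
  show "\<bar>spline_step2 x\<bar> \<le> 20" for x
    by (auto simp: spline_step2_def max_def)
qed

text \<open>Each factor climbs within the distance 3/n inside the interval, so the bump vanishes
  outside for every n and still tends to the indicator of the open interval at every point. For d <=
  c both are 0.\<close>

definition bump :: "nat \<Rightarrow> real \<Rightarrow> real \<Rightarrow> real \<Rightarrow> real" where
  "bump n c d x = spline_step (real n * (x - c)) * spline_step (real n * (d - x))"

lemma C2b_bump: "C2b (bump n c d)"
  unfolding bump_def[abs_def]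
  using C2b_mult[OF C2b_affine[OF C2b_spline_step, of "real n" "- real n * c"]
      C2b_affine[OF C2b_spline_step, of "- real n" "real n * d"]]
  by (simp add: algebra_simps)

lemma bump_abs_le: "\<bar>bump n c d x\<bar> \<le> 1"
  unfolding bump_def using spline_step_bounds[of "real n * (x - c)"] spline_step_bounds[of "real n * (d - x)"]
  by (simp add: abs_mult mult_le_one)

lemma bump_zero: "x \<le> c \<or> x \<ge> d \<Longrightarrow> bump n c d x = 0"
  unfolding bump_def by (auto intro!: spline_step_left mult_nonneg_nonpos)

lemma bump_tendsto: "(\<lambda>n. bump n c d x) \<longlonglongrightarrow> indicator {c<..<d} x"
proof (cases "x \<in> {c<..<d}")
  case True
  have ev: "\<forall>\<^sub>F n in sequentially. real n * y \<ge> 3" if "y > 0" for y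
  proof -
    have "filterlim (\<lambda>n. real n * y) at_top sequentially"
      using that by (simp add: filterlim_at_top_mult_tendsto_pos[OF tendsto_const _ filterlim_real_sequentially])
    then show ?thesis by (simp add: filterlim_at_top)
  qed
  have "\<forall>\<^sub>F n in sequentially. bump n c d x = 1"
  proof (rule eventually_mono[OF eventually_conj[OF ev[of "x - c"] ev[of "d - x"]]])
  qed (use True in \<open>auto simp: bump_def spline_step_right\<close>)
  then show ?thesis using True by (simp add: tendsto_eventually)
next
  case False
  then show ?thesis by (auto simp: bump_zero not_less)
qed

section \<open>Dynkin arguments: null functions and density of smooth functions\<close>

lemma integrable_bounded_support:
  fixes f :: "'a::euclidean_space \<Rightarrow> real"
  assumes "f \<in> borel_measurable borel" "bounded A" "A \<in> sets borel" "\<And>x. x \<notin> A \<Longrightarrow> f x = 0" "\<And>x. \<bar>f x\<bar> \<le> M"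
  shows "integrable lborel f"
proof (rule Bochner_Integration.integrable_bound[where f = "\<lambda>x. M * indicator A x"])
  show "integrable lborel (\<lambda>x. M * indicator A x)"
    using assms emeasure_bounded_finite[of A] by (intro integrable_mult_right integrable_real_indicator) auto
  show "AE x in lborel. norm (f x) \<le> norm (M * indicator A x)"
    using assms by (auto simp: indicator_def intro!: AE_I2 order.trans[OF assms(5)])
qed (use assms in auto)

text \<open>The Borel sets over which the integral vanishes form a Dynkin system: the whole space
  belongs to it by dominated convergence along growing boxes, and disjoint unions by countable
  additivity. Boxes are an intersection-stable generator of the Borel sets.\<close>

lemma AE_zero_if_box_integrals_zero:
  fixes f :: "'a::euclidean_space \<Rightarrow> real"
  assumes f: "integrable lborel f"
    and box: "\<And>a b. (LINT x:box a b|lborel. f x) = 0"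
  shows "AE x in lborel. f x = 0"
proof -
  have si: "set_integrable lborel A f" if "A \<in> sets borel" for A
    unfolding set_integrable_def using integrable_mult_indicator[OF _ f, of A] that by simp
  have U: "(LINT x:UNIV|lborel. f x) = 0"
  proof -
    define bx where "bx n = box (- (real n *\<^sub>R One)) (real n *\<^sub>R (One::'a))" for n
    have "(\<lambda>n. integral\<^sup>L lborel (\<lambda>x. indicator (bx n) x * f x)) \<longlonglongrightarrow> integral\<^sup>L lborel f"
    proof (rule integral_dominated_convergence[where w = "\<lambda>x. \<bar>f x\<bar>"])
      show "AE x in lborel. (\<lambda>n. indicator (bx n) x * f x) \<longlonglongrightarrow> f x"
      proof (rule AE_I2)
        fix x :: 'a
        have "\<forall>\<^sub>F n in sequentially. x \<in> bx n"
        proof (rule eventually_sequentiallyI)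
          fix n assume n: "nat \<lceil>infnorm x + 1\<rceil> \<le> n"
          then have "infnorm x < real n" by linarith
          then have "\<bar>x \<bullet> i\<bar> < real n" if "i \<in> Basis" for i
            using Basis_le_infnorm[OF that, of x] by simp
          then show "x \<in> bx n" unfolding bx_def mem_box by (force simp: abs_less_iff)
        qed
        then have "\<forall>\<^sub>F n in sequentially. indicator (bx n) x * f x = f x" by eventually_elim simp
        then show "(\<lambda>n. indicator (bx n) x * f x) \<longlonglongrightarrow> f x" by (rule tendsto_eventually)
      qed
      show "(\<lambda>x. indicator (bx n) x * f x) \<in> borel_measurable lborel" for n
        using f by (auto simp: bx_def)
    qed (use f in \<open>auto simp: indicator_def\<close>)
    moreover have "integral\<^sup>L lborel (\<lambda>x. indicator (bx n) x * f x) = 0" for n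
      using box unfolding bx_def set_lebesgue_integral_def by (simp add: scaleR_conv_of_real)
    ultimately have "integral\<^sup>L lborel f = 0" by (simp add: LIMSEQ_const_iff)
    then show ?thesis by (simp add: set_lebesgue_integral_def)
  qed
  have "(LINT x:A|lborel. f x) = 0" if "A \<in> sets borel" for A
  proof -
    let ?G = "range (\<lambda>(a, b). box a b) :: 'a set set"
    have "Int_stable ?G"
    proof (rule Int_stableI)
      fix X Y assume "X \<in> ?G" "Y \<in> ?G"
      then obtain a b c d where XY: "X = box a b" "Y = box c d" by auto
      show "X \<inter> Y \<in> ?G" unfolding XY box_Int_box by auto
    qed
    moreover have "?G \<subseteq> Pow UNIV" by simp
    moreover have "A \<in> sigma_sets UNIV ?G" using that by (simp add: borel_eq_box)
    ultimately show ?thesis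
    proof (induction rule: sigma_sets_induct_disjoint)
      case (basic A) then show ?case using box by auto
    next
      case empty then show ?case by (simp add: set_lebesgue_integral_def)
    next
      case (compl A)
      have A: "A \<in> sets borel" using compl.hyps by (simp add: borel_eq_box)
      have "(LINT x:A \<union> (UNIV - A)|lborel. f x) = (LINT x:A|lborel. f x) + (LINT x:UNIV - A|lborel. f x)"
        by (rule set_integral_Un) (use A si in auto)
      then show ?case using U compl.IH by simp
    next
      case (union A)
      have A: "A i \<in> sets borel" for i using union.hyps by (auto simp: borel_eq_box)
      have "(LINT x:(\<Union>i. A i)|lborel. f x) = (\<Sum>i. (LINT x:A i|lborel. f x))"
      proof (rule lebesgue_integral_countable_add)
        show "set_integrable lborel (\<Union>i. A i) f" using A by (intro si) auto
      qed (use union.hyps A in \<open>auto simp: disjoint_family_on_def\<close>)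
      then show ?case using union.IH by simp
    qed
  qed
  then have "AE x in lborel. f x = (\<lambda>_. 0) x"
    using f by (intro density_unique_real) (auto simp: set_lebesgue_integral_def)
  then show ?thesis by simp
qed

text \<open>The approximable functions are closed under sums, multiples and dominated limits, which
  reduces the claim to indicators of Borel sets; there the Dynkin argument starts from intervals.
  The approximants vanish outside \<open>{a<..<b}\<close>, so that boundary values can later be
  attached without interference.\<close>

lemma C2b_dense:
  fixes f :: "real \<Rightarrow> real"
  assumes "integrable lborel f" "\<eta> > 0"
  shows "\<exists>p. C2b p \<and> (\<forall>x. x \<notin> {a<..<b} \<longrightarrow> p x = 0) \<and>
           (LINT x|lborel. \<bar>indicator {a<..<b} x * f x - p x\<bar>) < \<eta>"
  using assms
proof (induction arbitrary: \<eta> rule: integrable_induct)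
  have int_p: "integrable lborel p" if p: "C2b p" "\<forall>x. x \<notin> {a<..<b} \<longrightarrow> p x = 0" for p
  proof -
    obtain M where "\<And>x. \<bar>p x\<bar> \<le> M" using C2b_bounded[OF p(1)] by blast
    then show ?thesis
      using p by (intro integrable_bounded_support[where A = "{a<..<b}"] C2b_borel) auto
  qed
  have int_ind: "integrable lborel (\<lambda>x. indicator {a<..<b} x * f x)" if "integrable lborel f" for f :: "real \<Rightarrow> real"
    using integrable_mult_indicator[OF _ that, of "{a<..<b}"] by simp
  let ?Q = "\<lambda>f \<eta>. \<exists>p. C2b p \<and> (\<forall>x. x \<notin> {a<..<b} \<longrightarrow> p x = 0) \<and>
           (LINT x|lborel. \<bar>indicator {a<..<b} x * f x - p x\<bar>) < \<eta>"
  have Q_add: "?Q (\<lambda>x. f x + g x) \<eta>"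
    if f: "integrable lborel f" "\<And>\<eta>. \<eta> > 0 \<Longrightarrow> ?Q f \<eta>" and g: "integrable lborel g" "\<And>\<eta>. \<eta> > 0 \<Longrightarrow> ?Q g \<eta>"
      and "\<eta> > 0" for f g :: "real \<Rightarrow> real" and \<eta>
  proof -
    obtain p where p: "C2b p" "\<forall>x. x \<notin> {a<..<b} \<longrightarrow> p x = 0"
      "(LINT x|lborel. \<bar>indicator {a<..<b} x * f x - p x\<bar>) < \<eta> / 2"
      using f(2)[of "\<eta>/2"] \<open>\<eta> > 0\<close> by auto
    obtain q where q: "C2b q" "\<forall>x. x \<notin> {a<..<b} \<longrightarrow> q x = 0"
      "(LINT x|lborel. \<bar>indicator {a<..<b} x * g x - q x\<bar>) < \<eta> / 2"
      using g(2)[of "\<eta>/2"] \<open>\<eta> > 0\<close> by auto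
    have "(LINT x|lborel. \<bar>indicator {a<..<b} x * (f x + g x) - (p x + q x)\<bar>)
      \<le> (LINT x|lborel. \<bar>indicator {a<..<b} x * f x - p x\<bar> + \<bar>indicator {a<..<b} x * g x - q x\<bar>)"
    proof (rule integral_mono)
      show "integrable lborel (\<lambda>x. \<bar>indicator {a<..<b} x * (f x + g x) - (p x + q x)\<bar>)"
        unfolding distrib_left
        by (intro integrable_abs Bochner_Integration.integrable_diff Bochner_Integration.integrable_add
            int_p[OF p(1,2)] int_p[OF q(1,2)] int_ind[OF f(1)] int_ind[OF g(1)])
      show "integrable lborel (\<lambda>x. \<bar>indicator {a<..<b} x * f x - p x\<bar> + \<bar>indicator {a<..<b} x * g x - q x\<bar>)"
        by (intro integrable_abs Bochner_Integration.integrable_diff Bochner_Integration.integrable_add int_p[OF p(1,2)] int_p[OF q(1,2)] int_ind[OF f(1)] int_ind[OF g(1)])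
      show "\<bar>indicator {a<..<b} x * (f x + g x) - (p x + q x)\<bar>
          \<le> \<bar>indicator {a<..<b} x * f x - p x\<bar> + \<bar>indicator {a<..<b} x * g x - q x\<bar>" for x
        unfolding distrib_left by linarith
    qed
    also have "\<dots> = (LINT x|lborel. \<bar>indicator {a<..<b} x * f x - p x\<bar>) + (LINT x|lborel. \<bar>indicator {a<..<b} x * g x - q x\<bar>)"
      by (rule Bochner_Integration.integral_add) (intro integrable_abs Bochner_Integration.integrable_diff Bochner_Integration.integrable_add int_p[OF p(1,2)] int_p[OF q(1,2)] int_ind[OF f(1)] int_ind[OF g(1)])+
    finally show ?thesis using p q C2b_add[OF p(1) q(1)] by (intro exI[of _ "\<lambda>x. p x + q x"]) auto
  qed
  have Q_lim: "?Q f \<eta>"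
    if s: "\<And>i. integrable lborel (s i)" "\<And>i \<eta>. \<eta> > 0 \<Longrightarrow> ?Q (s i) \<eta>"
      and lim: "\<And>x. (\<lambda>i. indicator {a<..<b} x * s i x) \<longlonglongrightarrow> indicator {a<..<b} x * f x"
      and bd: "\<And>i x. \<bar>indicator {a<..<b} x * s i x\<bar> \<le> w x" and w: "integrable lborel w"
      and f: "integrable lborel f" and "\<eta> > 0" for s :: "nat \<Rightarrow> real \<Rightarrow> real" and f w :: "real \<Rightarrow> real" and \<eta>
  proof -
    have "(\<lambda>i. LINT x|lborel. \<bar>indicator {a<..<b} x * f x - indicator {a<..<b} x * s i x\<bar>) \<longlonglongrightarrow> (LINT x|(lborel::real measure). 0)"
    proof (rule integral_dominated_convergence[where w = "\<lambda>x. \<bar>indicator {a<..<b} x * f x\<bar> + w x"])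
      show "AE x in lborel. (\<lambda>i. \<bar>indicator {a<..<b} x * f x - indicator {a<..<b} x * s i x\<bar>) \<longlonglongrightarrow> 0"
      proof (rule AE_I2)
        fix x
        show "(\<lambda>i. \<bar>indicator {a<..<b} x * f x - indicator {a<..<b} x * s i x\<bar>) \<longlonglongrightarrow> 0"
          using tendsto_rabs[OF tendsto_diff[OF tendsto_const lim[of x], of "indicator {a<..<b} x * f x"]] by simp
      qed
      show "AE x in lborel. norm \<bar>indicator {a<..<b} x * f x - indicator {a<..<b} x * s i x\<bar>
          \<le> \<bar>indicator {a<..<b} x * f x\<bar> + w x" for i
      proof (rule AE_I2)
        fix x show "norm \<bar>indicator {a<..<b} x * f x - indicator {a<..<b} x * s i x\<bar>
          \<le> \<bar>indicator {a<..<b} x * f x\<bar> + w x" using bd[of x i] unfolding real_norm_def by linarith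
      qed
      show "integrable lborel (\<lambda>x. \<bar>indicator {a<..<b} x * f x\<bar> + w x)"
        by (intro integrable_abs Bochner_Integration.integrable_diff Bochner_Integration.integrable_add int_ind[OF f] w)
      show "(\<lambda>x. \<bar>indicator {a<..<b} x * f x - indicator {a<..<b} x * s i x\<bar>) \<in> borel_measurable lborel" for i
        by (rule borel_measurable_integrable) (intro integrable_abs Bochner_Integration.integrable_diff Bochner_Integration.integrable_add int_ind[OF f] int_ind[OF s(1)])
    qed simp
    then have "\<forall>\<^sub>F i in sequentially. (LINT x|lborel. \<bar>indicator {a<..<b} x * f x - indicator {a<..<b} x * s i x\<bar>) < \<eta>/2"
      using \<open>\<eta> > 0\<close> by (intro order_tendstoD) auto
    then obtain i where i: "(LINT x|lborel. \<bar>indicator {a<..<b} x * f x - indicator {a<..<b} x * s i x\<bar>) < \<eta>/2"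
      by (meson eventually_happens trivial_limit_sequentially)
    obtain p where p: "C2b p" "\<forall>x. x \<notin> {a<..<b} \<longrightarrow> p x = 0"
      "(LINT x|lborel. \<bar>indicator {a<..<b} x * s i x - p x\<bar>) < \<eta> / 2"
      using s(2)[of "\<eta>/2" i] \<open>\<eta> > 0\<close> by auto
    have "(LINT x|lborel. \<bar>indicator {a<..<b} x * f x - p x\<bar>)
      \<le> (LINT x|lborel. \<bar>indicator {a<..<b} x * f x - indicator {a<..<b} x * s i x\<bar> + \<bar>indicator {a<..<b} x * s i x - p x\<bar>)"
    proof (rule integral_mono)
      show "integrable lborel (\<lambda>x. \<bar>indicator {a<..<b} x * f x - p x\<bar>)"
        by (intro integrable_abs Bochner_Integration.integrable_diff Bochner_Integration.integrable_add int_p[OF p(1,2)] int_ind[OF f] int_ind[OF s(1)] w)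
      show "integrable lborel (\<lambda>x. \<bar>indicator {a<..<b} x * f x - indicator {a<..<b} x * s i x\<bar> + \<bar>indicator {a<..<b} x * s i x - p x\<bar>)"
        by (intro integrable_abs Bochner_Integration.integrable_diff Bochner_Integration.integrable_add int_p[OF p(1,2)] int_ind[OF f] int_ind[OF s(1)] w)
    qed linarith
    also have "\<dots> = (LINT x|lborel. \<bar>indicator {a<..<b} x * f x - indicator {a<..<b} x * s i x\<bar>)
        + (LINT x|lborel. \<bar>indicator {a<..<b} x * s i x - p x\<bar>)"
      by (rule Bochner_Integration.integral_add) (intro integrable_abs Bochner_Integration.integrable_diff Bochner_Integration.integrable_add int_p[OF p(1,2)] int_ind[OF f] int_ind[OF s(1)] w)+
    finally show ?thesis using p i by (intro exI[of _ p]) auto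
  qed
  have Q_cmult: "?Q (\<lambda>x. c * f x) \<eta>" if Qf: "\<And>\<eta>. \<eta> > 0 \<Longrightarrow> ?Q f \<eta>" and "\<eta> > 0" for f \<eta> c
  proof -
    obtain p where p: "C2b p" "\<forall>x. x \<notin> {a<..<b} \<longrightarrow> p x = 0"
      "(LINT x|lborel. \<bar>indicator {a<..<b} x * f x - p x\<bar>) < \<eta> / (\<bar>c\<bar> + 1)"
      using Qf[of "\<eta> / (\<bar>c\<bar> + 1)"] \<open>\<eta> > 0\<close> by auto
    have "(LINT x|lborel. \<bar>indicator {a<..<b} x * (c * f x) - c * p x\<bar>)
      = (LINT x|lborel. \<bar>c\<bar> * \<bar>indicator {a<..<b} x * f x - p x\<bar>)"
      by (intro Bochner_Integration.integral_cong) (auto simp: abs_mult[symmetric] algebra_simps)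
    also have "\<dots> = \<bar>c\<bar> * (LINT x|lborel. \<bar>indicator {a<..<b} x * f x - p x\<bar>)" by simp
    also have "\<dots> \<le> \<bar>c\<bar> * (\<eta> / (\<bar>c\<bar> + 1))" using p by (intro mult_left_mono) auto
    also have "\<dots> < \<eta>" using \<open>\<eta> > 0\<close> by (simp add: field_simps)
    finally show ?thesis using p C2b_cmult[OF p(1), of c] by (intro exI[of _ "\<lambda>x. c * p x"]) auto
  qed
  have Q_ind: "?Q (indicator A) \<eta>" if "A \<in> sets borel" "A \<subseteq> {a<..<b}" "\<eta> > 0" for A :: "real set" and \<eta>
  proof -
    let ?ab = "{a<..<b}"
    have ind_int: "integrable lborel (indicator (?ab \<inter> B) :: real \<Rightarrow> real)" if "B \<in> sets borel" for B
      using that by (intro integrable_real_indicator emeasure_bounded_finite) (simp_all add: bounded_Int)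
    have gen: "\<forall>\<eta>>0. ?Q (indicator (?ab \<inter> B)) \<eta>" if "B \<in> sigma_sets UNIV (range (\<lambda>(c, d). box c d))" for B :: "real set"
    proof -
      let ?G = "range (\<lambda>(a, b). box a b) :: real set set"
      have "Int_stable ?G"
      proof (rule Int_stableI)
        fix X Y assume "X \<in> ?G" "Y \<in> ?G"
        then obtain a b c d where XY: "X = box a b" "Y = box c d" by auto
        show "X \<inter> Y \<in> ?G" unfolding XY box_Int_box by auto
      qed
      moreover have "?G \<subseteq> Pow UNIV" by simp
      ultimately show ?thesis using that
      proof (induction rule: sigma_sets_induct_disjoint)
        case (basic A)
        then obtain c d where A: "A = box c d" by auto
        have eq: "?ab \<inter> A = {max a c<..<min b d}" unfolding A by (auto simp: box_real)
        show ?case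
        proof (intro allI impI)
          fix \<eta> :: real assume "\<eta> > 0"
          \<comment> \<open>Each bump is its own approximation with error 0, so only the limit
            towards the indicator is at stake.\<close>
          show "?Q (indicator (?ab \<inter> A)) \<eta>"
          proof (rule Q_lim[where s = "\<lambda>n. bump n (max a c) (min b d)" and w = "indicator ?ab"])
            have z: "\<forall>x. x \<notin> ?ab \<longrightarrow> bump i (max a c) (min b d) x = 0" for i
              by (auto intro!: bump_zero)
            show "integrable lborel (bump i (max a c) (min b d))" for i
              using int_p[OF C2b_bump z] by simp
            show "?Q (bump i (max a c) (min b d)) \<eta>" if "\<eta> > 0" for i \<eta>
            proof (intro exI[of _ "bump i (max a c) (min b d)"] conjI C2b_bump z)
              have "\<bar>indicator ?ab x * bump i (max a c) (min b d) x - bump i (max a c) (min b d) x\<bar> = 0" for x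
                using z by (auto simp: indicator_def)
              then show "(LINT x|lborel. \<bar>indicator ?ab x * bump i (max a c) (min b d) x - bump i (max a c) (min b d) x\<bar>) < \<eta>"
                using that by (simp only: Bochner_Integration.integral_zero)
            qed
            show "(\<lambda>i. indicator ?ab x * bump i (max a c) (min b d) x) \<longlonglongrightarrow> indicator ?ab x * indicator (?ab \<inter> A) x" for x
              unfolding eq by (intro tendsto_mult tendsto_const bump_tendsto)
            show "\<bar>indicator ?ab x * bump i (max a c) (min b d) x\<bar> \<le> indicator ?ab x" for i x
              using bump_abs_le by (auto simp: indicator_def)
            show "integrable lborel (indicator (?ab \<inter> A) :: real \<Rightarrow> real)" using A by (intro ind_int) auto
            show "integrable lborel (indicator ?ab :: real \<Rightarrow> real)" using ind_int[of UNIV] by simp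
          qed fact
        qed
      next
        case empty
        then show ?case by (auto intro!: exI[of _ "\<lambda>_. 0"] C2b_const)
      next
        case (compl A)
        have A: "A \<in> sets borel" using compl.hyps by (simp add: borel_eq_box)
        have U: "\<forall>\<eta>>0. ?Q (indicator (?ab \<inter> UNIV)) \<eta>"
        proof (intro allI impI)
          fix \<eta> :: real assume "\<eta> > 0"
          show "?Q (indicator (?ab \<inter> UNIV)) \<eta>"
          proof (rule Q_lim[where s = "\<lambda>n. bump n a b" and w = "indicator ?ab"])
            have z: "\<forall>x. x \<notin> ?ab \<longrightarrow> bump i a b x = 0" for i
              by (auto intro!: bump_zero)
            show "integrable lborel (bump i a b)" for i
              using int_p[OF C2b_bump z] by simp
            show "?Q (bump i a b) \<eta>" if "\<eta> > 0" for i \<eta>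
            proof (intro exI[of _ "bump i a b"] conjI C2b_bump z)
              have "\<bar>indicator ?ab x * bump i a b x - bump i a b x\<bar> = 0" for x
                using z by (auto simp: indicator_def)
              then show "(LINT x|lborel. \<bar>indicator ?ab x * bump i a b x - bump i a b x\<bar>) < \<eta>"
                using that by (simp only: Bochner_Integration.integral_zero)
            qed
            show "(\<lambda>i. indicator ?ab x * bump i a b x) \<longlonglongrightarrow> indicator ?ab x * indicator (?ab \<inter> UNIV) x" for x
              by (simp, intro tendsto_mult tendsto_const bump_tendsto)
            show "\<bar>indicator ?ab x * bump i a b x\<bar> \<le> indicator ?ab x" for i x
              using bump_abs_le by (auto simp: indicator_def)
            show "integrable lborel (indicator (?ab \<inter> UNIV) :: real \<Rightarrow> real)" by (intro ind_int) auto
            show "integrable lborel (indicator ?ab :: real \<Rightarrow> real)" using ind_int[of UNIV] by simp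
          qed fact
        qed
        have QC: "?Q (\<lambda>x. indicator (?ab \<inter> UNIV) x + (-1) * indicator (?ab \<inter> A) x) \<eta>" if "\<eta> > 0" for \<eta>
        proof (rule Q_add)
          show "integrable lborel (indicator (?ab \<inter> UNIV) :: real \<Rightarrow> real)" by (rule ind_int) simp
          show "?Q (indicator (?ab \<inter> UNIV)) \<eta>" if "\<eta> > 0" for \<eta> using U[rule_format, OF that] .
          show "integrable lborel (\<lambda>x. (-1) * indicator (?ab \<inter> A) x :: real)"
            by (rule integrable_mult_right[OF ind_int[OF A]])
          show "?Q (\<lambda>x. (-1) * indicator (?ab \<inter> A) x) \<eta>" if "\<eta> > 0" for \<eta>
            by (rule Q_cmult[OF compl.IH[rule_format] that])
        qed fact
        have eq: "indicator (?ab \<inter> UNIV) x + (-1) * indicator (?ab \<inter> A) x = (indicator (?ab \<inter> (UNIV - A)) x :: real)" for x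
          by (auto simp: indicator_def)
        show ?case
        proof (intro allI impI)
          fix \<eta> :: real assume "\<eta> > 0"
          from QC[OF this] show "?Q (indicator (?ab \<inter> (UNIV - A))) \<eta>" unfolding eq .
        qed
      next
        case (union A)
        have A: "A i \<in> sets borel" for i using union.hyps by (auto simp: borel_eq_box)
        \<comment> \<open>Disjointness makes the partial sums indicators again, hence bounded by the
          one majorant \<open>indicator ?ab\<close>.\<close>
        let ?s = "\<lambda>n x. \<Sum>i<n. indicator (?ab \<inter> A i) x :: real"
        have s_eq: "?s n x = indicator (\<Union>i<n. ?ab \<inter> A i) x" for n x
        proof -
          have "disjoint_family_on (\<lambda>i. ?ab \<inter> A i) {..<n}"
            using union.hyps by (auto simp: disjoint_family_on_def)
          then show ?thesis
            by (intro indicator_UN_disjoint[symmetric]) auto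
        qed
        have Qs: "\<forall>\<eta>>0. ?Q (?s n) \<eta>" for n
        proof (induction n)
          case 0 then show ?case by (auto intro!: exI[of _ "\<lambda>_. 0"] C2b_const)
        next
          case (Suc n)
          have i: "integrable lborel (?s n)" using ind_int[OF A] by simp
          show ?case
          proof (intro allI impI)
            fix \<eta> :: real assume "\<eta> > 0"
            then have "?Q (\<lambda>x. ?s n x + indicator (?ab \<inter> A n) x) \<eta>"
              by (intro Q_add i ind_int[OF A] Suc.IH[rule_format] union.IH[rule_format])
            then show "?Q (?s (Suc n)) \<eta>" by simp
          qed
        qed
        show ?case
        proof (intro allI impI)
          fix \<eta> :: real assume "\<eta> > 0"
          show "?Q (indicator (?ab \<inter> (\<Union>i. A i))) \<eta>"
          proof (rule Q_lim[where s = ?s and w = "indicator ?ab"])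
            show "(\<lambda>i. indicator ?ab x * ?s i x) \<longlonglongrightarrow> indicator ?ab x * indicator (?ab \<inter> (\<Union>i. A i)) x" for x
            proof (intro tendsto_mult tendsto_const)
              show "(\<lambda>i. ?s i x) \<longlonglongrightarrow> indicator (?ab \<inter> (\<Union>i. A i)) x"
                unfolding s_eq Int_UN_distrib by (rule LIMSEQ_indicator_UN)
            qed
            show "\<bar>indicator ?ab x * ?s i x\<bar> \<le> indicator ?ab x" for i x
              unfolding s_eq by (auto simp: indicator_def)
            show "integrable lborel (?s i)" for i using ind_int[OF A] by simp
            show "integrable lborel (indicator (?ab \<inter> (\<Union>i. A i)) :: real \<Rightarrow> real)" using A by (intro ind_int) auto
            show "integrable lborel (indicator ?ab :: real \<Rightarrow> real)" using ind_int[of UNIV] by simp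
            show "?Q (?s i) \<eta>" if "\<eta> > 0" for i \<eta> using Qs[of i, rule_format, OF that] .
            show "\<eta> > 0" by fact
          qed
        qed
      qed
    qed
    have "?ab \<inter> A = A" using that by auto
    then show ?thesis using gen[of A] that by (simp add: borel_eq_box)
  qed
  {
    case (base A c)
    have "?Q (\<lambda>x. c * indicator (A \<inter> {a<..<b}) x) \<eta>"
    proof (rule Q_cmult)
      show "?Q (indicator (A \<inter> {a<..<b})) \<eta>" if "\<eta> > 0" for \<eta>
        by (rule Q_ind) (use base that in auto)
    qed (rule base.prems)
    moreover have "indicator {a<..<b} x * (c * indicator (A \<inter> {a<..<b}) x) = indicator {a<..<b} x * (indicator A x *\<^sub>R c)" for x :: real
      by (auto simp: indicator_def)
    ultimately show ?case by simp
  next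
    case (add f g)
    show ?case by (rule Q_add[OF add.hyps(1) add.IH(1) add.hyps(2) add.IH(2) add.prems])
  next
    case (lim f s)
    show ?case
    proof (rule Q_lim[where s = s and w = "\<lambda>x. 2 * \<bar>f x\<bar>"])
      show "(\<lambda>i. indicator {a<..<b} x * s i x) \<longlonglongrightarrow> indicator {a<..<b} x * f x" for x
        using lim by (intro tendsto_mult tendsto_const) auto
      show "\<bar>indicator {a<..<b} x * s i x\<bar> \<le> 2 * \<bar>f x\<bar>" for i x
        using lim.hyps(3)[of x i] by (auto simp: indicator_def)
      show "integrable lborel (s i)" for i by (rule lim.hyps)
      show "?Q (s i) \<eta>" if "\<eta> > 0" for i \<eta> by (rule lim.IH[OF that])
      show "integrable lborel (\<lambda>x. 2 * \<bar>f x\<bar>)" using lim.hyps(4) by simp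
    qed (rule lim.hyps lim.prems)+
  }
qed

text \<open>As the trace is a definite description, uniqueness has to be shown as well: if c and c'
  both qualified, integrating |c - c'| over the half ball would bound \<open>\<kappa>\<close> |c -
  c'| by two averages tending to 0. The lower density \<open>\<kappa>\<close> excludes domains that
  are too thin at \<open>p\<close> for this.\<close>

lemma bdry_trace_eqI:
  fixes f :: "'a::euclidean_space \<Rightarrow> real"
  assumes O: "\<Omega> \<in> sets borel" "p \<notin> \<Omega>" and f: "set_borel_measurable lborel \<Omega> f"
    and lim: "(f \<longlongrightarrow> c) (at p within \<Omega>)"
    and dens: "\<kappa> > 0" "\<forall>\<^sub>F r in at_right 0. \<kappa> * r ^ DIM('a) \<le> measure lborel (ball p r \<inter> \<Omega>)"
  shows "bdry_trace \<Omega> f p = c"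
proof -
  let ?I = "\<lambda>c r. (LINT z:(ball p r \<inter> \<Omega>)|lborel. \<bar>f z - c\<bar>)"
  have fin: "emeasure lborel (ball p r \<inter> \<Omega>) < \<infinity>" for r
    by (intro emeasure_bounded_finite) (simp add: bounded_Int)
  have meas: "(\<lambda>z. indicator (ball p r \<inter> \<Omega>) z * \<bar>f z - d\<bar>) \<in> borel_measurable borel" for r d
  proof -
    have [measurable]: "\<Omega> \<in> sets borel" "(\<lambda>z. indicator \<Omega> z * f z) \<in> borel_measurable borel" "ball p r \<in> sets borel"
      using f O unfolding set_borel_measurable_def by auto
    have "(\<lambda>z. indicator (ball p r) z * \<bar>indicator \<Omega> z * f z - indicator \<Omega> z * d\<bar>) \<in> borel_measurable borel"
      by measurable
    also have "(\<lambda>z. indicator (ball p r) z * \<bar>indicator \<Omega> z * f z - indicator \<Omega> z * d\<bar>) = (\<lambda>z. indicator (ball p r \<inter> \<Omega>) z * \<bar>f z - d\<bar>)"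
      by (auto simp: indicator_def fun_eq_iff)
    finally show ?thesis .
  qed
  have small: "\<exists>d>0. \<forall>z\<in>\<Omega>. dist z p < d \<longrightarrow> \<bar>f z - c\<bar> < \<eta>" if "\<eta> > 0" for \<eta>
  proof -
    from tendstoD[OF lim that] obtain d where "d > 0" "\<forall>x\<in>\<Omega>. x \<noteq> p \<and> dist x p < d \<longrightarrow> dist (f x) c < \<eta>"
      unfolding eventually_at by blast
    then show ?thesis using O(2) by (auto simp: dist_real_def intro!: exI[of _ d])
  qed
  obtain d1 where d1: "d1 > 0" "\<And>z. z \<in> \<Omega> \<Longrightarrow> dist z p < d1 \<Longrightarrow> \<bar>f z - c\<bar> < 1" using small[of 1] by auto
  have int: "integrable lborel (\<lambda>z. indicator (ball p r \<inter> \<Omega>) z * \<bar>f z - d\<bar>)" if "r < d1" for r d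
  proof (rule integrable_bounded_support[where A = "ball p r \<inter> \<Omega>" and M = "1 + \<bar>c - d\<bar>"])
    show "\<bar>indicator (ball p r \<inter> \<Omega>) x * \<bar>f x - d\<bar>\<bar> \<le> 1 + \<bar>c - d\<bar>" for x
    proof (cases "x \<in> ball p r \<inter> \<Omega>")
      case True
      then have "\<bar>f x - c\<bar> < 1" using d1(2)[of x] that by (auto simp: dist_commute)
      then show ?thesis using True by auto
    qed auto
    show "(\<lambda>z. indicator (ball p r \<inter> \<Omega>) z * \<bar>f z - d\<bar>) \<in> borel_measurable borel" by (rule meas)
    show "bounded (ball p r \<inter> \<Omega>)" by (simp add: bounded_Int)
    show "ball p r \<inter> \<Omega> \<in> sets borel" using O(1) by simp
  qed simp
  have lim0: "((\<lambda>r. ?I c r / r ^ DIM('a)) \<longlongrightarrow> 0) (at_right 0)"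
  proof (rule tendstoI)
    fix \<eta> :: real assume "\<eta> > 0"
    define V where "V = unit_ball_vol (DIM('a)) + 1"
    have V: "V > 0" unfolding V_def by (simp add: add_nonneg_pos)
    obtain d where d: "d > 0" "\<And>z. z \<in> \<Omega> \<Longrightarrow> dist z p < d \<Longrightarrow> \<bar>f z - c\<bar> < \<eta> / (2 * V)"
      using small[of "\<eta> / (2 * V)"] \<open>\<eta> > 0\<close> V by auto
    have "dist (?I c r / r ^ DIM('a)) 0 < \<eta>" if r: "0 < r" "r < d" for r
    proof -
      have "?I c r \<le> (LINT z|lborel. \<eta> / (2 * V) * indicator (ball p r) z)"
        unfolding set_lebesgue_integral_def real_scaleR_def
      proof (rule integral_mono')
        show "integrable lborel (\<lambda>z. \<eta> / (2 * V) * indicator (ball p r) z)"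
          by (intro integrable_mult_right integrable_real_indicator emeasure_bounded_finite) auto
        show "indicator (ball p r \<inter> \<Omega>) z * \<bar>f z - c\<bar> \<le> \<eta> / (2 * V) * indicator (ball p r) z" for z
          using d(2)[of z] r \<open>\<eta> > 0\<close> V by (auto simp: indicator_def dist_commute less_imp_le)
        show "0 \<le> \<eta> / (2 * V) * indicator (ball p r) z" for z using \<open>\<eta> > 0\<close> V by simp
      qed
      also have "\<dots> = \<eta> / (2 * V) * (unit_ball_vol (DIM('a)) * r ^ DIM('a))"
        using r by (simp add: content_ball)
      also have "\<dots> \<le> \<eta> / (2 * V) * (V * r ^ DIM('a))"
        using r \<open>\<eta> > 0\<close> V by (intro mult_left_mono mult_right_mono) (auto simp: V_def)
      also have "\<dots> = \<eta> / 2 * r ^ DIM('a)" using V by simp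
      finally have "?I c r / r ^ DIM('a) \<le> \<eta> / 2" using r by (simp add: field_simps)
      moreover have "?I c r / r ^ DIM('a) \<ge> 0" using r by (simp add: set_lebesgue_integral_def)
      ultimately show ?thesis using \<open>\<eta> > 0\<close> unfolding dist_real_def by linarith
    qed
    then show "\<forall>\<^sub>F r in at_right 0. dist (?I c r / r ^ DIM('a)) 0 < \<eta>"
      by (intro eventually_at_rightI[OF _ d(1)]) simp
  qed
  have uniq: "c' = c" if c': "((\<lambda>r. ?I c' r / r ^ DIM('a)) \<longlongrightarrow> 0) (at_right 0)" for c'
  proof -
    have "\<kappa> * \<bar>c - c'\<bar> \<le> 0 + 0"
    proof (rule tendsto_le[OF _ tendsto_add[OF lim0 c'] tendsto_const])
      have "\<forall>\<^sub>F r in at_right 0. r > 0 \<and> r < d1"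
        by (intro eventually_at_rightI[OF _ d1(1)]) simp
      with dens(2) show "\<forall>\<^sub>F r in at_right 0. \<kappa> * \<bar>c - c'\<bar> \<le> ?I c r / r ^ DIM('a) + ?I c' r / r ^ DIM('a)"
      proof eventually_elim
        case (elim r)
        have "\<kappa> * r ^ DIM('a) * \<bar>c - c'\<bar> \<le> measure lborel (ball p r \<inter> \<Omega>) * \<bar>c - c'\<bar>"
          using elim by (intro mult_right_mono) auto
        also have "\<dots> = (LINT z|lborel. indicator (ball p r \<inter> \<Omega>) z * \<bar>c - c'\<bar>)"
          using fin[of r] O by simp
        also have "\<dots> \<le> (LINT z|lborel. indicator (ball p r \<inter> \<Omega>) z * \<bar>f z - c\<bar> + indicator (ball p r \<inter> \<Omega>) z * \<bar>f z - c'\<bar>)"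
        proof (rule integral_mono)
          show "integrable lborel (\<lambda>z. indicator (ball p r \<inter> \<Omega>) z * \<bar>c - c'\<bar>)"
            using fin[of r] O by (intro integrable_mult_left integrable_real_indicator) auto
          show "integrable lborel (\<lambda>z. indicator (ball p r \<inter> \<Omega>) z * \<bar>f z - c\<bar> + indicator (ball p r \<inter> \<Omega>) z * \<bar>f z - c'\<bar>)"
            using elim by (intro Bochner_Integration.integrable_add int) auto
        qed (auto simp: indicator_def)
        also have "\<dots> = ?I c r + ?I c' r"
          unfolding set_lebesgue_integral_def real_scaleR_def
          using elim by (intro Bochner_Integration.integral_add int) auto
        finally show ?case using elim by (simp add: field_simps)
      qed
    qed simp
    then show ?thesis using dens(1) by (simp add: mult_le_0_iff)
  qed
  show ?thesis unfolding bdry_trace_def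
    by (rule the_equality, rule lim0, rule uniq)
qed

section \<open>Absolutely continuous functions and weak derivatives\<close>

lemma C1_compact_support_realI:
  fixes s s1 :: "real \<Rightarrow> real"
  assumes "\<And>x. x \<in> S \<Longrightarrow> (s has_real_derivative s1 x) (at x)" "continuous_on S s1"
    and "compact C" "C \<subseteq> S" "\<And>x. x \<in> S - C \<Longrightarrow> s x = 0"
  shows "C1_compact_support S s (\<lambda>x h. s1 x * h)"
  unfolding C1_compact_support_def
proof (intro conjI ballI allI)
  show "(s has_derivative (\<lambda>h. s1 x * h)) (at x within S)" if "x \<in> S" for x
    using assms(1)[OF that] has_field_derivative_at_within unfolding has_field_derivative_def by blast
  show "continuous_on S (\<lambda>z. s1 z * v)" for v
    using assms(2) by (intro continuous_intros)
  show "\<exists>C. compact C \<and> C \<subseteq> S \<and> (\<forall>z\<in>S - C. s z = 0)" using assms(3-5) by blast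
qed

text \<open>The complement of the compact support is open and covers the line together with the
  interval, so the extension by zero is C^1 everywhere. Integration by parts on the closed interval
  then has vanishing end values, although values of a test function outside its domain are
  arbitrary.\<close>

lemma C1_compact_support_realD:
  fixes \<psi> :: "real \<Rightarrow> real"
  assumes "C1_compact_support {a<..<b} \<psi> D"
  defines "s \<equiv> \<lambda>x. if x \<in> {a<..<b} then \<psi> x else 0" and "s1 \<equiv> \<lambda>x. if x \<in> {a<..<b} then D x 1 else 0"
  shows "\<And>x. (s has_real_derivative s1 x) (at x)" "continuous_on UNIV s1"
proof -
  let ?S = "{a<..<b}"
  obtain C where C: "compact C" "C \<subseteq> ?S" "\<And>z. z \<in> ?S - C \<Longrightarrow> \<psi> z = 0"
    using assms(1) unfolding C1_compact_support_def by auto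
  have zero: "s x = 0" if "x \<notin> C" for x using that C(3)[of x] by (auto simp: s_def)
  have openC: "open (- C)" using C(1) compact_imp_closed by auto
  have d1: "(s has_real_derivative s1 x) (at x)" if "x \<in> ?S" for x
  proof -
    have "(\<psi> has_derivative D x) (at x within ?S)" using assms(1) that unfolding C1_compact_support_def by blast
    then have *: "(\<psi> has_derivative D x) (at x)" using that at_within_open[of x ?S] by simp
    have "D x = (*) (D x 1)"
    proof
      fix h show "D x h = D x 1 * h"
        using linear_scale[OF has_derivative_linear[OF *], of h 1] by simp
    qed
    then have "(\<psi> has_real_derivative D x 1) (at x)" using * by (simp add: has_field_derivative_def)
    then have "(\<psi> has_real_derivative s1 x) (at x)" using that by (simp add: s1_def)
    then show ?thesis
      by (rule has_field_derivative_transform_within_open[where S = ?S]) (use that in \<open>auto simp: s_def\<close>)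
  qed
  have d2: "(s has_real_derivative 0) (at x)" if "x \<notin> C" for x
  proof -
    have "((\<lambda>_. 0) has_real_derivative 0) (at x)" by simp
    then show ?thesis
      by (rule has_field_derivative_transform_within_open[where S = "- C"]) (use that openC zero in auto)
  qed
  have s1z: "s1 x = 0" if "x \<notin> C" for x
    using d2[OF that] d1[of x] DERIV_unique[of s "s1 x" x 0] by (cases "x \<in> ?S") (auto simp: s1_def)
  show "(s has_real_derivative s1 x) (at x)" for x
    using d1[of x] d2[of x] s1z[of x] C(2) by (cases "x \<in> C") auto
  have "continuous_on (- C \<union> ?S) s1"
  proof (rule continuous_on_open_Un)
    show "continuous_on (- C) s1" by (rule continuous_on_eq[OF continuous_on_const[of _ 0]]) (simp add: s1z)
    have "continuous_on ?S (\<lambda>x. D x 1)" using assms(1) unfolding C1_compact_support_def by blast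
    then show "continuous_on ?S s1" by (rule continuous_on_eq) (simp add: s1_def)
  qed (use openC in auto)
  moreover have "- C \<union> ?S = UNIV" using C(2) by auto
  ultimately show "continuous_on UNIV s1" by simp
qed

lemma continuous_imp_set_integrable:
  fixes f :: "real \<Rightarrow> real"
  assumes "continuous_on {a..b} f"
  shows "set_integrable lborel {a<..<b} f"
proof (rule set_integrable_subset[of lborel "{a..b}"])
  show "set_integrable lborel {a..b} f"
    using borel_integrable_compact[of "{a..b}" f] assms by (simp add: set_integrable_def)
qed auto

lemma set_integral_FTC:
  fixes s s1 :: "real \<Rightarrow> real"
  assumes "a \<le> b" "\<And>x. a \<le> x \<Longrightarrow> x \<le> b \<Longrightarrow> (s has_real_derivative s1 x) (at x within {a..b})" "continuous_on {a..b} s1"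
  shows "(LINT x:{a<..<b}|lborel. s1 x) = s b - s a"
proof -
  have "(LINT x:{a..b}|lborel. s1 x) = s b - s a"
    unfolding set_lebesgue_integral_def
    using integral_FTC_Icc[of a b s s1] assms by (simp add: has_real_derivative_iff_has_vector_derivative)
  moreover have "(LINT x:{a..b}|lborel. s1 x) = (LINT x:{a<..<b}|lborel. s1 x)"
    unfolding set_lebesgue_integral_def
  proof (rule integral_cong_AE)
    show "(\<lambda>x. indicator {a..b} x *\<^sub>R s1 x) \<in> borel_measurable lborel"
      using borel_integrable_compact[of "{a..b}" s1] assms(3) by (intro borel_measurable_integrable) auto
    show "(\<lambda>x. indicator {a<..<b} x *\<^sub>R s1 x) \<in> borel_measurable lborel"
      using continuous_imp_set_integrable[OF assms(3)] by (intro borel_measurable_integrable) (simp add: set_integrable_def)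
    show "AE x in lborel. indicator {a..b} x *\<^sub>R s1 x = indicator {a<..<b} x *\<^sub>R s1 x"
      using AE_lborel_singleton[of a] AE_lborel_singleton[of b] by eventually_elim (auto simp: indicator_def)
  qed
  ultimately show ?thesis by simp
qed

text \<open>Integration by parts for an absolutely continuous and a continuously differentiable function.\<close>

lemma integration_by_parts_AC:
  fixes s s1 p q :: "real \<Rightarrow> real"
  assumes "0 \<le> L" and p: "set_integrable lborel {0<..<L} p"
    and q: "\<And>x. 0 \<le> x \<Longrightarrow> x \<le> L \<Longrightarrow> q x = q0 + (LINT y:{0<..<x}|lborel. p y)"
    and s: "\<And>x. 0 \<le> x \<Longrightarrow> x \<le> L \<Longrightarrow> (s has_real_derivative s1 x) (at x within {0..L})" and s1: "continuous_on {0..L} s1"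
  shows "(LINT x:{0<..<L}|lborel. s x * p x) + (LINT x:{0<..<L}|lborel. s1 x * q x) = s L * q L - s 0 * q 0"
    and "set_integrable lborel {0<..<L} (\<lambda>x. s x * p x)"
    and "set_integrable lborel {0<..<L} (\<lambda>x. s1 x * q x)"
proof -
  let ?i = "indicator {0<..<L} :: real \<Rightarrow> real"
  define P where "P y = ?i y * p y" for y
  define R where "R x = ?i x * s1 x" for x
  have P: "integrable lborel P" using p unfolding P_def set_integrable_def by simp
  have R: "integrable lborel R" using continuous_imp_set_integrable[OF s1] unfolding R_def set_integrable_def by simp
  note [measurable] = borel_measurable_integrable[OF P] borel_measurable_integrable[OF R]
  have Pb [measurable]: "P \<in> borel_measurable borel" "R \<in> borel_measurable borel"
    using borel_measurable_integrable[OF P] borel_measurable_integrable[OF R] by simp_all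
  \<comment> \<open>Fubini for s1(x) p(y) on the triangle y < x: integrating over y first gives s1
    (q - q0), over x first gives p (s L - s).\<close>
  define H where "H = (\<lambda>(x, y). R x * P y * (if y < x then 1 else 0 :: real))"
  have "integrable (lborel \<Otimes>\<^sub>M lborel) (\<lambda>(x, y). R x * P y)"
  proof (rule lborel_pair.Fubini_integrable)
    show "integrable lborel (\<lambda>x. LINT y|lborel. norm (case (x, y) of (x, y) \<Rightarrow> R x * P y))"
      using R P by (simp add: abs_mult)
    show "AE x in lborel. integrable lborel (\<lambda>y. case (x, y) of (x, y) \<Rightarrow> R x * P y)"
      using P by simp
  qed measurable
  then have H: "integrable (lborel \<Otimes>\<^sub>M lborel) H"
    by (rule Bochner_Integration.integrable_bound) (auto simp: H_def)
  have inner1: "(LINT y|lborel. H (x, y)) = ?i x * s1 x * (q x - q0)" for x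
  proof (cases "x \<in> {0<..<L}")
    case True
    have "(LINT y|lborel. H (x, y)) = (LINT y|lborel. R x * (indicator {0<..<x} y * p y))"
      using True by (intro Bochner_Integration.integral_cong) (auto simp: H_def P_def indicator_def)
    also have "\<dots> = R x * (q x - q0)" using q[of x] True by (simp add: set_lebesgue_integral_def)
    finally show ?thesis by (simp add: R_def)
  qed (simp add: H_def R_def)
  have inner2: "(LINT x|lborel. H (x, y)) = P y * (s L - s y)" for y
  proof (cases "y \<in> {0<..<L}")
    case True
    have "(LINT x|lborel. H (x, y)) = (LINT x|lborel. P y * (indicator {y<..<L} x * s1 x))"
      using True by (intro Bochner_Integration.integral_cong) (auto simp: H_def R_def indicator_def)
    also have "\<dots> = P y * (LINT x:{y<..<L}|lborel. s1 x)" by (simp add: set_lebesgue_integral_def)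
    also have "(LINT x:{y<..<L}|lborel. s1 x) = s L - s y"
    proof (rule set_integral_FTC)
      show "(s has_real_derivative s1 x) (at x within {y..L})" if "y \<le> x" "x \<le> L" for x
        by (rule DERIV_subset[OF s]) (use True that in auto)
      show "continuous_on {y..L} s1" using s1 by (rule continuous_on_subset) (use True in auto)
    qed (use True in auto)
    finally show ?thesis .
  qed (simp add: H_def P_def)
  have A: "integrable lborel (\<lambda>x. ?i x * s1 x * (q x - q0))"
    using lborel_pair.integrable_fst'[OF H] by (simp add: inner1)
  have B: "integrable lborel (\<lambda>y. P y * (s L - s y))"
    using lborel_pair.integrable_snd[of "\<lambda>x y. H (x, y)"] H by (simp add: inner2)
  have AB: "(LINT x|lborel. ?i x * s1 x * (q x - q0)) = (LINT y|lborel. P y * (s L - s y))"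
    using lborel_pair.Fubini_integral[of "\<lambda>x y. H (x, y)"] H by (simp add: inner1 inner2)
  have sp: "integrable lborel (\<lambda>y. ?i y * (s y * p y))"
  proof -
    have "integrable lborel (\<lambda>y. s L * P y - P y * (s L - s y))"
      by (rule Bochner_Integration.integrable_diff[OF integrable_mult_right[OF P] B])
    then show ?thesis by (simp add: P_def algebra_simps)
  qed
  have sq: "integrable lborel (\<lambda>x. ?i x * (s1 x * q x))"
  proof -
    have "integrable lborel (\<lambda>x. ?i x * s1 x * (q x - q0) + q0 * R x)"
      by (rule Bochner_Integration.integrable_add[OF A integrable_mult_right[OF R]])
    then show ?thesis by (simp add: R_def algebra_simps)
  qed
  show "set_integrable lborel {0<..<L} (\<lambda>x. s x * p x)" "set_integrable lborel {0<..<L} (\<lambda>x. s1 x * q x)"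
    using sp sq by (simp_all add: set_integrable_def)
  have IP: "(LINT y|lborel. P y) = q L - q0" using q[of L] assms(1) by (simp add: P_def set_lebesgue_integral_def)
  have IR: "(LINT y|lborel. R y) = s L - s 0"
    using set_integral_FTC[OF assms(1) s s1] by (simp add: R_def set_lebesgue_integral_def)
  have q0: "q 0 = q0" using q[of 0] assms(1) by (simp add: set_lebesgue_integral_def)
  have e1: "(LINT x|lborel. ?i x * s1 x * (q x - q0)) = (LINT x|lborel. ?i x * (s1 x * q x)) - q0 * (s L - s 0)"
  proof -
    have "(LINT x|lborel. ?i x * s1 x * (q x - q0)) = (LINT x|lborel. ?i x * (s1 x * q x) - q0 * R x)"
      by (simp add: R_def algebra_simps)
    also have "\<dots> = (LINT x|lborel. ?i x * (s1 x * q x)) - (LINT x|lborel. q0 * R x)"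
      by (rule Bochner_Integration.integral_diff[OF sq integrable_mult_right[OF R]])
    finally show ?thesis using IR by simp
  qed
  have e2: "(LINT y|lborel. P y * (s L - s y)) = s L * (q L - q0) - (LINT y|lborel. ?i y * (s y * p y))"
  proof -
    have "(LINT y|lborel. P y * (s L - s y)) = (LINT y|lborel. s L * P y - ?i y * (s y * p y))"
      by (simp add: P_def algebra_simps)
    also have "\<dots> = (LINT x|lborel. s L * P x) - (LINT y|lborel. ?i y * (s y * p y))"
      by (rule Bochner_Integration.integral_diff[OF integrable_mult_right[OF P] sp])
    finally show ?thesis using IP by simp
  qed
  show "(LINT x:{0<..<L}|lborel. s x * p x) + (LINT x:{0<..<L}|lborel. s1 x * q x) = s L * q L - s 0 * q 0"
    using AB unfolding e1 e2 set_lebesgue_integral_def q0 by (simp add: algebra_simps)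
qed

section \<open>Functions of bounded variation on an interval\<close>

lemma spline_step1_integral:
  fixes n :: real
  assumes "n > 0"
  shows "integrable lborel (\<lambda>z. n * spline_step1 (n * (z - x)))" "(LINT z|lborel. n * spline_step1 (n * (z - x))) = 1"
    and "integrable lborel (\<lambda>x. n * spline_step1 (n * (z - x)))" "(LINT x|lborel. n * spline_step1 (n * (z - x))) = 1"
proof -
  have eq: "spline_step1 x = indicator {0<..<3} x * spline_step1 x" for x
    using spline_step1_left[of x] spline_step1_right[of x]
    by (cases "x \<le> 0"; cases "3 \<le> x") (auto simp: indicator_def)
  have "set_integrable lborel {0<..<3} spline_step1"
    by (rule continuous_imp_set_integrable) (rule continuous_spline_step1)
  then have i: "integrable lborel spline_step1"
    unfolding set_integrable_def real_scaleR_def using eq by simp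
  have "(LINT x:{0<..<3}|lborel. spline_step1 x) = spline_step 3 - spline_step 0"
    by (rule set_integral_FTC) (auto intro: DERIV_spline_step DERIV_subset continuous_spline_step1)
  then have v: "(LINT x|lborel. spline_step1 x) = 1"
    unfolding set_lebesgue_integral_def real_scaleR_def using eq by (simp add: spline_step_left spline_step_right)
  show "integrable lborel (\<lambda>z. n * spline_step1 (n * (z - x)))"
    using lborel_integrable_real_affine[OF i, of n "- n * x"] assms by (simp add: algebra_simps)
  show "integrable lborel (\<lambda>x. n * spline_step1 (n * (z - x)))"
    using lborel_integrable_real_affine[OF i, of "- n" "n * z"] assms by (simp add: algebra_simps)
  show "(LINT z|lborel. n * spline_step1 (n * (z - x))) = 1"
    using lborel_integral_real_affine[of n spline_step1 "- n * x"] assms v by (simp add: algebra_simps)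
  show "(LINT x|lborel. n * spline_step1 (n * (z - x))) = 1"
    using lborel_integral_real_affine[of "- n" spline_step1 "n * z"] assms v by (simp add: algebra_simps)
qed

lemma spline_step1_borel [measurable]: "spline_step1 \<in> borel_measurable borel"
  by (intro borel_measurable_continuous_onI continuous_spline_step1)

text \<open>The kernel is the derivative in z of \<open>spline_step (n * (z - x))\<close>. Hence the
  difference of two mollified values is an integral of g against the derivative of a difference of
  two smoothed steps, which is an admissible test function.\<close>

definition mollify :: "real \<Rightarrow> (real \<Rightarrow> real) \<Rightarrow> real \<Rightarrow> real" where
  "mollify n g x = (LINT z|lborel. g z * (n * spline_step1 (n * (z - x))))"

lemma mollify_integrable:
  assumes g: "integrable lborel g" and n: "n > 0"
  shows "integrable lborel (\<lambda>z. g z * (n * spline_step1 (n * (z - x))))"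
proof -
  have "\<exists>M. \<forall>x. \<bar>spline_step1 x\<bar> \<le> M"
  proof -
    have "continuous_on {0..3} spline_step1" by (rule continuous_spline_step1)
    then have "bounded (spline_step1 ` {0..3})" by (intro compact_imp_bounded compact_continuous_image) auto
    then obtain M where M: "\<forall>x\<in>{0..3}. \<bar>spline_step1 x\<bar> \<le> M" unfolding bounded_iff by auto
    have "\<bar>spline_step1 x\<bar> \<le> max M 0" for x
      using bspec[OF M, of x] spline_step1_left[of x] spline_step1_right[of x] by (cases "x \<in> {0..3}") auto
    then show ?thesis by blast
  qed
  then obtain M where M: "\<And>x. \<bar>spline_step1 x\<bar> \<le> M" by blast
  show ?thesis
  proof (rule Bochner_Integration.integrable_bound)
  show "integrable lborel (\<lambda>z. n * M * g z)" using g by simp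
  show "AE z in lborel. norm (g z * (n * spline_step1 (n * (z - x)))) \<le> norm (n * M * g z)"
  proof (rule AE_I2)
    fix z
    have "norm (g z * (n * spline_step1 (n * (z - x)))) = \<bar>g z\<bar> * n * \<bar>spline_step1 (n * (z - x))\<bar>"
      using n by (simp add: abs_mult)
    also have "\<dots> \<le> \<bar>g z\<bar> * n * M" using n M by (intro mult_left_mono) auto
    also have "\<dots> \<le> norm (n * M * g z)"
      using n order_trans[OF abs_ge_zero M[of 0]] by (simp add: abs_mult)
    finally show "norm (g z * (n * spline_step1 (n * (z - x)))) \<le> norm (n * M * g z)" .
  qed
  have [measurable]: "g \<in> borel_measurable borel" using borel_measurable_integrable[OF g] by simp
  show "(\<lambda>z. g z * (n * spline_step1 (n * (z - x)))) \<in> borel_measurable lborel" by measurable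
  qed
qed

text \<open>Fubini, using that the kernel has mass 1 also in x. The contraction carries convergence
  over from smooth functions to integrable ones.\<close>

lemma mollify_L1:
  assumes g: "integrable lborel g" and n: "n > 0"
  shows "integrable lborel (mollify n g)" "(LINT x|lborel. \<bar>mollify n g x\<bar>) \<le> (LINT x|lborel. \<bar>g x\<bar>)"
proof -
  have [measurable]: "g \<in> borel_measurable borel" using borel_measurable_integrable[OF g] by simp
  define H where "H = (\<lambda>(z, x). g z * (n * spline_step1 (n * (z - x))))"
  have [measurable]: "H \<in> borel_measurable (lborel \<Otimes>\<^sub>M lborel)" unfolding H_def by measurable
  have nH: "(LINT x|lborel. \<bar>H (z, x)\<bar>) = \<bar>g z\<bar>" for z
  proof -
    have "(LINT x|lborel. \<bar>H (z, x)\<bar>) = (LINT x|lborel. \<bar>g z\<bar> * (n * spline_step1 (n * (z - x))))"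
      using n spline_step1_nonneg by (intro Bochner_Integration.integral_cong) (auto simp: H_def abs_mult)
    then show ?thesis using spline_step1_integral(4)[OF n, of z] by simp
  qed
  have H: "integrable (lborel \<Otimes>\<^sub>M lborel) H"
  proof (rule lborel_pair.Fubini_integrable)
    show "integrable lborel (\<lambda>z. LINT x|lborel. norm (H (z, x)))" using g nH by simp
    show "AE z in lborel. integrable lborel (\<lambda>x. H (z, x))"
      unfolding H_def prod.case by (intro AE_I2 integrable_mult_right spline_step1_integral(3) n)
  qed measurable
  have eq: "mollify n g x = (LINT z|lborel. H (z, x))" for x by (simp add: mollify_def H_def)
  show i: "integrable lborel (mollify n g)"
    unfolding eq[abs_def] using lborel_pair.integrable_snd[of "\<lambda>x y. H (x, y)"] H by simp
  have aH: "integrable (lborel \<Otimes>\<^sub>M lborel) (\<lambda>p. \<bar>H p\<bar>)" using H by simp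
  have "(LINT x|lborel. \<bar>mollify n g x\<bar>) \<le> (LINT x|lborel. (LINT z|lborel. \<bar>H (z, x)\<bar>))"
  proof (rule integral_mono)
    show "integrable lborel (\<lambda>x. LINT z|lborel. \<bar>H (z, x)\<bar>)"
      using lborel_pair.integrable_snd[of "\<lambda>x y. \<bar>H (x, y)\<bar>"] aH by (simp add: split_beta')
    show "\<bar>mollify n g x\<bar> \<le> (LINT z|lborel. \<bar>H (z, x)\<bar>)" for x
      unfolding eq by (rule integral_abs_bound)
  qed (use i in simp)
  also have "\<dots> = (LINT z|lborel. (LINT x|lborel. \<bar>H (z, x)\<bar>))"
    using lborel_pair.Fubini_integral[of "\<lambda>x y. \<bar>H (x, y)\<bar>"] aH by (simp add: split_beta')
  finally show "(LINT x|lborel. \<bar>mollify n g x\<bar>) \<le> (LINT x|lborel. \<bar>g x\<bar>)" by (simp add: nH)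
qed

lemma mollify_diff:
  assumes "integrable lborel f" "integrable lborel g" "n > 0"
  shows "mollify n (\<lambda>x. f x - g x) x = mollify n f x - mollify n g x"
  unfolding mollify_def left_diff_distrib
  by (rule Bochner_Integration.integral_diff) (rule mollify_integrable[OF assms(1,3)] mollify_integrable[OF assms(2,3)])+

lemma mollify_C2b_close:
  assumes p: "C2b p" "\<And>x. x \<notin> {a<..<b} \<Longrightarrow> p x = 0" and ab: "a \<le> b"
  shows "\<exists>M. \<forall>n::real\<ge>1. (LINT x|lborel. \<bar>mollify n p x - p x\<bar>) \<le> M / n"
proof -
  obtain p1 p2 M where d: "\<And>x. (p has_real_derivative p1 x) (at x)" and M: "\<And>x. \<bar>p x\<bar> \<le> M" "\<And>x. \<bar>p1 x\<bar> \<le> M"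
    using C2bE[OF p(1)] by metis
  have M0: "M \<ge> 0" using order_trans[OF abs_ge_zero M(1)] .
  have ip: "integrable lborel p"
    by (rule integrable_bounded_support[where A = "{a<..<b}"]) (use p M in \<open>auto intro: C2b_borel\<close>)
  have lip: "\<bar>p z - p x\<bar> \<le> M * \<bar>z - x\<bar>" for x z
    using field_differentiable_bound[of UNIV p p1 M z x] d M by auto
  show ?thesis
  proof (intro exI allI impI)
    fix n :: real assume n: "n \<ge> 1"
    \<comment> \<open>A Lipschitz constant M times the kernel width 3/n. The kernel looks to the
      right by at most 3 when n is at least 1, hence the enlarged interval
      \<open>{a - 3..b}\<close>.\<close>
    have bound: "\<bar>mollify n p x - p x\<bar> \<le> 3 * M / n * indicator {a - 3..b} x" for x
    proof (cases "x \<in> {a - 3..b}")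
      case True
      have k: "integrable lborel (\<lambda>z. n * spline_step1 (n * (z - x)))" "(LINT z|lborel. n * spline_step1 (n * (z - x))) = 1"
        using spline_step1_integral[of n x] n by auto
      have "mollify n p x - p x = (LINT z|lborel. p z * (n * spline_step1 (n * (z - x)))) - (LINT z|lborel. p x * (n * spline_step1 (n * (z - x))))"
        using k by (simp add: mollify_def)
      also have "\<dots> = (LINT z|lborel. p z * (n * spline_step1 (n * (z - x))) - p x * (n * spline_step1 (n * (z - x))))"
        using mollify_integrable[OF ip, of n x] k n by (intro Bochner_Integration.integral_diff[symmetric]) auto
      finally have "\<bar>mollify n p x - p x\<bar> \<le> (LINT z|lborel. \<bar>p z * (n * spline_step1 (n * (z - x))) - p x * (n * spline_step1 (n * (z - x)))\<bar>)"
        using integral_abs_bound by metis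
      also have "\<dots> \<le> (LINT z|lborel. 3 * M / n * (n * spline_step1 (n * (z - x))))"
      proof (rule integral_mono)
        show "integrable lborel (\<lambda>z. \<bar>p z * (n * spline_step1 (n * (z - x))) - p x * (n * spline_step1 (n * (z - x)))\<bar>)"
          using mollify_integrable[OF ip, of n x] k n by (intro integrable_abs Bochner_Integration.integrable_diff) auto
        show "integrable lborel (\<lambda>z. 3 * M / n * (n * spline_step1 (n * (z - x))))" by (rule integrable_mult_right[OF k(1)])
        fix z
        have nn: "n * spline_step1 (n * (z - x)) \<ge> 0" using n spline_step1_nonneg by simp
        have "\<bar>p z - p x\<bar> \<le> 3 * M / n \<or> n * spline_step1 (n * (z - x)) = 0"
        proof (cases "0 \<le> z - x \<and> z - x \<le> 3 / n")
          case True
          then have "M * \<bar>z - x\<bar> \<le> M * (3 / n)" using M0 by (intro mult_left_mono) auto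
          then show ?thesis using lip[of z x] by (simp add: mult.commute)
        next
          case False
          then have "n * (z - x) \<le> 0 \<or> n * (z - x) \<ge> 3" using n by (auto simp: field_simps mult_le_0_iff)
          then show ?thesis using spline_step1_left spline_step1_right by auto
        qed
        then have "\<bar>p z - p x\<bar> * (n * spline_step1 (n * (z - x))) \<le> 3 * M / n * (n * spline_step1 (n * (z - x)))"
          using mult_right_mono[OF _ nn, of "\<bar>p z - p x\<bar>" "3 * M / n"] by (elim disjE) (simp, simp only: mult_zero_right order.refl)
        then show "\<bar>p z * (n * spline_step1 (n * (z - x))) - p x * (n * spline_step1 (n * (z - x)))\<bar>
            \<le> 3 * M / n * (n * spline_step1 (n * (z - x)))"
          unfolding left_diff_distrib[symmetric] abs_mult[of "p z - p x"] abs_of_nonneg[OF nn] .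
      qed
      also have "\<dots> = 3 * M / n" unfolding integral_mult_right_zero using k by simp
      finally show ?thesis using True by simp
    next
      case False
      have "p z * (n * spline_step1 (n * (z - x))) = 0" for z
      proof (cases "z \<in> {a<..<b}")
        case True
        have "n * (z - x) \<le> 0 \<or> n * (z - x) \<ge> 3"
        proof (cases "x > b")
          case False
          with \<open>x \<notin> {a - 3..b}\<close> True have "z - x \<ge> 3" by auto
          then have "1 * 3 \<le> n * (z - x)" using n by (intro mult_mono) auto
          then show ?thesis by simp
        qed (use n True in \<open>auto simp: mult_le_0_iff\<close>)
        then show ?thesis using spline_step1_left spline_step1_right by auto
      qed (use p in auto)
      then have "mollify n p x = 0" unfolding mollify_def by (simp only: Bochner_Integration.integral_zero)
      moreover have "p x = 0" using False by (intro p(2)) auto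
      ultimately show ?thesis using False by simp
    qed
    have "(LINT x|lborel. \<bar>mollify n p x - p x\<bar>) \<le> (LINT x|lborel. 3 * M / n * indicator {a - 3..b} x)"
    proof (rule integral_mono)
      show "integrable lborel (\<lambda>x. \<bar>mollify n p x - p x\<bar>)"
        using mollify_L1(1)[OF ip, of n] ip n by auto
      show "integrable lborel (\<lambda>x. 3 * M / n * indicator {a - 3..b} x)"
        by (intro integrable_mult_right integrable_real_indicator emeasure_bounded_finite) auto
    qed (rule bound)
    also have "\<dots> = (3 * M * (b - a + 3)) / n" using ab by simp
    finally show "(LINT x|lborel. \<bar>mollify n p x - p x\<bar>) \<le> (3 * M * (b - a + 3)) / n" .
  qed
qed

text \<open>Three errors: replacing g by a smooth p costs little before and, by the contraction,
  also after mollifying; for p itself the rate is M/n.\<close>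

lemma mollify_tendsto_L1:
  assumes g: "integrable lborel g" "\<And>x. x \<notin> {a<..<b} \<Longrightarrow> g x = 0" and ab: "a \<le> b"
  shows "(\<lambda>n. LINT x|lborel. \<bar>mollify (real (Suc n)) g x - g x\<bar>) \<longlonglongrightarrow> 0"
proof (rule LIMSEQ_I)
  fix r :: real assume r: "r > 0"
  obtain p where p: "C2b p" "\<And>x. x \<notin> {a<..<b} \<Longrightarrow> p x = 0" "(LINT x|lborel. \<bar>indicator {a<..<b} x * g x - p x\<bar>) < r / 4"
    using C2b_dense[OF g(1), of "r / 4" a b] r by auto
  have "indicator {a<..<b} x * g x = g x" for x using g(2)[of x] by (auto simp: indicator_def)
  then have gp: "(LINT x|lborel. \<bar>g x - p x\<bar>) < r / 4" using p(3) by (simp only:)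
  obtain M where M: "\<And>n::real. n \<ge> 1 \<Longrightarrow> (LINT x|lborel. \<bar>mollify n p x - p x\<bar>) \<le> M / n"
    using mollify_C2b_close[OF p(1,2) ab] by blast
  obtain N where N: "\<bar>M\<bar> / (r / 4) < real N" using reals_Archimedean2 by blast
  obtain Mp where Mp: "\<And>x. \<bar>p x\<bar> \<le> Mp" using C2b_bounded[OF p(1)] by blast
  have ip: "integrable lborel p"
    by (rule integrable_bounded_support[where A = "{a<..<b}" and M = Mp]) (use p Mp in \<open>auto intro: C2b_borel\<close>)
  show "\<exists>no. \<forall>n\<ge>no. norm ((LINT x|lborel. \<bar>mollify (real (Suc n)) g x - g x\<bar>) - 0) < r"
  proof (intro exI allI impI)
    fix n assume n: "n \<ge> N"
    define k where "k = real (Suc n)"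
    have k: "k \<ge> 1" "k > 0" "k \<ge> real N" using n by (auto simp: k_def)
    note ints = mollify_L1(1)[OF g(1) k(2)] mollify_L1(1)[OF ip k(2)] g(1) ip
    have gpi: "integrable lborel (\<lambda>x. g x - p x)" using g(1) ip by simp
    have "(LINT x|lborel. \<bar>mollify k g x - g x\<bar>) \<le>
      (LINT x|lborel. \<bar>mollify k (\<lambda>x. g x - p x) x\<bar> + \<bar>mollify k p x - p x\<bar> + \<bar>g x - p x\<bar>)"
    proof (rule integral_mono)
      show "integrable lborel (\<lambda>x. \<bar>mollify k g x - g x\<bar>)" using ints by simp
      show "integrable lborel (\<lambda>x. \<bar>mollify k (\<lambda>x. g x - p x) x\<bar> + \<bar>mollify k p x - p x\<bar> + \<bar>g x - p x\<bar>)"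
        using ints mollify_L1(1)[OF gpi k(2)] by simp
      show "\<bar>mollify k g x - g x\<bar> \<le> \<bar>mollify k (\<lambda>x. g x - p x) x\<bar> + \<bar>mollify k p x - p x\<bar> + \<bar>g x - p x\<bar>" for x
        unfolding mollify_diff[OF g(1) ip k(2)] by linarith
    qed
    also have "\<dots> = (LINT x|lborel. \<bar>mollify k (\<lambda>x. g x - p x) x\<bar>) + (LINT x|lborel. \<bar>mollify k p x - p x\<bar>) + (LINT x|lborel. \<bar>g x - p x\<bar>)"
      using ints mollify_L1(1)[OF gpi k(2)] by simp
    also have "(LINT x|lborel. \<bar>mollify k (\<lambda>x. g x - p x) x\<bar>) \<le> (LINT x|lborel. \<bar>g x - p x\<bar>)"
      by (rule mollify_L1(2)[OF gpi k(2)])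
    also have "(LINT x|lborel. \<bar>mollify k p x - p x\<bar>) \<le> M / k" by (rule M[OF k(1)])
    also have "M / k \<le> r / 4"
    proof -
      have "\<bar>M\<bar> < real N * (r / 4)" using N r by (simp add: field_simps)
      also have "\<dots> \<le> k * (r / 4)" using k r by (intro mult_right_mono) auto
      finally show ?thesis using k by (simp add: field_simps)
    qed
    finally have "(LINT x|lborel. \<bar>mollify k g x - g x\<bar>) < r" using gp r by simp
    moreover have "(LINT x|lborel. \<bar>mollify k g x - g x\<bar>) \<ge> 0" by simp
    ultimately show "norm ((LINT x|lborel. \<bar>mollify (real (Suc n)) g x - g x\<bar>) - 0) < r" by (simp add: k_def)
  qed
qed

section \<open>Essential variation and Jordan decomposition\<close>

text \<open>Testing with a signed sum of smoothed steps bounds the variation of the mollifications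
  along any chain; almost everywhere convergence carries the bound over to the function.\<close>

lemma essential_variation:
  fixes f :: "real \<Rightarrow> real"
  assumes f: "set_integrable lborel {a<..<b} f" and ab: "a \<le> b"
    and V: "\<And>\<psi> D. C1_compact_support {a<..<b} \<psi> D \<Longrightarrow> \<forall>x\<in>{a<..<b}. norm (\<psi> x) \<le> 1 \<Longrightarrow>
      (LINT x:{a<..<b}|lborel. f x * D x 1) \<le> V"
  shows "\<exists>S\<subseteq>{a<..<b}. (AE x in lborel. x \<in> {a<..<b} \<longrightarrow> x \<in> S) \<and>
    (\<forall>(y :: nat \<Rightarrow> real) N. (\<forall>i\<le>N. y i \<in> S) \<longrightarrow> (\<forall>i<N. y i \<le> y (Suc i)) \<longrightarrow>
      (\<Sum>i<N. \<bar>f (y (Suc i)) - f (y i)\<bar>) \<le> V)"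
proof -
  define g where "g x = indicator {a<..<b} x * f x" for x
  have g: "integrable lborel g" using f unfolding g_def set_integrable_def by simp
  have gz: "g x = 0" if "x \<notin> {a<..<b}" for x using that by (simp add: g_def)
  define m where "m n = mollify (real (Suc n)) g" for n
  have mi: "integrable lborel (\<lambda>x. m n x - g x)" for n
    unfolding m_def by (intro Bochner_Integration.integrable_diff g mollify_L1(1)) simp
  have "(\<lambda>n. LINT x|lborel. norm (m n x - g x)) \<longlonglongrightarrow> 0"
    using mollify_tendsto_L1[OF g gz ab] by (simp add: m_def)
  from tendsto_L1_AE_subseq[OF mi this] obtain r :: "nat \<Rightarrow> nat"
    where r: "strict_mono r" and ae: "AE x in lborel. (\<lambda>n. m (r n) x - g x) \<longlonglongrightarrow> 0" by blast
  define S where "S = {x \<in> {a<..<b}. (\<lambda>n. m (r n) x) \<longlonglongrightarrow> f x}"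
  have "AE x in lborel. x \<in> {a<..<b} \<longrightarrow> x \<in> S"
    using ae
  proof eventually_elim
    case (elim x)
    then have "(\<lambda>n. m (r n) x) \<longlonglongrightarrow> g x" by (simp add: LIM_zero_iff)
    then show ?case by (auto simp: S_def g_def)
  qed
  moreover have "(\<Sum>i<N. \<bar>f (y (Suc i)) - f (y i)\<bar>) \<le> V"
    if yS: "\<forall>i\<le>N. y i \<in> S" and ymono: "\<forall>i<N. y i \<le> y (Suc i)" for y :: "nat \<Rightarrow> real" and N
  proof -
    have yle: "y i \<le> y j" if "i \<le> j" "j \<le> N" for i j
      using that
    proof (induction j)
      case (Suc j)
      show ?case
      proof (cases "i = Suc j")
        case False
        then have "y i \<le> y j" using Suc by auto
        also have "y j \<le> y (Suc j)" using ymono Suc by auto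
        finally show ?thesis .
      qed simp
    qed simp
    have yab: "y i \<in> {a<..<b}" if "i \<le> N" for i using yS that by (auto simp: S_def)
    \<comment> \<open>The smoothed steps rise to the right of the points of the chain, the last one
      up to \<open>y N + 3 / k\<close>. Keeping this below \<open>b\<close> makes the test function
      compactly supported, and it holds for all large k.\<close>
    have chain: "(\<Sum>i<N. \<bar>mollify k g (y (Suc i)) - mollify k g (y i)\<bar>) \<le> V"
      if k: "k > 0" "y N + 3 / k < b" for k :: real
    proof -
      define \<sigma> where "\<sigma> i = sgn (mollify k g (y (Suc i)) - mollify k g (y i))" for i
      define \<psi> where "\<psi> z = (\<Sum>i<N. \<sigma> i * (spline_step (k * (z - y (Suc i))) - spline_step (k * (z - y i))))" for z
      define \<psi>1 where "\<psi>1 z = (\<Sum>i<N. \<sigma> i * (k * spline_step1 (k * (z - y (Suc i))) - k * spline_step1 (k * (z - y i))))" for z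
      have step: "((\<lambda>z. spline_step (k * (z - c))) has_real_derivative k * spline_step1 (k * (z - c))) (at z)" for c z
      proof -
        have "((\<lambda>z. k * (z - c)) has_real_derivative k) (at z)"
          using DERIV_cmult[OF DERIV_diff[OF DERIV_ident DERIV_const[of c]], of k] by simp
        from DERIV_chain2[OF DERIV_spline_step this] show ?thesis by (simp only: mult.commute[of k])
      qed
      have sup: "C1_compact_support {a<..<b} \<psi> (\<lambda>x h. \<psi>1 x * h)"
      proof (rule C1_compact_support_realI[where C = "{y 0..y N + 3 / k}"])
        show "(\<psi> has_real_derivative \<psi>1 x) (at x)" for x
          unfolding \<psi>_def \<psi>1_def by (intro DERIV_sum DERIV_cmult DERIV_diff step)
        show "continuous_on {a<..<b} \<psi>1"
          unfolding \<psi>1_def by (intro continuous_intros continuous_on_compose2[OF continuous_spline_step1[of UNIV]]) auto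
        show "{y 0..y N + 3 / k} \<subseteq> {a<..<b}" using yab[of 0] k by auto
        show "\<psi> x = 0" if "x \<in> {a<..<b} - {y 0..y N + 3 / k}" for x
        proof -
          have "spline_step (k * (x - y (Suc i))) = spline_step (k * (x - y i))" if "i < N" for i
          proof (cases "x < y 0")
            case True
            then have "x < y i" "x < y (Suc i)" using yle[of 0 i] yle[of 0 "Suc i"] that by auto
            then show ?thesis using k by (simp add: spline_step_left mult_nonneg_nonpos)
          next
            case False
            then have "x > y N + 3 / k" using \<open>x \<in> {a<..<b} - {y 0..y N + 3 / k}\<close> by auto
            then have "x - y i > 3 / k" "x - y (Suc i) > 3 / k" using yle[of i N] yle[of "Suc i" N] that by auto
            then have "k * (x - y i) \<ge> 3" "k * (x - y (Suc i)) \<ge> 3" using k by (auto simp: field_simps)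
            then show ?thesis by (simp add: spline_step_right)
          qed
          then show ?thesis unfolding \<psi>_def by (intro sum.neutral) simp
        qed
      qed simp
      have "norm (\<psi> z) \<le> 1" for z
      proof -
        \<comment> \<open>A step starting further to the right is smaller, so the differences have
          one sign and their absolute values telescope to a difference of two steps, whatever the
          signs \<open>\<sigma> i\<close> are.\<close>
        have "norm (\<psi> z) \<le> (\<Sum>i<N. spline_step (k * (z - y i)) - spline_step (k * (z - y (Suc i))))"
          unfolding \<psi>_def
        proof (rule sum_norm_le)
          fix i assume "i \<in> {..<N}"
          then have "k * (z - y (Suc i)) \<le> k * (z - y i)" using ymono k by (intro mult_left_mono) auto
          from spline_step_mono[OF this]
          have "norm (\<sigma> i * (spline_step (k * (z - y (Suc i))) - spline_step (k * (z - y i))))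
              = \<bar>\<sigma> i\<bar> * (spline_step (k * (z - y i)) - spline_step (k * (z - y (Suc i))))"
            by (simp add: abs_mult)
          also have "\<dots> \<le> 1 * (spline_step (k * (z - y i)) - spline_step (k * (z - y (Suc i))))"
            using spline_step_mono[OF \<open>k * (z - y (Suc i)) \<le> k * (z - y i)\<close>]
            by (intro mult_right_mono) (auto simp: \<sigma>_def sgn_if)
          finally show "norm (\<sigma> i * (spline_step (k * (z - y (Suc i))) - spline_step (k * (z - y i))))
              \<le> spline_step (k * (z - y i)) - spline_step (k * (z - y (Suc i)))" by simp
        qed
        also have "\<dots> = spline_step (k * (z - y 0)) - spline_step (k * (z - y N))"
          by (rule sum_lessThan_telescope')
        also have "\<dots> \<le> 1" using spline_step_bounds[of "k * (z - y 0)"] spline_step_bounds[of "k * (z - y N)"] by linarith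
        finally show ?thesis .
      qed
      then have "(LINT x:{a<..<b}|lborel. f x * (\<psi>1 x * 1)) \<le> V" by (intro V[OF sup]) simp
      moreover have "(LINT x:{a<..<b}|lborel. f x * (\<psi>1 x * 1)) = (\<Sum>i<N. \<bar>mollify k g (y (Suc i)) - mollify k g (y i)\<bar>)"
      proof -
        have "(LINT x:{a<..<b}|lborel. f x * (\<psi>1 x * 1)) = (LINT x|lborel. (\<Sum>i<N. \<sigma> i *
            (g x * (k * spline_step1 (k * (x - y (Suc i)))) - g x * (k * spline_step1 (k * (x - y i))))))"
          unfolding set_lebesgue_integral_def
          by (intro Bochner_Integration.integral_cong) (simp_all add: \<psi>1_def g_def sum_distrib_left algebra_simps)
        also have "\<dots> = (\<Sum>i<N. LINT x|lborel. \<sigma> i *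
            (g x * (k * spline_step1 (k * (x - y (Suc i)))) - g x * (k * spline_step1 (k * (x - y i)))))"
          by (intro Bochner_Integration.integral_sum integrable_mult_right Bochner_Integration.integrable_diff mollify_integrable g k)
        also have "\<dots> = (\<Sum>i<N. \<bar>mollify k g (y (Suc i)) - mollify k g (y i)\<bar>)"
        proof (rule sum.cong[OF refl])
          fix i
          have sg: "sgn d * d = \<bar>d\<bar>" for d :: real by (simp add: sgn_if)
          have "(LINT x|lborel. \<sigma> i * (g x * (k * spline_step1 (k * (x - y (Suc i)))) - g x * (k * spline_step1 (k * (x - y i)))))
              = \<sigma> i * (mollify k g (y (Suc i)) - mollify k g (y i))"
            unfolding integral_mult_right_zero mollify_def
            using Bochner_Integration.integral_diff[OF mollify_integrable[OF g k(1), of "y (Suc i)"] mollify_integrable[OF g k(1), of "y i"]]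
            by simp
          then show "(LINT x|lborel. \<sigma> i * (g x * (k * spline_step1 (k * (x - y (Suc i)))) - g x * (k * spline_step1 (k * (x - y i)))))
              = \<bar>mollify k g (y (Suc i)) - mollify k g (y i)\<bar>"
            unfolding \<sigma>_def sg .
        qed
        finally show ?thesis .
      qed
      ultimately show ?thesis by simp
    qed
    show ?thesis
    proof (rule tendsto_upperbound)
      show "(\<lambda>n. \<Sum>i<N. \<bar>m (r n) (y (Suc i)) - m (r n) (y i)\<bar>) \<longlonglongrightarrow> (\<Sum>i<N. \<bar>f (y (Suc i)) - f (y i)\<bar>)"
      proof (rule tendsto_sum)
        fix i assume "i \<in> {..<N}"
        then have "(\<lambda>n. m (r n) (y (Suc i))) \<longlonglongrightarrow> f (y (Suc i))" "(\<lambda>n. m (r n) (y i)) \<longlonglongrightarrow> f (y i)"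
          using yS by (auto simp: S_def)
        then show "(\<lambda>n. \<bar>m (r n) (y (Suc i)) - m (r n) (y i)\<bar>) \<longlonglongrightarrow> \<bar>f (y (Suc i)) - f (y i)\<bar>"
          by (intro tendsto_intros)
      qed
      obtain n0 where n0: "3 / (b - y N) < real n0" using reals_Archimedean2 by blast
      show "\<forall>\<^sub>F n in sequentially. (\<Sum>i<N. \<bar>m (r n) (y (Suc i)) - m (r n) (y i)\<bar>) \<le> V"
      proof (rule eventually_sequentiallyI)
        fix n assume n: "n0 \<le> n"
        have "b - y N > 0" using yab[of N] by simp
        have "real n0 \<le> real (Suc (r n))" using n seq_suble[OF r, of n] by simp
        then have "3 / (b - y N) < real (Suc (r n))" using n0 by linarith
        then have "y N + 3 / real (Suc (r n)) < b" using \<open>b - y N > 0\<close> by (simp add: field_simps)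
        then show "(\<Sum>i<N. \<bar>m (r n) (y (Suc i)) - m (r n) (y i)\<bar>) \<le> V"
          unfolding m_def by (intro chain) auto
      qed
    qed simp
  qed
  ultimately show ?thesis by (intro exI[of _ S]) (auto simp: S_def)
qed

text \<open>Jordan decomposition relative to an arbitrary set S: \<open>T\<close> is the variation
  over chains in S that end before x, and T - f is monotone on S because a chain may be prolonged.
  Both parts are defined by suprema, which extends them monotonically from S to the line.\<close>

lemma mono_difference_of_variation:
  fixes f :: "real \<Rightarrow> real"
  assumes "\<forall>(y :: nat \<Rightarrow> real) N. (\<forall>i\<le>N. y i \<in> S) \<longrightarrow> (\<forall>i<N. y i \<le> y (Suc i)) \<longrightarrow>
      (\<Sum>i<N. \<bar>f (y (Suc i)) - f (y i)\<bar>) \<le> V"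
  shows "\<exists>M1 M2 C. mono M1 \<and> mono M2 \<and> (\<forall>x. \<bar>M1 x\<bar> \<le> C \<and> \<bar>M2 x\<bar> \<le> C) \<and> (\<forall>x\<in>S. f x = M1 x - M2 x)"
proof (cases "S = {}")
  case True
  then show ?thesis by (intro exI[of _ "\<lambda>_. 0"] exI[of _ 0]) (auto simp: mono_def)
next
  case False
  then obtain s0 where s0: "s0 \<in> S" by blast
  have chain: "(\<Sum>i<N. \<bar>f (y (Suc i)) - f (y i)\<bar>) \<le> V"
    if "\<forall>i\<le>N. y i \<in> S" "\<forall>i<N. y i \<le> y (Suc i)" for y :: "nat \<Rightarrow> real" and N
    using assms that by simp
  have V0: "0 \<le> V" using chain[of 0 "\<lambda>_. s0"] s0 by simp
  have two: "\<bar>f y - f x\<bar> \<le> V" if "x \<in> S" "y \<in> S" for x y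
  proof -
    have *: "\<bar>f y - f x\<bar> \<le> V" if "x \<in> S" "y \<in> S" "x \<le> y" for x y
      using chain[of 1 "\<lambda>i. if i = 0 then x else y"] that by simp
    show ?thesis using *[of x y] *[of y x] that by (cases "x \<le> y") auto
  qed
  define A where "A x = {(\<Sum>i<N. \<bar>f (y (Suc i)) - f (y i)\<bar>) | (y :: nat \<Rightarrow> real) N.
      (\<forall>i\<le>N. y i \<in> S) \<and> (\<forall>i<N. y i \<le> y (Suc i)) \<and> y N \<le> x}" for x
  define T where "T x = Sup (insert 0 (A x))" for x
  have AV: "v \<le> V" if "v \<in> insert 0 (A x)" for v x using that chain V0 unfolding A_def by auto
  have bdd: "bdd_above (insert 0 (A x))" for x using AV unfolding bdd_above_def by blast
  have T0: "0 \<le> T x" for x unfolding T_def by (rule cSup_upper[OF _ bdd]) simp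
  have TV: "T x \<le> V" for x unfolding T_def by (rule cSup_least) (use AV in auto)
  have Tmono: "T x \<le> T y" if "x \<le> y" for x y
    unfolding T_def
  proof (rule cSup_subset_mono[OF _ bdd])
    have "A x \<subseteq> A y"
    proof
      fix v assume "v \<in> A x"
      then obtain u N where u: "v = (\<Sum>i<N. \<bar>f (u (Suc i)) - f (u i)\<bar>)" "\<forall>i\<le>N. u i \<in> S" "\<forall>i<N. u i \<le> u (Suc i)" "u N \<le> x"
        unfolding A_def by blast
      then have "u N \<le> y" using that by linarith
      with u show "v \<in> A y" unfolding A_def by blast
    qed
    then show "insert 0 (A x) \<subseteq> insert 0 (A y)" by blast
  qed simp
  have key: "T x + \<bar>f y - f x\<bar> \<le> T y" if xy: "x \<in> S" "y \<in> S" "x \<le> y" for x y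
  proof -
    have "T x \<le> T y - \<bar>f y - f x\<bar>"
      unfolding T_def[of x]
    proof (rule cSup_least)
      fix v assume "v \<in> insert 0 (A x)"
      then consider "v = 0" | "v \<in> A x" by blast
      then show "v \<le> T y - \<bar>f y - f x\<bar>"
      proof cases
        case 1
        have "\<bar>f y - f x\<bar> \<in> A y"
          unfolding A_def using xy
          by (intro CollectI exI[of _ "\<lambda>i. if i = 0 then x else y"] exI[of _ 1]) simp
        then have "\<bar>f y - f x\<bar> \<le> T y" unfolding T_def by (intro cSup_upper[OF _ bdd]) simp
        then show ?thesis using 1 by simp
      next
        case 2
        then obtain u N where u: "v = (\<Sum>i<N. \<bar>f (u (Suc i)) - f (u i)\<bar>)" "\<forall>i\<le>N. u i \<in> S" "\<forall>i<N. u i \<le> u (Suc i)" "u N \<le> x"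
          unfolding A_def by blast
        \<comment> \<open>The chain is prolonged by x and then y. The jump from its last point to x
          can only increase the sum, which gives
          \<open>T x + \<bar>f y - f x\<bar> \<le> T y\<close>.\<close>
        define w where "w i = (if i \<le> N then u i else if i = Suc N then x else y)" for i
        have "(\<Sum>i<Suc (Suc N). \<bar>f (w (Suc i)) - f (w i)\<bar>) = v + \<bar>f x - f (u N)\<bar> + \<bar>f y - f x\<bar>"
        proof -
          have "(\<Sum>i<N. \<bar>f (w (Suc i)) - f (w i)\<bar>) = v"
            unfolding u(1) by (rule sum.cong) (auto simp: w_def)
          then show ?thesis by (simp add: w_def)
        qed
        moreover have "(\<Sum>i<Suc (Suc N). \<bar>f (w (Suc i)) - f (w i)\<bar>) \<in> A y"
          unfolding A_def
        proof (intro CollectI exI[of _ w] exI[of _ "Suc (Suc N)"] conjI refl allI impI)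
          show "w i \<in> S" for i using u xy by (auto simp: w_def)
          show "w i \<le> w (Suc i)" if "i < Suc (Suc N)" for i
          proof -
            consider "i < N" | "i = N" | "i = Suc N" using \<open>i < Suc (Suc N)\<close> by linarith
            then show ?thesis using u xy by cases (auto simp: w_def)
          qed
          show "w (Suc (Suc N)) \<le> y" by (simp add: w_def)
        qed
        then have "(\<Sum>i<Suc (Suc N). \<bar>f (w (Suc i)) - f (w i)\<bar>) \<le> T y"
          unfolding T_def by (intro cSup_upper[OF _ bdd]) simp
        ultimately show ?thesis by linarith
      qed
    qed simp
    then show ?thesis by linarith
  qed
  define C where "C = \<bar>f s0\<bar> + V"
  \<comment> \<open>The monotone extension of T - f. The value \<open>- C\<close> lies below all
    values of T - f on S and is the default to the left of S, where the other set is empty.\<close>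
  define B where "B x = insert (- C) {T u - f u | u. u \<in> S \<and> u \<le> x}" for x
  define M2 where "M2 x = Sup (B x)" for x
  have Bb: "- C \<le> v \<and> v \<le> V + C" if "v \<in> B x" for v x
  proof -
    have "\<bar>f u\<bar> \<le> C" if "u \<in> S" for u using two[OF s0 that] unfolding C_def by linarith
    then have fu: "- C \<le> T u - f u \<and> T u - f u \<le> V + C" if "u \<in> S" for u
      using that T0[of u] TV[of u] by (smt (verit))
    from that consider "v = - C" | u where "u \<in> S" "v = T u - f u" by (auto simp: B_def)
    then show ?thesis
    proof cases
      case 1 then show ?thesis using V0 unfolding C_def by linarith
    next
      case 2 then show ?thesis using fu by simp
    qed
  qed
  have bddB: "bdd_above (B x)" for x using Bb unfolding bdd_above_def by blast
  have "mono M2"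
  proof (rule monoI)
    fix x y :: real assume "x \<le> y"
    then show "M2 x \<le> M2 y" unfolding M2_def
      by (intro cSup_subset_mono[OF _ bddB]) (auto simp: B_def)
  qed
  moreover have "\<bar>M2 x\<bar> \<le> V + C" for x
  proof -
    have "- C \<le> M2 x" unfolding M2_def by (rule cSup_upper[OF _ bddB]) (simp add: B_def)
    moreover have "M2 x \<le> V + C" unfolding M2_def by (rule cSup_least) (use Bb in \<open>auto simp: B_def\<close>)
    ultimately show ?thesis using V0 by linarith
  qed
  moreover have "f x = T x - M2 x" if "x \<in> S" for x
  proof -
    have "M2 x = T x - f x" unfolding M2_def
    proof (rule cSup_eq_maximum)
      show "T x - f x \<in> B x" using that by (auto simp: B_def)
      fix v assume "v \<in> B x"
      then consider "v = - C" | u where "u \<in> S" "u \<le> x" "v = T u - f u" by (auto simp: B_def)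
      then show "v \<le> T x - f x"
      proof cases
        case 1 then show ?thesis using two[OF s0 that] T0[of x] unfolding C_def by linarith
      next
        case 2 then show ?thesis using key[OF 2(1) that 2(2)] by linarith
      qed
    qed
    then show ?thesis by simp
  qed
  moreover have "\<bar>T x\<bar> \<le> V + C" for x using T0[of x] TV[of x] unfolding C_def by linarith
  moreover have "mono T" using Tmono by (rule monoI)
  ultimately show ?thesis by blast
qed

text \<open>Provides initial data with a representative whose values are meaningful pointwise: it is
  continuous outside a countable set, which is what the traces of transported profiles
  require.\<close>

lemma BV_mono_difference:
  fixes f :: "real \<Rightarrow> real"
  assumes f: "BV {a<..<b} f" and ab: "a \<le> b"
  shows "\<exists>M1 M2 C. mono M1 \<and> mono M2 \<and> (\<forall>x. \<bar>M1 x\<bar> \<le> C \<and> \<bar>M2 x\<bar> \<le> C) \<and>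
    (AE x in lborel. x \<in> {a<..<b} \<longrightarrow> f x = M1 x - M2 x)"
proof -
  have si: "set_integrable lborel {a<..<b} f" using f by (simp add: BV_def L1_def)
  obtain V where V: "\<And>v. v \<in> {LINT z:{a<..<b}|lborel. f z * (\<Sum>b\<in>Basis. D z b \<bullet> b) | (\<phi> :: real \<Rightarrow> real) D.
       C1_compact_support {a<..<b} \<phi> D \<and> (\<forall>z\<in>{a<..<b}. norm (\<phi> z) \<le> 1)} \<Longrightarrow> v \<le> V"
    using f unfolding BV_def bdd_above_def by blast
  have test: "(LINT x:{a<..<b}|lborel. f x * D x 1) \<le> V"
    if "C1_compact_support {a<..<b} \<psi> D" "\<forall>x\<in>{a<..<b}. norm (\<psi> x) \<le> 1" for \<psi> D
    by (rule V, rule CollectI, rule exI[of _ \<psi>], rule exI[of _ D]) (use that in simp)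
  have "\<exists>S\<subseteq>{a<..<b}. (AE x in lborel. x \<in> {a<..<b} \<longrightarrow> x \<in> S) \<and>
    (\<forall>(y :: nat \<Rightarrow> real) N. (\<forall>i\<le>N. y i \<in> S) \<longrightarrow> (\<forall>i<N. y i \<le> y (Suc i)) \<longrightarrow>
      (\<Sum>i<N. \<bar>f (y (Suc i)) - f (y i)\<bar>) \<le> V)"
    by (rule essential_variation[OF si ab]) (rule test)
  then obtain S where S: "AE x in lborel. x \<in> {a<..<b} \<longrightarrow> x \<in> S"
    and chain: "\<forall>(y :: nat \<Rightarrow> real) N. (\<forall>i\<le>N. y i \<in> S) \<longrightarrow> (\<forall>i<N. y i \<le> y (Suc i)) \<longrightarrow>
      (\<Sum>i<N. \<bar>f (y (Suc i)) - f (y i)\<bar>) \<le> V"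
    by blast
  obtain M1 M2 C where M: "mono M1" "mono M2" "\<forall>x. \<bar>M1 x\<bar> \<le> C \<and> \<bar>M2 x\<bar> \<le> C" "\<forall>x\<in>S. f x = M1 x - M2 x"
    using mono_difference_of_variation[OF chain] by blast
  have "AE x in lborel. x \<in> {a<..<b} \<longrightarrow> f x = M1 x - M2 x"
    using S by eventually_elim (use M(4) in auto)
  then show ?thesis using M by blast
qed

section \<open>Sobolev functions on an interval\<close>

lemma set_integrable_mult_continuous:
  fixes f s :: "real \<Rightarrow> real"
  assumes f: "set_integrable lborel {a<..<b} f" and s: "continuous_on {a..b} s"
  shows "set_integrable lborel {a<..<b} (\<lambda>x. f x * s x)"
proof -
  have "bounded (s ` {a..b})" by (intro compact_imp_bounded compact_continuous_image s) simp
  then obtain M where M: "\<forall>x\<in>{a..b}. \<bar>s x\<bar> \<le> M" unfolding bounded_iff by auto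
  have fi: "integrable lborel (\<lambda>x. indicator {a<..<b} x * f x)" using f by (simp add: set_integrable_def)
  have si: "(\<lambda>x. indicator {a<..<b} x * s x) \<in> borel_measurable lborel"
    using borel_measurable_integrable[OF continuous_imp_set_integrable[OF s, unfolded set_integrable_def]] by simp
  have "integrable lborel (\<lambda>x. indicator {a<..<b} x * f x * (indicator {a<..<b} x * s x))"
  proof (rule Bochner_Integration.integrable_bound[where f = "\<lambda>x. M * (indicator {a<..<b} x * f x)"])
    show "integrable lborel (\<lambda>x. M * (indicator {a<..<b} x * f x))" by (rule integrable_mult_right[OF fi])
    show "(\<lambda>x. indicator {a<..<b} x * f x * (indicator {a<..<b} x * s x)) \<in> borel_measurable lborel"
      by (rule borel_measurable_times[OF borel_measurable_integrable[OF fi] si])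
    show "AE x in lborel. norm (indicator {a<..<b} x * f x * (indicator {a<..<b} x * s x)) \<le> norm (M * (indicator {a<..<b} x * f x))"
    proof (rule AE_I2)
      fix x
      show "norm (indicator {a<..<b} x * f x * (indicator {a<..<b} x * s x)) \<le> norm (M * (indicator {a<..<b} x * f x))"
      proof (cases "x \<in> {a<..<b}")
        case True
        then have "\<bar>s x\<bar> \<le> \<bar>M\<bar>" using bspec[OF M, of x] by auto
        from mult_left_mono[OF this abs_ge_zero[of "f x"]] show ?thesis using True
          by (simp add: abs_mult mult.commute[of "\<bar>M\<bar>"])
      qed simp
    qed
  qed
  then show ?thesis unfolding set_integrable_def
    by (rule back_subst[of "integrable lborel"]) (auto simp: indicator_def fun_eq_iff)
qed

lemma set_integrable_HK:
  fixes p :: "real \<Rightarrow> real"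
  assumes p: "set_integrable lborel {0<..<L} p" and x: "0 \<le> a" "a \<le> b" "b \<le> L"
  shows "p integrable_on {a..b}" "(LINT y:{a<..<b}|lborel. p y) = integral {a..b} p"
proof -
  have "set_integrable lborel {a<..<b} p" by (rule set_integrable_subset[OF p]) (use x in auto)
  from set_borel_integral_eq_integral[OF this]
  show "p integrable_on {a..b}" "(LINT y:{a<..<b}|lborel. p y) = integral {a..b} p"
    by (simp_all add: integrable_on_open_interval_real integral_open_interval_real)
qed

lemma AC_continuous:
  fixes p :: "real \<Rightarrow> real"
  assumes p: "set_integrable lborel {0<..<L} p" and L: "0 \<le> L"
  shows "continuous_on {0..L} (\<lambda>x. c + (LINT y:{0<..<x}|lborel. p y))"
proof -
  have "continuous_on {0..L} (\<lambda>x. c + integral {0..x} p)"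
    by (intro continuous_intros indefinite_integral_continuous_1 set_integrable_HK[OF p]) (use L in auto)
  then show ?thesis
    by (rule continuous_on_eq) (use set_integrable_HK(2)[OF p, of 0] in auto)
qed

text \<open>Subtracting a primitive of the weak derivative leaves a function all of whose tested
  integrals vanish. This is the case V = 0 of \<open>essential_variation\<close>: chains of two
  points then show that the difference is constant on a set of full measure.\<close>

lemma is_weak_deriv_AC:
  assumes wd: "is_weak_deriv {0<..<L} f g" and L: "0 \<le> L"
  shows "\<exists>c. AE x in lborel. x \<in> {0<..<L} \<longrightarrow> f x = c + (LINT y:{0<..<x}|lborel. g y)"
proof -
  define G where "G x = 0 + (LINT y:{0<..<x}|lborel. g y)" for x
  have f: "set_integrable lborel {0<..<L} f" and g: "set_integrable lborel {0<..<L} g"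
    using wd by (auto simp: is_weak_deriv_def L1_def)
  have Gc: "continuous_on {0..L} G" unfolding G_def[abs_def] by (rule AC_continuous[OF g L])
  have Gi: "set_integrable lborel {0<..<L} G" by (rule continuous_imp_set_integrable[OF Gc])
  have hi: "set_integrable lborel {0<..<L} (\<lambda>x. f x - G x)" by (rule set_integral_diff(1)[OF f Gi])
  have test: "(LINT x:{0<..<L}|lborel. (f x - G x) * D x 1) \<le> 0" if C1: "C1_compact_support {0<..<L} \<psi> D" for \<psi> D
  proof -
    define s where "s x = (if x \<in> {0<..<L} then \<psi> x else 0)" for x
    define s1 where "s1 x = (if x \<in> {0<..<L} then D x 1 else 0)" for x
    have s: "(s has_real_derivative s1 x) (at x)" "continuous_on UNIV s1" for x
      using C1_compact_support_realD[OF C1] unfolding s_def[abs_def] s1_def[abs_def] by auto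
    have s1c: "continuous_on {0..L} s1" using s(2) by (rule continuous_on_subset) simp
    have cong: "(LINT x:{0<..<L}|lborel. k x * D x 1) = (LINT x:{0<..<L}|lborel. k x * s1 x)" for k
      by (rule set_lebesgue_integral_cong) (auto simp: s1_def)
    have ibp: "(LINT x:{0<..<L}|lborel. s x * g x) + (LINT x:{0<..<L}|lborel. s1 x * G x) = s L * G L - s 0 * G 0"
    proof (rule integration_by_parts_AC(1)[where s = s and ?s1.0 = s1 and p = g and q = G and L = L and ?q0.0 = 0, OF L g _ _ s1c])
      show "G x = 0 + (LINT y:{0<..<x}|lborel. g y)" for x by (rule G_def)
      show "(s has_real_derivative s1 x) (at x within {0..L})" for x
        by (rule has_field_derivative_at_within) (rule s(1))
    qed
    have "(LINT x:{0<..<L}|lborel. f x * D x 1) = - (LINT x:{0<..<L}|lborel. g x * \<psi> x)"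
      using wd C1 unfolding is_weak_deriv_def by blast
    also have "(LINT x:{0<..<L}|lborel. g x * \<psi> x) = (LINT x:{0<..<L}|lborel. s x * g x)"
      by (rule set_lebesgue_integral_cong) (auto simp: s_def)
    finally have 1: "(LINT x:{0<..<L}|lborel. f x * s1 x) = - (LINT x:{0<..<L}|lborel. s x * g x)"
      unfolding cong .
    have "(LINT x:{0<..<L}|lborel. (f x - G x) * D x 1) = (LINT x:{0<..<L}|lborel. f x * s1 x - G x * s1 x)"
      unfolding cong by (simp add: left_diff_distrib)
    also have "\<dots> = (LINT x:{0<..<L}|lborel. f x * s1 x) - (LINT x:{0<..<L}|lborel. G x * s1 x)"
      by (intro set_integral_diff(2) set_integrable_mult_continuous f Gi s1c)
    also have "\<dots> = 0" using 1 ibp by (simp add: s_def mult.commute[of "G _"])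
    finally show ?thesis by simp
  qed
  have "\<exists>S\<subseteq>{0<..<L}. (AE x in lborel. x \<in> {0<..<L} \<longrightarrow> x \<in> S) \<and>
    (\<forall>(y :: nat \<Rightarrow> real) N. (\<forall>i\<le>N. y i \<in> S) \<longrightarrow> (\<forall>i<N. y i \<le> y (Suc i)) \<longrightarrow>
      (\<Sum>i<N. \<bar>(f (y (Suc i)) - G (y (Suc i))) - (f (y i) - G (y i))\<bar>) \<le> 0)"
    by (rule essential_variation[OF hi L]) (rule test)
  then obtain S where S: "AE x in lborel. x \<in> {0<..<L} \<longrightarrow> x \<in> S"
    and chain: "\<forall>(y :: nat \<Rightarrow> real) N. (\<forall>i\<le>N. y i \<in> S) \<longrightarrow> (\<forall>i<N. y i \<le> y (Suc i)) \<longrightarrow>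
      (\<Sum>i<N. \<bar>(f (y (Suc i)) - G (y (Suc i))) - (f (y i) - G (y i))\<bar>) \<le> 0"
    by blast
  have const: "f y - G y = f x - G x" if "x \<in> S" "y \<in> S" for x y
  proof -
    have *: "f y - G y = f x - G x" if "x \<in> S" "y \<in> S" "x \<le> y" for x y
      using chain[rule_format, of 1 "\<lambda>i. if i = 0 then x else y"] that by simp
    show ?thesis using *[of x y] *[of y x] that by (cases "x \<le> y") auto
  qed
  obtain c where c: "\<And>x. x \<in> S \<Longrightarrow> f x - G x = c" using const by metis
  have "AE x in lborel. x \<in> {0<..<L} \<longrightarrow> f x = c + (LINT y:{0<..<x}|lborel. g y)"
    using S
  proof eventually_elim
    case (elim x)
    then show ?case using c[of x] by (auto simp: G_def)
  qed
  then show ?thesis ..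
qed

lemma AE_interval_ex:
  assumes "AE x in lborel. x \<in> {a<..<b} \<longrightarrow> P x" "a < (b::real)"
  shows "\<exists>x\<in>{a<..<b}. P x"
proof (rule ccontr)
  assume *: "\<not> (\<exists>x\<in>{a<..<b}. P x)"
  have "AE x in lborel. x \<notin> {a<..<b}" using assms(1) by eventually_elim (use * in auto)
  then have "emeasure lborel {a<..<b} = 0" by (subst (asm) AE_iff_null_sets[symmetric]) (auto simp: null_sets_def)
  then show False using assms(2) by simp
qed

lemma continuous_AE_eq:
  fixes F G :: "real \<Rightarrow> real"
  assumes c: "continuous_on {0..L} F" "continuous_on {0..L} G"
    and ae: "AE x in lborel. x \<in> {0<..<L} \<longrightarrow> F x = G x" and x: "x \<in> {0..L}" and L: "0 < L"
  shows "F x = G x"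
proof (rule ccontr)
  assume ne: "F x \<noteq> G x"
  have "continuous_on {0..L} (\<lambda>x. F x - G x)" by (intro continuous_intros c)
  then obtain d where d: "d > 0" "\<forall>y\<in>{0..L}. dist y x < d \<longrightarrow> dist (F y - G y) (F x - G x) < \<bar>F x - G x\<bar>"
    unfolding continuous_on_iff using x ne by (metis abs_ge_zero order_le_less right_minus_eq abs_eq_0)
  have "max 0 (x - d) < min L (x + d)" using x L d(1) by auto
  moreover have "AE y in lborel. y \<in> {max 0 (x - d)<..<min L (x + d)} \<longrightarrow> F y = G y"
    using ae by eventually_elim auto
  ultimately have "\<exists>y\<in>{max 0 (x - d)<..<min L (x + d)}. F y = G y"
    by (intro AE_interval_ex)
  then obtain y where y: "y \<in> {max 0 (x - d)<..<min L (x + d)}" "F y = G y" by blast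
  then have "y \<in> {0..L}" "dist y x < d" by (auto simp: dist_real_def)
  with d(2) have "dist (F y - G y) (F x - G x) < \<bar>F x - G x\<bar>" by blast
  then show False using y by (simp add: dist_real_def)
qed

text \<open>Both derivatives have primitives that agree almost everywhere, hence everywhere by
  continuity; so their integrals agree over every interval.\<close>

lemma is_weak_deriv_unique:
  assumes wd: "is_weak_deriv {0<..<L} f g" "is_weak_deriv {0<..<L} f g'" and L: "0 < L"
  shows "AE x in lborel. x \<in> {0<..<L} \<longrightarrow> g x = g' x"
proof -
  have g: "set_integrable lborel {0<..<L} g" "set_integrable lborel {0<..<L} g'"
    using wd by (auto simp: is_weak_deriv_def L1_def)
  obtain c where c: "AE x in lborel. x \<in> {0<..<L} \<longrightarrow> f x = c + (LINT y:{0<..<x}|lborel. g y)"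
    using is_weak_deriv_AC[OF wd(1)] L by auto
  obtain c' where c': "AE x in lborel. x \<in> {0<..<L} \<longrightarrow> f x = c' + (LINT y:{0<..<x}|lborel. g' y)"
    using is_weak_deriv_AC[OF wd(2)] L by auto
  have ae: "AE x in lborel. x \<in> {0<..<L} \<longrightarrow> c + (LINT y:{0<..<x}|lborel. g y) = c' + (LINT y:{0<..<x}|lborel. g' y)"
    using c c' by eventually_elim auto
  have eq: "c + (LINT y:{0<..<x}|lborel. g y) = c' + (LINT y:{0<..<x}|lborel. g' y)" if "x \<in> {0..L}" for x
    by (rule continuous_AE_eq[OF AC_continuous AC_continuous ae that L]) (use g L in auto)
  define k where "k x = indicator {0<..<L} x * g x - indicator {0<..<L} x * g' x" for x
  have ki: "integrable lborel k"
    unfolding k_def using g by (intro Bochner_Integration.integrable_diff) (auto simp: set_integrable_def)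
  have "AE x in lborel. k x = 0"
  proof (rule AE_zero_if_box_integrals_zero[OF ki])
    fix a b :: real
    define a' where "a' = max 0 a"
    define b' where "b' = min L b"
    have "(LINT x:box a b|lborel. k x) = (LINT x:{a'<..<b'}|lborel. g x - g' x)"
      unfolding set_lebesgue_integral_def
      by (intro Bochner_Integration.integral_cong) (auto simp: k_def a'_def b'_def indicator_def)
    also have "\<dots> = 0"
    proof (cases "a' < b'")
      case True
      have ab: "0 \<le> a'" "a' \<le> b'" "b' \<le> L" using True by (auto simp: a'_def b'_def)
      have int: "set_integrable lborel {a'<..<b'} g" "set_integrable lborel {a'<..<b'} g'"
        by (rule set_integrable_subset[OF g(1)] set_integrable_subset[OF g(2)]; use ab in auto)+
      have "integral {0..a'} p + integral {a'..b'} p = integral {0..b'} p" if "set_integrable lborel {0<..<L} p" for p :: "real \<Rightarrow> real"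
        by (intro Henstock_Kurzweil_Integration.integral_combine set_integrable_HK[OF that]) (use ab in auto)
      from this[OF g(1)] this[OF g(2)] eq[of a'] eq[of b']
      have "integral {a'..b'} g = integral {a'..b'} g'"
        using ab set_integrable_HK(2)[OF g(1), of 0] set_integrable_HK(2)[OF g(2), of 0] by simp
      then show ?thesis
        using set_integral_diff(2)[OF int] set_integrable_HK(2)[OF g(1) ab] set_integrable_HK(2)[OF g(2) ab] by simp
    qed (simp add: set_lebesgue_integral_def)
    finally show "(LINT x:box a b|lborel. k x) = 0" .
  qed
  then show ?thesis by eventually_elim (auto simp: k_def)
qed

lemma set_lborel_integral_cong_AE:
  fixes f g :: "'a::euclidean_space \<Rightarrow> real"
  assumes "set_borel_measurable lborel A f" "set_borel_measurable lborel A g" "AE x in lborel. x \<in> A \<longrightarrow> f x = g x"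
  shows "(LINT x:A|lborel. f x) = (LINT x:A|lborel. g x)"
  unfolding set_lebesgue_integral_def
proof (rule integral_cong_AE)
  show "AE x in lborel. indicator A x *\<^sub>R f x = indicator A x *\<^sub>R g x"
    using assms(3) by eventually_elim (auto simp: indicator_def)
qed (use assms in \<open>auto simp: set_borel_measurable_def\<close>)

lemma set_borel_measurable_mult:
  fixes f g :: "'a \<Rightarrow> real"
  assumes "set_borel_measurable M A f" "set_borel_measurable M A g"
  shows "set_borel_measurable M A (\<lambda>x. f x * g x)"
proof -
  have "(\<lambda>x. (indicator A x *\<^sub>R f x) * (indicator A x *\<^sub>R g x)) \<in> borel_measurable M"
    using assms unfolding set_borel_measurable_def by (rule borel_measurable_times)
  also have "(\<lambda>x. (indicator A x *\<^sub>R f x) * (indicator A x *\<^sub>R g x)) = (\<lambda>x. indicator A x *\<^sub>R (f x * g x))"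
    by (auto simp: indicator_def fun_eq_iff)
  finally show ?thesis unfolding set_borel_measurable_def .
qed

lemma L1_measurable: "L1 A f \<Longrightarrow> set_borel_measurable lborel A f"
  unfolding L1_def set_integrable_def set_borel_measurable_def by (rule borel_measurable_integrable)

lemma is_weak_deriv_cong_AE:
  assumes wd: "is_weak_deriv {0<..<L} g h" and f: "L1 {0<..<L} f" and ae: "AE x in lborel. x \<in> {0<..<L} \<longrightarrow> f x = g x"
  shows "is_weak_deriv {0<..<L} f h"
  unfolding is_weak_deriv_def
proof (intro conjI allI impI)
  fix \<phi> D assume C1: "C1_compact_support {0<..<L} \<phi> (D :: real \<Rightarrow> real \<Rightarrow> real)"
  have "continuous_on {0<..<L} (\<lambda>x. D x 1)" using C1 unfolding C1_compact_support_def by blast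
  then have Dm: "set_borel_measurable lborel {0<..<L} (\<lambda>x. D x 1)"
    unfolding set_borel_measurable_def using borel_measurable_continuous_on_indicator[of "{0<..<L}" "\<lambda>x. D x 1"] by simp
  have gm: "set_borel_measurable lborel {0<..<L} g" using wd by (auto simp: is_weak_deriv_def intro: L1_measurable)
  have "(LINT x:{0<..<L}|lborel. f x * D x 1) = (LINT x:{0<..<L}|lborel. g x * D x 1)"
    by (rule set_lborel_integral_cong_AE[OF set_borel_measurable_mult[OF L1_measurable[OF f] Dm] set_borel_measurable_mult[OF gm Dm]])
      (use ae in \<open>eventually_elim, auto\<close>)
  then show "(LINT x:{0<..<L}|lborel. f x * D x 1) = - (LINT x:{0<..<L}|lborel. h x * \<phi> x)"
    using wd C1 unfolding is_weak_deriv_def by simp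
qed (use wd f in \<open>auto simp: is_weak_deriv_def\<close>)

text \<open>The derivative chosen by \<open>weak_deriv\<close> need not be the function witnessing
  \<open>W21\<close>; uniqueness and invariance under null sets show that it is itself weakly
  differentiable. Two integrations then yield a C^1 representative on the closed interval with
  absolutely continuous derivative.\<close>

lemma W21_representation:
  assumes f: "W21 {0<..<L} f" and L: "0 < L"
  defines "f1 \<equiv> weak_deriv {0<..<L} f"
  defines "f2 \<equiv> weak_deriv {0<..<L} f1"
  shows "\<exists>F F1. (\<forall>x\<in>{0..L}. (F has_real_derivative F1 x) (at x within {0..L})) \<and> continuous_on {0..L} F1 \<and>
    (\<forall>x\<in>{0..L}. F1 x = F1 0 + (LINT y:{0<..<x}|lborel. f2 y)) \<and>
    (AE x in lborel. x \<in> {0<..<L} \<longrightarrow> f x = F x) \<and> (AE x in lborel. x \<in> {0<..<L} \<longrightarrow> f1 x = F1 x) \<and>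
    L1 {0<..<L} f \<and> L1 {0<..<L} f1 \<and> L1 {0<..<L} f2"
proof -
  obtain g h where gh: "is_weak_deriv {0<..<L} f g" "is_weak_deriv {0<..<L} g h" using f unfolding W21_def by blast
  have 1: "is_weak_deriv {0<..<L} f f1" unfolding f1_def weak_deriv_def by (rule someI[of _ g]) (rule gh)
  have "is_weak_deriv {0<..<L} f1 h"
    by (rule is_weak_deriv_cong_AE[OF gh(2) _ is_weak_deriv_unique[OF 1 gh(1) L]]) (use 1 in \<open>simp add: is_weak_deriv_def\<close>)
  then have 2: "is_weak_deriv {0<..<L} f1 f2" unfolding f2_def weak_deriv_def[of _ f1] by (rule someI[of _ h])
  have L1: "L1 {0<..<L} f" "L1 {0<..<L} f1" "L1 {0<..<L} f2" using 1 2 by (auto simp: is_weak_deriv_def)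
  obtain c1 where c1: "AE x in lborel. x \<in> {0<..<L} \<longrightarrow> f1 x = c1 + (LINT y:{0<..<x}|lborel. f2 y)"
    using is_weak_deriv_AC[OF 2] L by auto
  obtain c where c: "AE x in lborel. x \<in> {0<..<L} \<longrightarrow> f x = c + (LINT y:{0<..<x}|lborel. f1 y)"
    using is_weak_deriv_AC[OF 1] L by auto
  define F1 where "F1 x = c1 + (LINT y:{0<..<x}|lborel. f2 y)" for x
  define F where "F x = c + integral {0..x} F1" for x
  have F1c: "continuous_on {0..L} F1"
    unfolding F1_def[abs_def] by (rule AC_continuous) (use L1 L in \<open>auto simp: L1_def\<close>)
  have F1i: "set_integrable lborel {0<..<L} F1" by (rule continuous_imp_set_integrable[OF F1c])
  have "(F has_real_derivative F1 x) (at x within {0..L})" if "x \<in> {0..L}" for x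
    unfolding F_def[abs_def] using integral_has_real_derivative[OF F1c that] by (auto intro!: derivative_eq_intros)
  moreover have "F1 x = F1 0 + (LINT y:{0<..<x}|lborel. f2 y)" for x
    by (simp add: F1_def set_lebesgue_integral_def)
  moreover have "AE x in lborel. x \<in> {0<..<L} \<longrightarrow> f x = F x"
    using c
  proof eventually_elim
    case (elim x)
    show ?case
    proof
      assume x: "x \<in> {0<..<L}"
      have "(LINT y:{0<..<x}|lborel. f1 y) = (LINT y:{0<..<x}|lborel. F1 y)"
      proof (rule set_lborel_integral_cong_AE)
        have sub: "set_integrable lborel {0<..<x} k" if "set_integrable lborel {0<..<L} k" for k :: "real \<Rightarrow> real"
          by (rule set_integrable_subset[OF that]) (use x in auto)
        show "set_borel_measurable lborel {0<..<x} f1"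
          by (rule L1_measurable) (use sub L1(2) in \<open>auto simp: L1_def\<close>)
        show "set_borel_measurable lborel {0<..<x} F1"
          by (rule L1_measurable) (use sub F1i in \<open>auto simp: L1_def\<close>)
        show "AE y in lborel. y \<in> {0<..<x} \<longrightarrow> f1 y = F1 y"
          using c1 by eventually_elim (use x in \<open>auto simp: F1_def\<close>)
      qed
      also have "\<dots> = integral {0..x} F1" by (rule set_integrable_HK(2)[OF F1i]) (use x in auto)
      finally show "f x = F x" using elim x by (simp add: F_def)
    qed
  qed
  moreover have "AE x in lborel. x \<in> {0<..<L} \<longrightarrow> f1 x = F1 x" using c1 unfolding F1_def .
  ultimately show ?thesis using F1c L1 by blast
qed

lemma bdry_trace_cong_AE:
  fixes f g :: "'a::euclidean_space \<Rightarrow> real"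
  assumes "\<Omega> \<in> sets borel" "set_borel_measurable lborel \<Omega> f" "set_borel_measurable lborel \<Omega> g"
    and ae: "AE z in lborel. z \<in> \<Omega> \<longrightarrow> f z = g z"
  shows "bdry_trace \<Omega> f p = bdry_trace \<Omega> g p"
proof -
  have meas: "set_borel_measurable lborel (ball p r \<inter> \<Omega>) (\<lambda>z. \<bar>f z - c\<bar>)"
    if "set_borel_measurable lborel \<Omega> f" for f :: "'a \<Rightarrow> real" and r c
  proof -
    have [measurable]: "\<Omega> \<in> sets borel" "(\<lambda>z. indicator \<Omega> z * f z) \<in> borel_measurable borel" "ball p r \<in> sets borel"
      using that assms(1) unfolding set_borel_measurable_def by auto
    have "(\<lambda>z. indicator (ball p r) z * \<bar>indicator \<Omega> z * f z - indicator \<Omega> z * c\<bar>) \<in> borel_measurable borel"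
      by measurable
    also have "(\<lambda>z. indicator (ball p r) z * \<bar>indicator \<Omega> z * f z - indicator \<Omega> z * c\<bar>)
        = (\<lambda>z. indicator (ball p r \<inter> \<Omega>) z *\<^sub>R \<bar>f z - c\<bar>)"
      by (auto simp: indicator_def fun_eq_iff)
    finally show ?thesis by (simp add: set_borel_measurable_def)
  qed
  have "(LINT z:(ball p r \<inter> \<Omega>)|lborel. \<bar>f z - c\<bar>) = (LINT z:(ball p r \<inter> \<Omega>)|lborel. \<bar>g z - c\<bar>)" for r c
    by (rule set_lborel_integral_cong_AE[OF meas[OF assms(2)] meas[OF assms(3)]]) (use ae in \<open>eventually_elim, auto\<close>)
  then show ?thesis unfolding bdry_trace_def by (simp only:)
qed

lemma bdry_trace_interval:
  fixes f F :: "real \<Rightarrow> real"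
  assumes L: "0 < L" and f: "L1 {0<..<L} f" and F: "continuous_on {0..L} F"
    and ae: "AE x in lborel. x \<in> {0<..<L} \<longrightarrow> f x = F x" and p: "p = 0 \<or> p = L"
  shows "bdry_trace {0<..<L} f p = F p"
proof -
  have Fm: "set_borel_measurable lborel {0<..<L} F"
    by (rule L1_measurable) (simp add: L1_def continuous_imp_set_integrable[OF F])
  have "bdry_trace {0<..<L} f p = bdry_trace {0<..<L} F p"
    by (rule bdry_trace_cong_AE[OF _ L1_measurable[OF f] Fm ae]) simp
  also have "\<dots> = F p"
  proof (rule bdry_trace_eqI[where \<kappa> = 1, OF _ _ Fm])
    have "(F \<longlongrightarrow> F p) (at p within {0..L})" using F p L unfolding continuous_on_def by auto
    then show "(F \<longlongrightarrow> F p) (at p within {0<..<L})" by (rule tendsto_within_subset) auto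
    show "\<forall>\<^sub>F r in at_right 0. 1 * r ^ DIM(real) \<le> measure lborel (ball p r \<inter> {0<..<L})"
    proof (rule eventually_at_rightI[OF _ L])
      fix r assume r: "r \<in> {0<..<L}"
      have "ball p r \<inter> {0<..<L} = (if p = 0 then {0<..<r} else {L - r<..<L})"
        using p L r by (auto simp: ball_def dist_real_def)
      then show "1 * r ^ DIM(real) \<le> measure lborel (ball p r \<inter> {0<..<L})" using r by auto
    qed
  qed (use p in auto)
  finally show ?thesis .
qed

section \<open>Dissipativity of the viscous transport operator in \<open>L\<^sup>1\<close>\<close>

lemma tendsto_smooth_sgn: "(\<lambda>n. r / sqrt (r\<^sup>2 + (inverse (real (Suc n)))\<^sup>2)) \<longlonglongrightarrow> sgn r" for r :: real
proof (cases "r = 0")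
  case False
  have "(\<lambda>n. r / sqrt (r\<^sup>2 + (inverse (real (Suc n)))\<^sup>2)) \<longlonglongrightarrow> r / sqrt (r\<^sup>2 + 0\<^sup>2)"
    by (intro tendsto_intros LIMSEQ_inverse_real_of_nat) (use False in simp)
  moreover have "r / sqrt (r\<^sup>2 + 0\<^sup>2) = sgn r" using False by (simp add: sgn_if)
  ultimately show ?thesis by simp
qed simp

lemma smooth_sgn_abs_le: "\<bar>r / sqrt (r\<^sup>2 + d\<^sup>2)\<bar> \<le> 1" for r d :: real
proof -
  define w where "w = sqrt (r\<^sup>2 + d\<^sup>2)"
  have "\<bar>r\<bar> \<le> w" unfolding w_def by (rule real_le_rsqrt) simp
  moreover have w0: "0 \<le> w" unfolding w_def by simp
  ultimately have "\<bar>r\<bar> / w \<le> w / w" by (rule divide_right_mono)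
  also have "w / w \<le> 1" by (simp add: divide_self_if)
  finally show ?thesis unfolding w_def[symmetric] abs_divide abs_of_nonneg[OF w0] .
qed

lemma smooth_sgn_mult_le: "\<bar>r / sqrt (r\<^sup>2 + d\<^sup>2) * b\<bar> \<le> \<bar>b\<bar>" for r d b :: real
proof -
  have "\<bar>r / sqrt (r\<^sup>2 + d\<^sup>2)\<bar> * \<bar>b\<bar> \<le> 1 * \<bar>b\<bar>"
    by (rule mult_right_mono[OF smooth_sgn_abs_le abs_ge_zero])
  then show ?thesis unfolding abs_mult by (simp only: mult_1_left)
qed

text \<open>With \<sigma>(r) = r / sqrt(r^2 + d^2), the second formula gives a primitive of r
  \<sigma>'(r). It is what makes the transport term in Kato's inequality an exact derivative, of
  size at most d.\<close>

lemma DERIV_smooth_sgn: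
  assumes "d > 0"
  shows "((\<lambda>r. r / sqrt (r\<^sup>2 + d\<^sup>2)) has_real_derivative d\<^sup>2 / sqrt (r\<^sup>2 + d\<^sup>2) ^ 3) (at r)"
    and "((\<lambda>r. - (d\<^sup>2 / sqrt (r\<^sup>2 + d\<^sup>2))) has_real_derivative d\<^sup>2 * r / sqrt (r\<^sup>2 + d\<^sup>2) ^ 3) (at r)"
proof -
  have pos: "r\<^sup>2 + d\<^sup>2 > 0" by (rule add_nonneg_pos) (use assms in simp_all)
  have sq: "sqrt (r\<^sup>2 + d\<^sup>2) ^ 2 = r\<^sup>2 + d\<^sup>2" using pos by (intro real_sqrt_pow2) linarith
  have w0: "sqrt (r\<^sup>2 + d\<^sup>2) \<noteq> 0" using real_sqrt_gt_zero[OF pos] by linarith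
  have ds: "((\<lambda>r. sqrt (r\<^sup>2 + d\<^sup>2)) has_real_derivative r / sqrt (r\<^sup>2 + d\<^sup>2)) (at r)"
  proof -
    have "((\<lambda>r. r\<^sup>2 + d\<^sup>2) has_real_derivative 2 * r) (at r)" by (auto intro!: derivative_eq_intros)
    from DERIV_chain2[OF DERIV_real_sqrt[OF pos] this]
    show ?thesis by (simp only: divide_inverse inverse_mult_distrib mult.assoc mult.left_commute[of _ 2]
        mult.commute[of "inverse 2"]) (simp add: mult.commute[of r])
  qed
  have "d\<^sup>2 = sqrt (r\<^sup>2 + d\<^sup>2) ^ 2 - r\<^sup>2" using sq by simp
  then have e1: "d\<^sup>2 / sqrt (r\<^sup>2 + d\<^sup>2) ^ 3 = (1 * sqrt (r\<^sup>2 + d\<^sup>2) - r * (r / sqrt (r\<^sup>2 + d\<^sup>2))) / (sqrt (r\<^sup>2 + d\<^sup>2) * sqrt (r\<^sup>2 + d\<^sup>2))"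
    using w0 by (simp add: field_simps power2_eq_square power3_eq_cube)
  show "((\<lambda>r. r / sqrt (r\<^sup>2 + d\<^sup>2)) has_real_derivative d\<^sup>2 / sqrt (r\<^sup>2 + d\<^sup>2) ^ 3) (at r)"
    unfolding e1 by (rule DERIV_divide[OF DERIV_ident ds w0])
  have di: "((\<lambda>r. - (d\<^sup>2 * inverse (sqrt (r\<^sup>2 + d\<^sup>2)))) has_real_derivative
      - (d\<^sup>2 * (- (inverse (sqrt (r\<^sup>2 + d\<^sup>2)) * (r / sqrt (r\<^sup>2 + d\<^sup>2)) * inverse (sqrt (r\<^sup>2 + d\<^sup>2)))))) (at r)"
    by (intro DERIV_minus DERIV_cmult DERIV_inverse' ds w0)
  have eq: "- (d\<^sup>2 * (- (inverse (sqrt (r\<^sup>2 + d\<^sup>2)) * (r / sqrt (r\<^sup>2 + d\<^sup>2)) * inverse (sqrt (r\<^sup>2 + d\<^sup>2)))))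
      = d\<^sup>2 * r / sqrt (r\<^sup>2 + d\<^sup>2) ^ 3"
    using w0 by (simp add: field_simps power3_eq_cube)
  show "((\<lambda>r. - (d\<^sup>2 / sqrt (r\<^sup>2 + d\<^sup>2))) has_real_derivative d\<^sup>2 * r / sqrt (r\<^sup>2 + d\<^sup>2) ^ 3) (at r)"
    using di unfolding eq divide_inverse[of "d\<^sup>2"] .
qed

lemma AC_linear_combination:
  fixes e e1 e2 :: "real \<Rightarrow> real"
  assumes e: "\<And>x. x \<in> {0..L} \<Longrightarrow> (e has_real_derivative e1 x) (at x within {0..L})" and e1c: "continuous_on {0..L} e1"
    and e2: "set_integrable lborel {0<..<L} e2" and e1: "\<And>x. x \<in> {0..L} \<Longrightarrow> e1 x = e1 0 + (LINT y:{0<..<x}|lborel. e2 y)"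
    and x: "x \<in> {0..L}"
  shows "a * e x + b * e1 x = (a * e 0 + b * e1 0) + (LINT y:{0<..<x}|lborel. a * e1 y + b * e2 y)"
proof -
  have i1: "set_integrable lborel {0<..<x} e1"
    by (rule continuous_imp_set_integrable, rule continuous_on_subset[OF e1c]) (use x in auto)
  have i2: "set_integrable lborel {0<..<x} e2" by (rule set_integrable_subset[OF e2]) (use x in auto)
  have A: "(LINT y:{0<..<x}|lborel. e1 y) = e x - e 0"
  proof (rule set_integral_FTC)
    show "(e has_real_derivative e1 y) (at y within {0..x})" if "0 \<le> y" "y \<le> x" for y
      by (rule DERIV_subset[OF e]) (use that x in auto)
    show "continuous_on {0..x} e1" by (rule continuous_on_subset[OF e1c]) (use x in auto)
  qed (use x in auto)
  have B: "(LINT y:{0<..<x}|lborel. a * e1 y + b * e2 y) = a * (LINT y:{0<..<x}|lborel. e1 y) + b * (LINT y:{0<..<x}|lborel. e2 y)"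
    using set_integral_add(2)[of lborel "{0<..<x}" "\<lambda>y. a * e1 y" "\<lambda>y. b * e2 y"] i1 i2 by simp
  have C: "(LINT y:{0<..<x}|lborel. e2 y) = e1 x - e1 0" using e1[OF x] by linarith
  show ?thesis unfolding A B C by (simp add: algebra_simps)
qed

text \<open>Kato's inequality: the sign function is replaced by \<open>r / sqrt (r\<^sup>2 + d\<^sup>2)\<close>; the diffusion term then has a
  sign, and the transport term is an exact derivative whose primitive is at most \<open>d\<close>.\<close>

lemma kato_interval:
  fixes e e1 e2 :: "real \<Rightarrow> real"
  assumes L: "0 \<le> L" and eps: "0 \<le> eps" and lam: "0 \<le> lam"
    and e: "\<And>x. x \<in> {0..L} \<Longrightarrow> (e has_real_derivative e1 x) (at x within {0..L})" and e1c: "continuous_on {0..L} e1"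
    and e2: "set_integrable lborel {0<..<L} e2" and e1: "\<And>x. x \<in> {0..L} \<Longrightarrow> e1 x = e1 0 + (LINT y:{0<..<x}|lborel. e2 y)"
  shows "(LINT x:{0<..<L}|lborel. sgn (e x) * (- lam * e1 x + eps * e2 x))
    \<le> sgn (e L) * (- lam * e L + eps * e1 L) - sgn (e 0) * (- lam * e 0 + eps * e1 0)"
    and "set_integrable lborel {0<..<L} (\<lambda>x. sgn (e x) * (- lam * e1 x + eps * e2 x))"
proof -
  define p where "p x = - lam * e1 x + eps * e2 x" for x
  define q where "q x = - lam * e x + eps * e1 x" for x
  have ec: "continuous_on {0..L} e" using e by (metis DERIV_continuous continuous_on_eq_continuous_within)
  have p: "set_integrable lborel {0<..<L} p"
    unfolding p_def[abs_def]
    by (rule set_integral_add(1)[OF set_integrable_mult_right set_integrable_mult_right]) (rule continuous_imp_set_integrable[OF e1c] e2)+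
  have q: "q x = q 0 + (LINT y:{0<..<x}|lborel. p y)" if "0 \<le> x" "x \<le> L" for x
    unfolding q_def p_def by (rule AC_linear_combination[OF e e1c e2 e1]) (use that in auto)
  define s where "s d x = e x / sqrt ((e x)\<^sup>2 + d\<^sup>2)" for d x
  have step: "(LINT x:{0<..<L}|lborel. s d x * p x) \<le> s d L * q L - s d 0 * q 0 + lam * d" if d: "d > 0" for d
  proof -
    define w where "w x = sqrt ((e x)\<^sup>2 + d\<^sup>2)" for x
    have wpos: "w x > 0" for x unfolding w_def by (intro real_sqrt_gt_zero add_nonneg_pos) (use d in simp_all)
    define s1 where "s1 x = d\<^sup>2 / w x ^ 3 * e1 x" for x
    have wc: "continuous_on {0..L} w" unfolding w_def[abs_def] by (intro continuous_intros ec)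
    have s1c: "continuous_on {0..L} s1"
      unfolding s1_def[abs_def] by (intro continuous_intros wc e1c) (use wpos in \<open>simp add: less_imp_neq[THEN not_sym]\<close>)
    have sd: "(s d has_real_derivative s1 x) (at x within {0..L})" if "0 \<le> x" "x \<le> L" for x
      using DERIV_chain2[OF DERIV_smooth_sgn(1)[OF d] e, of x] that unfolding s_def[abs_def] s1_def w_def by simp
    note ibp = integration_by_parts_AC[where s = "s d" and ?s1.0 = s1 and p = p and q = q and L = L and ?q0.0 = "q 0", OF L p q sd s1c]
    define k where "k x = - lam * (d\<^sup>2 * e x / w x ^ 3 * e1 x)" for x
    have kc: "continuous_on {0..L} (\<lambda>x. d\<^sup>2 * e x / w x ^ 3 * e1 x)"
      by (intro continuous_intros wc e1c ec) (use wpos in \<open>simp add: less_imp_neq[THEN not_sym]\<close>)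
    have "(LINT x:{0<..<L}|lborel. d\<^sup>2 * e x / w x ^ 3 * e1 x) = - (d\<^sup>2 / w L) - - (d\<^sup>2 / w 0)"
    proof (rule set_integral_FTC[OF L _ kc])
      show "((\<lambda>x. - (d\<^sup>2 / w x)) has_real_derivative d\<^sup>2 * e x / w x ^ 3 * e1 x) (at x within {0..L})" if "0 \<le> x" "x \<le> L" for x
        using DERIV_chain2[OF DERIV_smooth_sgn(2)[OF d] e, of x] that unfolding w_def by simp
    qed
    also have "\<dots> \<le> d"
    proof -
      have "d \<le> w 0" unfolding w_def using d by (intro real_le_rsqrt) simp
      then have "d\<^sup>2 / w 0 \<le> d" using wpos[of 0] d by (simp add: divide_le_eq power2_eq_square)
      moreover have "d\<^sup>2 / w L \<ge> 0" using wpos[of L] by (intro divide_nonneg_pos) auto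
      ultimately show ?thesis by linarith
    qed
    finally have "lam * (LINT x:{0<..<L}|lborel. d\<^sup>2 * e x / w x ^ 3 * e1 x) \<le> lam * d"
      using lam by (rule mult_left_mono)
    moreover have "(LINT x:{0<..<L}|lborel. k x) = - lam * (LINT x:{0<..<L}|lborel. d\<^sup>2 * e x / w x ^ 3 * e1 x)"
      unfolding k_def by (rule set_integral_mult_right)
    ultimately have 1: "(LINT x:{0<..<L}|lborel. k x) \<ge> - (lam * d)" by linarith
    have "(LINT x:{0<..<L}|lborel. k x) \<le> (LINT x:{0<..<L}|lborel. s1 x * q x)"
    proof (rule set_integral_mono)
      show "set_integrable lborel {0<..<L} k" unfolding k_def[abs_def]
        by (rule set_integrable_mult_right) (rule continuous_imp_set_integrable[OF kc])
      show "set_integrable lborel {0<..<L} (\<lambda>x. s1 x * q x)" by (rule ibp(3))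
      fix x
      have "s1 x * q x = k x + d\<^sup>2 / w x ^ 3 * eps * (e1 x)\<^sup>2"
      proof -
        have "c * a * (- lam * b + eps * a) = - lam * (c * b * a) + c * eps * a\<^sup>2" for a b c
          by (simp add: algebra_simps power2_eq_square)
        then show ?thesis unfolding s1_def q_def k_def times_divide_eq_left[symmetric] .
      qed
      moreover have "d\<^sup>2 / w x ^ 3 * eps * (e1 x)\<^sup>2 \<ge> 0"
        by (intro mult_nonneg_nonneg divide_nonneg_nonneg zero_le_power2 zero_le_power eps less_imp_le[OF wpos])
      ultimately show "k x \<le> s1 x * q x" by linarith
    qed
    then show ?thesis using 1 ibp(1) by linarith
  qed
  have pi: "integrable lborel (\<lambda>x. indicator {0<..<L} x * p x)" using p by (simp add: set_integrable_def)
  have em: "(\<lambda>x. indicator {0<..<L} x * e x) \<in> borel_measurable lborel"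
    using borel_measurable_integrable[OF continuous_imp_set_integrable[OF ec, unfolded set_integrable_def]] by simp
  have dn: "inverse (real (Suc n)) > 0" for n by simp
  note [measurable] = em borel_measurable_integrable[OF pi]
  \<comment> \<open>The limit d = 1/(n+1) -> 0 is dominated by |p|. The indicator is moved inside
    the sign to have measurable functions on the whole line; where it vanishes the factor p is cut
    off too.\<close>
  have lim: "(\<lambda>n. LINT x|lborel. (indicator {0<..<L} x * e x) / sqrt ((indicator {0<..<L} x * e x)\<^sup>2 + (inverse (real (Suc n)))\<^sup>2) * (indicator {0<..<L} x * p x))
      \<longlonglongrightarrow> (LINT x|lborel. sgn (indicator {0<..<L} x * e x) * (indicator {0<..<L} x * p x))"
  proof (rule integral_dominated_convergence[where w = "\<lambda>x. \<bar>indicator {0<..<L} x * p x\<bar>"])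
    show "AE x in lborel. (\<lambda>n. (indicator {0<..<L} x * e x) / sqrt ((indicator {0<..<L} x * e x)\<^sup>2 + (inverse (real (Suc n)))\<^sup>2) * (indicator {0<..<L} x * p x))
        \<longlonglongrightarrow> sgn (indicator {0<..<L} x * e x) * (indicator {0<..<L} x * p x)"
      by (intro AE_I2 tendsto_mult tendsto_smooth_sgn tendsto_const)
    show "AE x in lborel. norm ((indicator {0<..<L} x * e x) / sqrt ((indicator {0<..<L} x * e x)\<^sup>2 + (inverse (real (Suc n)))\<^sup>2) * (indicator {0<..<L} x * p x))
        \<le> \<bar>indicator {0<..<L} x * p x\<bar>" for n
      unfolding real_norm_def by (rule AE_I2) (rule smooth_sgn_mult_le)
    show "(\<lambda>x. sgn (indicator {0<..<L} x * e x) * (indicator {0<..<L} x * p x)) \<in> borel_measurable lborel" by measurable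
    show "integrable lborel (\<lambda>x. \<bar>indicator {0<..<L} x * p x\<bar>)" using pi by (rule integrable_abs)
  qed measurable
  have eq1: "(LINT x|lborel. (indicator {0<..<L} x * e x) / sqrt ((indicator {0<..<L} x * e x)\<^sup>2 + d\<^sup>2) * (indicator {0<..<L} x * p x))
      = (LINT x:{0<..<L}|lborel. s d x * p x)" for d
    unfolding set_lebesgue_integral_def by (intro Bochner_Integration.integral_cong) (auto simp: s_def indicator_def)
  have fe: "sgn (indicator {0<..<L} x * e x) * (indicator {0<..<L} x * p x) = indicator {0<..<L} x *\<^sub>R (sgn (e x) * p x)" for x
    by (auto simp: indicator_def)
  have "integrable lborel (\<lambda>x. sgn (indicator {0<..<L} x * e x) * (indicator {0<..<L} x * p x))"
  proof (rule Bochner_Integration.integrable_bound[OF pi])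
    show "(\<lambda>x. sgn (indicator {0<..<L} x * e x) * (indicator {0<..<L} x * p x)) \<in> borel_measurable lborel" by measurable
    show "AE x in lborel. norm (sgn (indicator {0<..<L} x * e x) * (indicator {0<..<L} x * p x)) \<le> norm (indicator {0<..<L} x * p x)"
      by (rule AE_I2) (simp add: abs_mult sgn_if)
  qed
  then have "set_integrable lborel {0<..<L} (\<lambda>x. sgn (e x) * p x)"
    by (simp only: fe set_integrable_def)
  then show "set_integrable lborel {0<..<L} (\<lambda>x. sgn (e x) * (- lam * e1 x + eps * e2 x))"
    by (simp only: p_def)
  have "(\<lambda>n. s (inverse (real (Suc n))) L * q L - s (inverse (real (Suc n))) 0 * q 0 + lam * inverse (real (Suc n)))
      \<longlonglongrightarrow> sgn (e L) * q L - sgn (e 0) * q 0 + lam * 0"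
    unfolding s_def by (intro tendsto_add tendsto_diff tendsto_mult tendsto_const tendsto_smooth_sgn LIMSEQ_inverse_real_of_nat)
  from tendsto_le[OF trivial_limit_sequentially this lim[unfolded eq1]]
  have "(LINT x|lborel. sgn (indicator {0<..<L} x * e x) * (indicator {0<..<L} x * p x)) \<le> sgn (e L) * q L - sgn (e 0) * q 0 + lam * 0"
    using step[OF dn] by simp
  moreover have "(LINT x|lborel. sgn (indicator {0<..<L} x * e x) * (indicator {0<..<L} x * p x)) = (LINT x:{0<..<L}|lborel. sgn (e x) * p x)"
    unfolding fe set_lebesgue_integral_def ..
  ultimately have "(LINT x:{0<..<L}|lborel. sgn (e x) * p x) \<le> sgn (e L) * q L - sgn (e 0) * q 0"
    by linarith
  then show "(LINT x:{0<..<L}|lborel. sgn (e x) * (- lam * e1 x + eps * e2 x))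
    \<le> sgn (e L) * (- lam * e L + eps * e1 L) - sgn (e 0) * (- lam * e 0 + eps * e1 0)"
    unfolding p_def q_def .
qed

text \<open>Kato's inequality on each arc leaves sgn(n_i) times the node condition, and sgn(n_i)
  (n_j - n_i) <= |n_j| - |n_i|. Weighted with a symmetric K, the right-hand sides cancel in the
  double sum, and only the node residuals remain.\<close>

lemma network_dissipation:
  fixes e e1 e2 :: "nat \<Rightarrow> real \<Rightarrow> real" and L vel r :: "nat \<Rightarrow> real"
  assumes pos: "\<And>i. i \<in> Inc \<union> Out \<Longrightarrow> L i > 0" "\<And>i. i \<in> Inc \<union> Out \<Longrightarrow> vel i > 0" and eps: "eps > 0"
    and K: "\<And>i j. i \<in> Inc \<union> Out \<Longrightarrow> j \<in> Inc \<union> Out \<Longrightarrow> K i j = K j i"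
      "\<And>i j. i \<in> Inc \<union> Out \<Longrightarrow> j \<in> Inc \<union> Out \<Longrightarrow> i \<noteq> j \<Longrightarrow> K i j \<ge> 0"
    and e: "\<And>i x. i \<in> Inc \<union> Out \<Longrightarrow> x \<in> {0..L i} \<Longrightarrow> (e i has_real_derivative e1 i x) (at x within {0..L i})"
      "\<And>i. i \<in> Inc \<union> Out \<Longrightarrow> continuous_on {0..L i} (e1 i)"
      "\<And>i. i \<in> Inc \<union> Out \<Longrightarrow> set_integrable lborel {0<..<L i} (e2 i)"
      "\<And>i x. i \<in> Inc \<union> Out \<Longrightarrow> x \<in> {0..L i} \<Longrightarrow> e1 i x = e1 i 0 + (LINT y:{0<..<x}|lborel. e2 i y)"
    and bd: "\<And>i. i \<in> Inc \<Longrightarrow> e i 0 = 0" "\<And>i. i \<in> Out \<Longrightarrow> e i (L i) = 0"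
    and nd: "\<And>i. i \<in> Inc \<union> Out \<Longrightarrow> orient Inc i * (- vel i * e i (node Inc L i) + eps * e1 i (node Inc L i))
      = (\<Sum>j\<in>Inc \<union> Out. K i j * (e j (node Inc L j) - e i (node Inc L i))) + r i"
  shows "(\<Sum>i\<in>Inc \<union> Out. LINT x:{0<..<L i}|lborel. sgn (e i x) * (- vel i * e1 i x + eps * e2 i x)) \<le> (\<Sum>i\<in>Inc \<union> Out. \<bar>r i\<bar>)"
proof -
  let ?I = "Inc \<union> Out"
  define n where "n i = e i (node Inc L i)" for i
  have "(LINT x:{0<..<L i}|lborel. sgn (e i x) * (- vel i * e1 i x + eps * e2 i x))
      \<le> (\<Sum>j\<in>?I. K i j * (\<bar>n j\<bar> - \<bar>n i\<bar>)) + \<bar>r i\<bar>" if i: "i \<in> ?I" for i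
  proof -
    have "(LINT x:{0<..<L i}|lborel. sgn (e i x) * (- vel i * e1 i x + eps * e2 i x))
      \<le> sgn (e i (L i)) * (- vel i * e i (L i) + eps * e1 i (L i)) - sgn (e i 0) * (- vel i * e i 0 + eps * e1 i 0)"
      using pos[OF i] eps
      by (intro kato_interval(1)[OF _ _ _ e(1)[OF i] e(2)[OF i] e(3)[OF i] e(4)[OF i]] less_imp_le)
    \<comment> \<open>At the Dirichlet end e = 0, and sgn 0 = 0 removes the flux there although the
      derivative of e is unknown. Of the two ends only the node survives, and \<open>orient\<close>
      accounts for the sign.\<close>
    also have "\<dots> = sgn (n i) * (orient Inc i * (- vel i * n i + eps * e1 i (node Inc L i)))"
    proof (cases "i \<in> Inc")
      case True
      then show ?thesis using bd(1)[OF True] by (simp add: n_def node_def orient_def)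
    next
      case False
      then have "i \<in> Out" using i by simp
      then show ?thesis using bd(2)[of i] False by (simp add: n_def node_def orient_def algebra_simps)
    qed
    also have "\<dots> = sgn (n i) * ((\<Sum>j\<in>?I. K i j * (n j - n i)) + r i)"
      using nd[OF i] unfolding n_def by simp
    also have "\<dots> = (\<Sum>j\<in>?I. K i j * (sgn (n i) * n j - \<bar>n i\<bar>)) + sgn (n i) * r i"
      by (simp add: distrib_left sum_distrib_left right_diff_distrib abs_sgn algebra_simps)
    also have "\<dots> \<le> (\<Sum>j\<in>?I. K i j * (\<bar>n j\<bar> - \<bar>n i\<bar>)) + \<bar>r i\<bar>"
    proof (rule add_mono)
      show "(\<Sum>j\<in>?I. K i j * (sgn (n i) * n j - \<bar>n i\<bar>)) \<le> (\<Sum>j\<in>?I. K i j * (\<bar>n j\<bar> - \<bar>n i\<bar>))"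
      proof (rule sum_mono)
        fix j assume j: "j \<in> ?I"
        show "K i j * (sgn (n i) * n j - \<bar>n i\<bar>) \<le> K i j * (\<bar>n j\<bar> - \<bar>n i\<bar>)"
        proof (cases "i = j")
          case True
          then show ?thesis by (simp add: abs_sgn mult.commute)
        next
          case False
          have "sgn (n i) * n j \<le> \<bar>n j\<bar>" by (auto simp: sgn_if)
          then show ?thesis using K(2)[OF i j False] by (intro mult_left_mono) auto
        qed
      qed
      show "sgn (n i) * r i \<le> \<bar>r i\<bar>" by (auto simp: sgn_if)
    qed
    finally show ?thesis .
  qed
  then have "(\<Sum>i\<in>?I. LINT x:{0<..<L i}|lborel. sgn (e i x) * (- vel i * e1 i x + eps * e2 i x))
      \<le> (\<Sum>i\<in>?I. (\<Sum>j\<in>?I. K i j * (\<bar>n j\<bar> - \<bar>n i\<bar>)) + \<bar>r i\<bar>)" by (rule sum_mono)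
  also have "\<dots> = (\<Sum>i\<in>?I. \<Sum>j\<in>?I. K i j * \<bar>n j\<bar>) - (\<Sum>i\<in>?I. \<Sum>j\<in>?I. K i j * \<bar>n i\<bar>) + (\<Sum>i\<in>?I. \<bar>r i\<bar>)"
    by (simp add: sum.distrib sum_subtractf right_diff_distrib)
  also have "(\<Sum>i\<in>?I. \<Sum>j\<in>?I. K i j * \<bar>n j\<bar>) = (\<Sum>j\<in>?I. \<Sum>i\<in>?I. K i j * \<bar>n j\<bar>)" by (rule sum.swap)
  also have "\<dots> = (\<Sum>i\<in>?I. \<Sum>j\<in>?I. K i j * \<bar>n i\<bar>)"
    by (intro sum.cong refl) (simp add: K(1))
  finally show ?thesis by simp
qed

text \<open>Backward increments suffice: they match an implicit time step, in which the error is
  tested with the sign of its value at the later time, where the equation is known.\<close>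

lemma left_Dini_bound:
  fixes \<phi> :: "real \<Rightarrow> real"
  assumes c: "continuous_on {0..T} \<phi>" and T: "0 \<le> T"
    and D: "\<And>t \<delta>. 0 < t \<Longrightarrow> t \<le> T \<Longrightarrow> \<delta> > 0 \<Longrightarrow> \<exists>h0>0. \<forall>h. 0 < h \<and> h < h0 \<longrightarrow> \<phi> t \<le> \<phi> (t - h) + h * (\<rho> + \<delta>)"
  shows "\<phi> T \<le> \<phi> 0 + \<rho> * T"
proof -
  have *: "\<phi> T \<le> \<phi> 0 + (\<rho> + \<delta>) * T" if \<delta>: "\<delta> > 0" for \<delta>
  proof -
    define g where "g t = \<phi> t - (\<rho> + \<delta>) * t" for t
    \<comment> \<open>The times at which g is at least g T. This set is closed, and the backward
      step leads from its infimum to an earlier member unless the infimum is 0; so g 0 >= g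
      T.\<close>
    define A where "A = {0..T} \<inter> g -` {g T..}"
    have "continuous_on {0..T} g" unfolding g_def by (intro continuous_intros c)
    then have "closed A" unfolding A_def by (rule continuous_closed_preimage) auto
    moreover have "T \<in> A" using T by (simp add: A_def)
    moreover have "bdd_below A" unfolding A_def by (rule bdd_belowI[of _ 0]) simp
    ultimately have s: "Inf A \<in> A" using closed_contains_Inf by blast
    have "Inf A = 0"
    proof (rule ccontr)
      assume "Inf A \<noteq> 0"
      then have s0: "0 < Inf A" "Inf A \<le> T" using s by (auto simp: A_def)
      obtain h0 where h0: "h0 > 0" "\<And>h. 0 < h \<Longrightarrow> h < h0 \<Longrightarrow> \<phi> (Inf A) \<le> \<phi> (Inf A - h) + h * (\<rho> + \<delta>)"
        using D[OF s0 \<delta>] by blast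
      define h where "h = min (h0 / 2) (Inf A)"
      have h: "0 < h" "h < h0" "h \<le> Inf A" using h0(1) s0 by (auto simp: h_def)
      from h0(2)[OF h(1,2)] have "g (Inf A) \<le> g (Inf A - h)" by (simp add: g_def algebra_simps)
      moreover have "g T \<le> g (Inf A)" using s by (simp add: A_def)
      ultimately have "Inf A - h \<in> A" using h s0 by (simp add: A_def)
      then have "Inf A \<le> Inf A - h" by (rule cInf_lower) (rule \<open>bdd_below A\<close>)
      then show False using h by simp
    qed
    then show ?thesis using s by (simp add: A_def g_def algebra_simps)
  qed
  show ?thesis
  proof (rule field_le_epsilon)
    fix x :: real assume x: "x > 0"
    have "x / (T + 1) * T \<le> x" using x T by (simp add: field_simps)
    then show "\<phi> T \<le> \<phi> 0 + \<rho> * T + x" using *[of "x / (T + 1)"] x T by (simp add: algebra_simps)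
  qed
qed

section \<open>Stability of the viscous problem\<close>

lemma L1_norm_triangle:
  assumes "L1 \<Omega> f" "L1 \<Omega> g"
  shows "L1_norm \<Omega> (\<lambda>x. f x + g x) \<le> L1_norm \<Omega> f + L1_norm \<Omega> g"
proof -
  have i: "set_integrable lborel \<Omega> f" "set_integrable lborel \<Omega> g" using assms by (auto simp: L1_def)
  have "L1_norm \<Omega> (\<lambda>x. f x + g x) \<le> (LINT z:\<Omega>|lborel. \<bar>f z\<bar> + \<bar>g z\<bar>)"
    unfolding L1_norm_def
    by (rule set_integral_mono) (auto intro!: set_integrable_abs set_integral_add(1) i)
  also have "\<dots> = L1_norm \<Omega> f + L1_norm \<Omega> g"
    unfolding L1_norm_def by (rule set_integral_add(2)) (rule set_integrable_abs i)+
  finally show ?thesis .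
qed

lemma L1_norm_nonneg: "L1_norm \<Omega> f \<ge> 0"
  unfolding L1_norm_def set_lebesgue_integral_def by (rule integral_nonneg_AE) (simp add: indicator_def)

lemma L1_norm_cong: "(\<And>x. x \<in> \<Omega> \<Longrightarrow> \<bar>f x\<bar> = \<bar>g x\<bar>) \<Longrightarrow> L1_norm \<Omega> f = L1_norm \<Omega> g"
  unfolding L1_norm_def set_lebesgue_integral_def
  by (rule Bochner_Integration.integral_cong[OF refl]) (simp add: indicator_def)

lemma L1_diff: "L1 \<Omega> f \<Longrightarrow> L1 \<Omega> g \<Longrightarrow> L1 \<Omega> (\<lambda>x. f x - g x)"
  unfolding L1_def by (rule set_integral_diff(1))

lemma L1_norm_bounded_le:
  assumes "0 \<le> (L::real)" "\<And>x. x \<in> {0<..<L} \<Longrightarrow> \<bar>f x\<bar> \<le> c"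
  shows "L1_norm {0<..<L} f \<le> L * c"
proof (cases "L = 0")
  case False
  then have "0 \<le> c" using assms(2)[of "L / 2"] assms(1) by (smt (verit) abs_ge_zero greaterThanLessThan_iff field_sum_of_halves)
  have "L1_norm {0<..<L} f \<le> (LINT x|lborel. c * indicator {0<..<L} x)"
    unfolding L1_norm_def set_lebesgue_integral_def
  proof (rule integral_mono')
    show "integrable lborel (\<lambda>x. c * indicator {0<..<L} x)"
      by (intro integrable_mult_right integrable_real_indicator emeasure_bounded_finite) auto
    show "indicator {0<..<L} x *\<^sub>R \<bar>f x\<bar> \<le> c * indicator {0<..<L} x" for x
      using assms(2)[of x] by (simp add: indicator_def)
    show "0 \<le> c * indicator {0<..<L} x" for x using \<open>0 \<le> c\<close> by simp
  qed
  then show ?thesis using assms(1) by (simp add: mult.commute)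
qed (simp add: L1_norm_def set_lebesgue_integral_def)

text \<open>One backward time step: \<open>e(t) = e(t - h) + h (V - z\<^sub>t + o(1))\<close> is tested with the sign of \<open>e(t)\<close>.\<close>

lemma backward_step:
  fixes wt ws z zs E f0 X R :: "real \<Rightarrow> real"
  assumes L: "0 < L" and h: "0 < h" and \<eta>: "0 \<le> \<eta>"
    and L1: "L1 {0<..<L} wt" "L1 {0<..<L} ws" "L1 {0<..<L} V" "L1 {0<..<L} z" "L1 {0<..<L} zs" "L1 {0<..<L} R"
    and E: "AE x in lborel. x \<in> {0<..<L} \<longrightarrow> wt x - z x = E x"
    and X: "set_integrable lborel {0<..<L} (\<lambda>x. sgn (E x) * X x)"
    and V: "AE x in lborel. x \<in> {0<..<L} \<longrightarrow> V x = X x + R x + zt x"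
    and dw: "L1_norm {0<..<L} (\<lambda>x. (ws x - wt x) / (- h) - V x) \<le> \<eta>"
    and dz: "\<And>x. x \<in> {0<..<L} \<Longrightarrow> \<bar>(zs x - z x) / (- h) - zt x\<bar> \<le> \<eta>"
  shows "L1_norm {0<..<L} (\<lambda>x. wt x - z x) \<le> L1_norm {0<..<L} (\<lambda>x. ws x - zs x)
    + h * ((LINT x:{0<..<L}|lborel. sgn (E x) * X x) + L1_norm {0<..<L} R + \<eta> + L * \<eta>)"
proof -
  let ?O = "{0<..<L}"
  \<comment> \<open>The error of the difference quotient of the curve is small only in L^1, whereas
    the corresponding error for z is small pointwise; this is why the two contribute
    \<open>\<eta>\<close> and \<open>L * \<eta>\<close> respectively.\<close>
  define r where "r x = (ws x - wt x) / (- h) - V x" for x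
  have i: "set_integrable lborel ?O wt" "set_integrable lborel ?O ws" "set_integrable lborel ?O V"
    "set_integrable lborel ?O z" "set_integrable lborel ?O zs" "set_integrable lborel ?O R"
    using L1 by (auto simp: L1_def)
  have ri: "set_integrable lborel ?O r"
    unfolding r_def[abs_def] by (intro set_integral_diff(1) set_integrable_divide i)
  have c: "set_integrable lborel ?O (\<lambda>x. \<eta>)"
    by (rule continuous_imp_set_integrable) simp
  have a1: "set_integrable lborel ?O (\<lambda>x. \<bar>wt x - z x\<bar>)" by (intro set_integrable_abs set_integral_diff(1) i)
  have a2: "set_integrable lborel ?O (\<lambda>x. \<bar>ws x - zs x\<bar>)" by (intro set_integrable_abs set_integral_diff(1) i)
  have a3: "set_integrable lborel ?O (\<lambda>x. h * (sgn (E x) * X x))" by (rule set_integrable_mult_right) (rule X)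
  have a4: "set_integrable lborel ?O (\<lambda>x. h * \<bar>R x\<bar>)" by (rule set_integrable_mult_right) (intro set_integrable_abs i)
  have a5: "set_integrable lborel ?O (\<lambda>x. h * \<bar>r x\<bar>)" by (rule set_integrable_mult_right) (intro set_integrable_abs ri)
  have a6: "set_integrable lborel ?O (\<lambda>x. h * \<eta>)" by (rule set_integrable_mult_right) (rule c)
  note s1 = set_integral_add[OF a2 a3]
  note s2 = set_integral_add[OF s1(1) a4]
  note s3 = set_integral_add[OF s2(1) a5]
  note s4 = set_integral_add[OF s3(1) a6]
  have "L1_norm ?O (\<lambda>x. wt x - z x)
      \<le> (LINT x:?O|lborel. \<bar>ws x - zs x\<bar> + h * (sgn (E x) * X x) + h * \<bar>R x\<bar> + h * \<bar>r x\<bar> + h * \<eta>)"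
    unfolding L1_norm_def
  proof (rule set_integral_mono_AE[OF a1 s4(1)])
    show "AE x\<in>?O in lborel. \<bar>wt x - z x\<bar> \<le> \<bar>ws x - zs x\<bar> + h * (sgn (E x) * X x) + h * \<bar>R x\<bar> + h * \<bar>r x\<bar> + h * \<eta>"
      using E V
    proof eventually_elim
      case (elim x)
      show ?case
      proof
        assume x: "x \<in> ?O"
        define r' where "r' = (zs x - z x) / (- h) - zt x"
        have r': "\<bar>r'\<bar> \<le> \<eta>" unfolding r'_def by (rule dz[OF x])
        have e1: "E x = wt x - z x" using elim(1) x by simp
        have e2: "V x = X x + R x + zt x" using elim(2) x by simp
        have "wt x - ws x = h * (r x + V x)" using h by (simp add: r_def field_simps)
        moreover have "z x - zs x = h * (r' + zt x)" using h by (simp add: r'_def field_simps)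
        ultimately have "E x = (ws x - zs x) + h * X x + h * R x + h * r x - h * r'"
          unfolding e1 e2 by (simp add: algebra_simps)
        then have "sgn (E x) * E x = sgn (E x) * (ws x - zs x) + h * (sgn (E x) * X x) + h * (sgn (E x) * R x)
            + h * (sgn (E x) * r x) - h * (sgn (E x) * r')"
          by (metis (no_types, opaque_lifting) distrib_left mult.left_commute right_diff_distrib)
        moreover have "sgn (E x) * E x = \<bar>wt x - z x\<bar>" unfolding e1 by (simp add: sgn_if)
        moreover have b: "sgn (E x) * u \<le> \<bar>u\<bar>" "- (sgn (E x) * u) \<le> \<bar>u\<bar>" for u :: real by (auto simp: sgn_if)
        have "h * (sgn (E x) * R x) \<le> h * \<bar>R x\<bar>" "h * (sgn (E x) * r x) \<le> h * \<bar>r x\<bar>"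
          using h b by (auto intro!: mult_left_mono)
        moreover have "h * - (sgn (E x) * r') \<le> h * \<eta>"
          using h b(2)[of r'] r' by (intro mult_left_mono) auto
        moreover have "sgn (E x) * (ws x - zs x) \<le> \<bar>ws x - zs x\<bar>" by (rule b(1))
        ultimately show "\<bar>wt x - z x\<bar> \<le> \<bar>ws x - zs x\<bar> + h * (sgn (E x) * X x) + h * \<bar>R x\<bar> + h * \<bar>r x\<bar> + h * \<eta>"
          by simp
      qed
    qed
  qed
  also have "\<dots> = L1_norm ?O (\<lambda>x. ws x - zs x) + h * (LINT x:?O|lborel. sgn (E x) * X x) + h * L1_norm ?O R
      + h * L1_norm ?O r + L * (h * \<eta>)"
    unfolding s4(2) s3(2) s2(2) s1(2) set_integral_mult_right L1_norm_def
    using L by (simp add: set_lebesgue_integral_def)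
  also have "h * L1_norm ?O r \<le> h * \<eta>" using dw h unfolding r_def[abs_def] by (intro mult_left_mono) auto
  finally show ?thesis by (simp add: algebra_simps)
qed

definition L1_dist_network where
  "L1_dist_network A L f g = (\<Sum>i\<in>A. L1_norm {0<..<L i} (\<lambda>x. f i x - g i x))"

text \<open>By dissipation the distance grows at most at the rate of the residuals,
  \<open>\<rho> i\<close> inside the arcs in L^1 and \<open>r i\<close> at the node, while z attains
  the Dirichlet data exactly. The Lipschitz bound in time makes the distance continuous, and the
  difference quotients, uniform in x, give its left Dini bound.\<close>

lemma parabolic_comparison:
  fixes w :: "nat \<Rightarrow> real \<times> real \<Rightarrow> real" and z zx zxx zt :: "nat \<Rightarrow> real \<Rightarrow> real \<Rightarrow> real"
    and L vel r \<rho> :: "nat \<Rightarrow> real"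
  assumes sol: "solves_parabolic Inc Out L vel K B eps v w"
    and fin: "finite (Inc \<union> Out)" and disj: "Inc \<inter> Out = {}"
    and pos: "\<And>i. i \<in> Inc \<union> Out \<Longrightarrow> L i > 0" "\<And>i. i \<in> Inc \<union> Out \<Longrightarrow> vel i > 0" and eps: "eps > 0"
    and K: "\<And>i j. i \<in> Inc \<union> Out \<Longrightarrow> j \<in> Inc \<union> Out \<Longrightarrow> K i j = K j i"
      "\<And>i j. i \<in> Inc \<union> Out \<Longrightarrow> j \<in> Inc \<union> Out \<Longrightarrow> i \<noteq> j \<Longrightarrow> K i j \<ge> 0"
    and v: "\<And>i. i \<in> Inc \<union> Out \<Longrightarrow> L1 {0<..<L i} (v i)"
    and z: "\<And>i t x. i \<in> Inc \<union> Out \<Longrightarrow> t \<ge> 0 \<Longrightarrow> ((\<lambda>x. z i x t) has_real_derivative zx i x t) (at x)"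
      "\<And>i t x. i \<in> Inc \<union> Out \<Longrightarrow> t \<ge> 0 \<Longrightarrow> ((\<lambda>x. zx i x t) has_real_derivative zxx i x t) (at x)"
      "\<And>i t. i \<in> Inc \<union> Out \<Longrightarrow> t \<ge> 0 \<Longrightarrow> continuous_on UNIV (\<lambda>x. zxx i x t)"
      "\<And>i t. i \<in> Inc \<union> Out \<Longrightarrow> t \<ge> 0 \<Longrightarrow> continuous_on UNIV (\<lambda>x. zt i x t)"
    and z_t: "\<And>i t \<eta>. i \<in> Inc \<union> Out \<Longrightarrow> t > 0 \<Longrightarrow> \<eta> > 0 \<Longrightarrow>
        \<exists>h0>0. \<forall>h x. 0 < h \<and> h < h0 \<and> x \<in> {0<..<L i} \<longrightarrow> \<bar>(z i x (t - h) - z i x t) / (- h) - zt i x t\<bar> \<le> \<eta>"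
    and z_lip: "\<And>i x s t. i \<in> Inc \<union> Out \<Longrightarrow> x \<in> {0<..<L i} \<Longrightarrow> \<bar>z i x s - z i x t\<bar> \<le> C * \<bar>s - t\<bar>"
    and res: "\<And>i t. i \<in> Inc \<union> Out \<Longrightarrow> t > 0 \<Longrightarrow>
        L1_norm {0<..<L i} (\<lambda>x. - vel i * zx i x t + eps * zxx i x t - zt i x t) \<le> \<rho> i"
    and bd: "\<And>i t. i \<in> Inc \<Longrightarrow> t > 0 \<Longrightarrow> z i 0 t = B i"
      "\<And>i t. i \<in> Out \<Longrightarrow> t > 0 \<Longrightarrow> z i (L i) t = bdry_trace {0<..<L i} (v i) (L i)"
    and nd: "\<And>i t. i \<in> Inc \<union> Out \<Longrightarrow> t > 0 \<Longrightarrow>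
      \<bar>orient Inc i * (- vel i * z i (node Inc L i) t + eps * zx i (node Inc L i) t)
        - (\<Sum>j\<in>Inc \<union> Out. K i j * (z j (node Inc L j) t - z i (node Inc L i) t))\<bar> \<le> r i"
    and T: "T \<ge> 0"
  shows "L1_dist_network (Inc \<union> Out) L (\<lambda>i x. w i (x, T)) (\<lambda>i x. z i x T)
    \<le> L1_dist_network (Inc \<union> Out) L v (\<lambda>i x. z i x 0) + (\<Sum>i\<in>Inc \<union> Out. \<rho> i + r i) * T"
proof -
  let ?I = "Inc \<union> Out"
  define \<phi> where "\<phi> t = L1_dist_network ?I L (\<lambda>i x. w i (x, t)) (\<lambda>i x. z i x t)" for t
  have zL1: "L1 {0<..<L i} (\<lambda>x. z i x t)" if "i \<in> ?I" "t \<ge> 0" for i t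
    unfolding L1_def by (intro continuous_imp_set_integrable continuous_at_imp_continuous_on ballI DERIV_isCont[OF z(1)[OF that]])
  have zxc: "continuous_on S (\<lambda>x. zx i x t)" if "i \<in> ?I" "t \<ge> 0" for i t S
    by (intro continuous_at_imp_continuous_on ballI DERIV_isCont[OF z(2)[OF that]])
  have "\<forall>i\<in>?I. \<exists>V. C1_L1 {0<..<L i} (\<lambda>t x. w i (x, t)) V \<and>
           (\<forall>t>0. AE x in lborel. x \<in> {0<..<L i} \<longrightarrow>
              V t x = - vel i * weak_deriv {0<..<L i} (\<lambda>x. w i (x, t)) x
                + eps * weak_deriv {0<..<L i} (weak_deriv {0<..<L i} (\<lambda>x. w i (x, t))) x)"
    using sol unfolding solves_parabolic_def by blast
  then obtain V where V: "\<And>i. i \<in> ?I \<Longrightarrow> C1_L1 {0<..<L i} (\<lambda>t x. w i (x, t)) (V i)"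
    "\<And>i t. i \<in> ?I \<Longrightarrow> t > 0 \<Longrightarrow> AE x in lborel. x \<in> {0<..<L i} \<longrightarrow>
              V i t x = - vel i * weak_deriv {0<..<L i} (\<lambda>x. w i (x, t)) x
                + eps * weak_deriv {0<..<L i} (weak_deriv {0<..<L i} (\<lambda>x. w i (x, t))) x"
    unfolding bchoice_iff by blast
  have wL1: "L1 {0<..<L i} (\<lambda>x. w i (x, t))" if "i \<in> ?I" "t \<ge> 0" for i t
    using V(1)[OF that(1)] that(2) unfolding C1_L1_def C0_L1_def by blast
  have VL1: "L1 {0<..<L i} (V i t)" if "i \<in> ?I" "t \<ge> 0" for i t
    using V(1)[OF that(1)] that(2) unfolding C1_L1_def C0_L1_def by blast
  have wc: "((\<lambda>s. L1_norm {0<..<L i} (\<lambda>x. w i (x, s) - w i (x, t))) \<longlongrightarrow> 0) (at t within {0..})" if "i \<in> ?I" "t \<ge> 0" for i t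
    using V(1)[OF that(1)] that(2) unfolding C1_L1_def C0_L1_def by blast
  have wd: "((\<lambda>s. L1_norm {0<..<L i} (\<lambda>x. (w i (x, s) - w i (x, t)) / (s - t) - V i t x)) \<longlongrightarrow> 0) (at t within {0..})" if "i \<in> ?I" "t \<ge> 0" for i t
    using V(1)[OF that(1)] that(2) unfolding C1_L1_def by blast
  have cont: "continuous_on {0..T} \<phi>"
    unfolding \<phi>_def L1_dist_network_def
  proof (rule continuous_on_sum)
    fix i assume i: "i \<in> ?I"
    define n where "n t = L1_norm {0<..<L i} (\<lambda>x. w i (x, t) - z i x t)" for t
    have tri: "n s \<le> n t + (L1_norm {0<..<L i} (\<lambda>x. w i (x, s) - w i (x, t)) + L i * (C * \<bar>s - t\<bar>))" if "s \<ge> 0" "t \<ge> 0" for s t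
    proof -
      have "n s = L1_norm {0<..<L i} (\<lambda>x. (w i (x, t) - z i x t) + ((w i (x, s) - w i (x, t)) + (z i x t - z i x s)))"
        unfolding n_def by (rule L1_norm_cong) simp
      also have "\<dots> \<le> n t + L1_norm {0<..<L i} (\<lambda>x. (w i (x, s) - w i (x, t)) + (z i x t - z i x s))"
        unfolding n_def using wL1[OF i] zL1[OF i] that
        by (intro L1_norm_triangle L1_diff) (auto simp: L1_def intro!: set_integral_add(1) set_integral_diff(1))
      also have "L1_norm {0<..<L i} (\<lambda>x. (w i (x, s) - w i (x, t)) + (z i x t - z i x s))
          \<le> L1_norm {0<..<L i} (\<lambda>x. w i (x, s) - w i (x, t)) + L1_norm {0<..<L i} (\<lambda>x. z i x t - z i x s)"
        using wL1[OF i] zL1[OF i] that by (intro L1_norm_triangle L1_diff) auto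
      also have "L1_norm {0<..<L i} (\<lambda>x. z i x t - z i x s) \<le> L i * (C * \<bar>s - t\<bar>)"
        by (rule L1_norm_bounded_le) (use pos(1)[OF i] z_lip[OF i] in \<open>auto simp: abs_minus_commute\<close>)
      finally show ?thesis by simp
    qed
    have comm: "L1_norm {0<..<L i} (\<lambda>x. w i (x, s) - w i (x, t)) = L1_norm {0<..<L i} (\<lambda>x. w i (x, t) - w i (x, s))" for s t
      by (rule L1_norm_cong) simp
    show "continuous_on {0..T} (\<lambda>t. L1_norm {0<..<L i} (\<lambda>x. w i (x, t) - z i x t))"
      unfolding n_def[symmetric] continuous_on_def
    proof
      fix t assume t: "t \<in> {0..T}"
      have lim: "((\<lambda>s. L1_norm {0<..<L i} (\<lambda>x. w i (x, s) - w i (x, t)) + L i * (C * \<bar>s - t\<bar>)) \<longlongrightarrow> 0 + L i * (C * \<bar>t - t\<bar>)) (at t within {0..T})"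
        using t by (intro tendsto_intros tendsto_within_subset[OF wc[OF i]]) auto
      have "((\<lambda>s. n s - n t) \<longlongrightarrow> 0) (at t within {0..T})"
      proof (rule Lim_null_comparison)
        have "norm (n s - n t) \<le> L1_norm {0<..<L i} (\<lambda>x. w i (x, s) - w i (x, t)) + L i * (C * \<bar>s - t\<bar>)" if "s \<in> {0..T}" for s
          using tri[of s t] tri[of t s] comm[of s t] t that unfolding real_norm_def abs_minus_commute[of t s] by auto
        then show "\<forall>\<^sub>F s in at t within {0..T}. norm (n s - n t) \<le> L1_norm {0<..<L i} (\<lambda>x. w i (x, s) - w i (x, t)) + L i * (C * \<bar>s - t\<bar>)"
          by (intro eventually_at_topological[THEN iffD2] exI[of _ UNIV]) auto
        show "((\<lambda>s. L1_norm {0<..<L i} (\<lambda>x. w i (x, s) - w i (x, t)) + L i * (C * \<bar>s - t\<bar>)) \<longlongrightarrow> 0) (at t within {0..T})"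
          using lim by simp
      qed
      then show "(n \<longlongrightarrow> n t) (at t within {0..T})" by (simp add: LIM_zero_iff)
    qed
  qed
  have Dini: "\<exists>h0>0. \<forall>h. 0 < h \<and> h < h0 \<longrightarrow> \<phi> t \<le> \<phi> (t - h) + h * ((\<Sum>i\<in>?I. \<rho> i + r i) + \<delta>)"
    if t: "0 < t" "t \<le> T" and \<delta>: "\<delta> > 0" for t \<delta>
  proof -
    \<comment> \<open>Each arc spends \<open>\<eta>\<close> on the curve and
      \<open>L i * \<eta>\<close> on z in a backward step, so over the network these errors add up
      to \<open>\<delta>\<close>.\<close>
    define \<eta> where "\<eta> = \<delta> / (\<Sum>i\<in>?I. 1 + L i)"
    define NI where "NI = (\<Sum>i\<in>?I. 1 + L i)"
    show ?thesis
    proof (cases "?I = {}")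
      case True
      then have "\<phi> s = 0" for s unfolding \<phi>_def L1_dist_network_def by (simp only: sum.empty)
      moreover have "(\<Sum>i\<in>?I. \<rho> i + r i) = 0" unfolding True by simp
      ultimately show ?thesis using \<delta> by (intro exI[of _ 1]) auto
    next
      case False
      have NI: "NI > 0" unfolding NI_def by (rule sum_pos[OF fin False]) (use pos(1) in \<open>simp add: add_pos_pos\<close>)
      then have \<eta>: "\<eta> > 0" using \<delta> unfolding \<eta>_def NI_def by simp
      \<comment> \<open>At the fixed time t the solution is replaced by its C^1 representative on
        the closed arc, whose end values are the traces; the dissipation estimate is then applied to
        this representative minus z.\<close>
      have "\<exists>F F1. (\<forall>x\<in>{0..L i}. (F has_real_derivative F1 x) (at x within {0..L i})) \<and> continuous_on {0..L i} F1 \<and>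
        (\<forall>x\<in>{0..L i}. F1 x = F1 0 + (LINT y:{0<..<x}|lborel. weak_deriv {0<..<L i} (weak_deriv {0<..<L i} (\<lambda>x. w i (x, t))) y)) \<and>
        (AE x in lborel. x \<in> {0<..<L i} \<longrightarrow> w i (x, t) = F x) \<and>
        (AE x in lborel. x \<in> {0<..<L i} \<longrightarrow> weak_deriv {0<..<L i} (\<lambda>x. w i (x, t)) x = F1 x) \<and>
        L1 {0<..<L i} (\<lambda>x. w i (x, t)) \<and> L1 {0<..<L i} (weak_deriv {0<..<L i} (\<lambda>x. w i (x, t))) \<and>
        L1 {0<..<L i} (weak_deriv {0<..<L i} (weak_deriv {0<..<L i} (\<lambda>x. w i (x, t))))" if i: "i \<in> ?I" for i
      proof (rule W21_representation[OF _ pos(1)[OF i]])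
        show "W21 {0<..<L i} (\<lambda>x. w i (x, t))"
          using sol i t unfolding solves_parabolic_def C0_W21_def by (meson less_imp_le)
      qed
      then have "\<forall>i\<in>?I. \<exists>F F1. (\<forall>x\<in>{0..L i}. (F has_real_derivative F1 x) (at x within {0..L i})) \<and> continuous_on {0..L i} F1 \<and>
        (\<forall>x\<in>{0..L i}. F1 x = F1 0 + (LINT y:{0<..<x}|lborel. weak_deriv {0<..<L i} (weak_deriv {0<..<L i} (\<lambda>x. w i (x, t))) y)) \<and>
        (AE x in lborel. x \<in> {0<..<L i} \<longrightarrow> w i (x, t) = F x) \<and>
        (AE x in lborel. x \<in> {0<..<L i} \<longrightarrow> weak_deriv {0<..<L i} (\<lambda>x. w i (x, t)) x = F1 x) \<and>
        L1 {0<..<L i} (\<lambda>x. w i (x, t)) \<and> L1 {0<..<L i} (weak_deriv {0<..<L i} (\<lambda>x. w i (x, t))) \<and>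
        L1 {0<..<L i} (weak_deriv {0<..<L i} (weak_deriv {0<..<L i} (\<lambda>x. w i (x, t))))" by blast
      then obtain F F1 where
        FD: "\<And>i x. i \<in> ?I \<Longrightarrow> x \<in> {0..L i} \<Longrightarrow> (F i has_real_derivative F1 i x) (at x within {0..L i})"
        and F1c: "\<And>i. i \<in> ?I \<Longrightarrow> continuous_on {0..L i} (F1 i)"
        and F1: "\<And>i x. i \<in> ?I \<Longrightarrow> x \<in> {0..L i} \<Longrightarrow> F1 i x = F1 i 0 + (LINT y:{0<..<x}|lborel. weak_deriv {0<..<L i} (weak_deriv {0<..<L i} (\<lambda>x. w i (x, t))) y)"
        and Fae: "\<And>i. i \<in> ?I \<Longrightarrow> AE x in lborel. x \<in> {0<..<L i} \<longrightarrow> w i (x, t) = F i x"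
        and F1ae: "\<And>i. i \<in> ?I \<Longrightarrow> AE x in lborel. x \<in> {0<..<L i} \<longrightarrow> weak_deriv {0<..<L i} (\<lambda>x. w i (x, t)) x = F1 i x"
        and FL1: "\<And>i. i \<in> ?I \<Longrightarrow> L1 {0<..<L i} (\<lambda>x. w i (x, t))"
        and F1L1: "\<And>i. i \<in> ?I \<Longrightarrow> L1 {0<..<L i} (weak_deriv {0<..<L i} (\<lambda>x. w i (x, t)))"
        and F2L1: "\<And>i. i \<in> ?I \<Longrightarrow> L1 {0<..<L i} (weak_deriv {0<..<L i} (weak_deriv {0<..<L i} (\<lambda>x. w i (x, t))))"
        unfolding bchoice_iff by blast
      define w2 where "w2 i = weak_deriv {0<..<L i} (weak_deriv {0<..<L i} (\<lambda>x. w i (x, t)))" for i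
      have t0: "t \<ge> 0" using t by simp
      have Fc: "continuous_on {0..L i} (F i)" if "i \<in> ?I" for i
        unfolding continuous_on_eq_continuous_within using FD[OF that] DERIV_continuous by blast
      have trF: "bdry_trace {0<..<L i} (\<lambda>x. w i (x, t)) p = F i p" if "i \<in> ?I" "p = 0 \<or> p = L i" for i p
        by (rule bdry_trace_interval[OF pos(1)[OF that(1)] FL1[OF that(1)] Fc[OF that(1)] Fae[OF that(1)] that(2)])
      have trF1: "bdry_trace {0<..<L i} (weak_deriv {0<..<L i} (\<lambda>x. w i (x, t))) p = F1 i p" if "i \<in> ?I" "p = 0 \<or> p = L i" for i p
        by (rule bdry_trace_interval[OF pos(1)[OF that(1)] F1L1[OF that(1)] F1c[OF that(1)] F1ae[OF that(1)] that(2)])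
      have nodep: "node Inc L i = 0 \<or> node Inc L i = L i" for i by (simp add: node_def)
      have trans: "orient Inc i * (- vel i * F i (node Inc L i) + eps * F1 i (node Inc L i))
          = (\<Sum>j\<in>?I. K i j * (F j (node Inc L j) - F i (node Inc L i)))" if i: "i \<in> ?I" for i
      proof -
        have "orient Inc i * (- vel i * bdry_trace {0<..<L i} (\<lambda>x. w i (x, t)) (node Inc L i)
          + eps * bdry_trace {0<..<L i} (weak_deriv {0<..<L i} (\<lambda>x. w i (x, t))) (node Inc L i))
          = (\<Sum>j\<in>?I. K i j * (bdry_trace {0<..<L j} (\<lambda>x. w j (x, t)) (node Inc L j) - bdry_trace {0<..<L i} (\<lambda>x. w i (x, t)) (node Inc L i)))"
          using sol t i unfolding solves_parabolic_def transmission_def by blast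
        also have "\<dots> = (\<Sum>j\<in>?I. K i j * (F j (node Inc L j) - F i (node Inc L i)))"
          by (rule sum.cong[OF refl]) (simp only: trF[OF _ nodep] i)
        finally show ?thesis unfolding trF[OF i nodep] trF1[OF i nodep] .
      qed
      define e where "e i x = F i x - z i x t" for i x
      define e1 where "e1 i x = F1 i x - zx i x t" for i x
      define e2 where "e2 i x = w2 i x - zxx i x t" for i x
      \<comment> \<open>The representative satisfies the transmission condition exactly, so the node
        residual of the error is minus that of z.\<close>
      define rr where "rr i = - (orient Inc i * (- vel i * z i (node Inc L i) t + eps * zx i (node Inc L i) t)
        - (\<Sum>j\<in>?I. K i j * (z j (node Inc L j) t - z i (node Inc L i) t)))" for i
      have zxxi: "set_integrable lborel {0<..<L i} (\<lambda>x. zxx i x t)" if "i \<in> ?I" for i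
        by (rule continuous_imp_set_integrable, rule continuous_on_subset[OF z(3)[OF that t0]]) simp
      have w2i: "set_integrable lborel {0<..<L i} (w2 i)" if "i \<in> ?I" for i
        using F2L1[OF that] unfolding w2_def L1_def .
      have eD: "(e i has_real_derivative e1 i x) (at x within {0..L i})" if "i \<in> ?I" "x \<in> {0..L i}" for i x
        unfolding e_def[abs_def] e1_def
        by (rule DERIV_diff[OF FD[OF that] has_field_derivative_at_within[OF z(1)[OF that(1) t0]]])
      have e1c: "continuous_on {0..L i} (e1 i)" if "i \<in> ?I" for i
        unfolding e1_def[abs_def] by (intro continuous_on_diff F1c[OF that] zxc[OF that t0])
      have e2i: "set_integrable lborel {0<..<L i} (e2 i)" if "i \<in> ?I" for i
        unfolding e2_def[abs_def] by (rule set_integral_diff(1)[OF w2i[OF that] zxxi[OF that]])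
      have e1e: "e1 i x = e1 i 0 + (LINT y:{0<..<x}|lborel. e2 i y)" if i: "i \<in> ?I" and x: "x \<in> {0..L i}" for i x
      proof -
        have sub: "{0<..<x} \<subseteq> {0<..<L i}" using x by auto
        have "(LINT y:{0<..<x}|lborel. e2 i y) = (LINT y:{0<..<x}|lborel. w2 i y) - (LINT y:{0<..<x}|lborel. zxx i y t)"
          unfolding e2_def
          by (rule set_integral_diff(2)[OF set_integrable_subset[OF w2i[OF i] _ sub] set_integrable_subset[OF zxxi[OF i] _ sub]]) simp_all
        also have "(LINT y:{0<..<x}|lborel. zxx i y t) = zx i x t - zx i 0 t"
        proof (rule set_integral_FTC)
          show "((\<lambda>x. zx i x t) has_real_derivative zxx i y t) (at y within {0..x})" for y
            by (rule has_field_derivative_at_within[OF z(2)[OF i t0]])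
          show "continuous_on {0..x} (\<lambda>x. zxx i x t)" by (rule continuous_on_subset[OF z(3)[OF i t0]]) simp
        qed (use x in simp)
        finally show ?thesis using F1[OF i x] unfolding e1_def w2_def by linarith
      qed
      have enode: "orient Inc i * (- vel i * e i (node Inc L i) + eps * e1 i (node Inc L i))
        = (\<Sum>j\<in>?I. K i j * (e j (node Inc L j) - e i (node Inc L i))) + rr i" if i: "i \<in> ?I" for i
      proof -
        have "(\<Sum>j\<in>?I. K i j * (e j (node Inc L j) - e i (node Inc L i)))
          = (\<Sum>j\<in>?I. K i j * (F j (node Inc L j) - F i (node Inc L i))) - (\<Sum>j\<in>?I. K i j * (z j (node Inc L j) t - z i (node Inc L i) t))"
          unfolding sum_subtractf[symmetric] by (rule sum.cong[OF refl]) (simp add: e_def algebra_simps)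
        then show ?thesis using trans[OF i] unfolding rr_def e_def e1_def by (simp add: algebra_simps)
      qed
      have diss: "(\<Sum>i\<in>?I. LINT x:{0<..<L i}|lborel. sgn (e i x) * (- vel i * e1 i x + eps * e2 i x)) \<le> (\<Sum>i\<in>?I. r i)"
      proof (rule order.trans[OF network_dissipation[OF pos eps K eD e1c e2i e1e _ _ enode]])
        show "e i 0 = 0" if "i \<in> Inc" for i
        proof -
          have "bdry_trace {0<..<L i} (\<lambda>x. w i (x, t)) 0 = B i" using sol t that unfolding solves_parabolic_def by blast
          then show ?thesis using trF[of i 0] bd(1)[OF that t(1)] that by (simp add: e_def)
        qed
        show "e i (L i) = 0" if "i \<in> Out" for i
        proof -
          have "bdry_trace {0<..<L i} (\<lambda>x. w i (x, t)) (L i) = bdry_trace {0<..<L i} (v i) (L i)"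
            using sol t that unfolding solves_parabolic_def by blast
          then show ?thesis using trF[of i "L i"] bd(2)[OF that t(1)] that by (simp add: e_def)
        qed
        show "(\<Sum>i\<in>?I. \<bar>rr i\<bar>) \<le> (\<Sum>i\<in>?I. r i)"
          by (rule sum_mono) (use nd[OF _ t(1)] in \<open>simp only: rr_def abs_minus_cancel\<close>)
      qed
      have "\<exists>h0>0. h0 \<le> t \<and> (\<forall>h. 0 < h \<and> h < h0 \<longrightarrow> L1_norm {0<..<L i} (\<lambda>x. w i (x, t) - z i x t) \<le>
          L1_norm {0<..<L i} (\<lambda>x. w i (x, t - h) - z i x (t - h))
          + h * ((LINT x:{0<..<L i}|lborel. sgn (e i x) * (- vel i * e1 i x + eps * e2 i x)) + \<rho> i + \<eta> + L i * \<eta>))"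
        if i: "i \<in> ?I" for i
      proof -
        obtain h1 where h1: "h1 > 0" "\<And>h x. 0 < h \<Longrightarrow> h < h1 \<Longrightarrow> x \<in> {0<..<L i} \<Longrightarrow> \<bar>(z i x (t - h) - z i x t) / (- h) - zt i x t\<bar> \<le> \<eta>"
          using z_t[OF i t(1) \<eta>] by blast
        have "\<forall>\<^sub>F s in at t within {0..}. L1_norm {0<..<L i} (\<lambda>x. (w i (x, s) - w i (x, t)) / (s - t) - V i t x) < \<eta>"
          using order_tendstoD(2)[OF wd[OF i t0] \<eta>] .
        then obtain h2 where h2: "h2 > 0" "\<And>s. s \<in> {0..} \<Longrightarrow> s \<noteq> t \<Longrightarrow> dist s t < h2 \<Longrightarrow>
            L1_norm {0<..<L i} (\<lambda>x. (w i (x, s) - w i (x, t)) / (s - t) - V i t x) < \<eta>"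
          unfolding eventually_at by blast
        show ?thesis
        proof (intro exI[of _ "min h1 (min h2 t)"] conjI allI impI)
          fix h assume h: "0 < h \<and> h < min h1 (min h2 t)"
          have "L1_norm {0<..<L i} (\<lambda>x. w i (x, t) - z i x t) \<le>
            L1_norm {0<..<L i} (\<lambda>x. w i (x, t - h) - z i x (t - h))
            + h * ((LINT x:{0<..<L i}|lborel. sgn (e i x) * (- vel i * e1 i x + eps * e2 i x))
              + L1_norm {0<..<L i} (\<lambda>x. - vel i * zx i x t + eps * zxx i x t - zt i x t) + \<eta> + L i * \<eta>)"
          proof (rule backward_step[where V = "V i t" and zt = "\<lambda>x. zt i x t"])
            show "AE x in lborel. x \<in> {0<..<L i} \<longrightarrow> w i (x, t) - z i x t = e i x"
              using Fae[OF i] by eventually_elim (simp add: e_def)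
            show "set_integrable lborel {0<..<L i} (\<lambda>x. sgn (e i x) * (- vel i * e1 i x + eps * e2 i x))"
              by (rule kato_interval(2)[OF _ _ _ eD[OF i] e1c[OF i] e2i[OF i] e1e[OF i]])
                (rule less_imp_le, rule pos(1)[OF i] eps pos(2)[OF i])+
            show "AE x in lborel. x \<in> {0<..<L i} \<longrightarrow> V i t x = (- vel i * e1 i x + eps * e2 i x)
                + (- vel i * zx i x t + eps * zxx i x t - zt i x t) + zt i x t"
              using V(2)[OF i t(1)] F1ae[OF i]
              by eventually_elim (simp add: e1_def e2_def w2_def algebra_simps)
            show "L1_norm {0<..<L i} (\<lambda>x. (w i (x, t - h) - w i (x, t)) / - h - V i t x) \<le> \<eta>"
            proof -
              have "L1_norm {0<..<L i} (\<lambda>x. (w i (x, t - h) - w i (x, t)) / ((t - h) - t) - V i t x) < \<eta>"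
                by (rule h2(2)) (use h in \<open>auto simp: dist_real_def\<close>)
              then show ?thesis by simp
            qed
            show "\<bar>(z i x (t - h) - z i x t) / - h - zt i x t\<bar> \<le> \<eta>" if "x \<in> {0<..<L i}" for x
              by (rule h1(2)[OF _ _ that]) (use h in auto)
            show "L1 {0<..<L i} (\<lambda>x. - vel i * zx i x t + eps * zxx i x t - zt i x t)"
              unfolding L1_def
              by (rule continuous_imp_set_integrable)
                (intro continuous_on_diff continuous_on_add continuous_on_mult continuous_on_const zxc[OF i t0]
                  continuous_on_subset[OF z(3)[OF i t0]] continuous_on_subset[OF z(4)[OF i t0]] subset_UNIV)
            show "L1 {0<..<L i} (\<lambda>x. w i (x, t - h))" "L1 {0<..<L i} (\<lambda>x. z i x (t - h))"
              by (rule wL1[OF i] zL1[OF i]; use h in simp)+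
          qed (use h \<eta> pos(1)[OF i] wL1[OF i t0] zL1[OF i t0] VL1[OF i t0] in auto)
          also have "\<dots> \<le> L1_norm {0<..<L i} (\<lambda>x. w i (x, t - h) - z i x (t - h))
            + h * ((LINT x:{0<..<L i}|lborel. sgn (e i x) * (- vel i * e1 i x + eps * e2 i x)) + \<rho> i + \<eta> + L i * \<eta>)"
            using res[OF i t(1)] h by (intro add_left_mono mult_left_mono add_right_mono) auto
          finally show "L1_norm {0<..<L i} (\<lambda>x. w i (x, t) - z i x t) \<le> L1_norm {0<..<L i} (\<lambda>x. w i (x, t - h) - z i x (t - h))
            + h * ((LINT x:{0<..<L i}|lborel. sgn (e i x) * (- vel i * e1 i x + eps * e2 i x)) + \<rho> i + \<eta> + L i * \<eta>)" .
        qed (use h1(1) h2(1) t in auto)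
      qed
      then have "\<forall>i\<in>?I. \<exists>h0. h0 > 0 \<and> (\<forall>h. 0 < h \<and> h < h0 \<longrightarrow> L1_norm {0<..<L i} (\<lambda>x. w i (x, t) - z i x t) \<le>
          L1_norm {0<..<L i} (\<lambda>x. w i (x, t - h) - z i x (t - h))
          + h * ((LINT x:{0<..<L i}|lborel. sgn (e i x) * (- vel i * e1 i x + eps * e2 i x)) + \<rho> i + \<eta> + L i * \<eta>))"
        by blast
      then obtain h0 where h0: "\<And>i. i \<in> ?I \<Longrightarrow> h0 i > 0"
        "\<And>i h. i \<in> ?I \<Longrightarrow> 0 < h \<Longrightarrow> h < h0 i \<Longrightarrow> L1_norm {0<..<L i} (\<lambda>x. w i (x, t) - z i x t) \<le>
          L1_norm {0<..<L i} (\<lambda>x. w i (x, t - h) - z i x (t - h))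
          + h * ((LINT x:{0<..<L i}|lborel. sgn (e i x) * (- vel i * e1 i x + eps * e2 i x)) + \<rho> i + \<eta> + L i * \<eta>)"
        unfolding bchoice_iff by blast
      show ?thesis
      proof (intro exI[of _ "Min (h0 ` ?I)"] conjI allI impI)
        show "Min (h0 ` ?I) > 0" using h0(1) fin False by (subst Min_gr_iff) auto
        fix h assume h: "0 < h \<and> h < Min (h0 ` ?I)"
        then have hi: "h < h0 i" if "i \<in> ?I" for i using that fin False by (subst (asm) Min_gr_iff) auto
        have "\<phi> t \<le> (\<Sum>i\<in>?I. L1_norm {0<..<L i} (\<lambda>x. w i (x, t - h) - z i x (t - h))
          + h * ((LINT x:{0<..<L i}|lborel. sgn (e i x) * (- vel i * e1 i x + eps * e2 i x)) + \<rho> i + \<eta> + L i * \<eta>))"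
          unfolding \<phi>_def L1_dist_network_def by (rule sum_mono, rule h0(2)) (use h hi in auto)
        also have "\<dots> = \<phi> (t - h) + h * ((\<Sum>i\<in>?I. LINT x:{0<..<L i}|lborel. sgn (e i x) * (- vel i * e1 i x + eps * e2 i x))
            + (\<Sum>i\<in>?I. \<rho> i) + \<eta> * NI)"
          unfolding \<phi>_def L1_dist_network_def NI_def
          by (simp add: sum.distrib sum_distrib_left algebra_simps)
        also have "\<eta> * NI = \<delta>" using NI unfolding \<eta>_def NI_def[symmetric] by simp
        also have "\<phi> (t - h) + h * ((\<Sum>i\<in>?I. LINT x:{0<..<L i}|lborel. sgn (e i x) * (- vel i * e1 i x + eps * e2 i x))
            + (\<Sum>i\<in>?I. \<rho> i) + \<delta>) \<le> \<phi> (t - h) + h * ((\<Sum>i\<in>?I. \<rho> i + r i) + \<delta>)"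
          using diss h unfolding sum.distrib by (intro add_left_mono mult_left_mono) auto
        finally show "\<phi> t \<le> \<phi> (t - h) + h * ((\<Sum>i\<in>?I. \<rho> i + r i) + \<delta>)" .
      qed
    qed
  qed
  have "\<phi> T \<le> \<phi> 0 + (\<Sum>i\<in>?I. \<rho> i + r i) * T" by (rule left_Dini_bound[OF cont T Dini])
  moreover have "\<phi> 0 = L1_dist_network ?I L v (\<lambda>i x. z i x 0)"
    unfolding \<phi>_def L1_dist_network_def
  proof (rule sum.cong[OF refl])
    fix i assume i: "i \<in> ?I"
    have ae: "AE x in lborel. x \<in> {0<..<L i} \<longrightarrow> w i (x, 0) = v i x" using sol i unfolding solves_parabolic_def by blast
    show "L1_norm {0<..<L i} (\<lambda>x. w i (x, 0) - z i x 0) = L1_norm {0<..<L i} (\<lambda>x. v i x - z i x 0)"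
      unfolding L1_norm_def
    proof (rule set_lborel_integral_cong_AE)
      have "L1 {0<..<L i} (\<lambda>x. \<bar>w i (x, 0) - z i x 0\<bar>)" "L1 {0<..<L i} (\<lambda>x. \<bar>v i x - z i x 0\<bar>)"
        using L1_diff[OF wL1[OF i] zL1[OF i]] L1_diff[OF v[OF i] zL1[OF i]] unfolding L1_def by (auto intro: set_integrable_abs)
      then show "set_borel_measurable lborel {0<..<L i} (\<lambda>x. \<bar>w i (x, 0) - z i x 0\<bar>)"
        "set_borel_measurable lborel {0<..<L i} (\<lambda>x. \<bar>v i x - z i x 0\<bar>)" by (auto intro: L1_measurable)
      show "AE x in lborel. x \<in> {0<..<L i} \<longrightarrow> \<bar>w i (x, 0) - z i x 0\<bar> = \<bar>v i x - z i x 0\<bar>"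
        using ae by eventually_elim auto
    qed
  qed
  ultimately show ?thesis unfolding \<phi>_def by simp
qed

section \<open>Approximate solutions with boundary layers\<close>

lemma C2_difference_quotient:
  assumes p: "\<And>x. (p has_real_derivative p1 x) (at x)" "\<And>x. (p1 has_real_derivative p2 x) (at x)" "\<And>x. \<bar>p2 x\<bar> \<le> M"
    and h: "h > 0"
  shows "\<bar>(p (s - h) - p s) / (- h) - p1 s\<bar> \<le> M * h"
proof -
  obtain \<xi> where \<xi>: "s - h < \<xi>" "\<xi> < s" "p s - p (s - h) = (s - (s - h)) * p1 \<xi>"
    using MVT2[of "s - h" s p p1] p(1) h by auto
  obtain \<zeta> where \<zeta>: "p1 s - p1 \<xi> = (s - \<xi>) * p2 \<zeta>"
    using MVT2[of \<xi> s p1 p2] p(2) \<xi>(2) by auto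
  have "(p (s - h) - p s) / (- h) = p1 \<xi>" using \<xi>(3) h by (simp add: field_simps)
  then have "\<bar>(p (s - h) - p s) / (- h) - p1 s\<bar> = \<bar>s - \<xi>\<bar> * \<bar>p2 \<zeta>\<bar>"
    using \<zeta> unfolding abs_mult[symmetric] by linarith
  also have "\<dots> \<le> h * M" using \<xi> h p(3)[of \<zeta>] by (intro mult_mono) auto
  finally show ?thesis by (simp add: mult.commute)
qed

lemma C1_Lipschitz:
  assumes p: "\<And>x. (p has_real_derivative p1 x) (at x)" "\<And>x. \<bar>p1 x\<bar> \<le> M"
  shows "\<bar>p s - p t\<bar> \<le> M * \<bar>s - t\<bar>"
  using field_differentiable_bound[of UNIV p p1 M s t] p by auto

text \<open>The nonconstant solution of \<open>eps\<close> E'' = \<open>lam\<close> E', normalised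
  to 1 at x = L. It satisfies \<open>eps\<close> E' = \<open>lam\<close> E, so it carries no flux
  and can change the value at the end point freely.\<close>

definition bdry_layer :: "real \<Rightarrow> real \<Rightarrow> real \<Rightarrow> real \<Rightarrow> real" where
  "bdry_layer eps lam L x = exp (lam * (x - L) / eps)"

lemma bdry_layer_pos: "bdry_layer eps lam L x > 0"
  by (simp add: bdry_layer_def)

lemma bdry_layer_end: "bdry_layer eps lam L L = 1"
  by (simp add: bdry_layer_def)

lemma bdry_layer_le_1:
  assumes "eps > 0" "lam > 0" "x \<le> L" shows "bdry_layer eps lam L x \<le> 1"
  using assms by (simp add: bdry_layer_def divide_nonpos_pos mult_nonneg_nonpos)

lemma bdry_layer_mono:
  assumes "eps > 0" "lam > 0" "x \<le> y" shows "bdry_layer eps lam L x \<le> bdry_layer eps lam L y"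
  using assms unfolding bdry_layer_def by (simp add: divide_right_mono mult_left_mono)

lemma DERIV_bdry_layer: "eps \<noteq> 0 \<Longrightarrow> (bdry_layer eps lam L has_real_derivative lam / eps * bdry_layer eps lam L x) (at x)"
  unfolding bdry_layer_def[abs_def] by (auto intro!: derivative_eq_intros)

text \<open>At the far end the layer is exponentially small, but a bound linear in
  \<open>eps\<close> matches the order of the other residuals; it follows from y <= exp y.\<close>

lemma bdry_layer_start_le:
  assumes "eps > 0" "lam > 0" "L > 0" shows "bdry_layer eps lam L 0 \<le> eps / (lam * L)"
proof -
  define y where "y = lam * L / eps"
  have y: "y > 0" using assms by (simp add: y_def)
  have "y \<le> exp y" using exp_ge_add_one_self[of y] by linarith
  then have "exp (- y) \<le> 1 / y" using y by (simp add: exp_minus field_simps)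
  moreover have "bdry_layer eps lam L 0 = exp (- y)" by (simp add: bdry_layer_def y_def)
  moreover have "1 / y = eps / (lam * L)" by (simp add: y_def)
  ultimately show ?thesis by simp
qed

lemma bdry_layer_L1:
  assumes "eps > 0" "lam > 0" "L > 0" "0 \<le> c" "c \<le> bdry_layer eps lam L 0" "\<And>x. \<bar>k x\<bar> \<le> a * (bdry_layer eps lam L x - c)"
  shows "L1_norm {0<..<L} k \<le> a * (eps / lam)"
proof -
  have c: "continuous_on S (bdry_layer eps lam L)" for S
    unfolding bdry_layer_def[abs_def] by (intro continuous_intros) (use assms in simp)
  have int: "set_integrable lborel {0<..<L} (\<lambda>x. a * bdry_layer eps lam L x)"
    by (rule continuous_imp_set_integrable) (intro continuous_intros c)
  \<comment> \<open>The assumed bound at x = L, where the layer equals 1 and exceeds c, excludes a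
    negative factor.\<close>
  have "a \<ge> 0"
  proof (rule ccontr)
    assume "\<not> a \<ge> 0"
    moreover have "bdry_layer eps lam L L - c > 0"
    proof -
      have "c \<le> exp (- (lam * L / eps))" using assms(5) by (simp add: bdry_layer_def)
      also have "\<dots> < 1" using assms by simp
      finally show ?thesis by (simp add: bdry_layer_end)
    qed
    ultimately have "a * (bdry_layer eps lam L L - c) < 0" by (simp add: mult_neg_pos)
    then show False using assms(6)[of L] by linarith
  qed
  have "L1_norm {0<..<L} k \<le> (LINT x:{0<..<L}|lborel. a * bdry_layer eps lam L x)"
    unfolding L1_norm_def set_lebesgue_integral_def
  proof (rule integral_mono')
    show "integrable lborel (\<lambda>x. indicator {0<..<L} x *\<^sub>R (a * bdry_layer eps lam L x))" using int by (simp add: set_integrable_def)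
    show "indicator {0<..<L} x *\<^sub>R \<bar>k x\<bar> \<le> indicator {0<..<L} x *\<^sub>R (a * bdry_layer eps lam L x)" for x
    proof -
      have "a * (bdry_layer eps lam L x - c) \<le> a * bdry_layer eps lam L x"
        using \<open>a \<ge> 0\<close> assms(4) by (intro mult_left_mono) auto
      then have "\<bar>k x\<bar> \<le> a * bdry_layer eps lam L x" using assms(6)[of x] by linarith
      then show ?thesis by (simp add: indicator_def)
    qed
    show "0 \<le> indicator {0<..<L} x *\<^sub>R (a * bdry_layer eps lam L x)" for x
      using \<open>a \<ge> 0\<close> bdry_layer_pos[of eps lam L x] by (simp add: indicator_def)
  qed
  also have "\<dots> = a * (LINT x:{0<..<L}|lborel. bdry_layer eps lam L x)" by (rule set_integral_mult_right)
  also have "(LINT x:{0<..<L}|lborel. bdry_layer eps lam L x) = eps / lam * bdry_layer eps lam L L - eps / lam * bdry_layer eps lam L 0"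
  proof (rule set_integral_FTC)
    show "((\<lambda>x. eps / lam * bdry_layer eps lam L x) has_real_derivative bdry_layer eps lam L x) (at x within {0..L})" for x
    proof -
      have "((\<lambda>x. eps / lam * bdry_layer eps lam L x) has_real_derivative eps / lam * (lam / eps * bdry_layer eps lam L x)) (at x within {0..L})"
        using assms by (intro DERIV_cmult has_field_derivative_at_within[OF DERIV_bdry_layer]) simp
      then show ?thesis using assms by simp
    qed
  qed (use assms c in auto)
  also have "\<dots> \<le> eps / lam" using assms bdry_layer_pos[of eps lam L 0] by (simp add: bdry_layer_end)
  finally show ?thesis using \<open>a \<ge> 0\<close> by (simp add: mult_left_mono)
qed

section \<open>Error of the transported profile with boundary layers\<close>

lemma L1_dist_network_triangle:
  assumes "\<And>i. i \<in> A \<Longrightarrow> L1 {0<..<L i} (f i)" "\<And>i. i \<in> A \<Longrightarrow> L1 {0<..<L i} (g i)" "\<And>i. i \<in> A \<Longrightarrow> L1 {0<..<L i} (h i)"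
  shows "L1_dist_network A L f h \<le> L1_dist_network A L f g + L1_dist_network A L g h"
  unfolding L1_dist_network_def sum.distrib[symmetric]
proof (rule sum_mono)
  fix i assume i: "i \<in> A"
  have "L1_norm {0<..<L i} (\<lambda>x. f i x - h i x) = L1_norm {0<..<L i} (\<lambda>x. (f i x - g i x) + (g i x - h i x))"
    by (rule L1_norm_cong) simp
  also have "\<dots> \<le> L1_norm {0<..<L i} (\<lambda>x. f i x - g i x) + L1_norm {0<..<L i} (\<lambda>x. g i x - h i x)"
    by (intro L1_norm_triangle L1_diff assms i)
  finally show "L1_norm {0<..<L i} (\<lambda>x. f i x - h i x) \<le> L1_norm {0<..<L i} (\<lambda>x. f i x - g i x) + L1_norm {0<..<L i} (\<lambda>x. g i x - h i x)" .
qed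

lemma C2b_familyE:
  fixes P :: "nat \<Rightarrow> real \<Rightarrow> real"
  assumes "finite A" "\<And>i. i \<in> A \<Longrightarrow> C2b (P i)"
  obtains P1 P2 M where "M \<ge> 0" "\<And>i x. i \<in> A \<Longrightarrow> (P i has_real_derivative P1 i x) (at x)"
    "\<And>i x. i \<in> A \<Longrightarrow> (P1 i has_real_derivative P2 i x) (at x)" "\<And>i. i \<in> A \<Longrightarrow> continuous_on UNIV (P2 i)"
    "\<And>i x. i \<in> A \<Longrightarrow> \<bar>P i x\<bar> \<le> M" "\<And>i x. i \<in> A \<Longrightarrow> \<bar>P1 i x\<bar> \<le> M" "\<And>i x. i \<in> A \<Longrightarrow> \<bar>P2 i x\<bar> \<le> M"
proof -
  have "\<forall>i\<in>A. \<exists>p1 p2 M. (\<forall>x. (P i has_real_derivative p1 x) (at x)) \<and> (\<forall>x. (p1 has_real_derivative p2 x) (at x)) \<and>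
    continuous_on UNIV p2 \<and> (\<forall>x. \<bar>P i x\<bar> \<le> M \<and> \<bar>p1 x\<bar> \<le> M \<and> \<bar>p2 x\<bar> \<le> M)"
    using assms(2) unfolding C2b_def by blast
  then obtain P1 P2 M where *: "\<forall>i\<in>A. (\<forall>x. (P i has_real_derivative P1 i x) (at x)) \<and> (\<forall>x. (P1 i has_real_derivative P2 i x) (at x)) \<and>
    continuous_on UNIV (P2 i) \<and> (\<forall>x. \<bar>P i x\<bar> \<le> M i \<and> \<bar>P1 i x\<bar> \<le> M i \<and> \<bar>P2 i x\<bar> \<le> M i)"
    unfolding bchoice_iff by blast
  have le: "M i \<le> (\<Sum>i\<in>A. \<bar>M i\<bar>)" if "i \<in> A" for i
    using member_le_sum[OF that, of "\<lambda>i. \<bar>M i\<bar>"] assms(1) by auto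
  show ?thesis
  proof (rule that[of "\<Sum>i\<in>A. \<bar>M i\<bar>" P1 P2])
    show "(\<Sum>i\<in>A. \<bar>M i\<bar>) \<ge> 0" by (simp add: sum_nonneg)
    fix i assume i: "i \<in> A"
    note ** = bspec[OF * i]
    show "continuous_on UNIV (P2 i)" using ** by blast
    fix x
    show "(P i has_real_derivative P1 i x) (at x)" using ** by blast
    show "(P1 i has_real_derivative P2 i x) (at x)" using ** by blast
    have b: "\<bar>P i x\<bar> \<le> M i" "\<bar>P1 i x\<bar> \<le> M i" "\<bar>P2 i x\<bar> \<le> M i" using ** by simp_all
    show "\<bar>P i x\<bar> \<le> (\<Sum>i\<in>A. \<bar>M i\<bar>)" by (rule order.trans[OF b(1) le[OF i]])
    show "\<bar>P1 i x\<bar> \<le> (\<Sum>i\<in>A. \<bar>M i\<bar>)" by (rule order.trans[OF b(2) le[OF i]])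
    show "\<bar>P2 i x\<bar> \<le> (\<Sum>i\<in>A. \<bar>M i\<bar>)" by (rule order.trans[OF b(3) le[OF i]])
  qed
qed

text \<open>The profile with layers attains the Dirichlet data exactly, solves equation and
  transmission condition up to O(eps), and differs from the bare profile by O(eps) in L^1. The
  hypothesis on \<open>P\<close> and \<open>W\<close> is the transmission condition with the
  diffusive flux dropped. The point is that C is uniform in \<open>eps\<close>, the data and the
  time; \<open>\<beta>\<close> controls the outlet layers, whose height depends on the outlet
  datum.\<close>

lemma viscous_profile_estimate:
  fixes P W :: "nat \<Rightarrow> real \<Rightarrow> real" and L vel B :: "nat \<Rightarrow> real" and K :: "nat \<Rightarrow> nat \<Rightarrow> real"
  assumes fin: "finite (Inc \<union> Out)" and disj: "Inc \<inter> Out = {}"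
    and pos: "\<And>i. i \<in> Inc \<union> Out \<Longrightarrow> L i > 0" "\<And>i. i \<in> Inc \<union> Out \<Longrightarrow> vel i > 0"
    and K: "\<And>i j. i \<in> Inc \<union> Out \<Longrightarrow> j \<in> Inc \<union> Out \<Longrightarrow> K i j = K j i"
      "\<And>i j. i \<in> Inc \<union> Out \<Longrightarrow> j \<in> Inc \<union> Out \<Longrightarrow> i \<noteq> j \<Longrightarrow> K i j \<ge> 0"
    and P: "\<And>i. i \<in> Inc \<union> Out \<Longrightarrow> C2b (P i)" and W: "\<And>i. i \<in> Inc \<union> Out \<Longrightarrow> C2b (W i)"
    and PB: "\<And>i t. i \<in> Inc \<Longrightarrow> t > 0 \<Longrightarrow> P i t = B i"
    and PW: "\<And>i t. i \<in> Out \<Longrightarrow> t > 0 \<Longrightarrow> W i t = P i t"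
    and nd: "\<And>i t. i \<in> Inc \<union> Out \<Longrightarrow> t > 0 \<Longrightarrow>
      orient Inc i * (- vel i * P i (t - node Inc L i / vel i)) = (\<Sum>j\<in>Inc \<union> Out. K i j * (W j t - W i t))"
    and T: "T \<ge> 0" and \<beta>: "\<beta> \<ge> 0"
  shows "\<exists>C. \<forall>eps v w t. 0 < eps \<and> (\<forall>i\<in>Inc \<union> Out. L1 {0<..<L i} (v i)) \<and> solves_parabolic Inc Out L vel K B eps v w \<and>
      (\<forall>i\<in>Out. \<bar>bdry_trace {0<..<L i} (v i) (L i)\<bar> \<le> \<beta>) \<and> 0 \<le> t \<and> t \<le> T \<longrightarrow>
    L1_dist_network (Inc \<union> Out) L (\<lambda>i x. w i (x, t)) (\<lambda>i x. P i (t - x / vel i))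
      \<le> L1_dist_network (Inc \<union> Out) L v (\<lambda>i x. P i (0 - x / vel i)) + C * eps"
proof -
  let ?I = "Inc \<union> Out"
  \<comment> \<open>The part of the layer amplitude that does not depend on the viscous data. The
    outlet datum of an outgoing arc is constant in time and is added only in \<open>d\<close>, so
    bounds for \<open>Q\<close> and its derivatives can be fixed before \<open>v\<close> is.\<close>
  define Q where "Q i t = (if i \<in> Inc then W i t else 0) + (-1) * P i (1 * t + - (L i / vel i))" for i t
  have Q: "C2b (Q i)" if i: "i \<in> ?I" for i
  proof -
    have "C2b (\<lambda>t. if i \<in> Inc then W i t else 0)" using W[OF i] by (cases "i \<in> Inc") (simp_all add: C2b_const)
    then show ?thesis unfolding Q_def[abs_def] by (intro C2b_add C2b_cmult C2b_affine P i)
  qed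
  obtain P1 P2 MP where MP: "MP \<ge> 0" and P1D: "\<And>i x. i \<in> ?I \<Longrightarrow> (P i has_real_derivative P1 i x) (at x)"
    and P2D: "\<And>i x. i \<in> ?I \<Longrightarrow> (P1 i has_real_derivative P2 i x) (at x)" and P2c: "\<And>i. i \<in> ?I \<Longrightarrow> continuous_on UNIV (P2 i)"
    and Pm: "\<And>i x. i \<in> ?I \<Longrightarrow> \<bar>P i x\<bar> \<le> MP" "\<And>i x. i \<in> ?I \<Longrightarrow> \<bar>P1 i x\<bar> \<le> MP" "\<And>i x. i \<in> ?I \<Longrightarrow> \<bar>P2 i x\<bar> \<le> MP"
  proof (rule C2b_familyE[of ?I P, OF fin])
    show "C2b (P i)" if "i \<in> ?I" for i by (rule P[OF that])
  qed (rule that)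
  obtain Q1 Q2 MQ where MQ: "MQ \<ge> 0" and Q1D: "\<And>i x. i \<in> ?I \<Longrightarrow> (Q i has_real_derivative Q1 i x) (at x)"
    and Q2D: "\<And>i x. i \<in> ?I \<Longrightarrow> (Q1 i has_real_derivative Q2 i x) (at x)" and "\<And>i. i \<in> ?I \<Longrightarrow> continuous_on UNIV (Q2 i)"
    and Qm: "\<And>i x. i \<in> ?I \<Longrightarrow> \<bar>Q i x\<bar> \<le> MQ" "\<And>i x. i \<in> ?I \<Longrightarrow> \<bar>Q1 i x\<bar> \<le> MQ" "\<And>i x. i \<in> ?I \<Longrightarrow> \<bar>Q2 i x\<bar> \<le> MQ"
  proof (rule C2b_familyE[of ?I Q, OF fin])
    show "C2b (Q i)" if "i \<in> ?I" for i by (rule Q[OF that])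
  qed (rule that)
  define M where "M = MP + MQ + \<beta>"
  have le: "MP \<le> M" "MQ + \<beta> \<le> M" "MQ \<le> M" and M0: "M \<ge> 0" using MP MQ \<beta> by (simp_all add: M_def)
  have Pb: "\<bar>P i x\<bar> \<le> M" "\<bar>P1 i x\<bar> \<le> M" "\<bar>P2 i x\<bar> \<le> M" if i: "i \<in> ?I" for i x
    by (rule order.trans[OF Pm(1)[OF i] le(1)], rule order.trans[OF Pm(2)[OF i] le(1)], rule order.trans[OF Pm(3)[OF i] le(1)])
  have Qb: "\<bar>Q i x\<bar> + \<beta> \<le> M" "\<bar>Q1 i x\<bar> \<le> M" "\<bar>Q2 i x\<bar> \<le> M" if i: "i \<in> ?I" for i x
    by (rule order.trans[OF add_right_mono[OF Qm(1)[OF i]] le(2)], rule order.trans[OF Qm(2)[OF i] le(3)], rule order.trans[OF Qm(3)[OF i] le(3)])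
  \<comment> \<open>All constants are coefficients of \<open>eps\<close>. In \<open>\<rho>\<close>:
    the diffusion of the profile and the time derivative of the layer. In \<open>s\<close>: the
    deviation of the node value from W, due to the tail of the layer. In \<open>r\<close>: the
    resulting flux error, the diffusive flux of the profile, and the coupling terms.
    \<open>C\<close> adds the layers at time 0 and at time t.\<close>
  define \<rho> where "\<rho> i = L i * (M / (vel i)\<^sup>2) + M / vel i" for i
  define s where "s i = M / (vel i * L i)" for i
  define r where "r i = M / L i + M / vel i + (\<Sum>j\<in>?I. \<bar>K i j\<bar> * (s j + s i))" for i
  define C where "C = (\<Sum>i\<in>?I. \<rho> i + r i) * T + 2 * (\<Sum>i\<in>?I. M / vel i)"
  have s0: "s i \<ge> 0" if "i \<in> ?I" for i using pos[OF that] M0 by (simp add: s_def)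
  have r0: "r i \<ge> 0" if "i \<in> ?I" for i
    unfolding r_def using pos[OF that] M0 s0 that by (intro add_nonneg_nonneg sum_nonneg mult_nonneg_nonneg) auto
  have \<rho>0: "\<rho> i \<ge> 0" if "i \<in> ?I" for i unfolding \<rho>_def using pos[OF that] M0 by simp
  show ?thesis
  proof (intro exI[of _ C] allI impI)
    fix eps v w t
    assume A: "0 < eps \<and> (\<forall>i\<in>?I. L1 {0<..<L i} (v i)) \<and> solves_parabolic Inc Out L vel K B eps v w \<and>
      (\<forall>i\<in>Out. \<bar>bdry_trace {0<..<L i} (v i) (L i)\<bar> \<le> \<beta>) \<and> 0 \<le> t \<and> t \<le> T"
    then have eps: "eps > 0" and v: "\<And>i. i \<in> ?I \<Longrightarrow> L1 {0<..<L i} (v i)" and sol: "solves_parabolic Inc Out L vel K B eps v w"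
      and bv: "\<And>i. i \<in> Out \<Longrightarrow> \<bar>bdry_trace {0<..<L i} (v i) (L i)\<bar> \<le> \<beta>" and t: "0 \<le> t" "t \<le> T" by auto
    define b where "b i = (if i \<in> Inc then 0 else bdry_trace {0<..<L i} (v i) (L i))" for i
    have bb: "\<bar>b i\<bar> \<le> \<beta>" if "i \<in> ?I" for i using bv[of i] \<beta> that by (auto simp: b_def)
    define E where "E i = bdry_layer eps (vel i) (L i)" for i
    define c where "c i = (if i \<in> Inc then E i 0 else 0)" for i
    define d where "d i t = Q i t + b i" for i t
    \<comment> \<open>\<open>z\<close> is the transport profile with a boundary layer at \<open>x = L i\<close>; subtracting \<open>c i\<close> keeps the value at the
      inlet of the incoming arcs, and \<open>d i t\<close> gives node value \<open>W i t\<close> up to \<open>c i\<close>, or the Dirichlet datum.\<close>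
    have db: "\<bar>d i t\<bar> \<le> M" if "i \<in> ?I" for i t using Qb(1)[OF that, of t] bb[OF that] unfolding d_def by linarith
    define z where "z i x t = P i (t - x / vel i) + d i t * (E i x - c i)" for i x t
    define zx where "zx i x t = - (P1 i (t - x / vel i) / vel i) + d i t * (vel i / eps * E i x)" for i x t
    define zxx where "zxx i x t = P2 i (t - x / vel i) / (vel i)\<^sup>2 + d i t * (vel i / eps * (vel i / eps * E i x))" for i x t
    define zt where "zt i x t = P1 i (t - x / vel i) + Q1 i t * (E i x - c i)" for i x t
    have ED: "(E i has_real_derivative vel i / eps * E i x) (at x)" for i x
      unfolding E_def using eps by (intro DERIV_bdry_layer) simp
    have c0: "0 \<le> c i" "c i \<le> E i 0" for i using bdry_layer_pos[of eps "vel i" "L i" 0] by (auto simp: c_def E_def)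
    have Ec: "0 \<le> E i x - c i" "E i x - c i \<le> 1" if "i \<in> ?I" "x \<in> {0..L i}" for i x
    proof -
      have "E i 0 \<le> E i x" unfolding E_def by (rule bdry_layer_mono) (use eps pos[OF that(1)] that in auto)
      then show "0 \<le> E i x - c i" using c0(2)[of i] by linarith
      have "E i x \<le> 1" unfolding E_def by (rule bdry_layer_le_1) (use eps pos[OF that(1)] that in auto)
      then show "E i x - c i \<le> 1" using c0(1)[of i] by linarith
    qed
    have arg: "((\<lambda>x. t - x / vel i) has_real_derivative - (1 / vel i)) (at x)" if "i \<in> ?I" for i x t
      using pos(2)[OF that] by (auto intro!: derivative_eq_intros)
    have zD: "((\<lambda>x. z i x t) has_real_derivative zx i x t) (at x)" if i: "i \<in> ?I" for i x t
    proof -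
      have "((\<lambda>x. P i (t - x / vel i) + d i t * (E i x - c i)) has_real_derivative
          P1 i (t - x / vel i) * - (1 / vel i) + d i t * (vel i / eps * E i x - 0)) (at x)"
        by (intro DERIV_add DERIV_chain2[OF P1D[OF i] arg[OF i]] DERIV_cmult DERIV_diff ED DERIV_const)
      then show ?thesis unfolding z_def zx_def by simp
    qed
    have zxD: "((\<lambda>x. zx i x t) has_real_derivative zxx i x t) (at x)" if i: "i \<in> ?I" for i x t
    proof -
      have "((\<lambda>x. - (P1 i (t - x / vel i) / vel i) + d i t * (vel i / eps * E i x)) has_real_derivative
          - (P2 i (t - x / vel i) * - (1 / vel i) / vel i) + d i t * (vel i / eps * (vel i / eps * E i x))) (at x)"
        by (intro DERIV_add DERIV_minus DERIV_cdivide DERIV_chain2[OF P2D[OF i] arg[OF i]] DERIV_cmult ED)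
      then show ?thesis unfolding zx_def zxx_def by (simp add: power2_eq_square)
    qed
    have Econt: "continuous_on S (E i)" for i S
      by (intro continuous_at_imp_continuous_on ballI DERIV_isCont[OF ED])
    have argc: "continuous_on S (\<lambda>x. t - x / vel i)" if "i \<in> ?I" for S i t
      by (intro continuous_at_imp_continuous_on ballI DERIV_isCont[OF arg[OF that]])
    have P1c: "continuous_on UNIV (P1 i)" if "i \<in> ?I" for i
      by (intro continuous_at_imp_continuous_on ballI DERIV_isCont[OF P2D[OF that]])
    have Pc: "continuous_on UNIV (P i)" if "i \<in> ?I" for i
      by (intro continuous_at_imp_continuous_on ballI DERIV_isCont[OF P1D[OF that]])
    have zxxc: "continuous_on UNIV (\<lambda>x. zxx i x t)" if i: "i \<in> ?I" for i t
      unfolding zxx_def using pos(2)[OF i]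
      by (intro continuous_intros continuous_on_compose2[OF P2c[OF i] argc[OF i]] Econt) auto
    have ztc: "continuous_on UNIV (\<lambda>x. zt i x t)" if i: "i \<in> ?I" for i t
      unfolding zt_def by (intro continuous_intros continuous_on_compose2[OF P1c[OF i] argc[OF i]] Econt) auto
    have zL1: "L1 {0<..<L i} (\<lambda>x. z i x t)" if "i \<in> ?I" for i t
      unfolding L1_def by (intro continuous_imp_set_integrable continuous_at_imp_continuous_on ballI DERIV_isCont[OF zD[OF that]])
    have PL1: "L1 {0<..<L i} (\<lambda>x. P i (t - x / vel i))" if i: "i \<in> ?I" for i t
      unfolding L1_def by (intro continuous_imp_set_integrable continuous_on_compose2[OF Pc[OF i] argc[OF i]]) auto
    have layer: "L1_dist_network ?I L (\<lambda>i x. z i x t) (\<lambda>i x. P i (t - x / vel i)) \<le> (\<Sum>i\<in>?I. M / vel i) * eps" for t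
      unfolding L1_dist_network_def sum_distrib_right
    proof (rule sum_mono)
      fix i assume i: "i \<in> ?I"
      have "L1_norm {0<..<L i} (\<lambda>x. z i x t - P i (t - x / vel i)) = L1_norm {0<..<L i} (\<lambda>x. d i t * (if x \<in> {0..L i} then E i x - c i else 0))"
        by (rule L1_norm_cong) (simp add: z_def)
      also have "\<dots> \<le> M * (eps / vel i)"
      \<comment> \<open>As \<open>c i\<close> is nonnegative, \<open>min (c i) 0\<close> is 0: the
        truncated layer is bounded by the full exponential, also for those x where the truncation
        would be negative.\<close>
      proof (rule bdry_layer_L1[where c = "min (c i) 0"])
        fix x
        have Ep: "E i x > 0" unfolding E_def by (rule bdry_layer_pos)
        show "\<bar>d i t * (if x \<in> {0..L i} then E i x - c i else 0)\<bar> \<le> M * (bdry_layer eps (vel i) (L i) x - min (c i) 0)"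
          unfolding abs_mult E_def[symmetric]
          by (intro mult_mono db[OF i] M0) (use Ep Ec[OF i, of x] c0(1)[of i] in auto)
      qed (use eps pos[OF i] c0(1)[of i] bdry_layer_pos[of eps "vel i" "L i" 0] in auto)
      finally show "L1_norm {0<..<L i} (\<lambda>x. z i x t - P i (t - x / vel i)) \<le> M / vel i * eps" by simp
    qed
    have comp: "L1_dist_network ?I L (\<lambda>i x. w i (x, t)) (\<lambda>i x. z i x t)
      \<le> L1_dist_network ?I L v (\<lambda>i x. z i x 0) + (\<Sum>i\<in>?I. eps * \<rho> i + eps * r i) * t"
    proof (rule parabolic_comparison[OF sol fin disj pos eps K v zD zxD zxxc ztc, where C = "M + M"])
      fix i t \<eta> assume i: "i \<in> ?I" and t: "(t::real) > 0" and \<eta>: "(\<eta>::real) > 0"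
      show "\<exists>h0>0. \<forall>h x. 0 < h \<and> h < h0 \<and> x \<in> {0<..<L i} \<longrightarrow> \<bar>(z i x (t - h) - z i x t) / (- h) - zt i x t\<bar> \<le> \<eta>"
      proof (intro exI[of _ "\<eta> / (M + M + 1)"] conjI allI impI)
        show "\<eta> / (M + M + 1) > 0" using \<eta> M0 by simp
        fix h x assume h: "0 < h \<and> h < \<eta> / (M + M + 1) \<and> x \<in> {0<..<L i}"
        define u where "u = (P i (t - x / vel i - h) - P i (t - x / vel i)) / (- h) - P1 i (t - x / vel i)"
        define u' where "u' = (Q i (t - h) - Q i t) / (- h) - Q1 i t"
        have u: "\<bar>u\<bar> \<le> M * h" unfolding u_def by (rule C2_difference_quotient[OF P1D[OF i] P2D[OF i] Pb(3)[OF i]]) (use h in simp)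
        have u': "\<bar>u'\<bar> \<le> M * h" unfolding u'_def by (rule C2_difference_quotient[OF Q1D[OF i] Q2D[OF i] Qb(3)[OF i]]) (use h in simp)
        have x: "x \<in> {0..L i}" using h by auto
        have "(z i x (t - h) - z i x t) / (- h) - zt i x t = u + u' * (E i x - c i)"
          using h unfolding z_def zt_def u_def u'_def d_def by (simp add: field_simps)
        also have "\<bar>\<dots>\<bar> \<le> \<bar>u\<bar> + \<bar>u'\<bar> * \<bar>E i x - c i\<bar>" unfolding abs_mult[symmetric] by (rule abs_triangle_ineq)
        also have "\<dots> \<le> M * h + M * h * 1"
          using u u' Ec[OF i x] by (intro add_mono mult_mono) auto
        also have "\<dots> \<le> (M + M + 1) * h" using h by (simp add: algebra_simps)
        also have "\<dots> \<le> \<eta>" using h M0 by (simp add: field_simps)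
        finally show "\<bar>(z i x (t - h) - z i x t) / (- h) - zt i x t\<bar> \<le> \<eta>" .
      qed
    next
      fix i x s t assume i: "i \<in> ?I" and x: "x \<in> {0<..<L i}"
      have x': "x \<in> {0..L i}" using x by auto
      have "z i x s - z i x t = (P i (s - x / vel i) - P i (t - x / vel i)) + (Q i s - Q i t) * (E i x - c i)"
        unfolding z_def d_def by (simp add: algebra_simps)
      also have "\<bar>\<dots>\<bar> \<le> \<bar>P i (s - x / vel i) - P i (t - x / vel i)\<bar> + \<bar>Q i s - Q i t\<bar> * \<bar>E i x - c i\<bar>"
        unfolding abs_mult[symmetric] by (rule abs_triangle_ineq)
      also have "\<dots> \<le> M * \<bar>(s - x / vel i) - (t - x / vel i)\<bar> + M * \<bar>s - t\<bar> * 1"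
        using Ec[OF i x'] M0
        by (intro add_mono mult_mono C1_Lipschitz[OF P1D[OF i] Pb(2)[OF i]] C1_Lipschitz[OF Q1D[OF i] Qb(2)[OF i]]) auto
      finally show "\<bar>z i x s - z i x t\<bar> \<le> (M + M) * \<bar>s - t\<bar>" by (simp add: algebra_simps)
    next
      fix i t assume i: "i \<in> ?I" and t: "(t::real) > 0"
      have "L1_norm {0<..<L i} (\<lambda>x. - vel i * zx i x t + eps * zxx i x t - zt i x t)
        = L1_norm {0<..<L i} (\<lambda>x. eps * P2 i (t - x / vel i) / (vel i)\<^sup>2 + - (Q1 i t * (if x \<in> {0..L i} then E i x - c i else 0)))"
      proof (rule L1_norm_cong)
        fix x assume x: "x \<in> {0<..<L i}"
        define A where "A = P1 i (t - x / vel i)"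
        define A' where "A' = P2 i (t - x / vel i)"
        have "vel i \<noteq> 0" "eps \<noteq> 0" using pos(2)[OF i] eps by auto
        \<comment> \<open>The layer cancels between transport and diffusion, the first derivative of
          the profile between transport and time derivative. What is left is the diffusion of the
          profile and the time derivative of the layer amplitude.\<close>
        then have "- vel i * (- (A / vel i) + d i t * (vel i / eps * E i x)) + eps * (A' / (vel i)\<^sup>2 + d i t * (vel i / eps * (vel i / eps * E i x)))
            - (A + Q1 i t * (E i x - c i)) = eps * A' / (vel i)\<^sup>2 + - (Q1 i t * (E i x - c i))"
          by (simp add: field_simps power2_eq_square)
        then show "\<bar>- vel i * zx i x t + eps * zxx i x t - zt i x t\<bar>
            = \<bar>eps * P2 i (t - x / vel i) / (vel i)\<^sup>2 + - (Q1 i t * (if x \<in> {0..L i} then E i x - c i else 0))\<bar>"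
          using x unfolding zx_def zxx_def zt_def A_def A'_def by simp
      qed
      also have "\<dots> \<le> L1_norm {0<..<L i} (\<lambda>x. eps * P2 i (t - x / vel i) / (vel i)\<^sup>2)
          + L1_norm {0<..<L i} (\<lambda>x. - (Q1 i t * (if x \<in> {0..L i} then E i x - c i else 0)))"
      proof (rule L1_norm_triangle)
        show "L1 {0<..<L i} (\<lambda>x. eps * P2 i (t - x / vel i) / (vel i)\<^sup>2)"
          unfolding L1_def using pos(2)[OF i]
          by (intro continuous_imp_set_integrable continuous_intros continuous_on_compose2[OF P2c[OF i] argc[OF i]]) auto
        show "L1 {0<..<L i} (\<lambda>x. - (Q1 i t * (if x \<in> {0..L i} then E i x - c i else 0)))"
          unfolding L1_def
        proof (rule continuous_imp_set_integrable)
          have "continuous_on {0..L i} (\<lambda>x. - (Q1 i t * (E i x - c i)))" by (intro continuous_intros Econt)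
          then show "continuous_on {0..L i} (\<lambda>x. - (Q1 i t * (if x \<in> {0..L i} then E i x - c i else 0)))"
            by (rule continuous_on_eq) simp
        qed
      qed
      also have "\<dots> \<le> L i * (eps * M / (vel i)\<^sup>2) + M * (eps / vel i)"
      proof (rule add_mono)
        show "L1_norm {0<..<L i} (\<lambda>x. eps * P2 i (t - x / vel i) / (vel i)\<^sup>2) \<le> L i * (eps * M / (vel i)\<^sup>2)"
        proof (rule L1_norm_bounded_le)
          fix x
          have "\<bar>eps * P2 i (t - x / vel i) / (vel i)\<^sup>2\<bar> = eps * \<bar>P2 i (t - x / vel i)\<bar> / (vel i)\<^sup>2"
            using eps by (simp add: abs_mult)
          also have "\<dots> \<le> eps * M / (vel i)\<^sup>2"
            using eps Pb(3)[OF i] by (intro divide_right_mono mult_left_mono) auto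
          finally show "\<bar>eps * P2 i (t - x / vel i) / (vel i)\<^sup>2\<bar> \<le> eps * M / (vel i)\<^sup>2" .
        qed (use pos(1)[OF i] in simp)
        show "L1_norm {0<..<L i} (\<lambda>x. - (Q1 i t * (if x \<in> {0..L i} then E i x - c i else 0))) \<le> M * (eps / vel i)"
        proof (rule bdry_layer_L1[where c = "min (c i) 0"])
          fix x
          have Ep: "E i x > 0" unfolding E_def by (rule bdry_layer_pos)
          show "\<bar>- (Q1 i t * (if x \<in> {0..L i} then E i x - c i else 0))\<bar> \<le> M * (bdry_layer eps (vel i) (L i) x - min (c i) 0)"
            unfolding abs_minus_cancel abs_mult E_def[symmetric]
            by (intro mult_mono Qb(2)[OF i] M0) (use Ep Ec[OF i, of x] c0(1)[of i] in auto)
        qed (use eps pos[OF i] c0(1)[of i] bdry_layer_pos[of eps "vel i" "L i" 0] in auto)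
      qed
      also have "\<dots> = eps * \<rho> i" unfolding \<rho>_def by (simp add: algebra_simps)
      finally show "L1_norm {0<..<L i} (\<lambda>x. - vel i * zx i x t + eps * zxx i x t - zt i x t) \<le> eps * \<rho> i" .
    next
      fix i t assume i: "i \<in> Inc" and t: "(t::real) > 0"
      then show "z i 0 t = B i" using PB[OF i t] by (simp add: z_def c_def)
    next
      fix i t assume i: "i \<in> Out" and t: "(t::real) > 0"
      have ni: "i \<notin> Inc" using i disj by auto
      have "Q i t = - P i (t - L i / vel i)" using ni by (simp add: Q_def)
      then show "z i (L i) t = bdry_trace {0<..<L i} (v i) (L i)"
        using ni by (simp add: z_def c_def d_def b_def E_def bdry_layer_end)
    next
      fix i t assume i: "i \<in> ?I" and t: "(t::real) > 0"
      \<comment> \<open>On an incoming arc the deviation stems from the constant subtracted to keep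
        the inlet value, on an outgoing arc from the tail of the layer sitting at the outlet; both
        equal \<open>E j 0 * d j t\<close> up to sign.\<close>
      define \<sigma> where "\<sigma> j = z j (node Inc L j) t - W j t" for j
      have sig: "\<bar>\<sigma> j\<bar> \<le> eps * s j" and flux: "\<bar>orient Inc j * (- vel j * z j (node Inc L j) t + eps * zx j (node Inc L j) t)
          - orient Inc j * (- vel j * P j (t - node Inc L j / vel j))\<bar> \<le> eps * (M / L j + M / vel j)" if j: "j \<in> ?I" for j
      proof -
        have E0: "0 < E j 0" "E j 0 \<le> eps / (vel j * L j)"
          unfolding E_def using bdry_layer_pos bdry_layer_start_le[OF eps pos(2)[OF j] pos(1)[OF j]] by auto
        have E0d: "E j 0 * \<bar>d j t\<bar> \<le> eps / (vel j * L j) * M"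
          using E0 db[OF j] pos[OF j] eps by (intro mult_mono) auto
        have v0: "vel j > 0" "L j > 0" using pos[OF j] by auto
        have P1b: "eps * \<bar>P1 j y\<bar> / vel j \<le> eps * M / vel j" for y
          using eps v0 Pb(2)[OF j, of y] by (intro divide_right_mono mult_left_mono) auto
        have P1b': "\<bar>eps * P1 j y / vel j\<bar> \<le> eps * M / vel j" for y
          using P1b[of y] eps v0 by (simp add: abs_mult)
        have "\<bar>\<sigma> j\<bar> = E j 0 * \<bar>d j t\<bar> \<and> \<bar>orient Inc j * (- vel j * z j (node Inc L j) t + eps * zx j (node Inc L j) t)
          - orient Inc j * (- vel j * P j (t - node Inc L j / vel j))\<bar> \<le> vel j * (E j 0 * \<bar>d j t\<bar>) + eps * M / vel j"
        proof (cases "j \<in> Inc")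
          case True
          have dW: "d j t = W j t - P j (t - L j / vel j)" using True by (simp add: d_def b_def Q_def)
          have EL: "E j (L j) = 1" by (simp add: E_def bdry_layer_end)
          have n: "node Inc L j = L j" "orient Inc j = 1" "c j = E j 0" using True by (simp_all add: node_def orient_def c_def)
          have 1: "\<sigma> j = - (E j 0 * d j t)" unfolding \<sigma>_def z_def n EL dW by (simp add: algebra_simps)
          have 2: "orient Inc j * (- vel j * z j (node Inc L j) t + eps * zx j (node Inc L j) t)
            - orient Inc j * (- vel j * P j (t - node Inc L j / vel j)) = vel j * (E j 0 * d j t) - eps * P1 j (t - L j / vel j) / vel j"
            unfolding n z_def zx_def EL using eps v0 by (simp add: algebra_simps)
          have "\<bar>vel j * (E j 0 * d j t) - eps * P1 j (t - L j / vel j) / vel j\<bar> \<le> \<bar>vel j * (E j 0 * d j t)\<bar> + \<bar>eps * P1 j (t - L j / vel j) / vel j\<bar>"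
            by (rule abs_triangle_ineq4)
          also have "\<bar>vel j * (E j 0 * d j t)\<bar> = vel j * (E j 0 * \<bar>d j t\<bar>)" using v0 E0 by (simp add: abs_mult)
          finally show ?thesis unfolding 1 2 using P1b'[of "t - L j / vel j"] E0 by (simp add: abs_mult)
        next
          case False
          then have jO: "j \<in> Out" using j by simp
          have n: "node Inc L j = 0" "orient Inc j = -1" "c j = 0" using False by (simp_all add: node_def orient_def c_def)
          have 1: "\<sigma> j = E j 0 * d j t" unfolding \<sigma>_def z_def n PW[OF jO t] by simp
          have 2: "orient Inc j * (- vel j * z j (node Inc L j) t + eps * zx j (node Inc L j) t)
            - orient Inc j * (- vel j * P j (t - node Inc L j / vel j)) = eps * P1 j t / vel j"
            unfolding n z_def zx_def using eps v0 by (simp add: algebra_simps)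
          have "0 \<le> vel j * (E j 0 * \<bar>d j t\<bar>)" using v0 E0 by simp
          then show ?thesis unfolding 1 2 using P1b'[of t] E0 by (simp add: abs_mult)
        qed
        moreover have "eps / (vel j * L j) * M = eps * s j" by (simp add: s_def)
        moreover have "vel j * (E j 0 * \<bar>d j t\<bar>) \<le> vel j * (eps / (vel j * L j) * M)" using E0d v0 by (intro mult_left_mono) auto
        moreover have "vel j * (eps / (vel j * L j) * M) = eps * (M / L j)" using v0 by simp
        ultimately show "\<bar>\<sigma> j\<bar> \<le> eps * s j" "\<bar>orient Inc j * (- vel j * z j (node Inc L j) t + eps * zx j (node Inc L j) t)
          - orient Inc j * (- vel j * P j (t - node Inc L j / vel j))\<bar> \<le> eps * (M / L j + M / vel j)"
          using E0d by (auto simp: distrib_left)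
      qed
      have "orient Inc i * (- vel i * z i (node Inc L i) t + eps * zx i (node Inc L i) t)
        - (\<Sum>j\<in>?I. K i j * (z j (node Inc L j) t - z i (node Inc L i) t))
        = (orient Inc i * (- vel i * z i (node Inc L i) t + eps * zx i (node Inc L i) t) - orient Inc i * (- vel i * P i (t - node Inc L i / vel i)))
          - (\<Sum>j\<in>?I. K i j * (\<sigma> j - \<sigma> i))"
      proof -
        have "(\<Sum>j\<in>?I. K i j * (z j (node Inc L j) t - z i (node Inc L i) t))
          = (\<Sum>j\<in>?I. K i j * (W j t - W i t)) + (\<Sum>j\<in>?I. K i j * (\<sigma> j - \<sigma> i))"
          unfolding sum.distrib[symmetric] by (rule sum.cong[OF refl]) (simp add: \<sigma>_def algebra_simps)
        then show ?thesis unfolding nd[OF i t] by linarith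
      qed
      also have "\<bar>\<dots>\<bar> \<le> eps * (M / L i + M / vel i) + (\<Sum>j\<in>?I. \<bar>K i j\<bar> * (eps * s j + eps * s i))"
      proof (rule order.trans[OF abs_triangle_ineq4 add_mono[OF flux[OF i]]])
        show "\<bar>\<Sum>j\<in>?I. K i j * (\<sigma> j - \<sigma> i)\<bar> \<le> (\<Sum>j\<in>?I. \<bar>K i j\<bar> * (eps * s j + eps * s i))"
        proof (rule order.trans[OF sum_abs sum_mono])
          fix j assume j: "j \<in> ?I"
          show "\<bar>K i j * (\<sigma> j - \<sigma> i)\<bar> \<le> \<bar>K i j\<bar> * (eps * s j + eps * s i)"
            unfolding abs_mult using sig[OF j] sig[OF i] by (intro mult_left_mono) auto
        qed
      qed
      also have "\<dots> = eps * r i" unfolding r_def by (simp add: distrib_left sum_distrib_left mult.left_commute)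
      finally show "\<bar>orient Inc i * (- vel i * z i (node Inc L i) t + eps * zx i (node Inc L i) t)
        - (\<Sum>j\<in>?I. K i j * (z j (node Inc L j) t - z i (node Inc L i) t))\<bar> \<le> eps * r i" .
    qed (use t in auto)
    have wL1: "L1 {0<..<L i} (\<lambda>x. w i (x, t))" if "i \<in> ?I" for i
      using sol that t unfolding solves_parabolic_def C1_L1_def C0_L1_def by blast
    have "L1_dist_network ?I L (\<lambda>i x. w i (x, t)) (\<lambda>i x. P i (t - x / vel i)) \<le>
      L1_dist_network ?I L (\<lambda>i x. w i (x, t)) (\<lambda>i x. z i x t) + L1_dist_network ?I L (\<lambda>i x. z i x t) (\<lambda>i x. P i (t - x / vel i))"
      by (rule L1_dist_network_triangle[OF wL1 zL1 PL1])
    moreover have "L1_dist_network ?I L v (\<lambda>i x. z i x 0) \<le>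
      L1_dist_network ?I L v (\<lambda>i x. P i (0 - x / vel i)) + L1_dist_network ?I L (\<lambda>i x. P i (0 - x / vel i)) (\<lambda>i x. z i x 0)"
      by (rule L1_dist_network_triangle[OF v PL1 zL1])
    moreover have "L1_dist_network ?I L (\<lambda>i x. P i (0 - x / vel i)) (\<lambda>i x. z i x 0) = L1_dist_network ?I L (\<lambda>i x. z i x 0) (\<lambda>i x. P i (0 - x / vel i))"
      unfolding L1_dist_network_def by (intro sum.cong refl L1_norm_cong) (simp add: abs_minus_commute)
    moreover have "(\<Sum>i\<in>?I. eps * \<rho> i + eps * r i) * t \<le> (\<Sum>i\<in>?I. \<rho> i + r i) * T * eps"
    proof -
      have "(\<Sum>i\<in>?I. eps * \<rho> i + eps * r i) * t = eps * ((\<Sum>i\<in>?I. \<rho> i + r i) * t)" by (simp add: sum_distrib_left distrib_left sum.distrib sum_distrib_right algebra_simps)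
      also have "\<dots> \<le> eps * ((\<Sum>i\<in>?I. \<rho> i + r i) * T)"
        using eps t r0 \<rho>0 by (intro mult_left_mono sum_nonneg) auto
      finally show ?thesis by (simp add: mult.commute)
    qed
    ultimately show "L1_dist_network ?I L (\<lambda>i x. w i (x, t)) (\<lambda>i x. P i (t - x / vel i))
      \<le> L1_dist_network ?I L v (\<lambda>i x. P i (0 - x / vel i)) + C * eps"
      using comp layer[of t] layer[of 0] unfolding C_def distrib_right by linarith
  qed
qed

section \<open>The transport problem along characteristics\<close>

text \<open>For fixed x the shear is a translation in the second variable, so Tonelli and
  translation invariance suffice. With c = 1/\<open>lam\<close> it maps the coordinates (x, s), s =
  t - x/\<open>lam\<close>, to (x, t) and so straightens the characteristics.\<close>

lemma shear_distr:
  "distr lborel borel (\<lambda>p :: real \<times> real. (fst p, snd p + c * fst p)) = lborel"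
proof (rule measure_eqI)
  have [measurable]: "(\<lambda>p :: real \<times> real. (fst p, snd p + c * fst p)) \<in> borel_measurable borel"
    by (intro borel_measurable_continuous_onI continuous_intros)
  fix A assume "A \<in> sets (distr lborel borel (\<lambda>p :: real \<times> real. (fst p, snd p + c * fst p)))"
  then have A: "A \<in> sets borel" by simp
  then have A' [measurable]: "A \<in> sets (borel \<Otimes>\<^sub>M borel)" unfolding borel_prod .
  let ?f = "\<lambda>p :: real \<times> real. (fst p, snd p + c * fst p)"
  have vim: "?f -` A \<in> sets borel" using measurable_sets[of ?f borel borel A] A by simp
  have "emeasure (distr lborel borel ?f) A = emeasure lborel (?f -` A)"
    using A by (subst emeasure_distr) auto
  also have "\<dots> = (\<integral>\<^sup>+ p. indicator (?f -` A) p \<partial>(lborel \<Otimes>\<^sub>M lborel))"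
    using vim by (simp add: lborel_prod)
  also have "\<dots> = (\<integral>\<^sup>+ x. \<integral>\<^sup>+ s. indicator A (x, s + c * x) \<partial>lborel \<partial>lborel)"
  proof (subst lborel.nn_integral_fst[symmetric])
    show "(indicator (?f -` A) :: _ \<Rightarrow> ennreal) \<in> borel_measurable (lborel \<Otimes>\<^sub>M lborel)"
      using vim by (simp add: lborel_prod)
  qed (simp add: indicator_def)
  also have "\<dots> = (\<integral>\<^sup>+ x. \<integral>\<^sup>+ s. indicator A (x, s) \<partial>lborel \<partial>lborel)"
  proof (rule nn_integral_cong)
    fix x :: real
    have "(\<lambda>s. indicator A (x, s) :: ennreal) \<in> borel_measurable borel" by measurable
    from nn_integral_real_affine[OF this, of 1 "c * x"]
    show "(\<integral>\<^sup>+ s. indicator A (x, s + c * x) \<partial>lborel) = (\<integral>\<^sup>+ s. indicator A (x, s) \<partial>lborel)" by (simp add: add.commute)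
  qed
  also have "\<dots> = (\<integral>\<^sup>+ p. indicator A p \<partial>(lborel \<Otimes>\<^sub>M lborel))"
    by (rule lborel.nn_integral_fst) (intro borel_measurable_indicator, simp add: A lborel_prod)
  also have "\<dots> = emeasure lborel A" using A by (simp add: lborel_prod)
  finally show "emeasure (distr lborel borel ?f) A = emeasure lborel A" .
qed simp

lemma shear_measurable: "(\<lambda>p :: real \<times> real. (fst p, snd p + c * fst p)) \<in> measurable lborel borel"
  by (simp, intro borel_measurable_continuous_onI continuous_intros)

lemma shear_integral:
  fixes G :: "real \<times> real \<Rightarrow> real"
  assumes "integrable lborel G"
  shows "integrable lborel (\<lambda>p. G (fst p, snd p + c * fst p))"
    and "(LINT p|lborel. G (fst p, snd p + c * fst p)) = (LINT p|lborel. G p)"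
proof -
  have Gm: "G \<in> borel_measurable borel" using borel_measurable_integrable[OF assms] by simp
  show "integrable lborel (\<lambda>p. G (fst p, snd p + c * fst p))"
    using assms integrable_distr_eq[OF shear_measurable[of c] Gm] by (simp add: shear_distr)
  show "(LINT p|lborel. G (fst p, snd p + c * fst p)) = (LINT p|lborel. G p)"
    using integral_distr[OF shear_measurable[of c] Gm] by (simp add: shear_distr)
qed

lemma shear_AE:
  assumes "AE p in lborel. P (fst p, snd p + c * fst p :: real)" "{p. P p} \<in> sets borel"
  shows "AE p in lborel. P p"
proof -
  have "(AE p in distr lborel borel (\<lambda>p :: real \<times> real. (fst p, snd p + c * fst p)). P p)
    \<longleftrightarrow> (AE p in lborel. P (fst p, snd p + c * fst p))"
    by (rule AE_distr_iff[OF shear_measurable]) (use assms(2) in simp)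
  then show ?thesis using assms(1) by (simp only: shear_distr)
qed

lemma integral_prod_snd:
  fixes G :: "real \<times> real \<Rightarrow> real"
  assumes "integrable lborel G"
  shows "integrable lborel (\<lambda>s. LINT x|lborel. G (x, s))"
    and "(LINT s|lborel. LINT x|lborel. G (x, s)) = (LINT p|lborel. G p)"
proof -
  have G: "integrable (lborel \<Otimes>\<^sub>M lborel) (case_prod (\<lambda>x y. G (x, y)))" using assms by (simp add: lborel_prod)
  show "integrable lborel (\<lambda>s. LINT x|lborel. G (x, s))" using lborel_pair.integrable_snd[OF G] .
  show "(LINT s|lborel. LINT x|lborel. G (x, s)) = (LINT p|lborel. G p)"
    using lborel_pair.integral_snd[OF G] by (simp add: lborel_prod)
qed

lemma integral_prod_fst:
  fixes G :: "real \<times> real \<Rightarrow> real"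
  assumes "integrable lborel G"
  shows "integrable lborel (\<lambda>x. LINT t|lborel. G (x, t))"
    and "(LINT x|lborel. LINT t|lborel. G (x, t)) = (LINT p|lborel. G p)"
proof -
  have G: "integrable (lborel \<Otimes>\<^sub>M lborel) (case_prod (\<lambda>x y. G (x, y)))" using assms by (simp add: lborel_prod)
  show "integrable lborel (\<lambda>x. LINT t|lborel. G (x, t))" using lborel_pair.integrable_fst[OF G] .
  show "(LINT x|lborel. LINT t|lborel. G (x, t)) = (LINT p|lborel. G p)"
    using lborel_pair.integral_fst[OF G] by (simp add: lborel_prod)
qed

section \<open>Functions constant along characteristics as weak solutions\<close>

lemma C1_compact_support_deriv_bounded:
  fixes \<phi> :: "'a::euclidean_space \<Rightarrow> 'b::euclidean_space"
  assumes C1: "C1_compact_support S \<phi> D" and R: "open R" "R \<subseteq> S"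
  shows "\<exists>M. \<forall>z\<in>R. norm (D z v) \<le> M"
proof -
  obtain C where C: "compact C" "C \<subseteq> S" "\<forall>z\<in>S - C. \<phi> z = 0" using C1 unfolding C1_compact_support_def by blast
  have "continuous_on S (\<lambda>z. D z v)" using C1 unfolding C1_compact_support_def by blast
  then have "continuous_on C (\<lambda>z. D z v)" using C(2) by (rule continuous_on_subset)
  then have "bounded ((\<lambda>z. D z v) ` C)" using C(1) by (intro compact_imp_bounded compact_continuous_image)
  then obtain M where M: "\<forall>z\<in>C. norm (D z v) \<le> M" unfolding bounded_iff by auto
  have "norm (D z v) \<le> max M 0" if z: "z \<in> R" for z
  proof (cases "z \<in> C")
    case True
    then show ?thesis using M by (auto simp: le_max_iff_disj)
  next
    case False
    have o: "open (R - C)" using R(1) C(1) by (intro open_Diff compact_imp_closed)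
    have "(\<phi> has_derivative D z) (at z within S)" using C1 z R(2) unfolding C1_compact_support_def by blast
    then have "(\<phi> has_derivative D z) (at z within R - C)" by (rule has_derivative_subset) (use R(2) in auto)
    moreover have "at z within R - C = at z" by (rule at_within_open[OF _ o]) (use z False in blast)
    ultimately have 1: "(\<phi> has_derivative D z) (at z)" by (simp only:)
    \<comment> \<open>Off the support \<phi> agrees with 0 on an open set, which forces the
      derivative to vanish there; on the compact support itself it is bounded by continuity.\<close>
    have "((\<lambda>_. 0) has_derivative D z) (at z)"
      by (rule has_derivative_transform_within_open[OF 1 o]) (use z False C(3) R(2) in auto)
    then have "D z = (\<lambda>_. 0)" by (rule has_derivative_unique[OF _ has_derivative_const])
    then show ?thesis by simp
  qed
  then show ?thesis by blast
qed

text \<open>In the coordinates (x, s) the factor Q(s) is constant along each characteristic, and the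
  tested expression is \<open>lam\<close> times the derivative of \<phi> along it. Integration
  leaves minus the value of \<phi> at the entry point, on the side x = 0 for s > 0 and on t = 0 for
  s < 0; compact support kills the exit.\<close>

lemma transport_weak_identity:
  fixes Q :: "real \<Rightarrow> real" and \<phi> :: "real \<times> real \<Rightarrow> real"
  assumes lam: "lam > 0" and L: "L > 0" and T: "T > 0"
    and Q: "Q \<in> borel_measurable borel" "\<And>s. \<bar>Q s\<bar> \<le> MQ"
    and C1: "C1_compact_support ({0..<L} \<times> {0..<T}) \<phi> D"
  shows "(LINT z:({0<..<L} \<times> {0<..<T})|lborel. Q (snd z - fst z / lam) * (D z (0, 1) + lam * D z (1, 0)))
      + (LINT x:{0<..<L}|lborel. Q (- x / lam) * \<phi> (x, 0)) = - lam * (LINT t:{0<..<T}|lborel. \<phi> (0, t) * Q t)"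
proof -
  let ?S = "{0..<L} \<times> {0..<T}"
  let ?R = "{0<..<L} \<times> {0<..<T}"
  define \<Phi> where "\<Phi> z = D z (0, 1) + lam * D z (1, 0)" for z
  have Ro: "open ?R" by (intro open_Times) auto
  have RS: "?R \<subseteq> ?S" by auto
  obtain C where C: "compact C" "C \<subseteq> ?S" "\<forall>z\<in>?S - C. \<phi> z = 0" using C1 unfolding C1_compact_support_def by blast
  have Dc: "continuous_on ?S (\<lambda>z. D z v)" for v using C1 unfolding C1_compact_support_def by blast
  have \<phi>d: "(\<phi> has_derivative D z) (at z within ?S)" if "z \<in> ?S" for z using C1 that unfolding C1_compact_support_def by blast
  have \<Phi>c: "continuous_on ?R \<Phi>"
    unfolding \<Phi>_def[abs_def] by (intro continuous_intros continuous_on_subset[OF Dc RS])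
  obtain M1 M2 where M: "\<forall>z\<in>?R. norm (D z (0, 1)) \<le> M1" "\<forall>z\<in>?R. norm (D z (1, 0)) \<le> M2"
    using C1_compact_support_deriv_bounded[OF C1 Ro RS, of "(0, 1)"] C1_compact_support_deriv_bounded[OF C1 Ro RS, of "(1, 0)"] by auto
  have \<Phi>b: "\<bar>\<Phi> z\<bar> \<le> M1 + lam * M2" if "z \<in> ?R" for z
  proof -
    have "\<bar>\<Phi> z\<bar> \<le> \<bar>D z (0, 1)\<bar> + \<bar>lam * D z (1, 0)\<bar>" unfolding \<Phi>_def by (rule abs_triangle_ineq)
    also have "\<bar>lam * D z (1, 0)\<bar> = lam * \<bar>D z (1, 0)\<bar>" using lam by (simp add: abs_mult)
    also have "\<bar>D z (0, 1)\<bar> + lam * \<bar>D z (1, 0)\<bar> \<le> M1 + lam * M2"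
      using bspec[OF M(1) that] bspec[OF M(2) that] lam by (intro add_mono mult_left_mono) auto
    finally show ?thesis .
  qed
  define G where "G z = Q (snd z - fst z / lam) * (indicator ?R z * \<Phi> z)" for z
  have Gm: "G \<in> borel_measurable borel"
  proof -
    have 1: "(\<lambda>z. indicator ?R z * \<Phi> z) \<in> borel_measurable borel"
      using borel_measurable_continuous_on_indicator[OF _ \<Phi>c] Ro by simp
    have "(\<lambda>z :: real \<times> real. snd z - fst z / lam) \<in> borel_measurable borel"
      by (intro borel_measurable_continuous_onI continuous_intros) (use lam in simp)
    from measurable_compose[OF this Q(1)] have "(\<lambda>z. Q (snd z - fst z / lam)) \<in> borel_measurable borel" .
    from borel_measurable_times[OF this 1] show ?thesis unfolding G_def[abs_def] .
  qed
  have Rb: "bounded ?R" by (intro bounded_Times) auto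
  have Gi: "integrable lborel G"
  proof (rule integrable_bounded_support[OF Gm Rb, where M = "MQ * (M1 + lam * M2)"])
    have MQ0: "0 \<le> MQ" using order_trans[OF abs_ge_zero Q(2)] .
    have z0: "(L / 2, T / 2) \<in> ?R" using L T by simp
    have MM: "0 \<le> M1 + lam * M2" using order_trans[OF abs_ge_zero \<Phi>b[OF z0]] .
    show "\<bar>G x\<bar> \<le> MQ * (M1 + lam * M2)" for x
    proof (cases "x \<in> ?R")
      case True
      then have "\<bar>indicator ?R x * \<Phi> x\<bar> \<le> M1 + lam * M2" using \<Phi>b by simp
      then show ?thesis unfolding G_def abs_mult[of "Q _"] by (intro mult_mono Q(2) MQ0) auto
    next
      case False
      then show ?thesis using MQ0 MM by (simp add: G_def)
    qed
    show "?R \<in> sets borel" using Ro by simp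
  qed (simp add: G_def)
  define J where "J s = (LINT x|lborel. indicator ?R (x, s + x / lam) * \<Phi> (x, s + x / lam))" for s
  have int1: "(LINT p|lborel. G p) = (LINT s|lborel. Q s * J s)" and int2: "integrable lborel (\<lambda>s. Q s * J s)"
  proof -
    have inner: "(LINT x|lborel. G (fst (x, s), snd (x, s) + 1 / lam * fst (x, s))) = Q s * J s" for s
      unfolding J_def integral_mult_right_zero[symmetric] by (simp add: G_def)
    show "integrable lborel (\<lambda>s. Q s * J s)" "(LINT p|lborel. G p) = (LINT s|lborel. Q s * J s)"
      using integral_prod_snd[OF shear_integral(1)[OF Gi, of "1 / lam"]] shear_integral(2)[OF Gi, of "1 / lam"]
      unfolding inner by simp_all
  qed
  \<comment> \<open>The characteristic with parameter s lies in the rectangle for x between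
    \<open>max 0 (- lam * s)\<close>, where it enters, and \<open>min L (lam * (T - s))\<close>,
    where it leaves.\<close>
  have J: "J s = (if max 0 (- lam * s) < min L (lam * (T - s)) then - lam * \<phi> (max 0 (- lam * s), s + max 0 (- lam * s) / lam) else 0)" for s
  proof -
    define a where "a = max 0 (- lam * s)"
    define b where "b = min L (lam * (T - s))"
    have mem: "(x, s + x / lam) \<in> ?R \<longleftrightarrow> x \<in> {a<..<b}" for x
      using lam by (auto simp: a_def b_def field_simps)
    have ind: "indicator ?R (x, s + x / lam) = (indicator {a<..<b} x :: real)" for x
      unfolding indicator_def mem ..
    have J': "J s = (LINT x:{a<..<b}|lborel. \<Phi> (x, s + x / lam))"
      unfolding J_def set_lebesgue_integral_def ind real_scaleR_def ..
    show ?thesis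
    proof (cases "a < b")
      case False
      then show ?thesis unfolding J' a_def[symmetric] b_def[symmetric] by (simp add: set_lebesgue_integral_def)
    next
      case ab: True
      \<comment> \<open>The exit point lies outside \<open>?S\<close>, where \<phi> is arbitrary, so
        its value is replaced by 0. This is continuous because a neighbourhood of the exit point
        avoids the compact support.\<close>
      define \<psi> where "\<psi> x = (if x < b then \<phi> (x, s + x / lam) else 0)" for x
      define cv where "cv x = (x, s + x / lam)" for x
      have cvc: "continuous_on X cv" for X unfolding cv_def[abs_def] using lam by (intro continuous_intros) auto
      have memS: "cv x \<in> ?S" if "a \<le> x" "x < b" for x
        using that lam unfolding cv_def by (auto simp: a_def b_def field_simps)
      have memR: "cv x \<in> ?R" if "x \<in> {a<..<b}" for x
        unfolding cv_def mem by (rule that)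
      have nb: "cv b \<notin> C"
      proof
        assume "cv b \<in> C"
        then have "cv b \<in> ?S" using C(2) by blast
        then show False using lam unfolding cv_def by (auto simp: b_def min_def field_simps split: if_splits)
      qed
      have "\<forall>\<^sub>F x in at b within {a..b}. \<psi> x = 0"
      proof -
        have "(cv \<longlongrightarrow> cv b) (at b within {a..b})" using cvc[of "{a..b}"] ab unfolding continuous_on_def by auto
        then have "\<forall>\<^sub>F x in at b within {a..b}. cv x \<in> - C"
          by (rule topological_tendstoD) (use nb C(1) compact_imp_closed in auto)
        moreover have "\<forall>\<^sub>F x in at b within {a..b}. x \<in> {a..b}" by (simp add: eventually_at_filter)
        ultimately show ?thesis
        proof eventually_elim
          case (elim x)
          show ?case
          proof (cases "x < b")
            case True
            then have "cv x \<in> ?S - C" using memS[of x] elim by auto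
            then show ?thesis using C(3) True by (auto simp: \<psi>_def cv_def)
          qed (simp add: \<psi>_def)
        qed
      qed
      then have limb: "(\<psi> \<longlongrightarrow> \<psi> b) (at b within {a..b})" by (simp add: \<psi>_def tendsto_eventually)
      have \<psi>c: "continuous_on {a..b} \<psi>"
        unfolding continuous_on_def
      proof
        fix x assume x: "x \<in> {a..b}"
        show "(\<psi> \<longlongrightarrow> \<psi> x) (at x within {a..b})"
        proof (cases "x < b")
          case True
          have "continuous_on ?S \<phi>"
            unfolding continuous_on_eq_continuous_within using \<phi>d has_derivative_continuous by blast
          then have "continuous_on {a..<b} (\<lambda>x. \<phi> (cv x))"
            by (rule continuous_on_compose2[OF _ cvc]) (rule image_subsetI, rule memS, simp_all)
          then have "continuous_on {a..<b} \<psi>" by (rule continuous_on_eq) (simp add: \<psi>_def cv_def)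
          then have "(\<psi> \<longlongrightarrow> \<psi> x) (at x within {a..<b})" using x True unfolding continuous_on_def by auto
          moreover have "at x within {a..b} = at x within {a..<b}"
            by (rule at_within_nhd[of x "{..<b}"]) (use True in auto)
          ultimately show ?thesis by simp
        next
          case False
          then have "x = b" using x by auto
          then show ?thesis using limb by simp
        qed
      qed
      have \<psi>d: "(\<psi> has_vector_derivative \<Phi> (cv x) / lam) (at x)" if x: "x \<in> {a<..<b}" for x
      proof -
        have cvR: "cv x \<in> ?R" by (rule memR[OF x])
        have "cv x \<in> interior ?S" by (rule subsetD[OF interior_maximal[OF RS Ro] cvR])
        then have eq: "at (cv x) within ?S = at (cv x)" by (rule at_within_interior)
        have "(\<phi> has_derivative D (cv x)) (at (cv x))"
          using \<phi>d[OF subsetD[OF RS cvR]] unfolding eq .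
        moreover have "(cv has_derivative (\<lambda>h. (h, h / lam))) (at x)"
          unfolding cv_def[abs_def] using lam by (auto intro!: derivative_eq_intros)
        ultimately have "((\<lambda>x. \<phi> (cv x)) has_derivative (\<lambda>h. D (cv x) (h, h / lam))) (at x)"
          using has_derivative_compose[of cv "\<lambda>h. (h, h / lam)" x UNIV \<phi> "D (cv x)"] by simp
        moreover have "D (cv x) (h, h / lam) = h *\<^sub>R (\<Phi> (cv x) / lam)" for h
        proof -
          have lin: "linear (D (cv x))" using \<open>(\<phi> has_derivative D (cv x)) (at (cv x))\<close> has_derivative_linear by blast
          have "D (cv x) (h, h / lam) = D (cv x) (h *\<^sub>R (1, 0) + (h / lam) *\<^sub>R (0, 1))" by simp
          also have "\<dots> = h *\<^sub>R D (cv x) (1, 0) + (h / lam) *\<^sub>R D (cv x) (0, 1)"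
            unfolding linear_add[OF lin] linear_scale[OF lin] ..
          also have "\<dots> = h *\<^sub>R (\<Phi> (cv x) / lam)" using lam unfolding \<Phi>_def by (simp add: field_simps)
          finally show ?thesis .
        qed
        ultimately have "((\<lambda>x. \<phi> (cv x)) has_vector_derivative \<Phi> (cv x) / lam) (at x)"
          unfolding has_vector_derivative_def by simp
        then show ?thesis
          by (rule has_vector_derivative_transform_within_open[where S = "{..<b}"]) (use x in \<open>auto simp: \<psi>_def cv_def\<close>)
      qed
      have hi: "((\<lambda>x. \<Phi> (cv x) / lam) has_integral \<psi> b - \<psi> a) {a..b}"
        by (rule fundamental_theorem_of_calculus_interior[OF less_imp_le[OF ab] \<psi>c \<psi>d])
      have si: "set_integrable lborel {a<..<b} (\<lambda>x. \<Phi> (cv x) / lam)"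
        unfolding set_integrable_def
      proof (rule integrable_bounded_support[where A = "{a<..<b}" and M = "(M1 + lam * M2) / lam"])
        have "continuous_on {a<..<b} (\<lambda>x. \<Phi> (cv x) / lam)"
        proof (intro continuous_on_divide continuous_on_const)
          show "continuous_on {a<..<b} (\<lambda>x. \<Phi> (cv x))"
            by (rule continuous_on_compose2[OF \<Phi>c cvc]) (rule image_subsetI, rule memR)
        qed (use lam in simp)
        then show "(\<lambda>x. indicator {a<..<b} x *\<^sub>R (\<Phi> (cv x) / lam)) \<in> borel_measurable borel"
          by (intro borel_measurable_continuous_on_indicator) auto
        have MM: "0 \<le> (M1 + lam * M2) / lam"
        proof -
          have "cv ((a + b) / 2) \<in> ?R" using ab by (intro memR) simp
          from order_trans[OF abs_ge_zero \<Phi>b[OF this]] show ?thesis using lam by simp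
        qed
        show "\<bar>indicator {a<..<b} x *\<^sub>R (\<Phi> (cv x) / lam)\<bar> \<le> (M1 + lam * M2) / lam" for x
        proof (cases "x \<in> {a<..<b}")
          case True
          then have "\<bar>\<Phi> (cv x)\<bar> \<le> M1 + lam * M2" using \<Phi>b[OF memR] by simp
          then show ?thesis using True lam by (simp add: divide_right_mono)
        qed (use MM in simp)
      qed auto
      have "(LINT x:{a<..<b}|lborel. \<Phi> (cv x) / lam) = integral {a<..<b} (\<lambda>x. \<Phi> (cv x) / lam)"
        by (rule set_borel_integral_eq_integral(2)[OF si])
      also have "\<dots> = \<psi> b - \<psi> a" using integral_unique[OF hi] by (simp add: integral_open_interval_real)
      finally have "(LINT x:{a<..<b}|lborel. \<Phi> (cv x) / lam) = - \<phi> (cv a)" using ab by (simp add: \<psi>_def cv_def)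
      then have "(LINT x:{a<..<b}|lborel. \<Phi> (cv x)) = - lam * \<phi> (cv a)" using lam by (simp add: field_simps)
      then show ?thesis using ab unfolding J' a_def[symmetric] b_def[symmetric] cv_def by simp
    qed
  qed
  have Jpos: "J s = (if s < T then - lam * \<phi> (0, s) else 0)" if "s > 0" for s
    unfolding J using that lam L by (auto simp: max_def mult_le_0_iff not_le zero_less_mult_iff)
  have Jneg: "J s = (if - lam * s < L then - lam * \<phi> (- lam * s, 0) else 0)" if "s < 0" for s
  proof -
    have "max 0 (- lam * s) = - lam * s" using that lam by (simp add: max_def mult_nonneg_nonpos not_le)
    moreover have "- lam * s < lam * (T - s)" using lam T by (simp add: right_diff_distrib)
    moreover have "s + - lam * s / lam = 0" using lam by simp
    ultimately show ?thesis unfolding J by simp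
  qed
  have split: "(LINT s|lborel. Q s * J s) = (LINT s:{0<..}|lborel. Q s * J s) + (LINT s:{..<0}|lborel. Q s * J s)"
  proof -
    have i: "set_integrable lborel A (\<lambda>s. Q s * J s)" if "A \<in> sets borel" for A
      unfolding set_integrable_def using integrable_mult_indicator[OF _ int2, of A] that by simp
    have "(LINT s|lborel. Q s * J s) = (LINT s:({0<..} \<union> {..<0})|lborel. Q s * J s)"
      unfolding set_lebesgue_integral_def
    proof (rule integral_cong_AE)
      show "AE s in lborel. Q s * J s = indicator ({0<..} \<union> {..<0}) s *\<^sub>R (Q s * J s)"
        using AE_lborel_singleton[of 0] by eventually_elim (auto simp: indicator_def)
      show "(\<lambda>s. indicator ({0<..} \<union> {..<0}) s *\<^sub>R (Q s * J s)) \<in> borel_measurable lborel"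
        using i[of "{0<..} \<union> {..<0}"] unfolding set_integrable_def by (intro borel_measurable_integrable) simp
    qed (use int2 in simp)
    also have "\<dots> = (LINT s:{0<..}|lborel. Q s * J s) + (LINT s:{..<0}|lborel. Q s * J s)"
      by (rule set_integral_Un) (auto intro: i)
    finally show ?thesis .
  qed
  have "(LINT s:{0<..}|lborel. Q s * J s) = (LINT s|lborel. - lam * (indicator {0<..<T} s * (\<phi> (0, s) * Q s)))"
    unfolding set_lebesgue_integral_def
    by (rule Bochner_Integration.integral_cong) (auto simp: indicator_def Jpos)
  also have "\<dots> = - lam * (LINT t:{0<..<T}|lborel. \<phi> (0, t) * Q t)" by (simp add: set_lebesgue_integral_def)
  finally have e1: "(LINT s:{0<..}|lborel. Q s * J s) = - lam * (LINT t:{0<..<T}|lborel. \<phi> (0, t) * Q t)" .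
  \<comment> \<open>The substitution x = - \<open>lam\<close> s turns the part with s < 0 into an
    integral over the initial line, with Jacobian \<open>lam\<close>.\<close>
  have "(LINT x:{0<..<L}|lborel. Q (- x / lam) * \<phi> (x, 0))
      = \<bar>- lam\<bar> * (LINT s|lborel. indicator {0<..<L} (0 + - lam * s) * (Q (- (0 + - lam * s) / lam) * \<phi> (0 + - lam * s, 0)))"
    unfolding set_lebesgue_integral_def real_scaleR_def
    by (subst lborel_integral_real_affine[of "- lam" _ 0]) (use lam in simp_all)
  also have "\<dots> = (LINT s|lborel. \<bar>- lam\<bar> * (indicator {0<..<L} (0 + - lam * s) * (Q (- (0 + - lam * s) / lam) * \<phi> (0 + - lam * s, 0))))"
    by simp
  also have "\<dots> = (LINT s:{..<0}|lborel. - (Q s * J s))"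
    unfolding set_lebesgue_integral_def
  proof (rule Bochner_Integration.integral_cong[OF refl])
    fix s
    show "\<bar>- lam\<bar> * (indicator {0<..<L} (0 + - lam * s) * (Q (- (0 + - lam * s) / lam) * \<phi> (0 + - lam * s, 0))) = indicator {..<0} s *\<^sub>R - (Q s * J s)"
    proof (cases "s < 0")
      case True
      have e: "- (0 + - lam * s) / lam = s" using lam by simp
      have ind: "indicator {0<..<L} (0 + - lam * s) = (if - lam * s < L then 1 else 0 :: real)"
        using True lam by (auto simp: indicator_def mult_pos_neg)
      show ?thesis unfolding e ind using True lam by (simp add: Jneg)
    next
      case False
      then have "indicator {0<..<L} (0 + - lam * s) = (0 :: real)" using lam by (auto simp: indicator_def mult_less_0_iff)
      then show ?thesis using False by simp
    qed
  qed
  also have "\<dots> = - (LINT s:{..<0}|lborel. Q s * J s)" by (simp add: set_lebesgue_integral_def)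
  finally have e2: "(LINT x:{0<..<L}|lborel. Q (- x / lam) * \<phi> (x, 0)) = - (LINT s:{..<0}|lborel. Q s * J s)" .
  have "(LINT z:?R|lborel. Q (snd z - fst z / lam) * (D z (0, 1) + lam * D z (1, 0))) = (LINT p|lborel. G p)"
    unfolding set_lebesgue_integral_def G_def \<Phi>_def by (rule Bochner_Integration.integral_cong) simp_all
  then show ?thesis using int1 split e1 e2 by linarith
qed

section \<open>Uniqueness of weak solutions of the transport equation\<close>

text \<open>Testing with \<open>\<alpha>(t - x/lam) \<beta>(x)\<close>, which vanishes for \<open>x \<ge> x2\<close> or \<open>t - x/lam \<ge> s2\<close>, where \<open>\<alpha>\<close> and \<open>\<beta>'\<close>
  approximate indicator functions.\<close>

lemma transport_null_rectangle:
  fixes d :: "real \<times> real \<Rightarrow> real"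
  assumes lam: "lam > 0" and L: "L > 0" and T: "T > 0"
    and d: "L1 ({0<..<L} \<times> {0<..<T}) d"
    and test: "\<And>\<phi> D. C1_compact_support ({0..<L} \<times> {0..<T}) \<phi> D \<Longrightarrow>
        (LINT z:({0<..<L} \<times> {0<..<T})|lborel. d z * (D z (0, 1) + lam * D z (1, 0))) = 0"
    and x2: "x2 < L" and s2: "s2 + x2 / lam < T"
  shows "(LINT p|lborel. indicator ({0<..<L} \<times> {0<..<T}) p * d p *
      (indicator {x1<..<x2} (fst p) * indicator {s1<..<s2} (snd p - fst p / lam))) = 0"
proof -
  let ?S = "{0..<L} \<times> {0..<T}"
  let ?R = "{0<..<L} \<times> {0<..<T}"
  define G where "G p = indicator ?R p * d p" for p
  have Gi: "integrable lborel G" using d unfolding L1_def set_integrable_def G_def by simp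
  have zero: "(LINT p|lborel. G p * (bump n x1 x2 (fst p) * bump n s1 s2 (snd p - fst p / lam))) = 0" for n
  proof -
    define g where "g = bump n x1 x2"
    obtain \<alpha>1 where \<alpha>1: "\<And>x. (bump n s1 s2 has_real_derivative \<alpha>1 x) (at x)" "continuous_on UNIV \<alpha>1"
      using C2bE[OF C2b_bump[of n s1 s2]] by (metis DERIV_isCont continuous_at_imp_continuous_on)
    have gc: "continuous_on X g" for X unfolding g_def by (rule C2b_continuous[OF C2b_bump])
    \<comment> \<open>A primitive of the bump, normalised to vanish to the right of
      \<open>x2\<close>. The lower limit -1 puts x = 0 into the interior, so the derivative is
      two-sided at the inlet, where test functions need not vanish.\<close>
    define \<beta> where "\<beta> x = integral {-1..x} g - integral {-1..x2} g" for x
    have \<beta>d: "(\<beta> has_real_derivative g x) (at x)" if "x \<in> {0..<L}" for x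
    proof -
      have "((\<lambda>x. integral {-1..x} g) has_real_derivative g x) (at x within {-1..L + 1})"
        by (rule integral_has_real_derivative[OF gc]) (use that in auto)
      moreover have "at x within {-1..L + 1} = at x" by (rule at_within_interior) (use that in auto)
      ultimately have "((\<lambda>x. integral {-1..x} g) has_real_derivative g x) (at x)" by (simp only:)
      from DERIV_diff[OF this DERIV_const[of "integral {-1..x2} g"]] show ?thesis unfolding \<beta>_def[abs_def] by simp
    qed
    have \<beta>z: "\<beta> x = 0" if "x2 \<le> x" "0 \<le> x" for x
    proof (cases "x2 \<ge> -1")
      case True
      have "integral {-1..x2} g + integral {x2..x} g = integral {-1..x} g"
        by (rule Henstock_Kurzweil_Integration.integral_combine[OF True that(1)]) (rule integrable_continuous_interval[OF gc])
      moreover have "integral {x2..x} g = integral {x2..x} (\<lambda>_. 0)"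
        by (rule Henstock_Kurzweil_Integration.integral_cong) (simp add: g_def bump_zero)
      ultimately show ?thesis by (simp add: \<beta>_def)
    next
      case False
      have "integral {-1..x} g = integral {-1..x} (\<lambda>_. 0)"
        by (rule Henstock_Kurzweil_Integration.integral_cong) (use False in \<open>simp add: g_def bump_zero\<close>)
      then show ?thesis using False by (simp add: \<beta>_def)
    qed
    have \<beta>c: "continuous_on {0..<L} \<beta>" by (intro continuous_at_imp_continuous_on ballI DERIV_isCont[OF \<beta>d])
    define \<alpha> where "\<alpha> = bump n s1 s2"
    have \<alpha>d: "(\<alpha> has_real_derivative \<alpha>1 x) (at x)" for x unfolding \<alpha>_def by (rule \<alpha>1)
    have \<alpha>c: "continuous_on UNIV \<alpha>" by (intro continuous_at_imp_continuous_on ballI DERIV_isCont[OF \<alpha>d])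
    define \<phi> where "\<phi> z = \<alpha> (snd z - fst z / lam) * \<beta> (fst z)" for z
    define D where "D z h = \<alpha> (snd z - fst z / lam) * (fst h * g (fst z)) + (snd h - fst h / lam) * \<alpha>1 (snd z - fst z / lam) * \<beta> (fst z)" for z h :: "real \<times> real"
    have "C1_compact_support ?S \<phi> D"
      unfolding C1_compact_support_def
    proof (intro conjI ballI allI)
      fix z assume z: "z \<in> ?S"
      have 1: "((\<lambda>z. \<alpha> (snd z - fst z / lam)) has_derivative (\<lambda>h. (snd h - fst h / lam) * \<alpha>1 (snd z - fst z / lam))) (at z within ?S)"
        by (rule DERIV_compose_FDERIV[where f = \<alpha> and x = z, OF \<alpha>d]) (use lam in \<open>auto intro!: derivative_eq_intros\<close>)
      have 2: "((\<lambda>z. \<beta> (fst z)) has_derivative (\<lambda>h. fst h * g (fst z))) (at z within ?S)"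
      proof (rule DERIV_compose_FDERIV[where f = \<beta> and g = fst and g' = fst and x = z])
        show "(\<beta> has_real_derivative g (fst z)) (at (fst z))" by (rule \<beta>d) (use z in auto)
        show "(fst has_derivative fst) (at z within ?S)" by (rule has_derivative_fst[OF has_derivative_ident])
      qed
      show "(\<phi> has_derivative D z) (at z within ?S)"
        unfolding \<phi>_def[abs_def] D_def[abs_def] by (rule has_derivative_mult[OF 1 2])
    next
      fix v
      have c1: "continuous_on ?S (\<lambda>z. snd z - fst z / lam)" by (intro continuous_intros) (use lam in simp_all)
      have f: "continuous_on ?S (fst :: real \<times> real \<Rightarrow> real)" by (intro continuous_intros)
      have f2: "fst ` ?S \<subseteq> {0..<L}" by auto
      show "continuous_on ?S (\<lambda>z. D z v)"
        unfolding D_def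
        by (intro continuous_on_add continuous_on_mult continuous_on_const continuous_on_compose2[OF \<alpha>c c1]
            continuous_on_compose2[OF \<alpha>1(2) c1] continuous_on_compose2[OF gc[of UNIV] f] continuous_on_compose2[OF \<beta>c f f2]) auto
    next
      show "\<exists>C. compact C \<and> C \<subseteq> ?S \<and> (\<forall>z\<in>?S - C. \<phi> z = 0)"
      proof (intro exI[of _ "{0..x2} \<times> {0..max 0 (s2 + x2 / lam)}"] conjI ballI)
        show "compact ({0..x2} \<times> {0..max 0 (s2 + x2 / lam)})" by (intro compact_Times) auto
        show "{0..x2} \<times> {0..max 0 (s2 + x2 / lam)} \<subseteq> ?S" using x2 s2 T by auto
        fix z assume z: "z \<in> ?S - {0..x2} \<times> {0..max 0 (s2 + x2 / lam)}"
        show "\<phi> z = 0"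
        proof (cases "x2 \<le> fst z")
          case True
          then have "\<beta> (fst z) = 0" using z by (intro \<beta>z) auto
          then show ?thesis by (simp add: \<phi>_def)
        next
          case False
          then have "fst z / lam \<le> x2 / lam" using lam by (intro divide_right_mono) auto
          moreover have "snd z > s2 + x2 / lam" using z False by (cases z) auto
          ultimately have "\<alpha> (snd z - fst z / lam) = 0" unfolding \<alpha>_def by (intro bump_zero) auto
          then show ?thesis by (simp add: \<phi>_def)
        qed
      qed
    qed
    from test[OF this] have "(LINT z|lborel. indicator ?R z *\<^sub>R (d z * (D z (0, 1) + lam * D z (1, 0)))) = 0"
      unfolding set_lebesgue_integral_def .
    \<comment> \<open>The characteristic derivative sees only the second factor, since the first is
      constant along characteristics.\<close>
    moreover have "indicator ?R z *\<^sub>R (d z * (D z (0, 1) + lam * D z (1, 0))) = lam * (G z * (g (fst z) * \<alpha> (snd z - fst z / lam)))" for z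
      using lam by (simp add: D_def G_def field_simps)
    ultimately have "(LINT z|lborel. lam * (G z * (g (fst z) * \<alpha> (snd z - fst z / lam)))) = 0" by (simp only:)
    then show ?thesis using lam unfolding g_def \<alpha>_def by simp
  qed
  have bm: "(\<lambda>p :: real \<times> real. bump n x1 x2 (fst p) * bump n s1 s2 (snd p - fst p / lam)) \<in> borel_measurable lborel" for n
    using lam by (simp, intro borel_measurable_continuous_onI continuous_on_mult continuous_on_compose2[OF C2b_continuous[OF C2b_bump, of UNIV]] continuous_intros) auto
  have "(\<lambda>n. LINT p|lborel. G p * (bump n x1 x2 (fst p) * bump n s1 s2 (snd p - fst p / lam)))
    \<longlonglongrightarrow> (LINT p|lborel. G p * (indicator {x1<..<x2} (fst p) * indicator {s1<..<s2} (snd p - fst p / lam)))"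
  proof (rule integral_dominated_convergence[where w = "\<lambda>p. \<bar>G p\<bar>"])
    have Gm: "G \<in> borel_measurable lborel" by (rule borel_measurable_integrable[OF Gi])
    show "(\<lambda>p. G p * (bump n x1 x2 (fst p) * bump n s1 s2 (snd p - fst p / lam))) \<in> borel_measurable lborel" for n
      by (rule borel_measurable_times[OF Gm bm])
    have lim: "(\<lambda>n. G p * (bump n x1 x2 (fst p) * bump n s1 s2 (snd p - fst p / lam)))
        \<longlonglongrightarrow> G p * (indicator {x1<..<x2} (fst p) * indicator {s1<..<s2} (snd p - fst p / lam))" for p
      by (intro tendsto_mult tendsto_const bump_tendsto)
    then show "AE p in lborel. (\<lambda>n. G p * (bump n x1 x2 (fst p) * bump n s1 s2 (snd p - fst p / lam)))
        \<longlonglongrightarrow> G p * (indicator {x1<..<x2} (fst p) * indicator {s1<..<s2} (snd p - fst p / lam))" by (intro AE_I2)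
    show "(\<lambda>p. G p * (indicator {x1<..<x2} (fst p) * indicator {s1<..<s2} (snd p - fst p / lam))) \<in> borel_measurable lborel"
    proof (rule borel_measurable_LIMSEQ_real)
      show "(\<lambda>p. G p * (bump n x1 x2 (fst p) * bump n s1 s2 (snd p - fst p / lam))) \<in> borel_measurable lborel" for n
        by (rule borel_measurable_times[OF Gm bm])
    qed (rule lim)
    show "AE p in lborel. norm (G p * (bump n x1 x2 (fst p) * bump n s1 s2 (snd p - fst p / lam))) \<le> \<bar>G p\<bar>" for n
    proof (rule AE_I2)
      fix p :: "real \<times> real"
      have "\<bar>bump n x1 x2 (fst p)\<bar> * \<bar>bump n s1 s2 (snd p - fst p / lam)\<bar> \<le> 1"
        by (intro mult_le_one bump_abs_le abs_ge_zero)
      then show "norm (G p * (bump n x1 x2 (fst p) * bump n s1 s2 (snd p - fst p / lam))) \<le> \<bar>G p\<bar>"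
        unfolding real_norm_def abs_mult by (intro mult_left_le) auto
    qed
  qed (use Gi in simp)
  then have "(LINT p|lborel. G p * (indicator {x1<..<x2} (fst p) * indicator {s1<..<s2} (snd p - fst p / lam))) = 0"
    unfolding zero by (simp add: LIMSEQ_const_iff)
  then show ?thesis unfolding G_def .
qed

text \<open>Test functions need not vanish for x = 0 or t = 0, so this is uniqueness for zero
  initial and inflow data. After the shear, \<open>transport_null_rectangle\<close> says that the
  integrals over boxes left of and below an admissible corner vanish; countably many rational
  corners exhaust the sheared rectangle.\<close>

lemma transport_unique:
  fixes d :: "real \<times> real \<Rightarrow> real"
  assumes lam: "lam > 0" and L: "L > 0" and T: "T > 0"
    and d: "L1 ({0<..<L} \<times> {0<..<T}) d"
    and test: "\<And>\<phi> D. C1_compact_support ({0..<L} \<times> {0..<T}) \<phi> D \<Longrightarrow>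
        (LINT z:({0<..<L} \<times> {0<..<T})|lborel. d z * (D z (0, 1) + lam * D z (1, 0))) = 0"
  shows "AE z in lborel. z \<in> {0<..<L} \<times> {0<..<T} \<longrightarrow> d z = 0"
proof -
  let ?R = "{0<..<L} \<times> {0<..<T}"
  define G where "G p = indicator ?R p * d p" for p
  have Gi: "integrable lborel G" using d unfolding L1_def set_integrable_def G_def by simp
  define H where "H p = G (fst p, snd p + 1 / lam * fst p)" for p
  have Hi: "integrable lborel H" unfolding H_def[abs_def] by (rule shear_integral(1)[OF Gi])
  have corner: "AE p in lborel. p \<in> {..<x2} \<times> {..<s2} \<longrightarrow> H p = 0" if c: "x2 < L" "s2 + x2 / lam < T" for x2 s2
  proof -
    have o: "{..<x2} \<times> {..<s2} \<in> sets (borel :: (real \<times> real) measure)"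
      by (intro borel_open open_Times) auto
    have "AE p in lborel. indicator ({..<x2} \<times> {..<s2}) p * H p = 0"
    proof (rule AE_zero_if_box_integrals_zero)
      show "integrable lborel (\<lambda>p. indicator ({..<x2} \<times> {..<s2}) p * H p)"
        using integrable_mult_indicator[OF _ Hi, of "{..<x2} \<times> {..<s2}"] o by simp
      fix a b :: "real \<times> real"
      \<comment> \<open>Cutting the box at the corner \<open>(x2, s2)\<close> only lowers its upper
        right vertex, so the two constraints on the corner persist.\<close>
      define x2' where "x2' = min (fst b) x2"
      define s2' where "s2' = min (snd b) s2"
      define I where "I p = G p * (indicator {fst a<..<x2'} (fst p) * indicator {snd a<..<s2'} (snd p - fst p / lam))" for p
      have c': "x2' < L" "s2' + x2' / lam < T"
      proof -
        have "x2' / lam \<le> x2 / lam" using lam by (intro divide_right_mono) (auto simp: x2'_def)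
        then show "s2' + x2' / lam < T" using c unfolding s2'_def by linarith
        show "x2' < L" using c unfolding x2'_def by linarith
      qed
      have bx: "p \<in> box a b \<longleftrightarrow> fst a < fst p \<and> fst p < fst b \<and> snd a < snd p \<and> snd p < snd b" for p
        by (cases p; cases a; cases b) (auto simp: box_def Basis_prod_def inner_Pair)
      have Ii: "integrable lborel I"
      proof (rule Bochner_Integration.integrable_bound[OF Gi])
        have [measurable]: "G \<in> borel_measurable borel" using borel_measurable_integrable[OF Gi] by simp
        have [measurable]: "(fst :: real \<times> real \<Rightarrow> real) \<in> borel_measurable borel" "(\<lambda>p :: real \<times> real. snd p - fst p / lam) \<in> borel_measurable borel"
          using lam by (intro borel_measurable_continuous_onI continuous_intros; simp)+
        show "I \<in> borel_measurable lborel" unfolding I_def[abs_def] by measurable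
        show "AE p in lborel. norm (I p) \<le> norm (G p)" by (rule AE_I2) (simp add: I_def indicator_def)
      qed
      have "(LINT p:box a b|lborel. indicator ({..<x2} \<times> {..<s2}) p * H p) = (LINT p|lborel. I (fst p, snd p + 1 / lam * fst p))"
        unfolding set_lebesgue_integral_def
      proof (rule Bochner_Integration.integral_cong[OF refl])
        fix p :: "real \<times> real"
        show "indicator (box a b) p *\<^sub>R (indicator ({..<x2} \<times> {..<s2}) p * H p) = I (fst p, snd p + 1 / lam * fst p)"
          unfolding I_def H_def by (cases p) (auto simp: indicator_def bx x2'_def s2'_def)
      qed
      also have "\<dots> = (LINT p|lborel. I p)" by (rule shear_integral(2)[OF Ii])
      also have "\<dots> = 0" unfolding I_def G_def by (rule transport_null_rectangle[OF lam L T d test c'])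
      finally show "(LINT p:box a b|lborel. indicator ({..<x2} \<times> {..<s2}) p * H p) = 0" .
    qed
    then show ?thesis by eventually_elim (auto simp: indicator_def)
  qed
  have "AE p in lborel. \<forall>(x2, s2)\<in>(\<rat> \<times> \<rat>) \<inter> {(x2, s2). x2 < L \<and> s2 + x2 / lam < T}. p \<in> {..<x2} \<times> {..<s2} \<longrightarrow> H p = 0"
  proof (rule AE_ball_countable[THEN iffD2])
    show "countable ((\<rat> \<times> \<rat>) \<inter> {(x2, s2 :: real). x2 < L \<and> s2 + x2 / lam < T})"
      by (intro countable_Int1 countable_SIGMA countable_rat)
  qed (auto intro: corner)
  then have AH: "AE p in lborel. H p = 0"
  proof eventually_elim
    case (elim p)
    show ?case
    proof (rule ccontr)
      assume nz: "H p \<noteq> 0"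
      obtain x s where p: "p = (x, s)" by (cases p)
      have xs: "0 < x" "x < L" "s + x / lam < T"
        using nz unfolding H_def G_def p by (auto simp: indicator_def split: if_splits)
      define \<delta> where "\<delta> = T - (s + x / lam)"
      have \<delta>: "\<delta> > 0" using xs by (simp add: \<delta>_def)
      \<comment> \<open>The distance \<open>\<delta>\<close> to the final time is split into halves:
        one for the rational \<open>x2\<close>, measured in travel time, and one for
        \<open>s2\<close>.\<close>
      have "x < min L (x + lam * \<delta> / 2)" using xs \<delta> lam by simp
      then obtain x2 where x2: "x2 \<in> \<rat>" "x < x2" "x2 < min L (x + lam * \<delta> / 2)" using Rats_dense_in_real by blast
      obtain s2 where s2: "s2 \<in> \<rat>" "s < s2" "s2 < s + \<delta> / 2" using Rats_dense_in_real[of s "s + \<delta> / 2"] \<delta> by auto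
      have "x2 / lam < (x + lam * \<delta> / 2) / lam" using x2 lam by (intro divide_strict_right_mono) auto
      also have "\<dots> = x / lam + \<delta> / 2" using lam by (simp add: add_divide_distrib)
      finally have lt: "x2 / lam < x / lam + \<delta> / 2" .
      have "s2 + A < T" if "A < B + \<delta> / 2" "\<delta> = T - (s + B)" for A B using that s2(3) by linarith
      from this[OF lt \<delta>_def] have "s2 + x2 / lam < T" .
      then have "(x2, s2) \<in> (\<rat> \<times> \<rat>) \<inter> {(x2, s2). x2 < L \<and> s2 + x2 / lam < T}" using x2 s2 by simp
      from bspec[OF elim this] nz show False using x2 s2 by (simp add: p)
    qed
  qed
  have "AE p in lborel. G p = 0"
  proof (rule shear_AE[where c = "1 / lam"])
    show "AE p in lborel. G (fst p, snd p + 1 / lam * fst p) = 0" using AH unfolding H_def .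
    have "G \<in> borel_measurable borel" using borel_measurable_integrable[OF Gi] by simp
    then have "G -` {0} \<inter> space borel \<in> sets borel" by (rule measurable_sets) simp
    then show "{p. G p = 0} \<in> sets borel" by (simp add: vimage_def)
  qed
  then show ?thesis by eventually_elim (auto simp: G_def)
qed

subsection \<open>Differences of bounded monotone functions\<close>

text \<open>Functions of bounded variation on the line in pointwise form. The class is closed under
  the operations that build the solution: affine change of variable, linear combination, and cut-off
  at a point.\<close>

definition bounded_mono_diff :: "(real \<Rightarrow> real) \<Rightarrow> bool" where
  "bounded_mono_diff Q \<longleftrightarrow> (\<exists>M1 M2 C. mono M1 \<and> mono M2 \<and> (\<forall>x. \<bar>M1 x\<bar> \<le> C \<and> \<bar>M2 x\<bar> \<le> C) \<and> (\<forall>x. Q x = M1 x - M2 x))"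

lemma bounded_mono_diffE:
  assumes "bounded_mono_diff Q"
  obtains M1 M2 C where "mono M1" "mono M2" "\<And>x. \<bar>M1 x\<bar> \<le> C" "\<And>x. \<bar>M2 x\<bar> \<le> C" "\<And>x. Q x = M1 x - M2 x"
proof -
  from assms obtain M1 M2 C where *: "mono M1" "mono M2" "\<forall>x. \<bar>M1 x\<bar> \<le> C \<and> \<bar>M2 x\<bar> \<le> C" "\<forall>x. Q x = M1 x - M2 x"
    unfolding bounded_mono_diff_def by blast
  show ?thesis by (rule that[OF *(1,2)]) (use * in auto)
qed

lemma bounded_mono_diffI:
  assumes "mono M1" "mono M2" "\<And>x. \<bar>M1 x\<bar> \<le> C1" "\<And>x. \<bar>M2 x\<bar> \<le> C2" "\<And>x. Q x = M1 x - M2 x"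
  shows "bounded_mono_diff Q"
  unfolding bounded_mono_diff_def
proof (intro exI conjI allI)
  show "\<bar>M1 x\<bar> \<le> max C1 C2" "\<bar>M2 x\<bar> \<le> max C1 C2" for x using assms(3,4)[of x] by auto
qed (use assms in auto)

lemma bounded_mono_diff_const: "bounded_mono_diff (\<lambda>_. c)"
  by (rule bounded_mono_diffI[of "\<lambda>_. c" "\<lambda>_. 0" "\<bar>c\<bar>" 0]) (auto simp: mono_def)

lemma bounded_mono_diff_add:
  assumes "bounded_mono_diff P" "bounded_mono_diff Q" shows "bounded_mono_diff (\<lambda>x. P x + Q x)"
proof -
  obtain M1 M2 C where 1: "mono M1" "mono M2" "\<And>x. \<bar>M1 x\<bar> \<le> C" "\<And>x. \<bar>M2 x\<bar> \<le> C" "\<And>x. P x = M1 x - M2 x"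
    using bounded_mono_diffE[OF assms(1)] by metis
  obtain N1 N2 C' where 2: "mono N1" "mono N2" "\<And>x. \<bar>N1 x\<bar> \<le> C'" "\<And>x. \<bar>N2 x\<bar> \<le> C'" "\<And>x. Q x = N1 x - N2 x"
    using bounded_mono_diffE[OF assms(2)] by metis
  show ?thesis
  proof (rule bounded_mono_diffI[of "\<lambda>x. M1 x + N1 x" "\<lambda>x. M2 x + N2 x" "C + C'" "C + C'"])
    show "mono (\<lambda>x. M1 x + N1 x)" "mono (\<lambda>x. M2 x + N2 x)" using 1 2 by (auto simp: mono_def add_mono)
    show "\<bar>M1 x + N1 x\<bar> \<le> C + C'" for x using 1(3)[of x] 2(3)[of x] by linarith
    show "\<bar>M2 x + N2 x\<bar> \<le> C + C'" for x using 1(4)[of x] 2(4)[of x] by linarith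
  qed (use 1 2 in auto)
qed

lemma bounded_mono_diff_minus:
  assumes "bounded_mono_diff P" shows "bounded_mono_diff (\<lambda>x. - P x)"
proof -
  obtain M1 M2 C where 1: "mono M1" "mono M2" "\<And>x. \<bar>M1 x\<bar> \<le> C" "\<And>x. \<bar>M2 x\<bar> \<le> C" "\<And>x. P x = M1 x - M2 x"
    using bounded_mono_diffE[OF assms(1)] by metis
  show ?thesis by (rule bounded_mono_diffI[OF 1(2,1,4,3)]) (simp add: 1)
qed

lemma bounded_mono_diff_cmult:
  assumes "bounded_mono_diff P" shows "bounded_mono_diff (\<lambda>x. c * P x)"
proof -
  have pos: "bounded_mono_diff (\<lambda>x. c * P x)" if "c \<ge> 0" for c
  proof -
    obtain M1 M2 C where 1: "mono M1" "mono M2" "\<And>x. \<bar>M1 x\<bar> \<le> C" "\<And>x. \<bar>M2 x\<bar> \<le> C" "\<And>x. P x = M1 x - M2 x"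
      using bounded_mono_diffE[OF assms(1)] by metis
    show ?thesis
      by (rule bounded_mono_diffI[of "\<lambda>x. c * M1 x" "\<lambda>x. c * M2 x" "c * C" "c * C"])
        (use 1 that in \<open>auto simp: mono_def abs_mult right_diff_distrib intro!: mult_left_mono\<close>)
  qed
  show ?thesis using pos[of c] bounded_mono_diff_minus[OF pos[of "- c"]] by (cases "c \<ge> 0") auto
qed

lemma bounded_mono_diff_sum:
  "(\<And>i. i \<in> A \<Longrightarrow> bounded_mono_diff (f i)) \<Longrightarrow> bounded_mono_diff (\<lambda>x. \<Sum>i\<in>A. f i x)"
  by (induction A rule: infinite_finite_induct) (auto intro: bounded_mono_diff_const bounded_mono_diff_add)

lemma bounded_mono_diff_affine:
  assumes "bounded_mono_diff P" shows "bounded_mono_diff (\<lambda>x. P (a * x + b))"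
proof -
  obtain M1 M2 C where 1: "mono M1" "mono M2" "\<And>x. \<bar>M1 x\<bar> \<le> C" "\<And>x. \<bar>M2 x\<bar> \<le> C" "\<And>x. P x = M1 x - M2 x"
    using bounded_mono_diffE[OF assms(1)] by metis
  show ?thesis
  proof (cases "a \<ge> 0")
    case True
    have "mono (\<lambda>x. M (a * x + b))" if "mono M" for M :: "real \<Rightarrow> real"
      by (intro monoI monoD[OF that] add_right_mono mult_left_mono True)
    then show ?thesis
      by (intro bounded_mono_diffI[of "\<lambda>x. M1 (a * x + b)" "\<lambda>x. M2 (a * x + b)" C C]) (use 1 in auto)
  next
    case False
    have "mono (\<lambda>x. - M (a * x + b))" if "mono M" for M :: "real \<Rightarrow> real"
      by (intro monoI le_imp_neg_le monoD[OF that] add_right_mono mult_left_mono_neg) (use False in auto)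
    then show ?thesis
      by (intro bounded_mono_diffI[of "\<lambda>x. - M2 (a * x + b)" "\<lambda>x. - M1 (a * x + b)" C C]) (use 1 in auto)
  qed
qed

text \<open>Adding the bound \<open>C\<close> first makes both monotone parts nonnegative, so
  cutting them to 0 on the left keeps them monotone; the shift cancels in the difference.\<close>

lemma bounded_mono_diff_indicator:
  assumes "bounded_mono_diff P" shows "bounded_mono_diff (\<lambda>x. P x * indicator {a<..} x)"
proof -
  obtain M1 M2 C where 1: "mono M1" "mono M2" "\<And>x. \<bar>M1 x\<bar> \<le> C" "\<And>x. \<bar>M2 x\<bar> \<le> C" "\<And>x. P x = M1 x - M2 x"
    using bounded_mono_diffE[OF assms(1)] by metis
  have m: "mono (\<lambda>x. (M x + C) * indicator {a<..} x)" if "mono M" "\<And>x. \<bar>M x\<bar> \<le> C" for M :: "real \<Rightarrow> real"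
  proof (rule monoI)
    fix x y :: real assume "x \<le> y"
    moreover have "M y + C \<ge> 0" using that(2)[of y] by linarith
    ultimately show "(M x + C) * indicator {a<..} x \<le> (M y + C) * indicator {a<..} y"
      using monoD[OF that(1), of x y] by (auto simp: indicator_def)
  qed
  have b: "\<bar>(M x + C) * indicator {a<..} x\<bar> \<le> 2 * C" if "\<And>x. \<bar>M x\<bar> \<le> C" for M :: "real \<Rightarrow> real" and x
    using that[of x] by (auto simp: indicator_def)
  show ?thesis
  proof (rule bounded_mono_diffI[OF m[OF 1(1,3)] m[OF 1(2,4)]])
    show "\<bar>(M1 x + C) * indicator {a<..} x\<bar> \<le> 2 * C" "\<bar>(M2 x + C) * indicator {a<..} x\<bar> \<le> 2 * C" for x
      by (rule b, rule 1)+
  qed (simp add: 1 algebra_simps)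
qed

lemma bounded_mono_diff_borel: "bounded_mono_diff P \<Longrightarrow> P \<in> borel_measurable borel"
proof (elim bounded_mono_diffE)
  fix M1 M2 C assume "mono M1" "mono M2" and eq: "\<And>x. P x = M1 x - M2 x"
  then have "(\<lambda>x. M1 x - M2 x) \<in> borel_measurable borel" by (intro borel_measurable_diff borel_measurable_mono)
  then show ?thesis using eq by presburger
qed

lemma bounded_mono_diff_bounded: "bounded_mono_diff P \<Longrightarrow> \<exists>C. \<forall>x. \<bar>P x\<bar> \<le> C"
proof (elim bounded_mono_diffE)
  fix M1 M2 C assume *: "\<And>x. \<bar>M1 x\<bar> \<le> C" "\<And>x. \<bar>M2 x\<bar> \<le> C" "\<And>x. P x = M1 x - M2 x"
  have "\<bar>P x\<bar> \<le> C + C" for x using *(1)[of x] *(2)[of x] unfolding *(3) by linarith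
  then show ?thesis by blast
qed

lemma bounded_mono_diff_isCont: "bounded_mono_diff P \<Longrightarrow> countable {x. \<not> isCont P x}"
proof (elim bounded_mono_diffE)
  fix M1 M2 C assume *: "mono M1" "mono M2" "\<And>x. P x = M1 x - M2 x"
  have "{x. \<not> isCont P x} \<subseteq> {x. \<not> isCont M1 x} \<union> {x. \<not> isCont M2 x}"
  proof -
    have "isCont P x" if "isCont M1 x" "isCont M2 x" for x
    proof -
      have "isCont (\<lambda>x. M1 x - M2 x) x" by (intro continuous_intros that)
      moreover have "P = (\<lambda>x. M1 x - M2 x)" using *(3) by (rule ext)
      ultimately show ?thesis by (simp only:)
    qed
    then show ?thesis by blast
  qed
  moreover have "countable ({x. \<not> isCont M1 x} \<union> {x. \<not> isCont M2 x})"
    by (intro countable_Un mono_ctble_discont *)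
  ultimately show ?thesis by (rule countable_subset)
qed

section \<open>Bounded variation and traces of transported profiles\<close>

lemma upper_set_integral_bound:
  fixes s s1 :: "real \<Rightarrow> real"
  assumes s: "\<And>x. (s has_real_derivative s1 x) (at x)" "continuous_on UNIV s1" "s L = 0" "\<And>x. \<bar>s x\<bar> \<le> 1"
    and A: "A \<in> sets borel" "\<And>x y. x \<in> A \<Longrightarrow> x \<le> y \<Longrightarrow> y \<in> A"
  shows "\<bar>LINT x|lborel. indicator {0<..<L} x * s1 x * indicator A x\<bar> \<le> 1"
proof (cases "A \<inter> {0<..<L} = {}")
  case True
  have "(LINT x|lborel. indicator {0<..<L} x * s1 x * indicator A x) = (LINT x|(lborel :: real measure). 0)"
    by (rule Bochner_Integration.integral_cong[OF refl]) (use True in \<open>auto simp: indicator_def\<close>)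
  then show ?thesis by simp
next
  case False
  let ?B = "A \<inter> {0<..<L}"
  \<comment> \<open>Within the interval an upward closed set is a half-line from c up to that one
    point, so the integral collapses to \<open>s L - s c\<close>.\<close>
  define c where "c = Inf ?B"
  have bdd: "bdd_below ?B" by (rule bdd_belowI[of _ 0]) auto
  have cle: "c \<le> x" if "x \<in> ?B" for x unfolding c_def using that bdd by (rule cInf_lower)
  have cL: "c \<le> L" using False cle by force
  have c0: "0 \<le> c" unfolding c_def by (rule cInf_greatest[OF False]) auto
  have up: "x \<in> A" if cx: "c < x" for x
  proof -
    obtain b where "b \<in> ?B" "b < x" using cInf_lessD[OF False cx[unfolded c_def]] by blast
    then show ?thesis using A(2)[of b x] by auto
  qed
  have s1c: "continuous_on X s1" for X using s(2) by (rule continuous_on_subset) simp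
  have i0: "set_integrable lborel {0<..<L} s1" by (rule continuous_imp_set_integrable[OF s1c])
  have ic: "set_integrable lborel {c<..<L} s1" by (rule continuous_imp_set_integrable[OF s1c])
  have "(LINT x|lborel. indicator {0<..<L} x * s1 x * indicator A x) = (LINT x:{c<..<L}|lborel. s1 x)"
    unfolding set_lebesgue_integral_def
  proof (rule integral_cong_AE)
    have "(\<lambda>x. indicator {0<..<L} x * s1 x) \<in> borel_measurable lborel"
      using i0 unfolding set_integrable_def by (intro borel_measurable_integrable) simp
    then show "(\<lambda>x. indicator {0<..<L} x * s1 x * indicator A x) \<in> borel_measurable lborel"
      by (rule borel_measurable_times) (use A(1) in simp)
    show "(\<lambda>x. indicator {c<..<L} x *\<^sub>R s1 x) \<in> borel_measurable lborel"
      using ic unfolding set_integrable_def by (rule borel_measurable_integrable)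
    show "AE x in lborel. indicator {0<..<L} x * s1 x * indicator A x = indicator {c<..<L} x *\<^sub>R s1 x"
      using AE_lborel_singleton[of c]
    proof eventually_elim
      case (elim x)
      show ?case
      proof (cases "x \<in> {c<..<L}")
        case True
        then have "x \<in> A" "x \<in> {0<..<L}" using up c0 by auto
        then show ?thesis using True by simp
      next
        case False
        then have "x \<notin> ?B" using cle[of x] elim by auto
        then show ?thesis using False by (auto simp: indicator_def)
      qed
    qed
  qed
  also have "\<dots> = s L - s c"
    by (rule set_integral_FTC[OF cL has_field_derivative_at_within[OF s(1)] s1c])
  finally show ?thesis using s(3) s(4)[of c] by simp
qed

text \<open>Layer-cake formula: a bounded monotone function is a superposition of indicator functions of half-lines.\<close>

lemma mono_test_bound:
  fixes s s1 M :: "real \<Rightarrow> real"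
  assumes s: "\<And>x. (s has_real_derivative s1 x) (at x)" "continuous_on UNIV s1" "s 0 = 0" "s L = 0" "\<And>x. \<bar>s x\<bar> \<le> 1"
    and M: "mono M" "\<And>x. \<bar>M x\<bar> \<le> C" and L: "0 \<le> L"
  shows "\<bar>LINT x:{0<..<L}|lborel. M x * s1 x\<bar> \<le> 2 * C"
proof -
  have C0: "0 \<le> C" using order_trans[OF abs_ge_zero M(2)] .
  have s1c: "continuous_on X s1" for X using s(2) by (rule continuous_on_subset) simp
  define S where "S x = indicator {0<..<L} x * s1 x" for x
  have Si: "integrable lborel S" using continuous_imp_set_integrable[OF s1c, of 0 L] unfolding S_def set_integrable_def by simp
  have [measurable]: "M \<in> borel_measurable borel" using borel_measurable_mono[OF M(1)] .
  have [measurable]: "S \<in> borel_measurable borel" using borel_measurable_integrable[OF Si] by simp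
  \<comment> \<open>Integrating over the levels r gives M x + C instead of M x; the constant C is
    harmless because s1 has integral 0. For fixed r the remaining integral runs over an upward
    closed set.\<close>
  define F where "F = (\<lambda>(x, r). S x * indicator {-C<..<C} r * (if r < M x then 1 else 0 :: real))"
  have Fm [measurable]: "F \<in> borel_measurable (lborel \<Otimes>\<^sub>M lborel)" unfolding F_def by measurable
  have F0i: "integrable (lborel \<Otimes>\<^sub>M lborel) (\<lambda>(x, r). S x * indicator {-C<..<C} r)"
  proof (rule lborel_pair.Fubini_integrable)
    have i: "integrable lborel (indicator {-C<..<C} :: real \<Rightarrow> real)"
      by (intro integrable_real_indicator emeasure_bounded_finite) auto
    show "integrable lborel (\<lambda>x. LINT y|lborel. norm (case (x, y) of (x, r) \<Rightarrow> S x * indicator {-C<..<C} r))"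
      using Si by (simp add: abs_mult)
    show "AE x in lborel. integrable lborel (\<lambda>y. case (x, y) of (x, r) \<Rightarrow> S x * indicator {-C<..<C} r)"
      using i by simp
  qed measurable
  have Fi: "integrable (lborel \<Otimes>\<^sub>M lborel) F"
    by (rule Bochner_Integration.integrable_bound[OF F0i Fm]) (auto simp: F_def)
  have in1: "(LINT r|lborel. F (x, r)) = S x * (M x + C)" for x
  proof -
    have "(LINT r|lborel. F (x, r)) = (LINT r|lborel. S x * indicator {-C<..<M x} r)"
      using M(2)[of x] by (intro Bochner_Integration.integral_cong) (auto simp: F_def indicator_def abs_le_iff)
    also have "\<dots> = S x * (M x + C)" using M(2)[of x] by (simp add: abs_le_iff)
    finally show ?thesis .
  qed
  have in2: "\<bar>LINT x|lborel. F (x, r)\<bar> \<le> indicator {-C<..<C} r" for r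
  proof -
    have "(LINT x|lborel. F (x, r)) = (LINT x|lborel. indicator {-C<..<C} r * (indicator {0<..<L} x * s1 x * indicator {x. r < M x} x))"
      by (intro Bochner_Integration.integral_cong) (auto simp: F_def S_def indicator_def)
    also have "\<dots> = indicator {-C<..<C} r * (LINT x|lborel. indicator {0<..<L} x * s1 x * indicator {x. r < M x} x)" by simp
    finally have eq: "(LINT x|lborel. F (x, r)) = indicator {-C<..<C} r * (LINT x|lborel. indicator {0<..<L} x * s1 x * indicator {x. r < M x} x)" .
    have "{x. r < M x} \<in> sets borel"
    proof -
      have "{x \<in> space borel. r < M x} \<in> sets borel" by measurable
      then show ?thesis by simp
    qed
    then have "\<bar>LINT x|lborel. indicator {0<..<L} x * s1 x * indicator {x. r < M x} x\<bar> \<le> 1"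
      by (rule upper_set_integral_bound[OF s(1,2,4,5)]) (use monoD[OF M(1)] in \<open>auto intro: less_le_trans\<close>)
    then show ?thesis unfolding eq by (auto simp: abs_mult indicator_def)
  qed
  have A: "integrable lborel (\<lambda>x. S x * (M x + C))" using lborel_pair.integrable_fst'[OF Fi] by (simp add: in1)
  have "(LINT x|lborel. S x * (M x + C)) = (LINT r|lborel. LINT x|lborel. F (x, r))"
    using lborel_pair.Fubini_integral[of "\<lambda>x y. F (x, y)"] Fi by (simp add: in1)
  also have "\<bar>\<dots>\<bar> \<le> (LINT r|lborel. indicator {-C<..<C} r)"
  proof (rule order.trans[OF integral_abs_bound integral_mono])
    show "integrable lborel (\<lambda>r. \<bar>LINT x|lborel. F (x, r)\<bar>)"
      using lborel_pair.integrable_snd[of "\<lambda>x y. F (x, y)"] Fi by simp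
    show "integrable lborel (indicator {-C<..<C} :: real \<Rightarrow> real)"
      by (intro integrable_real_indicator emeasure_bounded_finite) auto
  qed (rule in2)
  also have "\<dots> = 2 * C" using C0 by simp
  finally have 1: "\<bar>LINT x|lborel. S x * (M x + C)\<bar> \<le> 2 * C" .
  have "(LINT x:{0<..<L}|lborel. s1 x) = s L - s 0"
    by (rule set_integral_FTC[OF L has_field_derivative_at_within[OF s(1)] s1c])
  then have 2: "(LINT x|lborel. S x) = 0" using s by (simp add: S_def set_lebesgue_integral_def)
  have "(LINT x:{0<..<L}|lborel. M x * s1 x) = (LINT x|lborel. S x * (M x + C) - C * S x)"
    unfolding set_lebesgue_integral_def by (intro Bochner_Integration.integral_cong) (simp_all add: S_def algebra_simps)
  also have "\<dots> = (LINT x|lborel. S x * (M x + C)) - (LINT x|lborel. C * S x)"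
    by (rule Bochner_Integration.integral_diff[OF A integrable_mult_right[OF Si]])
  finally show ?thesis using 1 2 by simp
qed

text \<open>The constant is uniform in the slope a, the offset b and the length: every horizontal or
  vertical slice of Q(t - x/\<open>lam\<close>) has this form, so the slice bounds can be
  integrated.\<close>

lemma bounded_mono_diff_test_bound:
  assumes Q: "bounded_mono_diff Q"
  shows "\<exists>C. \<forall>L a b s s1. 0 \<le> L \<longrightarrow> (\<forall>x. (s has_real_derivative s1 x) (at x)) \<longrightarrow> continuous_on UNIV s1 \<longrightarrow> s 0 = 0 \<longrightarrow> s L = 0 \<longrightarrow>
    (\<forall>x. \<bar>s x\<bar> \<le> 1) \<longrightarrow> \<bar>LINT x:{0<..<L}|lborel. Q (a * x + b) * s1 x\<bar> \<le> C"
proof -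
  obtain M1 M2 C where M: "mono M1" "mono M2" "\<And>x. \<bar>M1 x\<bar> \<le> C" "\<And>x. \<bar>M2 x\<bar> \<le> C" "\<And>x. Q x = M1 x - M2 x"
    using bounded_mono_diffE[OF Q] by metis
  have "\<bar>LINT x:{0<..<L}|lborel. Q (a * x + b) * s1 x\<bar> \<le> 2 * C + 2 * C"
    if L: "0 \<le> L" and s: "\<forall>x. (s has_real_derivative s1 x) (at x)" "continuous_on UNIV s1" "s 0 = 0" "s L = 0" "\<forall>x. \<bar>s x\<bar> \<le> 1"
    for L a b :: real and s s1
  proof -
    have one: "\<bar>LINT x:{0<..<L}|lborel. M (a * x + b) * s1 x\<bar> \<le> 2 * C \<and> set_integrable lborel {0<..<L} (\<lambda>x. M (a * x + b) * s1 x)"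
      if M: "mono M" "\<And>x. \<bar>M x\<bar> \<le> C" for M
    proof
      show "\<bar>LINT x:{0<..<L}|lborel. M (a * x + b) * s1 x\<bar> \<le> 2 * C"
      proof (cases "a \<ge> 0")
        case True
        have "mono (\<lambda>x. M (a * x + b))" by (intro monoI monoD[OF M(1)] add_right_mono mult_left_mono True)
        from mono_test_bound[OF _ s(2,3,4) _ this M(2) L] s show ?thesis by simp
      next
        case False
        have "mono (\<lambda>x. - M (a * x + b))"
          by (intro monoI le_imp_neg_le monoD[OF M(1)] add_right_mono mult_left_mono_neg) (use False in auto)
        moreover have "\<bar>- M (a * x + b)\<bar> \<le> C" for x using M(2) by simp
        ultimately have "\<bar>LINT x:{0<..<L}|lborel. - M (a * x + b) * s1 x\<bar> \<le> 2 * C"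
          using mono_test_bound[OF _ s(2,3,4) _ _ _ L, of "\<lambda>x. - M (a * x + b)" C] s by simp
        moreover have "(LINT x:{0<..<L}|lborel. - M (a * x + b) * s1 x) = - (LINT x:{0<..<L}|lborel. M (a * x + b) * s1 x)"
          by (simp add: set_lebesgue_integral_def)
        ultimately show ?thesis by simp
      qed
      have [measurable]: "M \<in> borel_measurable borel" using borel_measurable_mono[OF M(1)] .
      have "set_integrable lborel {0<..<L} (\<lambda>x. M (a * x + b))"
        unfolding set_integrable_def
      proof (rule integrable_bounded_support[where A = "{0<..<L}" and M = C])
        have C0: "0 \<le> C" using order_trans[OF abs_ge_zero M(2)] .
        show "\<bar>indicator {0<..<L} x *\<^sub>R M (a * x + b)\<bar> \<le> C" for x using M(2)[of "a * x + b"] C0 by (simp add: indicator_def)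
        show "(\<lambda>x. indicator {0<..<L} x *\<^sub>R M (a * x + b)) \<in> borel_measurable borel" by measurable
      qed auto
      then show "set_integrable lborel {0<..<L} (\<lambda>x. M (a * x + b) * s1 x)"
        by (rule set_integrable_mult_continuous) (rule continuous_on_subset[OF s(2)], simp)
    qed
    have "(LINT x:{0<..<L}|lborel. Q (a * x + b) * s1 x)
        = (LINT x:{0<..<L}|lborel. M1 (a * x + b) * s1 x - M2 (a * x + b) * s1 x)"
      by (simp add: M(5) left_diff_distrib)
    also have "\<dots> = (LINT x:{0<..<L}|lborel. M1 (a * x + b) * s1 x) - (LINT x:{0<..<L}|lborel. M2 (a * x + b) * s1 x)"
      by (rule set_integral_diff(2)) (use one[OF M(1,3)] one[OF M(2,4)] in auto)
    finally show ?thesis using one[OF M(1,3)] one[OF M(2,4)] by linarith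
  qed
  then show ?thesis by blast
qed

text \<open>The support of the slice is the projection of the original support intersected with a
  closed line, hence compact; the left inverse \<open>\<pi>\<close> serves as the
  projection.\<close>

lemma C1_compact_support_slice:
  fixes \<phi> :: "'a::euclidean_space \<Rightarrow> 'b::euclidean_space" and \<iota> :: "real \<Rightarrow> 'a" and p :: "'b \<Rightarrow> real"
  assumes C1: "C1_compact_support R \<phi> D" and p: "bounded_linear p" and \<iota>: "\<And>x. (\<iota> has_derivative l) (at x)"
    and X: "\<And>x. \<iota> x \<in> R \<longleftrightarrow> x \<in> X" and \<pi>: "continuous_on UNIV \<pi>" "\<And>x. \<pi> (\<iota> x) = x" and cl: "closed (range \<iota>)"
  shows "C1_compact_support X (\<lambda>x. p (\<phi> (\<iota> x))) (\<lambda>x h. p (D (\<iota> x) (l h)))"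
  unfolding C1_compact_support_def
proof (intro conjI ballI allI)
  have im: "\<iota> ` X \<subseteq> R" using X by auto
  fix x assume x: "x \<in> X"
  have "(\<phi> has_derivative D (\<iota> x)) (at (\<iota> x) within R)" using C1 x X unfolding C1_compact_support_def by blast
  then have 1: "(\<phi> has_derivative D (\<iota> x)) (at (\<iota> x) within \<iota> ` X)" using im by (rule has_derivative_subset)
  have 2: "(\<iota> has_derivative l) (at x within X)" using \<iota> by (rule has_derivative_at_withinI)
  show "((\<lambda>x. p (\<phi> (\<iota> x))) has_derivative (\<lambda>h. p (D (\<iota> x) (l h)))) (at x within X)"
    by (rule bounded_linear.has_derivative[OF p has_derivative_in_compose[OF 2 1]])
next
  fix v
  have "continuous_on R (\<lambda>z. D z (l v))" using C1 unfolding C1_compact_support_def by blast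
  moreover have "continuous_on X \<iota>"
    by (intro continuous_at_imp_continuous_on ballI has_derivative_continuous[OF \<iota>])
  ultimately have "continuous_on X (\<lambda>x. D (\<iota> x) (l v))"
    by (rule continuous_on_compose2) (use X in auto)
  then show "continuous_on X (\<lambda>x. p (D (\<iota> x) (l v)))" by (rule bounded_linear.continuous_on[OF p])
next
  obtain C where C: "compact C" "C \<subseteq> R" "\<forall>z\<in>R - C. \<phi> z = 0" using C1 unfolding C1_compact_support_def by blast
  show "\<exists>C. compact C \<and> C \<subseteq> X \<and> (\<forall>x\<in>X - C. p (\<phi> (\<iota> x)) = 0)"
  proof (intro exI[of _ "\<pi> ` (C \<inter> range \<iota>)"] conjI ballI)
    show "compact (\<pi> ` (C \<inter> range \<iota>))"
      by (intro compact_continuous_image continuous_on_subset[OF \<pi>(1)] compact_Int_closed C cl) simp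
    show "\<pi> ` (C \<inter> range \<iota>) \<subseteq> X" using C(2) X \<pi>(2) by auto
    fix x assume x: "x \<in> X - \<pi> ` (C \<inter> range \<iota>)"
    then have "\<iota> x \<notin> C" using \<pi>(2)[of x] by (metis DiffD2 IntI image_eqI rangeI)
    then have "\<phi> (\<iota> x) = 0" using C(3) x X by blast
    then show "p (\<phi> (\<iota> x)) = 0" using linear_0[OF bounded_linear.linear[OF p]] by simp
  qed
qed

lemma characteristic_measurable:
  fixes Q :: "real \<Rightarrow> real"
  assumes "Q \<in> borel_measurable borel" "lam > 0"
  shows "(\<lambda>z :: real \<times> real. Q (snd z - fst z / lam)) \<in> borel_measurable borel"
proof -
  have "(\<lambda>z :: real \<times> real. snd z - fst z / lam) \<in> borel_measurable borel"
    using assms(2) by (intro borel_measurable_continuous_onI continuous_intros) simp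
  from measurable_compose[OF this assms(1)] show ?thesis .
qed

lemma rectangle_integrable:
  fixes f :: "real \<times> real \<Rightarrow> real"
  assumes f: "(\<lambda>z. indicator ({0<..<L} \<times> {0<..<T}) z * f z) \<in> borel_measurable borel"
    and b: "\<And>z. z \<in> {0<..<L} \<times> {0<..<T} \<Longrightarrow> \<bar>f z\<bar> \<le> M"
  shows "set_integrable lborel ({0<..<L} \<times> {0<..<T}) f"
  unfolding set_integrable_def
proof (rule integrable_bounded_support[where A = "{0<..<L} \<times> {0<..<T}" and M = "max M 0"])
  show "(\<lambda>z. indicator ({0<..<L} \<times> {0<..<T}) z *\<^sub>R f z) \<in> borel_measurable borel" using f by simp
  show "bounded ({0<..<L} \<times> {0<..<T})" by (intro bounded_Times) auto
  show "{0<..<L} \<times> {0<..<T} \<in> sets borel" by (intro borel_open open_Times) auto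
  show "\<bar>indicator ({0<..<L} \<times> {0<..<T}) x *\<^sub>R f x\<bar> \<le> max M 0" for x
    using b[of x] by (cases "x \<in> {0<..<L} \<times> {0<..<T}") auto
qed simp

text \<open>The divergence splits into two partial derivatives, and each is integrated first along
  its own axis, where one-dimensional variation bounds the slice. Fubini yields the total T C + L
  C.\<close>

lemma BV_characteristic:
  assumes Q: "bounded_mono_diff Q" and lam: "lam > 0" and L: "L > 0" and T: "T > 0"
  shows "BV ({0<..<L} \<times> {0<..<T}) (\<lambda>z. Q (snd z - fst z / lam))"
proof -
  let ?R = "{0<..<L} \<times> {0<..<T}"
  let ?U = "\<lambda>z :: real \<times> real. Q (snd z - fst z / lam)"
  have Ro: "open ?R" by (intro open_Times) auto
  obtain MQ where MQ: "\<And>x. \<bar>Q x\<bar> \<le> MQ" using bounded_mono_diff_bounded[OF Q] by blast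
  have Um: "?U \<in> borel_measurable borel" by (rule characteristic_measurable[OF bounded_mono_diff_borel[OF Q] lam])
  have Ui: "set_integrable lborel ?R ?U"
    by (rule rectangle_integrable[OF _ MQ]) (intro borel_measurable_times Um borel_measurable_indicator borel_open Ro)
  obtain C where C: "\<forall>L a b s s1. 0 \<le> L \<longrightarrow> (\<forall>x. (s has_real_derivative s1 x) (at x)) \<longrightarrow> continuous_on UNIV s1 \<longrightarrow> s 0 = 0 \<longrightarrow> s L = 0 \<longrightarrow>
    (\<forall>x. \<bar>s x\<bar> \<le> 1) \<longrightarrow> \<bar>LINT x:{0<..<L}|lborel. Q (a * x + b) * s1 x\<bar> \<le> C"
    using bounded_mono_diff_test_bound[OF Q] by blast
  have test: "\<bar>LINT x:{0<..<X}|lborel. Q (a * x + b) * D x 1\<bar> \<le> C"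
    if C1: "C1_compact_support {0<..<X} \<psi> D" and b1: "\<And>x. x \<in> {0<..<X} \<Longrightarrow> \<bar>\<psi> x\<bar> \<le> 1" and X: "X > 0" for X a b and \<psi> :: "real \<Rightarrow> real" and D
  proof -
    define s where "s x = (if x \<in> {0<..<X} then \<psi> x else 0)" for x
    define s1 where "s1 x = (if x \<in> {0<..<X} then D x 1 else 0)" for x
    have d: "(s has_real_derivative s1 x) (at x)" "continuous_on UNIV s1" for x
      using C1_compact_support_realD[OF C1] unfolding s_def[abs_def] s1_def[abs_def] by auto
    have "\<bar>LINT x:{0<..<X}|lborel. Q (a * x + b) * s1 x\<bar> \<le> C"
      using C[rule_format, of X s s1 a b] d b1 X by (simp add: s_def)
    also have "(LINT x:{0<..<X}|lborel. Q (a * x + b) * s1 x) = (LINT x:{0<..<X}|lborel. Q (a * x + b) * D x 1)"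
      by (rule set_lebesgue_integral_cong) (auto simp: s1_def)
    finally show ?thesis .
  qed
  have C0: "0 \<le> C" using C[rule_format, of 0 "\<lambda>_. 0" "\<lambda>_. 0"] by (simp add: set_lebesgue_integral_def)
  have main: "(LINT z:?R|lborel. ?U z * (\<Sum>b\<in>Basis. D z b \<bullet> b)) \<le> T * C + L * C"
    if C1: "C1_compact_support ?R \<phi> D" and b1: "\<forall>z\<in>?R. norm (\<phi> z) \<le> 1" for \<phi> :: "real \<times> real \<Rightarrow> real \<times> real" and D
  proof -
    have part: "set_integrable lborel ?R (\<lambda>z. ?U z * p (D z v))" if p: "bounded_linear (p :: real \<times> real \<Rightarrow> real)" for p v
    proof -
      obtain M where M: "\<forall>z\<in>?R. norm (D z v) \<le> M" using C1_compact_support_deriv_bounded[OF C1 Ro subset_refl] by blast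
      obtain Kp where Kp: "\<And>x. norm (p x) \<le> norm x * Kp" "Kp > 0" using bounded_linear.pos_bounded[OF p] by blast
      show ?thesis
      proof (rule rectangle_integrable)
        have "continuous_on ?R (\<lambda>z. D z v)" using C1 unfolding C1_compact_support_def by blast
        then have "continuous_on ?R (\<lambda>z. p (D z v))" by (rule bounded_linear.continuous_on[OF p])
        then have "(\<lambda>z. indicator ?R z *\<^sub>R p (D z v)) \<in> borel_measurable borel"
          by (intro borel_measurable_continuous_on_indicator borel_open Ro)
        from borel_measurable_times[OF Um this] show "(\<lambda>z. indicator ?R z * (?U z * p (D z v))) \<in> borel_measurable borel"
          by (simp add: mult.left_commute)
        fix z assume z: "z \<in> ?R"
        have "\<bar>p (D z v)\<bar> \<le> M * Kp"
          using order_trans[OF Kp(1)[of "D z v"] mult_right_mono[OF bspec[OF M z]]] Kp(2) by simp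
        then show "\<bar>?U z * p (D z v)\<bar> \<le> MQ * (M * Kp)"
          unfolding abs_mult by (intro mult_mono MQ order_trans[OF abs_ge_zero MQ]) auto
      qed
    qed
    have i1: "set_integrable lborel ?R (\<lambda>z. ?U z * fst (D z (1, 0)))" by (rule part[OF bounded_linear_fst])
    have i2: "set_integrable lborel ?R (\<lambda>z. ?U z * snd (D z (0, 1)))" by (rule part[OF bounded_linear_snd])
    have e1: "\<bar>LINT z:?R|lborel. ?U z * fst (D z (1, 0))\<bar> \<le> T * C"
    proof -
      define G where "G z = indicator ?R z * (?U z * fst (D z (1, 0)))" for z
      have Gi: "integrable lborel G" using i1 unfolding G_def set_integrable_def by simp
      have inner: "\<bar>LINT x|lborel. G (x, t)\<bar> \<le> C * indicator {0<..<T} t" for t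
      proof (cases "t \<in> {0<..<T}")
        case True
        have "C1_compact_support {0<..<L} (\<lambda>x. fst (\<phi> (x, t))) (\<lambda>x h. fst (D (x, t) (h, 0)))"
        proof (rule C1_compact_support_slice[OF C1 bounded_linear_fst, where \<pi> = fst])
          show "((\<lambda>x. (x, t)) has_derivative (\<lambda>h. (h, 0))) (at x)" for x by (auto intro!: derivative_eq_intros)
          have "range (\<lambda>x :: real. (x, t)) = UNIV \<times> {t}" by auto
          then show "closed (range (\<lambda>x :: real. (x, t)))" by (simp add: closed_Times)
        qed (use True in \<open>auto intro: continuous_intros\<close>)
        moreover have "\<bar>fst (\<phi> (x, t))\<bar> \<le> 1" if "x \<in> {0<..<L}" for x
        proof -
          have "norm (fst (\<phi> (x, t))) \<le> norm (\<phi> (x, t))"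
            using norm_fst_le[of "fst (\<phi> (x, t))" "snd (\<phi> (x, t))"] by simp
          also have "\<dots> \<le> 1" using b1 that True by simp
          finally show ?thesis by simp
        qed
        ultimately have "\<bar>LINT x:{0<..<L}|lborel. Q (- 1 / lam * x + t) * fst (D (x, t) (1, 0))\<bar> \<le> C"
          using L by (rule test)
        moreover have "(LINT x|lborel. G (x, t)) = (LINT x:{0<..<L}|lborel. Q (- 1 / lam * x + t) * fst (D (x, t) (1, 0)))"
          unfolding set_lebesgue_integral_def
          by (intro Bochner_Integration.integral_cong) (use True in \<open>auto simp: G_def indicator_def\<close>)
        ultimately show ?thesis using True by simp
      next
        case False
        then have "G (x, t) = 0" for x by (auto simp: G_def)
        then show ?thesis using C0 by simp
      qed
      have "(LINT z:?R|lborel. ?U z * fst (D z (1, 0))) = (LINT t|lborel. LINT x|lborel. G (x, t))"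
        unfolding integral_prod_snd(2)[OF Gi] by (simp add: G_def[abs_def] set_lebesgue_integral_def)
      also have "\<bar>\<dots>\<bar> \<le> (LINT t|lborel. C * indicator {0<..<T} t)"
      proof (rule order.trans[OF integral_abs_bound integral_mono])
        show "integrable lborel (\<lambda>t. \<bar>LINT x|lborel. G (x, t)\<bar>)" by (rule integrable_abs[OF integral_prod_snd(1)[OF Gi]])
        show "integrable lborel (\<lambda>t. C * indicator {0<..<T} t)"
          by (intro integrable_mult_right integrable_real_indicator emeasure_bounded_finite) auto
      qed (rule inner)
      also have "\<dots> = T * C" using T by simp
      finally show ?thesis .
    qed
    have e2: "\<bar>LINT z:?R|lborel. ?U z * snd (D z (0, 1))\<bar> \<le> L * C"
    proof -
      define G where "G z = indicator ?R z * (?U z * snd (D z (0, 1)))" for z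
      have Gi: "integrable lborel G" using i2 unfolding G_def set_integrable_def by simp
      have inner: "\<bar>LINT t|lborel. G (x, t)\<bar> \<le> C * indicator {0<..<L} x" for x
      proof (cases "x \<in> {0<..<L}")
        case True
        have "C1_compact_support {0<..<T} (\<lambda>t. snd (\<phi> (x, t))) (\<lambda>t h. snd (D (x, t) (0, h)))"
        proof (rule C1_compact_support_slice[OF C1 bounded_linear_snd, where \<pi> = snd])
          show "((\<lambda>t. (x, t)) has_derivative (\<lambda>h. (0, h))) (at t)" for t by (auto intro!: derivative_eq_intros)
          have "range (\<lambda>t :: real. (x, t)) = {x} \<times> UNIV" by auto
          then show "closed (range (\<lambda>t :: real. (x, t)))" by (simp add: closed_Times)
        qed (use True in \<open>auto intro: continuous_intros\<close>)
        moreover have "\<bar>snd (\<phi> (x, t))\<bar> \<le> 1" if "t \<in> {0<..<T}" for t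
        proof -
          have "norm (snd (\<phi> (x, t))) \<le> norm (\<phi> (x, t))"
            using norm_snd_le[of "snd (\<phi> (x, t))" "fst (\<phi> (x, t))"] by simp
          also have "\<dots> \<le> 1" using b1 that True by simp
          finally show ?thesis by simp
        qed
        ultimately have "\<bar>LINT t:{0<..<T}|lborel. Q (1 * t + - (x / lam)) * snd (D (x, t) (0, 1))\<bar> \<le> C"
          using T by (rule test)
        moreover have "(LINT t|lborel. G (x, t)) = (LINT t:{0<..<T}|lborel. Q (1 * t + - (x / lam)) * snd (D (x, t) (0, 1)))"
          unfolding set_lebesgue_integral_def
          by (intro Bochner_Integration.integral_cong) (use True in \<open>auto simp: G_def indicator_def\<close>)
        ultimately show ?thesis using True by simp
      next
        case False
        then have "G (x, t) = 0" for t by (auto simp: G_def)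
        then show ?thesis using C0 by simp
      qed
      have "(LINT z:?R|lborel. ?U z * snd (D z (0, 1))) = (LINT x|lborel. LINT t|lborel. G (x, t))"
        unfolding integral_prod_fst(2)[OF Gi] by (simp add: G_def[abs_def] set_lebesgue_integral_def)
      also have "\<bar>\<dots>\<bar> \<le> (LINT x|lborel. C * indicator {0<..<L} x)"
      proof (rule order.trans[OF integral_abs_bound integral_mono])
        show "integrable lborel (\<lambda>x. \<bar>LINT t|lborel. G (x, t)\<bar>)" by (rule integrable_abs[OF integral_prod_fst(1)[OF Gi]])
        show "integrable lborel (\<lambda>x. C * indicator {0<..<L} x)"
          by (intro integrable_mult_right integrable_real_indicator emeasure_bounded_finite) auto
      qed (rule inner)
      also have "\<dots> = L * C" using L by simp
      finally show ?thesis .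
    qed
    have B: "(Basis :: (real \<times> real) set) = {(1, 0), (0, 1)}" by (auto simp: Basis_prod_def)
    have dv: "(\<Sum>b\<in>Basis. D z b \<bullet> b) = fst (D z (1, 0)) + snd (D z (0, 1))" for z
      unfolding B by (simp add: inner_prod_def)
    have "(LINT z:?R|lborel. ?U z * (\<Sum>b\<in>Basis. D z b \<bullet> b)) = (LINT z:?R|lborel. ?U z * fst (D z (1, 0)) + ?U z * snd (D z (0, 1)))"
      unfolding dv distrib_left ..
    also have "\<dots> = (LINT z:?R|lborel. ?U z * fst (D z (1, 0))) + (LINT z:?R|lborel. ?U z * snd (D z (0, 1)))"
      by (rule set_integral_add(2)[OF i1 i2])
    finally show ?thesis using e1 e2 by linarith
  qed
  show ?thesis
    unfolding BV_def L1_def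
  proof (intro conjI Ui bdd_aboveI[of _ "T * C + L * C"])
    fix v assume "v \<in> {LINT z:?R|lborel. ?U z * (\<Sum>b\<in>Basis. D z b \<bullet> b) | (\<phi> :: real \<times> real \<Rightarrow> real \<times> real) D.
       C1_compact_support ?R \<phi> D \<and> (\<forall>z\<in>?R. norm (\<phi> z) \<le> 1)}"
    then show "v \<le> T * C + L * C" using main by blast
  qed
qed

text \<open>Continuity of Q at the parameter of the characteristic through (L, t) is the condition
  that singles out good boundary points; for differences of monotone functions it fails at countably
  many times.\<close>

lemma bdry_trace_characteristic:
  fixes Q :: "real \<Rightarrow> real"
  assumes Q: "Q \<in> borel_measurable borel" "isCont Q (t - L / lam)" and lam: "lam > 0" and L: "L > 0" and t: "0 < t" "t < T"
  shows "bdry_trace ({0<..<L} \<times> {0<..<T}) (\<lambda>z. Q (snd z - fst z / lam)) (L, t) = Q (t - L / lam)"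
proof (rule bdry_trace_eqI[where \<kappa> = "1 / 2"])
  let ?R = "{0<..<L} \<times> {0<..<T}"
  show Rb: "?R \<in> sets borel" by (intro borel_open open_Times) auto
  show "set_borel_measurable lborel ?R (\<lambda>z. Q (snd z - fst z / lam))"
    unfolding set_borel_measurable_def using characteristic_measurable[OF Q(1) lam] Rb by simp
  have "isCont (\<lambda>z :: real \<times> real. Q (snd z - fst z / lam)) (L, t)"
  proof (rule isCont_o2[where g = Q])
    show "isCont (\<lambda>z :: real \<times> real. snd z - fst z / lam) (L, t)" using lam by (intro continuous_intros) auto
  qed (use Q(2) in simp)
  then have "((\<lambda>z :: real \<times> real. Q (snd z - fst z / lam)) \<longlongrightarrow> Q (t - L / lam)) (at (L, t))" by (simp add: isCont_def)
  then show "((\<lambda>z :: real \<times> real. Q (snd z - fst z / lam)) \<longlongrightarrow> Q (t - L / lam)) (at (L, t) within ?R)"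
    by (rule tendsto_within_subset) simp
  define r0 where "r0 = min L (min t (T - t))"
  have r0: "r0 > 0" using L t by (simp add: r0_def)
  show "\<forall>\<^sub>F r in at_right 0. 1 / 2 * r ^ DIM(real \<times> real) \<le> measure lborel (ball (L, t) r \<inter> ?R)"
  proof (rule eventually_at_rightI[OF _ r0])
    fix r assume r: "r \<in> {0<..<r0}"
    \<comment> \<open>A rectangle of area r^2 / 2 inside the half ball, which explains the density
      1/2; the sum of the coordinate distances is below r.\<close>
    let ?A = "{L - r / 2<..<L} \<times> {t - r / 2<..<t + r / 2}"
    have sub: "?A \<subseteq> ball (L, t) r \<inter> ?R"
    proof
      fix z assume z: "z \<in> ?A"
      obtain x s where xs: "z = (x, s)" by (cases z)
      have "dist (L, t) (x, s) \<le> dist L x + dist t s"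
        unfolding dist_Pair_Pair by (intro sqrt_sum_squares_le_sum) auto
      also have "\<dots> < r" using z r unfolding xs by (auto simp: dist_real_def abs_if)
      finally show "z \<in> ball (L, t) r \<inter> ?R" using z r unfolding xs by (auto simp: r0_def)
    qed
    have "emeasure lborel ?A = emeasure lborel {L - r / 2<..<L} * emeasure lborel {t - r / 2<..<t + r / 2}"
      unfolding lborel_prod[symmetric] by (rule lborel.emeasure_pair_measure_Times) auto
    also have "\<dots> = ennreal (1 / 2 * r ^ 2)" using r by (simp add: ennreal_mult'[symmetric] power2_eq_square)
    finally have "measure lborel ?A = 1 / 2 * r ^ 2" by (simp add: measure_def)
    moreover have "measure lborel ?A \<le> measure lborel (ball (L, t) r \<inter> ?R)"
    proof (rule measure_mono_fmeasurable[OF sub])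
      have "emeasure lborel (ball (L, t) r \<inter> ?R) < \<infinity>" by (rule emeasure_bounded_finite) (simp add: bounded_Int)
      then show "ball (L, t) r \<inter> ?R \<in> fmeasurable lborel" using Rb by (intro fmeasurableI) auto
    qed (simp add: borel_open open_Times)
    ultimately show "1 / 2 * r ^ DIM(real \<times> real) \<le> measure lborel (ball (L, t) r \<inter> ?R)"
      by (simp add: power2_eq_square)
  qed
qed auto

section \<open>The network\<close>

text \<open>With \<open>a j = \<kappa> j / (\<kappa> j + k)\<close> the node conditions amount to \<open>a j = g j (1 + S c) - S / l2\<close>, where
  \<open>S = k (\<Sum>j. a j)\<close> and \<open>c = 1/l1 + 1/l2\<close>; summing over \<open>j\<close> determines \<open>S\<close>.\<close>

lemma node_coefficients:
  fixes g :: "nat \<Rightarrow> real"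
  assumes fin: "finite I" and l: "l1 > 0" "l2 > 0" and g: "\<And>j. j \<in> I \<Longrightarrow> 0 < g j \<and> g j < 1"
  shows "\<exists>k0>0. \<forall>k. 0 < k \<and> k < k0 \<longrightarrow> (\<exists>\<kappa>. (\<forall>i\<in>I. \<kappa> i > 0) \<and>
    (\<forall>f w1 w2. w1 = (\<Sum>j\<in>I. g j * f j) / l1 \<longrightarrow> w2 = (\<Sum>j\<in>I. (1 - g j) * f j) / l2 \<longrightarrow>
      (\<Sum>j\<in>I. \<kappa> j * ((f j + \<kappa> j * w1 + k * w2) / (\<kappa> j + k) - w1)) = (\<Sum>j\<in>I. g j * f j) \<and>
      (\<Sum>j\<in>I. k * ((f j + \<kappa> j * w1 + k * w2) / (\<kappa> j + k) - w2)) = (\<Sum>j\<in>I. (1 - g j) * f j)))"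
proof -
  define c where "c = 1 / l1 + 1 / l2"
  define n where "n = real (card I)"
  define G where "G = (\<Sum>j\<in>I. g j)"
  \<comment> \<open>\<open>A k\<close> is meant to be the sum of the a_j. Summing their equation
    over j gives A d(k) = G. As k -> 0, d tends to 1 and a_j to g_j, which lies strictly between 0
    and 1; this provides \<open>k0\<close>.\<close>
  define d where "d k = 1 + k * (n / l2 - G * c)" for k
  define A where "A k = G / d k" for k
  define a where "a k j = g j * (1 + k * A k * c) - k * A k / l2" for k j
  have dlim: "(d \<longlongrightarrow> 1) (at_right 0)"
  proof -
    have "(d \<longlongrightarrow> 1 + 0 * (n / l2 - G * c)) (at_right 0)" unfolding d_def by (intro tendsto_intros)
    then show ?thesis by simp
  qed
  have Alim: "(A \<longlongrightarrow> G / 1) (at_right 0)" unfolding A_def by (intro tendsto_divide tendsto_const dlim) simp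
  have alim: "((\<lambda>k. a k j) \<longlongrightarrow> g j) (at_right 0)" for j
  proof -
    have "((\<lambda>k. a k j) \<longlongrightarrow> g j * (1 + 0 * (G / 1) * c) - 0 * (G / 1) / l2) (at_right 0)"
      unfolding a_def by (intro tendsto_intros Alim) (use l in auto)
    then show ?thesis by simp
  qed
  have "\<forall>\<^sub>F k in at_right 0. d k > 0 \<and> (\<forall>j\<in>I. 0 < a k j \<and> a k j < 1)"
  proof (rule eventually_conj)
    show "\<forall>\<^sub>F k in at_right 0. d k > 0" by (rule order_tendstoD(1)[OF dlim]) simp
    show "\<forall>\<^sub>F k in at_right 0. \<forall>j\<in>I. 0 < a k j \<and> a k j < 1"
    proof (rule eventually_ball_finite[OF fin], rule ballI)
      fix j assume j: "j \<in> I"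
      show "\<forall>\<^sub>F k in at_right 0. 0 < a k j \<and> a k j < 1"
        using order_tendstoD(1)[OF alim, of 0 j] order_tendstoD(2)[OF alim, of j 1] g[OF j] by (intro eventually_conj) auto
    qed
  qed
  then obtain k0 where k0: "k0 > 0" "\<And>k. 0 < k \<Longrightarrow> k < k0 \<Longrightarrow> d k > 0 \<and> (\<forall>j\<in>I. 0 < a k j \<and> a k j < 1)"
    unfolding eventually_at_right_field by blast
  show ?thesis
  proof (intro exI[of _ k0] conjI allI impI k0(1))
    fix k assume k: "0 < k \<and> k < k0"
    define S where "S = k * A k"
    define al where "al j = a k j" for j
    have aj: "0 < al j" "al j < 1" if "j \<in> I" for j using k0(2)[of k] k that by (auto simp: al_def)
    have al: "al j = g j * (1 + S * c) - S / l2" for j by (simp add: al_def a_def S_def)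
    have dk': "d k > 0" using k0(2)[of k] k by blast
    have suma: "k * (\<Sum>j\<in>I. al j) = S"
    proof -
      have "(\<Sum>j\<in>I. al j) = G * (1 + S * c) - n * (S / l2)"
        unfolding al sum_subtractf sum_distrib_right[symmetric] G_def n_def by simp
      also have "\<dots> = A k"
      proof -
        have "A k * d k = G" using dk' by (simp add: A_def)
        then have "A k + A k * (k * (n / l2)) - A k * (k * (G * c)) = G" by (simp add: d_def algebra_simps)
        then show ?thesis by (simp add: S_def algebra_simps)
      qed
      finally show ?thesis by (simp add: S_def)
    qed
    \<comment> \<open>Inverts a = \<kappa> / (\<kappa> + k); the bounds 0 < a < 1 are precisely what
      makes \<kappa> positive.\<close>
    define \<kappa> where "\<kappa> j = k * al j / (1 - al j)" for j
    show "\<exists>\<kappa>. (\<forall>i\<in>I. \<kappa> i > 0) \<and>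
      (\<forall>f w1 w2. w1 = (\<Sum>j\<in>I. g j * f j) / l1 \<longrightarrow> w2 = (\<Sum>j\<in>I. (1 - g j) * f j) / l2 \<longrightarrow>
      (\<Sum>j\<in>I. \<kappa> j * ((f j + \<kappa> j * w1 + k * w2) / (\<kappa> j + k) - w1)) = (\<Sum>j\<in>I. g j * f j) \<and>
      (\<Sum>j\<in>I. k * ((f j + \<kappa> j * w1 + k * w2) / (\<kappa> j + k) - w2)) = (\<Sum>j\<in>I. (1 - g j) * f j))"
    proof (intro exI[of _ \<kappa>] conjI allI impI ballI)
      show kp: "\<kappa> i > 0" if "i \<in> I" for i using aj[OF that] k by (simp add: \<kappa>_def)
      fix f w1 w2
      assume w1: "w1 = (\<Sum>j\<in>I. g j * f j) / l1" and w2: "w2 = (\<Sum>j\<in>I. (1 - g j) * f j) / l2"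
      define X where "X = (\<Sum>j\<in>I. g j * f j)"
      define Y where "Y = (\<Sum>j\<in>I. f j)"
      have w2Y: "w2 = (Y - X) / l2" unfolding w2 X_def Y_def by (simp add: left_diff_distrib sum_subtractf)
      have w1X: "w1 = X / l1" unfolding w1 X_def ..
      have diff: "w2 - w1 = Y / l2 - c * X" unfolding w2Y w1X c_def by (simp add: diff_divide_distrib algebra_simps)
      have afs: "(\<Sum>j\<in>I. al j * f j) = (1 + S * c) * X - S / l2 * Y"
        unfolding al X_def Y_def by (simp add: left_diff_distrib sum_subtractf sum_distrib_left mult.assoc mult.left_commute)
      \<comment> \<open>The quotient is the node value of the incoming arc j, eliminated by its own
        balance. The flux f_j is then divided in the proportions a_j and 1 - a_j, and the terms with
        w2 - w1 are an exchange between the outgoing arcs through arc j.\<close>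
      have t: "\<kappa> j * ((f j + \<kappa> j * w1 + k * w2) / (\<kappa> j + k) - w1) = al j * f j + k * al j * (w2 - w1)"
        "k * ((f j + \<kappa> j * w1 + k * w2) / (\<kappa> j + k) - w2) = f j - al j * f j - k * al j * (w2 - w1)" if j: "j \<in> I" for j
      proof -
        have s: "\<kappa> j + k > 0" using kp[OF j] k by simp
        have r: "\<kappa> j = al j * (\<kappa> j + k)" using aj[OF j] by (simp add: \<kappa>_def field_simps)
        have r1: "\<kappa> j / (\<kappa> j + k) = al j" using r s by (simp add: field_simps)
        have r2: "k / (\<kappa> j + k) = 1 - al j" using r1 s by (simp add: field_simps)
        have e1: "(f j + \<kappa> j * w1 + k * w2) / (\<kappa> j + k) - w1 = (f j + k * (w2 - w1)) / (\<kappa> j + k)" using s by (simp add: field_simps)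
        have e2: "(f j + \<kappa> j * w1 + k * w2) / (\<kappa> j + k) - w2 = (f j - \<kappa> j * (w2 - w1)) / (\<kappa> j + k)" using s by (simp add: field_simps)
        have "\<kappa> j * ((f j + k * (w2 - w1)) / (\<kappa> j + k)) = \<kappa> j / (\<kappa> j + k) * (f j + k * (w2 - w1))" by simp
        then show "\<kappa> j * ((f j + \<kappa> j * w1 + k * w2) / (\<kappa> j + k) - w1) = al j * f j + k * al j * (w2 - w1)"
          unfolding e1 r1 by (simp add: algebra_simps)
        have "k * ((f j - \<kappa> j * (w2 - w1)) / (\<kappa> j + k)) = k / (\<kappa> j + k) * f j - k * (\<kappa> j / (\<kappa> j + k)) * (w2 - w1)"
          by (simp add: diff_divide_distrib right_diff_distrib)
        then show "k * ((f j + \<kappa> j * w1 + k * w2) / (\<kappa> j + k) - w2) = f j - al j * f j - k * al j * (w2 - w1)"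
          unfolding e2 r1 r2 by (simp add: algebra_simps)
      qed
      have sS: "(\<Sum>j\<in>I. k * al j * (w2 - w1)) = S * (w2 - w1)"
        unfolding sum_distrib_right[symmetric] sum_distrib_left[symmetric] suma ..
      have key: "(1 + S * c) * X - S / l2 * Y + S * (w2 - w1) = X" unfolding diff by (simp add: algebra_simps)
      have "(\<Sum>j\<in>I. \<kappa> j * ((f j + \<kappa> j * w1 + k * w2) / (\<kappa> j + k) - w1)) = (\<Sum>j\<in>I. al j * f j + k * al j * (w2 - w1))"
        by (rule sum.cong[OF refl t(1)])
      also have "\<dots> = X" unfolding sum.distrib afs sS by (rule key)
      finally show "(\<Sum>j\<in>I. \<kappa> j * ((f j + \<kappa> j * w1 + k * w2) / (\<kappa> j + k) - w1)) = (\<Sum>j\<in>I. g j * f j)" unfolding X_def .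
      have "(\<Sum>j\<in>I. k * ((f j + \<kappa> j * w1 + k * w2) / (\<kappa> j + k) - w2)) = (\<Sum>j\<in>I. f j - al j * f j - k * al j * (w2 - w1))"
        by (rule sum.cong[OF refl t(2)])
      also have "\<dots> = Y - X" unfolding sum_subtractf afs sS Y_def[symmetric] using key by linarith
      also have "\<dots> = (\<Sum>j\<in>I. (1 - g j) * f j)" unfolding X_def Y_def by (simp add: left_diff_distrib sum_subtractf)
      finally show "(\<Sum>j\<in>I. k * ((f j + \<kappa> j * w1 + k * w2) / (\<kappa> j + k) - w2)) = (\<Sum>j\<in>I. (1 - g j) * f j)" .
    qed
  qed
qed

text \<open>The profile is written in the variable s = t - x/\<open>lam\<close>: the initial datum
  for s between -L/\<open>lam\<close> and 0, the boundary datum B for s >= 0. A smooth ramp carries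
  B, and the rest is approximated with support inside the arc. Vanishing for s <=
  -L/\<open>lam\<close> means that nothing arrives at the outlet before time 0, which makes the
  outgoing profiles smooth across s = 0.\<close>

lemma smooth_profile:
  fixes f :: "real \<Rightarrow> real"
  assumes f: "L1 {0<..<L} f" and lam: "lam > 0" and L: "L > 0" and \<eta>: "\<eta> > 0"
  shows "\<exists>P. C2b P \<and> (\<forall>s\<ge>0. P s = B) \<and> (\<forall>s\<le>- L / lam. P s = 0) \<and> L1_norm {0<..<L} (\<lambda>x. P (- x / lam) - f x) < \<eta>"
proof -
  \<comment> \<open>The affine map sends -L/\<open>lam\<close> to 0 and 0 to 3, the two ends of the
    rise of \<open>spline_step\<close>.\<close>
  define \<sigma> where "\<sigma> s = spline_step (3 * lam / L * s + 3)" for s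
  have \<sigma>: "C2b \<sigma>" unfolding \<sigma>_def[abs_def] by (rule C2b_affine[OF C2b_spline_step])
  have \<sigma>1: "\<sigma> s = 1" if "s \<ge> 0" for s unfolding \<sigma>_def using that lam L by (intro spline_step_right) simp
  have \<sigma>0: "\<sigma> s = 0" if "s \<le> - L / lam" for s
  proof -
    have "3 * lam / L * s \<le> 3 * lam / L * (- L / lam)" using that lam L by (intro mult_left_mono) auto
    also have "\<dots> = - 3" using lam L by simp
    finally show ?thesis unfolding \<sigma>_def by (intro spline_step_left) simp
  qed
  define f' where "f' x = indicator {0<..<L} x * f x - indicator {0<..<L} x * (B * \<sigma> (- 1 / lam * x + 0))" for x
  have "integrable lborel f'"
  proof -
    have "integrable lborel (\<lambda>x. indicator {0<..<L} x * f x)" using f by (simp add: L1_def set_integrable_def)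
    moreover have "set_integrable lborel {0<..<L} (\<lambda>x. B * \<sigma> (- 1 / lam * x + 0))"
      by (intro continuous_imp_set_integrable C2b_continuous C2b_cmult C2b_affine \<sigma>)
    ultimately show ?thesis unfolding f'_def[abs_def] by (intro Bochner_Integration.integrable_diff) (simp_all add: set_integrable_def)
  qed
  from C2b_dense[OF this \<eta>, of 0 L] obtain p where p: "C2b p" "\<forall>x. x \<notin> {0<..<L} \<longrightarrow> p x = 0"
    "(LINT x|lborel. \<bar>indicator {0<..<L} x * f' x - p x\<bar>) < \<eta>" by blast
  define P where "P s = p (- lam * s + 0) + B * \<sigma> s" for s
  show ?thesis
  proof (intro exI[of _ P] conjI allI impI)
    show "C2b P" unfolding P_def[abs_def] by (intro C2b_add C2b_affine C2b_cmult p \<sigma>)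
    show "P s = B" if "s \<ge> 0" for s
    proof -
      have "- lam * s + 0 \<notin> {0<..<L}" using that lam by (simp add: mult_less_0_iff not_less)
      then show ?thesis using p(2) \<sigma>1[OF that] by (simp add: P_def)
    qed
    show "P s = 0" if "s \<le> - L / lam" for s
    proof -
      have "lam * s \<le> lam * (- L / lam)" using that lam by (intro mult_left_mono) auto
      then have "- lam * s + 0 \<notin> {0<..<L}" using lam by simp
      then show ?thesis using p(2) \<sigma>0[OF that] by (simp add: P_def)
    qed
    have "L1_norm {0<..<L} (\<lambda>x. P (- x / lam) - f x) = (LINT x|lborel. \<bar>indicator {0<..<L} x * f' x - p x\<bar>)"
      unfolding L1_norm_def set_lebesgue_integral_def
    proof (rule Bochner_Integration.integral_cong[OF refl])
      fix x
      show "indicator {0<..<L} x *\<^sub>R \<bar>P (- x / lam) - f x\<bar> = \<bar>indicator {0<..<L} x * f' x - p x\<bar>"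
        using p(2) lam by (cases "x \<in> {0<..<L}") (auto simp: P_def f'_def)
    qed
    then show "L1_norm {0<..<L} (\<lambda>x. P (- x / lam) - f x) < \<eta>" using p(3) by simp
  qed
qed

text \<open>Averaging |F(L)| <= |F(x)| + (integral of |F'|) over the arc. It bounds the outlet data
  of the approximations, which act as Dirichlet values of the viscous problems.\<close>

lemma W21_trace_bound:
  assumes f: "W21 {0<..<L} f" and L: "L > 0"
  shows "\<bar>bdry_trace {0<..<L} f L\<bar> \<le> L1_norm {0<..<L} f / L + L1_norm {0<..<L} (weak_deriv {0<..<L} f)"
proof -
  obtain F F1 where F: "\<forall>x\<in>{0..L}. (F has_real_derivative F1 x) (at x within {0..L})" "continuous_on {0..L} F1"
    "AE x in lborel. x \<in> {0<..<L} \<longrightarrow> f x = F x" "AE x in lborel. x \<in> {0<..<L} \<longrightarrow> weak_deriv {0<..<L} f x = F1 x"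
    "L1 {0<..<L} f" "L1 {0<..<L} (weak_deriv {0<..<L} f)"
    using W21_representation[OF f L] by blast
  have Fc: "continuous_on {0..L} F"
    unfolding continuous_on_eq_continuous_within using F(1) DERIV_continuous by blast
  have tr: "bdry_trace {0<..<L} f L = F L" by (rule bdry_trace_interval[OF L F(5) Fc F(3)]) simp
  have n: "L1_norm {0<..<L} h = L1_norm {0<..<L} H"
    if h: "L1 {0<..<L} h" and H: "continuous_on {0..L} H" and ae: "AE x in lborel. x \<in> {0<..<L} \<longrightarrow> h x = H x" for h H
    unfolding L1_norm_def
  proof (rule set_lborel_integral_cong_AE)
    have "L1 {0<..<L} (\<lambda>x. \<bar>h x\<bar>)" using h unfolding L1_def by (rule set_integrable_abs)
    then show "set_borel_measurable lborel {0<..<L} (\<lambda>x. \<bar>h x\<bar>)" by (rule L1_measurable)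
    have "L1 {0<..<L} (\<lambda>x. \<bar>H x\<bar>)" unfolding L1_def by (intro set_integrable_abs continuous_imp_set_integrable H)
    then show "set_borel_measurable lborel {0<..<L} (\<lambda>x. \<bar>H x\<bar>)" by (rule L1_measurable)
    show "AE x in lborel. x \<in> {0<..<L} \<longrightarrow> \<bar>h x\<bar> = \<bar>H x\<bar>" using ae by eventually_elim simp
  qed
  note nF = n[OF F(5) Fc F(3)] and nF1 = n[OF F(6) F(2) F(4)]
  have F1i: "set_integrable lborel {0<..<L} F1" by (rule continuous_imp_set_integrable[OF F(2)])
  have pt: "\<bar>F L\<bar> \<le> \<bar>F x\<bar> + L1_norm {0<..<L} F1" if x: "x \<in> {0<..<L}" for x
  proof -
    have F1x: "set_integrable lborel {x<..<L} F1" by (rule set_integrable_subset[OF F1i]) (use x in auto)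
    have "(LINT y:{x<..<L}|lborel. F1 y) = F L - F x"
    proof (rule set_integral_FTC)
      show "(F has_real_derivative F1 y) (at y within {x..L})" if "x \<le> y" "y \<le> L" for y
        by (rule DERIV_subset[of _ _ _ "{0..L}"]) (use F(1) x that in auto)
      show "continuous_on {x..L} F1" by (rule continuous_on_subset[OF F(2)]) (use x in auto)
    qed (use x in auto)
    moreover have "\<bar>LINT y:{x<..<L}|lborel. F1 y\<bar> \<le> L1_norm {0<..<L} F1"
      unfolding L1_norm_def set_lebesgue_integral_def
    proof (rule order.trans[OF integral_abs_bound integral_mono])
      show "integrable lborel (\<lambda>y. \<bar>indicator {x<..<L} y *\<^sub>R F1 y\<bar>)"
        using F1x unfolding set_integrable_def by (rule integrable_abs)
      show "integrable lborel (\<lambda>y. indicator {0<..<L} y *\<^sub>R \<bar>F1 y\<bar>)"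
        using set_integrable_abs[OF F1i] unfolding set_integrable_def .
      show "\<bar>indicator {x<..<L} y *\<^sub>R F1 y\<bar> \<le> indicator {0<..<L} y *\<^sub>R \<bar>F1 y\<bar>" for y
        using x by (auto simp: indicator_def)
    qed
    ultimately show ?thesis by linarith
  qed
  have "L * \<bar>F L\<bar> \<le> L1_norm {0<..<L} F + L * L1_norm {0<..<L} F1"
  proof -
    have ci: "set_integrable lborel {0<..<L} (\<lambda>_. a)" for a :: real by (rule continuous_imp_set_integrable) simp
    have Fi: "set_integrable lborel {0<..<L} (\<lambda>x. \<bar>F x\<bar>)" by (intro set_integrable_abs continuous_imp_set_integrable Fc)
    have "(LINT x:{0<..<L}|lborel. \<bar>F L\<bar>) \<le> (LINT x:{0<..<L}|lborel. \<bar>F x\<bar> + L1_norm {0<..<L} F1)"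
      by (rule set_integral_mono[OF ci set_integral_add(1)[OF Fi ci]]) (rule pt)
    also have "\<dots> = L1_norm {0<..<L} F + (LINT x:{0<..<L}|lborel. L1_norm {0<..<L} F1)"
      unfolding set_integral_add(2)[OF Fi ci] L1_norm_def ..
    finally show ?thesis using L by (simp add: set_lebesgue_integral_def)
  qed
  then have "\<bar>F L\<bar> \<le> L1_norm {0<..<L} F / L + L1_norm {0<..<L} F1" using L by (simp add: field_simps)
  then show ?thesis unfolding tr nF nF1 .
qed

text \<open>Curves in L^1 only provide integrable slices. Joint measurability and a uniform slice
  bound give integrability on the rectangle by Tonelli.\<close>

lemma L1_rectangle_bound:
  fixes f :: "real \<times> real \<Rightarrow> real"
  assumes f: "set_borel_measurable lborel ({0<..<L} \<times> {0<..<T}) f" and T: "T > 0" and c: "c \<ge> 0"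
    and sl: "\<And>t. t \<in> {0<..<T} \<Longrightarrow> L1 {0<..<L} (\<lambda>x. f (x, t)) \<and> L1_norm {0<..<L} (\<lambda>x. f (x, t)) \<le> c"
  shows "L1 ({0<..<L} \<times> {0<..<T}) f" "L1_norm ({0<..<L} \<times> {0<..<T}) f \<le> T * c"
proof -
  let ?R = "{0<..<L} \<times> {0<..<T}"
  define g where "g z = indicator ?R z *\<^sub>R f z" for z
  have gm: "g \<in> borel_measurable lborel" using f unfolding g_def[abs_def] set_borel_measurable_def .
  have ngm: "(\<lambda>z. ennreal (norm (g z))) \<in> borel_measurable (lborel \<Otimes>\<^sub>M lborel)"
    using gm unfolding lborel_prod by measurable
  have "(\<integral>\<^sup>+ z. ennreal (norm (g z)) \<partial>lborel) = (\<integral>\<^sup>+ t. \<integral>\<^sup>+ x. ennreal (norm (g (x, t))) \<partial>lborel \<partial>lborel)"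
    using lborel_pair.nn_integral_snd[OF ngm] by (simp add: lborel_prod)
  also have "\<dots> \<le> (\<integral>\<^sup>+ t. ennreal (c * indicator {0<..<T} t) \<partial>lborel)"
  proof (rule nn_integral_mono)
    fix t
    show "(\<integral>\<^sup>+ x. ennreal (norm (g (x, t))) \<partial>lborel) \<le> ennreal (c * indicator {0<..<T} t)"
    proof (cases "t \<in> {0<..<T}")
      case True
      have ab: "integrable lborel (\<lambda>x. indicator {0<..<L} x *\<^sub>R \<bar>f (x, t)\<bar>)"
        using set_integrable_abs[of lborel "{0<..<L}" "\<lambda>x. f (x, t)"] sl[OF True] unfolding L1_def set_integrable_def by simp
      have "norm (g (x, t)) = indicator {0<..<L} x *\<^sub>R \<bar>f (x, t)\<bar>" for x using True by (simp add: g_def indicator_def)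
      then have "(\<integral>\<^sup>+ x. ennreal (norm (g (x, t))) \<partial>lborel) = (\<integral>\<^sup>+ x. ennreal (indicator {0<..<L} x *\<^sub>R \<bar>f (x, t)\<bar>) \<partial>lborel)"
        by (simp only:)
      also have "\<dots> = ennreal (LINT x|lborel. indicator {0<..<L} x *\<^sub>R \<bar>f (x, t)\<bar>)"
        by (rule nn_integral_eq_integral[OF ab]) (simp add: indicator_def)
      also have "\<dots> \<le> ennreal c" using sl[OF True] unfolding L1_norm_def set_lebesgue_integral_def by (intro ennreal_leI) simp
      finally show ?thesis using True by simp
    next
      case False
      then have "norm (g (x, t)) = 0" for x by (simp add: g_def)
      then have "(\<integral>\<^sup>+ x. ennreal (norm (g (x, t))) \<partial>lborel) = (\<integral>\<^sup>+ x. 0 \<partial>(lborel :: real measure))" by (simp only: ennreal_0)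
      then show ?thesis by simp
    qed
  qed
  also have "\<dots> = ennreal (T * c)"
  proof -
    have "integrable lborel (\<lambda>t. c * indicator {0<..<T} t)"
      by (intro integrable_mult_right integrable_real_indicator emeasure_bounded_finite) auto
    from nn_integral_eq_integral[OF this] show ?thesis using c T by (simp add: mult.commute)
  qed
  finally have bound: "(\<integral>\<^sup>+ z. ennreal (norm (g z)) \<partial>lborel) \<le> ennreal (T * c)" .
  have gi: "integrable lborel g"
    by (rule integrableI_bounded[OF gm le_less_trans[OF bound]]) simp
  then show "L1 ?R f" unfolding L1_def set_integrable_def g_def[abs_def] .
  have "ennreal (LINT z|lborel. norm (g z)) \<le> ennreal (T * c)"
    using nn_integral_eq_integral[OF integrable_norm[OF gi]] bound by simp
  then have "(LINT z|lborel. norm (g z)) \<le> T * c" using T c by (subst (asm) ennreal_le_iff) auto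
  moreover have "norm (g z) = indicator ?R z *\<^sub>R \<bar>f z\<bar>" for z by (simp add: g_def indicator_def)
  ultimately show "L1_norm ?R f \<le> T * c" unfolding L1_norm_def set_lebesgue_integral_def by (simp only:)
qed

lemma C1_compact_support_edge_measurable:
  fixes \<phi> :: "real \<times> real \<Rightarrow> real"
  assumes C1: "C1_compact_support ({0..<L} \<times> {0..<T}) \<phi> D" and T: "T > 0"
  shows "set_borel_measurable lborel {0<..<L} (\<lambda>x. \<phi> (x, 0))"
proof -
  have "continuous_on ({0..<L} \<times> {0..<T}) \<phi>"
    using C1 has_derivative_continuous unfolding C1_compact_support_def continuous_on_eq_continuous_within by blast
  moreover have "continuous_on {0<..<L} (\<lambda>x. (x, 0::real))" by (intro continuous_intros)
  ultimately have "continuous_on {0<..<L} (\<lambda>x. \<phi> (x, 0))"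
    by (rule continuous_on_compose2) (use T in auto)
  then have "(\<lambda>x. indicator {0<..<L} x *\<^sub>R \<phi> (x, 0)) \<in> borel_measurable borel"
    by (intro borel_measurable_continuous_on_indicator) auto
  then show ?thesis by (simp add: set_borel_measurable_def)
qed

section \<open>The explicit solution of the transport problem on the network\<close>

locale transport_network =
  fixes Inc Out :: "nat set" and L vel :: "nat \<Rightarrow> real" and \<gamma> :: "nat \<Rightarrow> nat \<Rightarrow> real" and B :: "nat \<Rightarrow> real"
    and u0 F :: "nat \<Rightarrow> real \<Rightarrow> real" and T :: real
  assumes fin: "finite (Inc \<union> Out)" and disj: "Inc \<inter> Out = {}"
    and Lpos: "\<And>i. i \<in> Inc \<union> Out \<Longrightarrow> L i > 0" and vpos: "\<And>i. i \<in> Inc \<union> Out \<Longrightarrow> vel i > 0" and T: "T > 0"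
    and F: "\<And>i. i \<in> Inc \<union> Out \<Longrightarrow> bounded_mono_diff (F i)"
    and u0F: "\<And>i. i \<in> Inc \<union> Out \<Longrightarrow> AE x in lborel. x \<in> {0<..<L i} \<longrightarrow> u0 i x = F i x"
    and u0L1: "\<And>i. i \<in> Inc \<union> Out \<Longrightarrow> L1 {0<..<L i} (u0 i)"
begin

text \<open>The solution is \<open>u\<^sub>i(x,t) = Q i (t - x / vel i)\<close>: negative arguments carry the initial datum,
  positive arguments the boundary datum.\<close>

definition Qinc :: "nat \<Rightarrow> real \<Rightarrow> real" where
  "Qinc j s = F j (- vel j * s + 0) + (B j + - F j (- vel j * s + 0)) * indicator {0<..} s"

definition influx :: "nat \<Rightarrow> real \<Rightarrow> real" where
  "influx i s = (\<Sum>j\<in>Inc. \<gamma> i j * vel j * Qinc j (1 * s + - (L j / vel j)))"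

definition Qout :: "nat \<Rightarrow> real \<Rightarrow> real" where
  "Qout i s = F i (- vel i * s + 0) + (1 / vel i * influx i s + - F i (- vel i * s + 0)) * indicator {0<..} s"

definition Q :: "nat \<Rightarrow> real \<Rightarrow> real" where
  "Q i = (if i \<in> Inc then Qinc i else Qout i)"

definition U :: "nat \<Rightarrow> real \<times> real \<Rightarrow> real" where
  "U i z = Q i (snd z - fst z / vel i)"

text \<open>The profiles glue two functions at s = 0 by a cut-off. Their arguments are written as
  \<open>a * s + b\<close> and subtractions as sums so that the closure rules apply term by
  term.\<close>

lemma Q_bounded_mono_diff: "i \<in> Inc \<union> Out \<Longrightarrow> bounded_mono_diff (Q i)"
proof -
  have glue: "bounded_mono_diff (\<lambda>s. f (a * s + b) + (g s + - f (a * s + b)) * indicator {0<..} s)"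
    if "bounded_mono_diff f" "bounded_mono_diff g" for f g a b
    by (rule bounded_mono_diff_add[OF bounded_mono_diff_affine[OF that(1)]
      bounded_mono_diff_indicator[OF bounded_mono_diff_add[OF that(2) bounded_mono_diff_minus[OF bounded_mono_diff_affine[OF that(1)]]]]])
  have inc: "bounded_mono_diff (Qinc j)" if j: "j \<in> Inc" for j
    unfolding Qinc_def[abs_def] by (rule glue[OF F bounded_mono_diff_const]) (use j in simp)
  have inf: "bounded_mono_diff (influx i)" for i
    unfolding influx_def[abs_def]
    by (rule bounded_mono_diff_sum, rule bounded_mono_diff_cmult, rule bounded_mono_diff_affine, rule inc)
  have out: "bounded_mono_diff (Qout i)" if i: "i \<in> Out" for i
    unfolding Qout_def[abs_def] by (rule glue[OF F bounded_mono_diff_cmult[OF inf]]) (use i in simp)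
  show "i \<in> Inc \<union> Out \<Longrightarrow> bounded_mono_diff (Q i)" unfolding Q_def using inc out by auto
qed

lemma Q_initial: "i \<in> Inc \<union> Out \<Longrightarrow> s \<le> 0 \<Longrightarrow> Q i s = F i (- vel i * s)"
  by (simp add: Q_def Qinc_def Qout_def)

lemma Q_inc_pos: "i \<in> Inc \<Longrightarrow> s > 0 \<Longrightarrow> Q i s = B i"
  by (simp add: Q_def Qinc_def)

lemma Q_out_pos: "i \<in> Out \<Longrightarrow> s > 0 \<Longrightarrow> Q i s = (\<Sum>j\<in>Inc. \<gamma> i j * vel j * Q j (s - L j / vel j)) / vel i"
proof -
  assume i: "i \<in> Out" "s > 0"
  then have "i \<notin> Inc" using disj by auto
  then show ?thesis using i(2) by (simp add: Q_def Qout_def influx_def)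
qed

lemma Q_u0: "i \<in> Inc \<union> Out \<Longrightarrow> AE x in lborel. x \<in> {0<..<L i} \<longrightarrow> u0 i x = Q i (- x / vel i)"
proof -
  assume i: "i \<in> Inc \<union> Out"
  show ?thesis using u0F[OF i]
  proof eventually_elim
    case (elim x)
    show ?case
    proof
      assume x: "x \<in> {0<..<L i}"
      then have "- x / vel i \<le> 0" using vpos[OF i] by simp
      then show "u0 i x = Q i (- x / vel i)" using elim x vpos[OF i] by (simp add: Q_initial[OF i])
    qed
  qed
qed

lemma Q_borel: "i \<in> Inc \<union> Out \<Longrightarrow> Q i \<in> borel_measurable borel"
  by (rule bounded_mono_diff_borel[OF Q_bounded_mono_diff])

lemma U_BV: "i \<in> Inc \<union> Out \<Longrightarrow> BV ({0<..<L i} \<times> {0<..<T}) (U i)"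
  unfolding U_def[abs_def] by (rule BV_characteristic[OF Q_bounded_mono_diff vpos Lpos T])

lemma U_L1: "i \<in> Inc \<union> Out \<Longrightarrow> L1 ({0<..<L i} \<times> {0<..<T}) (U i)"
  using U_BV unfolding BV_def by blast

lemma U_weak:
  fixes \<phi> :: "real \<times> real \<Rightarrow> real"
  assumes i: "i \<in> Inc \<union> Out" and C1: "C1_compact_support ({0..<L i} \<times> {0..<T}) \<phi> D"
  shows "(LINT z:({0<..<L i} \<times> {0<..<T})|lborel. U i z * (D z (0, 1) + vel i * D z (1, 0)))
      + (LINT x:{0<..<L i}|lborel. u0 i x * \<phi> (x, 0)) = - vel i * (LINT t:{0<..<T}|lborel. \<phi> (0, t) * Q i t)"
proof -
  obtain M where M: "\<And>s. \<bar>Q i s\<bar> \<le> M" using bounded_mono_diff_bounded[OF Q_bounded_mono_diff[OF i]] by blast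
  note \<phi>m = C1_compact_support_edge_measurable[OF C1 T]
  have "(LINT x:{0<..<L i}|lborel. u0 i x * \<phi> (x, 0)) = (LINT x:{0<..<L i}|lborel. Q i (- x / vel i) * \<phi> (x, 0))"
  proof (rule set_lborel_integral_cong_AE)
    show "set_borel_measurable lborel {0<..<L i} (\<lambda>x. u0 i x * \<phi> (x, 0))"
      by (rule set_borel_measurable_mult[OF L1_measurable[OF u0L1[OF i]] \<phi>m])
    have "(\<lambda>x. Q i (- x / vel i)) \<in> borel_measurable borel" using Q_borel[OF i] by measurable
    then have "set_borel_measurable lborel {0<..<L i} (\<lambda>x. Q i (- x / vel i))" by (simp add: set_borel_measurable_def)
    then show "set_borel_measurable lborel {0<..<L i} (\<lambda>x. Q i (- x / vel i) * \<phi> (x, 0))"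
      by (rule set_borel_measurable_mult[OF _ \<phi>m])
    show "AE x in lborel. x \<in> {0<..<L i} \<longrightarrow> u0 i x * \<phi> (x, 0) = Q i (- x / vel i) * \<phi> (x, 0)"
      using Q_u0[OF i] by eventually_elim auto
  qed
  then show ?thesis unfolding U_def using transport_weak_identity[OF vpos[OF i] Lpos[OF i] T Q_borel[OF i] M C1] by simp
qed

text \<open>Traces ignore null sets, so any y that equals \<open>U\<close> almost everywhere has the
  traces of \<open>U\<close>, which are values of \<open>Q j\<close> except at countably many times.
  Taking y = \<open>U\<close> shows that \<open>U\<close> is a solution; taking another solution
  gives uniqueness on outgoing arcs.\<close>

lemma flux_trace:
  fixes \<phi> :: "real \<Rightarrow> real"
  assumes y: "\<And>j. j \<in> Inc \<Longrightarrow> L1 ({0<..<L j} \<times> {0<..<T}) (y j)"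
    "\<And>j. j \<in> Inc \<Longrightarrow> AE z in lborel. z \<in> {0<..<L j} \<times> {0<..<T} \<longrightarrow> y j z = U j z" and i: "i \<in> Out"
  shows "(LINT t:{0<..<T}|lborel. \<phi> t * (\<Sum>j\<in>Inc. \<gamma> i j * vel j * bdry_trace ({0<..<L j} \<times> {0<..<T}) (y j) (L j, t)))
    = vel i * (LINT t:{0<..<T}|lborel. \<phi> t * Q i t)"
proof -
  let ?bad = "\<Union>j\<in>Inc. (\<lambda>s. s + L j / vel j) ` {s. \<not> isCont (Q j) s}"
  have cnt: "countable ?bad"
    using fin by (intro countable_UN countable_image bounded_mono_diff_isCont Q_bounded_mono_diff countable_finite) auto
  have tr: "bdry_trace ({0<..<L j} \<times> {0<..<T}) (y j) (L j, t) = Q j (t - L j / vel j)"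
    if j: "j \<in> Inc" and t: "t \<in> {0<..<T}" "t \<notin> ?bad" for j t
  proof -
    have jI: "j \<in> Inc \<union> Out" using j by simp
    have "bdry_trace ({0<..<L j} \<times> {0<..<T}) (y j) (L j, t) = bdry_trace ({0<..<L j} \<times> {0<..<T}) (U j) (L j, t)"
      by (rule bdry_trace_cong_AE[OF _ L1_measurable[OF y(1)[OF j]] L1_measurable[OF U_L1[OF jI]] y(2)[OF j]])
        (intro borel_open open_Times open_greaterThanLessThan)
    also have "\<dots> = Q j (t - L j / vel j)"
      unfolding U_def[abs_def]
    proof (rule bdry_trace_characteristic[OF Q_borel[OF jI] _ vpos[OF jI] Lpos[OF jI]])
      show "isCont (Q j) (t - L j / vel j)"
      proof (rule ccontr)
        assume "\<not> isCont (Q j) (t - L j / vel j)"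
        then have "(t - L j / vel j) + L j / vel j \<in> (\<lambda>s. s + L j / vel j) ` {s. \<not> isCont (Q j) s}" by blast
        then show False using t(2) j by auto
      qed
    qed (use t in auto)
    finally show ?thesis .
  qed
  have "(LINT t:{0<..<T}|lborel. \<phi> t * (\<Sum>j\<in>Inc. \<gamma> i j * vel j * bdry_trace ({0<..<L j} \<times> {0<..<T}) (y j) (L j, t)))
    = (LINT t:{0<..<T}|lborel. vel i * (\<phi> t * Q i t))"
    unfolding set_lebesgue_integral_def
  proof (rule integral_discrete_difference[OF cnt])
    fix t assume t: "t \<notin> ?bad"
    show "indicator {0<..<T} t *\<^sub>R (\<phi> t * (\<Sum>j\<in>Inc. \<gamma> i j * vel j * bdry_trace ({0<..<L j} \<times> {0<..<T}) (y j) (L j, t)))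
      = indicator {0<..<T} t *\<^sub>R (vel i * (\<phi> t * Q i t))"
    proof (cases "t \<in> {0<..<T}")
      case True
      have "(\<Sum>j\<in>Inc. \<gamma> i j * vel j * bdry_trace ({0<..<L j} \<times> {0<..<T}) (y j) (L j, t)) = (\<Sum>j\<in>Inc. \<gamma> i j * vel j * Q j (t - L j / vel j))"
        by (rule sum.cong[OF refl]) (simp only: tr[OF _ True t])
      also have "\<dots> = vel i * Q i t" using Q_out_pos[OF i, of t] True vpos[of i] i by simp
      finally show ?thesis by simp
    qed simp
  qed auto
  also have "\<dots> = vel i * (LINT t:{0<..<T}|lborel. \<phi> t * Q i t)" by (rule set_integral_mult_right)
  finally show ?thesis .
qed

lemma inc_boundary_integral:
  fixes \<phi> :: "real \<Rightarrow> real"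
  assumes i: "i \<in> Inc"
  shows "(LINT t:{0<..<T}|lborel. \<phi> t * Q i t) = B i * (LINT t:{0<..<T}|lborel. \<phi> t)"
proof -
  have "(LINT t:{0<..<T}|lborel. \<phi> t * Q i t) = (LINT t:{0<..<T}|lborel. B i * \<phi> t)"
    by (rule set_lebesgue_integral_cong) (auto simp: Q_inc_pos[OF i])
  also have "\<dots> = B i * (LINT t:{0<..<T}|lborel. \<phi> t)" by (rule set_integral_mult_right)
  finally show ?thesis .
qed

lemma U_solves: "solves_transport Inc Out L vel \<gamma> B u0 T U"
  unfolding solves_transport_def
proof (intro conjI ballI allI impI)
  fix i assume i: "i \<in> Inc \<union> Out"
  then show "BV ({0<..<L i} \<times> {0<..<T}) (U i)" by (rule U_BV)
next
  fix i and \<phi> :: "real \<times> real \<Rightarrow> real" and D assume i: "i \<in> Inc" and C1: "C1_compact_support ({0..<L i} \<times> {0..<T}) \<phi> D"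
  show "(LINT z:({0<..<L i} \<times> {0<..<T})|lborel. U i z * (D z (0, 1) + vel i * D z (1, 0)))
          + (LINT x:{0<..<L i}|lborel. u0 i x * \<phi> (x, 0)) = - vel i * B i * (LINT t:{0<..<T}|lborel. \<phi> (0, t))"
    using U_weak[OF _ C1] i inc_boundary_integral[OF i, of "\<lambda>t. \<phi> (0, t)"] by simp
next
  fix i and \<phi> :: "real \<times> real \<Rightarrow> real" and D assume i: "i \<in> Out" and C1: "C1_compact_support ({0..<L i} \<times> {0..<T}) \<phi> D"
  have "(LINT t:{0<..<T}|lborel. \<phi> (0, t) * (\<Sum>j\<in>Inc. \<gamma> i j * vel j * bdry_trace ({0<..<L j} \<times> {0<..<T}) (U j) (L j, t)))
    = vel i * (LINT t:{0<..<T}|lborel. \<phi> (0, t) * Q i t)"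
    by (rule flux_trace[OF U_L1 _ i]) auto
  then show "(LINT z:({0<..<L i} \<times> {0<..<T})|lborel. U i z * (D z (0, 1) + vel i * D z (1, 0)))
          + (LINT x:{0<..<L i}|lborel. u0 i x * \<phi> (x, 0))
        = - (LINT t:{0<..<T}|lborel. \<phi> (0, t) *
              (\<Sum>j\<in>Inc. \<gamma> i j * vel j * bdry_trace ({0<..<L j} \<times> {0<..<T}) (U j) (L j, t)))"
    using U_weak[OF _ C1] i by simp
qed

section \<open>Uniqueness for the network transport problem\<close>

lemma weak_difference:
  assumes i: "i \<in> Inc \<union> Out" and y: "L1 ({0<..<L i} \<times> {0<..<T}) y"
    and eq: "\<And>(\<phi> :: real \<times> real \<Rightarrow> real) D. C1_compact_support ({0..<L i} \<times> {0..<T}) \<phi> D \<Longrightarrow>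
      (LINT z:({0<..<L i} \<times> {0<..<T})|lborel. y z * (D z (0, 1) + vel i * D z (1, 0)))
      = (LINT z:({0<..<L i} \<times> {0<..<T})|lborel. U i z * (D z (0, 1) + vel i * D z (1, 0)))"
  shows "AE z in lborel. z \<in> {0<..<L i} \<times> {0<..<T} \<longrightarrow> y z = U i z"
proof -
  let ?R = "{0<..<L i} \<times> {0<..<T}"
  have Ro: "open ?R" by (intro open_Times) auto
  have "AE z in lborel. z \<in> ?R \<longrightarrow> y z - U i z = 0"
  proof (rule transport_unique[OF vpos[OF i] Lpos[OF i] T L1_diff[OF y U_L1[OF i]]])
    fix \<phi> :: "real \<times> real \<Rightarrow> real" and D
    assume C1: "C1_compact_support ({0..<L i} \<times> {0..<T}) \<phi> D"
    have RS: "?R \<subseteq> {0..<L i} \<times> {0..<T}" by auto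
    obtain M1 M2 where M: "\<forall>z\<in>?R. norm (D z (0, 1)) \<le> M1" "\<forall>z\<in>?R. norm (D z (1, 0)) \<le> M2"
      using C1_compact_support_deriv_bounded[OF C1 Ro RS, of "(0, 1)"] C1_compact_support_deriv_bounded[OF C1 Ro RS, of "(1, 0)"] by auto
    define \<Phi> where "\<Phi> z = D z (0, 1) + vel i * D z (1, 0)" for z
    have "continuous_on ?R (\<lambda>z. D z v)" for v
      using C1 continuous_on_subset[OF _ RS] unfolding C1_compact_support_def by blast
    then have "continuous_on ?R \<Phi>" unfolding \<Phi>_def[abs_def] by (intro continuous_intros)
    then have \<Phi>m: "(\<lambda>z. indicator ?R z *\<^sub>R \<Phi> z) \<in> borel_measurable borel"
      by (intro borel_measurable_continuous_on_indicator borel_open Ro)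
    have \<Phi>b: "\<bar>indicator ?R z *\<^sub>R \<Phi> z\<bar> \<le> \<bar>M1\<bar> + vel i * \<bar>M2\<bar>" for z
    proof (cases "z \<in> ?R")
      case True
      have "\<bar>\<Phi> z\<bar> \<le> \<bar>D z (0, 1)\<bar> + vel i * \<bar>D z (1, 0)\<bar>"
        unfolding \<Phi>_def using abs_triangle_ineq[of "D z (0, 1)" "vel i * D z (1, 0)"] vpos[OF i] by (simp add: abs_mult)
      also have "\<dots> \<le> \<bar>M1\<bar> + vel i * \<bar>M2\<bar>"
        using bspec[OF M(1) True] bspec[OF M(2) True] vpos[OF i] by (intro add_mono mult_left_mono) auto
      finally show ?thesis using True by simp
    qed (use vpos[OF i] in simp)
    have int: "set_integrable lborel ?R (\<lambda>z. h z * \<Phi> z)" if h: "L1 ?R h" for h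
    proof -
      have hi: "integrable lborel (\<lambda>z. indicator ?R z *\<^sub>R h z)" using h unfolding L1_def set_integrable_def .
      have "integrable lborel (\<lambda>z. (indicator ?R z *\<^sub>R h z) * (indicator ?R z *\<^sub>R \<Phi> z))"
      proof (rule Bochner_Integration.integrable_bound[OF integrable_mult_right[OF hi, of "\<bar>M1\<bar> + vel i * \<bar>M2\<bar>"]])
        show "(\<lambda>z. (indicator ?R z *\<^sub>R h z) * (indicator ?R z *\<^sub>R \<Phi> z)) \<in> borel_measurable lborel"
          by (rule borel_measurable_times[OF borel_measurable_integrable[OF hi]]) (use \<Phi>m in simp)
        show "AE z in lborel. norm ((indicator ?R z *\<^sub>R h z) * (indicator ?R z *\<^sub>R \<Phi> z)) \<le> norm ((\<bar>M1\<bar> + vel i * \<bar>M2\<bar>) * (indicator ?R z *\<^sub>R h z))"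
        proof (rule AE_I2)
          fix z
          have "\<bar>indicator ?R z *\<^sub>R h z\<bar> * \<bar>indicator ?R z *\<^sub>R \<Phi> z\<bar> \<le> \<bar>indicator ?R z *\<^sub>R h z\<bar> * (\<bar>M1\<bar> + vel i * \<bar>M2\<bar>)"
            by (rule mult_left_mono[OF \<Phi>b]) simp
          moreover have "\<bar>\<bar>M1\<bar> + vel i * \<bar>M2\<bar>\<bar> = \<bar>M1\<bar> + vel i * \<bar>M2\<bar>" using vpos[OF i] by simp
          ultimately show "norm ((indicator ?R z *\<^sub>R h z) * (indicator ?R z *\<^sub>R \<Phi> z)) \<le> norm ((\<bar>M1\<bar> + vel i * \<bar>M2\<bar>) * (indicator ?R z *\<^sub>R h z))"
            unfolding real_norm_def abs_mult[of "indicator ?R z *\<^sub>R h z"] abs_mult[of "\<bar>M1\<bar> + vel i * \<bar>M2\<bar>"]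
            by (simp only: mult.commute)
        qed
      qed
      moreover have "(indicator ?R z *\<^sub>R h z) * (indicator ?R z *\<^sub>R \<Phi> z) = indicator ?R z *\<^sub>R (h z * \<Phi> z)" for z
        by (simp add: indicator_def)
      ultimately show ?thesis unfolding set_integrable_def by (simp only:)
    qed
    have "(LINT z:?R|lborel. (y z - U i z) * \<Phi> z) = (LINT z:?R|lborel. y z * \<Phi> z - U i z * \<Phi> z)"
      by (simp only: left_diff_distrib)
    also have "\<dots> = (LINT z:?R|lborel. y z * \<Phi> z) - (LINT z:?R|lborel. U i z * \<Phi> z)"
      by (rule set_integral_diff(2)[OF int[OF y] int[OF U_L1[OF i]]])
    also have "\<dots> = 0" using eq[OF C1] unfolding \<Phi>_def by simp
    finally show "(LINT z:?R|lborel. (y z - U i z) * (D z (0, 1) + vel i * D z (1, 0))) = 0" unfolding \<Phi>_def .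
  qed
  then show ?thesis by eventually_elim auto
qed

text \<open>The weak formulation on an incoming arc involves no other arc, so these are settled
  first. Their traces then fix the inflow of the outgoing arcs, and the same argument applies there;
  no iteration in time arises.\<close>

lemma transport_solution_unique:
  assumes u: "solves_transport Inc Out L vel \<gamma> B u0 T u" and i: "i \<in> Inc \<union> Out"
  shows "AE z in lborel. z \<in> {0<..<L i} \<times> {0<..<T} \<longrightarrow> u i z = U i z"
proof -
  have uL1: "L1 ({0<..<L i} \<times> {0<..<T}) (u i)" if "i \<in> Inc \<union> Out" for i
    using u that unfolding solves_transport_def BV_def by blast
  have inc: "AE z in lborel. z \<in> {0<..<L i} \<times> {0<..<T} \<longrightarrow> u i z = U i z" if i: "i \<in> Inc" for i
  proof (rule weak_difference)
    fix \<phi> :: "real \<times> real \<Rightarrow> real" and D assume C1: "C1_compact_support ({0..<L i} \<times> {0..<T}) \<phi> D"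
    have "(LINT z:({0<..<L i} \<times> {0<..<T})|lborel. u i z * (D z (0, 1) + vel i * D z (1, 0)))
          + (LINT x:{0<..<L i}|lborel. u0 i x * \<phi> (x, 0)) = - vel i * B i * (LINT t:{0<..<T}|lborel. \<phi> (0, t))"
      using u i C1 unfolding solves_transport_def by blast
    moreover have "(LINT z:({0<..<L i} \<times> {0<..<T})|lborel. U i z * (D z (0, 1) + vel i * D z (1, 0)))
          + (LINT x:{0<..<L i}|lborel. u0 i x * \<phi> (x, 0)) = - vel i * B i * (LINT t:{0<..<T}|lborel. \<phi> (0, t))"
      using U_solves i C1 unfolding solves_transport_def by blast
    ultimately show "(LINT z:({0<..<L i} \<times> {0<..<T})|lborel. u i z * (D z (0, 1) + vel i * D z (1, 0)))
      = (LINT z:({0<..<L i} \<times> {0<..<T})|lborel. U i z * (D z (0, 1) + vel i * D z (1, 0)))" by linarith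
  qed (use i uL1 in auto)
  have out: "AE z in lborel. z \<in> {0<..<L i} \<times> {0<..<T} \<longrightarrow> u i z = U i z" if i: "i \<in> Out" for i
  proof (rule weak_difference)
    fix \<phi> :: "real \<times> real \<Rightarrow> real" and D assume C1: "C1_compact_support ({0..<L i} \<times> {0..<T}) \<phi> D"
    have "(LINT z:({0<..<L i} \<times> {0<..<T})|lborel. u i z * (D z (0, 1) + vel i * D z (1, 0)))
          + (LINT x:{0<..<L i}|lborel. u0 i x * \<phi> (x, 0))
        = - (LINT t:{0<..<T}|lborel. \<phi> (0, t) * (\<Sum>j\<in>Inc. \<gamma> i j * vel j * bdry_trace ({0<..<L j} \<times> {0<..<T}) (u j) (L j, t)))"
      using u i C1 unfolding solves_transport_def by blast
    moreover have "(LINT t:{0<..<T}|lborel. \<phi> (0, t) * (\<Sum>j\<in>Inc. \<gamma> i j * vel j * bdry_trace ({0<..<L j} \<times> {0<..<T}) (u j) (L j, t)))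
      = vel i * (LINT t:{0<..<T}|lborel. \<phi> (0, t) * Q i t)"
      by (rule flux_trace[OF uL1 inc i]) simp_all
    moreover have "(LINT z:({0<..<L i} \<times> {0<..<T})|lborel. U i z * (D z (0, 1) + vel i * D z (1, 0)))
      + (LINT x:{0<..<L i}|lborel. u0 i x * \<phi> (x, 0)) = - vel i * (LINT t:{0<..<T}|lborel. \<phi> (0, t) * Q i t)"
      by (rule U_weak[OF _ C1]) (use i in simp)
    ultimately show "(LINT z:({0<..<L i} \<times> {0<..<T})|lborel. u i z * (D z (0, 1) + vel i * D z (1, 0)))
      = (LINT z:({0<..<L i} \<times> {0<..<T})|lborel. U i z * (D z (0, 1) + vel i * D z (1, 0)))" by linarith
  qed (use i uL1 in auto)
  show ?thesis using i inc out by blast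
qed

end

section \<open>Smooth profiles and their distance from the explicit solution\<close>

lemma L1_bounded_borel:
  fixes f :: "real \<Rightarrow> real"
  assumes "f \<in> borel_measurable borel" "\<And>x. \<bar>f x\<bar> \<le> M"
  shows "L1 {0<..<L} f"
  unfolding L1_def set_integrable_def
proof (rule integrable_bounded_support[where A = "{0<..<L}" and M = "\<bar>M\<bar>"])
  show "(\<lambda>x. indicat_real {0<..<L} x *\<^sub>R f x) \<in> borel_measurable borel" using assms(1) by measurable
  show "\<bar>indicat_real {0<..<L} x *\<^sub>R f x\<bar> \<le> \<bar>M\<bar>" for x using assms(2)[of x] by (auto simp: indicator_def)
qed auto

text \<open>Passing from x to s = t - x/\<open>lam\<close> replaces the arc by an interval of
  parameters above -L/\<open>lam\<close>; integrating the majorant over the whole line makes the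
  bound uniform in t >= 0.\<close>

lemma L1_norm_profile_le:
  fixes d h :: "real \<Rightarrow> real"
  assumes h: "integrable lborel h" "\<And>s. h s \<ge> 0" and d: "\<And>s. - L / lam < s \<Longrightarrow> \<bar>d s\<bar> \<le> h s"
    and lam: "lam > 0" and t: "t \<ge> 0"
  shows "L1_norm {0<..<L} (\<lambda>x. d (t - x / lam)) \<le> lam * (LINT s|lborel. h s)"
proof -
  have c: "- 1 / lam \<noteq> 0" using lam by simp
  have "L1_norm {0<..<L} (\<lambda>x. d (t - x / lam)) \<le> (LINT x|lborel. h (t + (- 1 / lam) * x))"
    unfolding L1_norm_def set_lebesgue_integral_def
  proof (rule integral_mono')
    show "integrable lborel (\<lambda>x. h (t + (- 1 / lam) * x))" by (rule lborel_integrable_real_affine[OF h(1) c])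
    show "indicator {0<..<L} x *\<^sub>R \<bar>d (t - x / lam)\<bar> \<le> h (t + (- 1 / lam) * x)" for x
    proof (cases "x \<in> {0<..<L}")
      case True
      then have "x / lam < L / lam" using lam by (simp add: divide_strict_right_mono)
      then have "- L / lam < t - x / lam" using t by simp
      from d[OF this] show ?thesis using True by simp
    qed (use h(2) in simp)
  qed (rule h(2))
  also have "\<dots> = lam * (LINT s|lborel. h s)"
    using lborel_integral_real_affine[OF c, of h t] lam by simp
  finally show ?thesis .
qed

lemma L1_norm_profile_eq:
  fixes d :: "real \<Rightarrow> real"
  assumes lam: "lam > 0"
  shows "lam * (LINT s|lborel. \<bar>d s\<bar> * indicator {- L / lam<..0} s) = L1_norm {0<..<L} (\<lambda>x. d (- x / lam))"
proof -
  let ?k = "\<lambda>s. \<bar>d s\<bar> * indicator {- L / lam<..0} s"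
  have c: "- 1 / lam \<noteq> 0" using lam by simp
  have "lam * (LINT s|lborel. ?k s) = (LINT x|lborel. ?k (0 + (- 1 / lam) * x))"
    using lborel_integral_real_affine[OF c, of ?k 0] lam by simp
  also have "\<dots> = (LINT x|lborel. indicator {0<..<L} x *\<^sub>R \<bar>d (- x / lam)\<bar>)"
  \<comment> \<open>The half-open parameter interval corresponds to the arc together with x = 0, a
    single point that is discarded.\<close>
  proof (rule integral_discrete_difference[of "{0}"])
    fix x :: real assume "x \<notin> {0}"
    then have "0 + (- 1 / lam) * x \<in> {- L / lam<..0} \<longleftrightarrow> x \<in> {0<..<L}" using lam by (auto simp: field_simps)
    then have "indicator {- L / lam<..0} (0 + (- 1 / lam) * x) = (indicator {0<..<L} x :: real)"
      unfolding indicator_def by simp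
    then show "?k (0 + (- 1 / lam) * x) = indicator {0<..<L} x *\<^sub>R \<bar>d (- x / lam)\<bar>" by simp
  qed auto
  finally show ?thesis unfolding L1_norm_def set_lebesgue_integral_def .
qed

context transport_network
begin

definition smooth_inflow :: "(nat \<Rightarrow> real \<Rightarrow> real) \<Rightarrow> nat \<Rightarrow> real \<Rightarrow> real" where
  "smooth_inflow p i s = 1 / vel i * (\<Sum>j\<in>Inc. \<gamma> i j * (vel j * p j (1 * s + - (L j / vel j))))"

text \<open>On an outgoing arc the data profile will vanish for s >= 0 and the inflow for s <= 0, so
  the plain sum performs the gluing that \<open>Qout\<close> needs a cut-off for, and it stays twice
  differentiable.\<close>

definition smooth_transport :: "(nat \<Rightarrow> real \<Rightarrow> real) \<Rightarrow> nat \<Rightarrow> real \<Rightarrow> real" where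
  "smooth_transport p i s = p i s + of_bool (i \<in> Out) * smooth_inflow p i s"

lemma smooth_transport_initial:
  assumes p: "\<And>j s. j \<in> Inc \<Longrightarrow> s \<le> - L j / vel j \<Longrightarrow> p j s = 0" and s: "s \<le> 0"
  shows "smooth_transport p i s = p i s"
proof -
  have "p j (1 * s + - (L j / vel j)) = 0" if "j \<in> Inc" for j by (rule p[OF that]) (use s in simp)
  then have "smooth_inflow p i s = 0" by (simp add: smooth_inflow_def)
  then show ?thesis by (simp add: smooth_transport_def)
qed

text \<open>The boundary datum of the incoming arcs is reproduced exactly, so the only source of
  error is the initial datum, and transport merely moves it. Its mass reaches each outgoing arc once
  more, weighted with \<open>\<gamma> i j\<close>, which produces the second term of the constant;
  time does not enter.\<close>

lemma smooth_transport_deviation: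
  assumes \<gamma>: "\<And>i j. i \<in> Out \<Longrightarrow> j \<in> Inc \<Longrightarrow> \<gamma> i j \<ge> 0"
    and p: "\<And>i. i \<in> Inc \<union> Out \<Longrightarrow> C2b (p i)"
    and pB: "\<And>j s. j \<in> Inc \<Longrightarrow> s \<ge> 0 \<Longrightarrow> p j s = B j" and pO: "\<And>i s. i \<in> Out \<Longrightarrow> s \<ge> 0 \<Longrightarrow> p i s = 0"
    and p0: "\<And>j s. j \<in> Inc \<Longrightarrow> s \<le> - L j / vel j \<Longrightarrow> p j s = 0"
    and \<eta>: "\<And>i. i \<in> Inc \<union> Out \<Longrightarrow> L1_norm {0<..<L i} (\<lambda>x. p i (- x / vel i) - u0 i x) \<le> \<eta>" and t: "t \<ge> 0"
  shows "L1_dist_network (Inc \<union> Out) L (\<lambda>i x. smooth_transport p i (t - x / vel i)) (\<lambda>i x. U i (x, t))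
    \<le> (real (card (Inc \<union> Out)) + (\<Sum>i\<in>Out. \<Sum>j\<in>Inc. \<gamma> i j)) * \<eta>"
proof -
  \<comment> \<open>The interval includes s = 0, where \<open>Q\<close> still takes the initial
    datum while the smooth profile already has the boundary value.\<close>
  define k where "k i s = \<bar>p i s - Q i s\<bar> * indicator {- L i / vel i<..0} s" for i s
  have k0: "k i s \<ge> 0" for i s by (simp add: k_def)
  have kint: "integrable lborel (k i)" if i: "i \<in> Inc \<union> Out" for i
  proof -
    obtain M1 where M1: "\<And>x. \<bar>p i x\<bar> \<le> M1" using C2b_bounded[OF p[OF i]] by blast
    obtain M2 where M2: "\<And>x. \<bar>Q i x\<bar> \<le> M2" using bounded_mono_diff_bounded[OF Q_bounded_mono_diff[OF i]] by blast
    show ?thesis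
    proof (rule integrable_bounded_support[where A = "{- L i / vel i<..0}" and M = "M1 + M2"])
      show "k i \<in> borel_measurable borel"
        unfolding k_def[abs_def] using C2b_borel[OF p[OF i]] Q_borel[OF i] by measurable
      show "\<bar>k i s\<bar> \<le> M1 + M2" for s
        using M1[of s] M2[of s] abs_ge_zero[of "p i s"] by (auto simp: k_def indicator_def)
    qed (auto simp: k_def)
  qed
  have kn: "vel i * (LINT s|lborel. k i s) \<le> \<eta>" if i: "i \<in> Inc \<union> Out" for i
  proof -
    have "vel i * (LINT s|lborel. k i s) = L1_norm {0<..<L i} (\<lambda>x. p i (- x / vel i) - Q i (- x / vel i))"
      unfolding k_def using L1_norm_profile_eq[OF vpos[OF i], of "\<lambda>s. p i s - Q i s" "L i"] by simp
    also have "\<dots> = L1_norm {0<..<L i} (\<lambda>x. p i (- x / vel i) - u0 i x)"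
      unfolding L1_norm_def
    proof (rule set_lborel_integral_cong_AE)
      have m: "(\<lambda>x. p i (- x / vel i)) \<in> borel_measurable borel" "(\<lambda>x. Q i (- x / vel i)) \<in> borel_measurable borel"
        using C2b_borel[OF p[OF i]] Q_borel[OF i] by measurable
      then show "set_borel_measurable lborel {0<..<L i} (\<lambda>x. \<bar>p i (- x / vel i) - Q i (- x / vel i)\<bar>)"
        unfolding set_borel_measurable_def by measurable
      have u: "(\<lambda>x. indicator {0<..<L i} x *\<^sub>R u0 i x) \<in> borel_measurable lborel"
        using L1_measurable[OF u0L1[OF i]] unfolding set_borel_measurable_def .
      have "(\<lambda>x. indicator {0<..<L i} x *\<^sub>R \<bar>p i (- x / vel i) - indicator {0<..<L i} x *\<^sub>R u0 i x\<bar>) \<in> borel_measurable lborel"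
        using m(1) u by measurable
      then show "set_borel_measurable lborel {0<..<L i} (\<lambda>x. \<bar>p i (- x / vel i) - u0 i x\<bar>)"
        unfolding set_borel_measurable_def
        by (rule subst[where P = "\<lambda>f. f \<in> borel_measurable lborel", rotated]) (auto simp: indicator_def)
      show "AE x in lborel. x \<in> {0<..<L i} \<longrightarrow> \<bar>p i (- x / vel i) - Q i (- x / vel i)\<bar> = \<bar>p i (- x / vel i) - u0 i x\<bar>"
        using Q_u0[OF i] by eventually_elim simp
    qed
    also have "\<dots> \<le> \<eta>" by (rule \<eta>[OF i])
    finally show ?thesis .
  qed
  have inc: "\<bar>p j s - Q j s\<bar> \<le> k j s" if j: "j \<in> Inc" and s: "- L j / vel j < s" for j s
    using pB[OF j, of s] Q_inc_pos[OF j, of s] s by (cases "s \<le> 0") (auto simp: k_def)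
  \<comment> \<open>A majorant of the deviation: the error of the arc itself and, on outgoing arcs,
    the shifted errors arriving from the incoming ones. The factors \<open>vel\<close> turn
    integrals over s into L^1 norms over arcs.\<close>
  define h where "h i s = k i s + of_bool (i \<in> Out) * (1 / vel i * (\<Sum>j\<in>Inc. \<gamma> i j * (vel j * k j (- (L j / vel j) + 1 * s))))" for i s
  have h0: "h i s \<ge> 0" if i: "i \<in> Inc \<union> Out" for i s
  proof -
    have "0 \<le> \<gamma> i j * (vel j * k j (- (L j / vel j) + 1 * s))" if "i \<in> Out" "j \<in> Inc" for j
      using \<gamma>[OF that] vpos[of j] that(2) k0 by simp
    then have "0 \<le> (\<Sum>j\<in>Inc. \<gamma> i j * (vel j * k j (- (L j / vel j) + 1 * s)))" if "i \<in> Out"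
      using that by (intro sum_nonneg) blast
    then have "0 \<le> of_bool (i \<in> Out) * (1 / vel i * (\<Sum>j\<in>Inc. \<gamma> i j * (vel j * k j (- (L j / vel j) + 1 * s))))"
      using vpos[OF i] by simp
    then show ?thesis unfolding h_def by (rule add_nonneg_nonneg[OF k0])
  qed
  have shift: "integrable lborel (\<lambda>s. k j (- (L j / vel j) + 1 * s))" if "j \<in> Inc" for j
    by (rule lborel_integrable_real_affine) (use kint that in auto)
  have sint: "integrable lborel (\<lambda>s. \<Sum>j\<in>Inc. \<gamma> i j * (vel j * k j (- (L j / vel j) + 1 * s)))" for i
    by (rule Bochner_Integration.integrable_sum, rule integrable_mult_right, rule integrable_mult_right, rule shift)
  have hint: "integrable lborel (h i)" if i: "i \<in> Inc \<union> Out" for i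
    unfolding h_def[abs_def] by (rule Bochner_Integration.integrable_add[OF kint[OF i]], rule integrable_mult_right, rule integrable_mult_right, rule sint)
  have hv: "vel i * (LINT s|lborel. h i s) \<le> \<eta> + of_bool (i \<in> Out) * ((\<Sum>j\<in>Inc. \<gamma> i j) * \<eta>)" if i: "i \<in> Inc \<union> Out" for i
  proof -
    let ?S = "\<lambda>s. \<Sum>j\<in>Inc. \<gamma> i j * (vel j * k j (- (L j / vel j) + 1 * s))"
    have "(LINT s|lborel. h i s) = (LINT s|lborel. k i s) + (LINT s|lborel. of_bool (i \<in> Out) * (1 / vel i * ?S s))"
      unfolding h_def by (rule Bochner_Integration.integral_add[OF kint[OF i]], rule integrable_mult_right, rule integrable_mult_right, rule sint)
    also have "(LINT s|lborel. of_bool (i \<in> Out) * (1 / vel i * ?S s)) = of_bool (i \<in> Out) * (1 / vel i * (LINT s|lborel. ?S s))"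
      by (simp only: integral_mult_right_zero)
    also have "(LINT s|lborel. ?S s) = (\<Sum>j\<in>Inc. LINT s|lborel. \<gamma> i j * (vel j * k j (- (L j / vel j) + 1 * s)))"
      by (rule Bochner_Integration.integral_sum, rule integrable_mult_right, rule integrable_mult_right, rule shift)
    also have "\<dots> = (\<Sum>j\<in>Inc. \<gamma> i j * (vel j * (LINT s|lborel. k j s)))"
    proof (rule sum.cong[OF refl])
      fix j
      have "(LINT s|lborel. k j (- (L j / vel j) + 1 * s)) = (LINT s|lborel. k j s)"
        using lborel_integral_real_affine[of 1 "k j" "- (L j / vel j)"] by simp
      then show "(LINT s|lborel. \<gamma> i j * (vel j * k j (- (L j / vel j) + 1 * s))) = \<gamma> i j * (vel j * (LINT s|lborel. k j s))"
        by (simp only: integral_mult_right_zero)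
    qed
    finally have "vel i * (LINT s|lborel. h i s)
      = vel i * (LINT s|lborel. k i s) + of_bool (i \<in> Out) * (\<Sum>j\<in>Inc. \<gamma> i j * (vel j * (LINT s|lborel. k j s)))"
      using vpos[OF i] by (simp add: distrib_left)
    also have "\<dots> \<le> \<eta> + of_bool (i \<in> Out) * ((\<Sum>j\<in>Inc. \<gamma> i j) * \<eta>)"
    proof (rule add_mono[OF kn[OF i]])
      have "(\<Sum>j\<in>Inc. \<gamma> i j * (vel j * (LINT s|lborel. k j s))) \<le> (\<Sum>j\<in>Inc. \<gamma> i j * \<eta>)" if "i \<in> Out"
        by (rule sum_mono, rule mult_left_mono) (use kn \<gamma>[OF that] in auto)
      then show "of_bool (i \<in> Out) * (\<Sum>j\<in>Inc. \<gamma> i j * (vel j * (LINT s|lborel. k j s))) \<le> of_bool (i \<in> Out) * ((\<Sum>j\<in>Inc. \<gamma> i j) * \<eta>)"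
        by (simp add: sum_distrib_right)
    qed
    finally show ?thesis .
  qed
  have dev: "\<bar>smooth_transport p i s - Q i s\<bar> \<le> h i s" if i: "i \<in> Inc \<union> Out" and s: "- L i / vel i < s" for i s
  proof (cases "i \<in> Inc")
    case True
    then have "i \<notin> Out" using disj by auto
    then show ?thesis using inc[OF True s] by (simp add: smooth_transport_def h_def)
  next
    case False
    then have iO: "i \<in> Out" using i by simp
    show ?thesis
    proof (cases "s \<le> 0")
      case True
      have "\<bar>smooth_transport p i s - Q i s\<bar> = k i s"
        using smooth_transport_initial[of p, OF p0 True] s True by (simp add: k_def)
      also have "\<dots> \<le> h i s"
        unfolding h_def using \<gamma>[OF iO] vpos k0 iO by (auto intro!: divide_nonneg_pos sum_nonneg mult_nonneg_nonneg less_imp_le[OF vpos])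
      finally show ?thesis .
    next
      case sp: False
      have "smooth_transport p i s - Q i s = 1 / vel i * (\<Sum>j\<in>Inc. \<gamma> i j * (vel j * (p j (1 * s + - (L j / vel j)) - Q j (s - L j / vel j))))"
        using pO[OF iO, of s] Q_out_pos[OF iO, of s] sp iO
        by (simp add: smooth_transport_def smooth_inflow_def right_diff_distrib sum_subtractf diff_divide_distrib mult.assoc)
      then have "\<bar>smooth_transport p i s - Q i s\<bar> = 1 / vel i * \<bar>\<Sum>j\<in>Inc. \<gamma> i j * (vel j * (p j (1 * s + - (L j / vel j)) - Q j (s - L j / vel j)))\<bar>"
        using vpos[OF i] by (simp add: abs_mult)
      also have "\<dots> \<le> 1 / vel i * (\<Sum>j\<in>Inc. \<gamma> i j * (vel j * k j (- (L j / vel j) + 1 * s)))"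
      proof (rule mult_left_mono)
        show "\<bar>\<Sum>j\<in>Inc. \<gamma> i j * (vel j * (p j (1 * s + - (L j / vel j)) - Q j (s - L j / vel j)))\<bar> \<le> (\<Sum>j\<in>Inc. \<gamma> i j * (vel j * k j (- (L j / vel j) + 1 * s)))"
        proof (rule order_trans[OF sum_abs], rule sum_mono)
          fix j assume j: "j \<in> Inc"
          have "\<bar>p j (- (L j / vel j) + 1 * s) - Q j (- (L j / vel j) + 1 * s)\<bar> \<le> k j (- (L j / vel j) + 1 * s)"
            by (rule inc[OF j]) (use sp in simp)
          then have "\<gamma> i j * (vel j * \<bar>p j (- (L j / vel j) + 1 * s) - Q j (- (L j / vel j) + 1 * s)\<bar>) \<le> \<gamma> i j * (vel j * k j (- (L j / vel j) + 1 * s))"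
            using \<gamma>[OF iO j] vpos[of j] j by (intro mult_left_mono) auto
          moreover have "1 * s + - (L j / vel j) = - (L j / vel j) + 1 * s" "s - L j / vel j = - (L j / vel j) + 1 * s" by auto
          ultimately show "\<bar>\<gamma> i j * (vel j * (p j (1 * s + - (L j / vel j)) - Q j (s - L j / vel j)))\<bar> \<le> \<gamma> i j * (vel j * k j (- (L j / vel j) + 1 * s))"
            using \<gamma>[OF iO j] vpos[of j] j by (simp only: abs_mult abs_of_nonneg abs_of_pos Un_iff simp_thms)
        qed
      qed (use vpos[OF i] in simp)
      also have "\<dots> \<le> h i s" using k0[of i s] iO by (simp add: h_def)
      finally show ?thesis .
    qed
  qed
  have "L1_dist_network (Inc \<union> Out) L (\<lambda>i x. smooth_transport p i (t - x / vel i)) (\<lambda>i x. U i (x, t))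
    \<le> (\<Sum>i\<in>Inc \<union> Out. \<eta> + of_bool (i \<in> Out) * ((\<Sum>j\<in>Inc. \<gamma> i j) * \<eta>))"
    unfolding L1_dist_network_def
  proof (rule sum_mono)
    fix i assume i: "i \<in> Inc \<union> Out"
    have "L1_norm {0<..<L i} (\<lambda>x. smooth_transport p i (t - x / vel i) - U i (x, t)) \<le> vel i * (LINT s|lborel. h i s)"
      unfolding U_def fst_conv snd_conv
      by (rule L1_norm_profile_le[OF hint[OF i] h0[OF i] dev[OF i] vpos[OF i] t])
    also note hv[OF i]
    finally show "L1_norm {0<..<L i} (\<lambda>x. smooth_transport p i (t - x / vel i) - U i (x, t)) \<le> \<eta> + of_bool (i \<in> Out) * ((\<Sum>j\<in>Inc. \<gamma> i j) * \<eta>)" .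
  qed
  also have "\<dots> = real (card (Inc \<union> Out)) * \<eta> + (\<Sum>i\<in>Inc \<union> Out. of_bool (i \<in> Out) * ((\<Sum>j\<in>Inc. \<gamma> i j) * \<eta>))"
    by (simp add: sum.distrib)
  also have "(\<Sum>i\<in>Inc \<union> Out. of_bool (i \<in> Out) * ((\<Sum>j\<in>Inc. \<gamma> i j) * \<eta>)) = (\<Sum>i\<in>Out. (\<Sum>j\<in>Inc. \<gamma> i j) * \<eta>)"
    using fin by (intro sum.mono_neutral_cong_right) auto
  also have "\<dots> = (\<Sum>i\<in>Out. \<Sum>j\<in>Inc. \<gamma> i j) * \<eta>" by (simp add: sum_distrib_right)
  finally show ?thesis by (simp add: distrib_right)
qed

end

text \<open>Encodes the order of limits: C may depend on \<open>\<eta>\<close>, so n goes to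
  infinity for fixed \<open>\<eta>\<close>, which is chosen beforehand from the target
  accuracy.\<close>

lemma tendsto_zero_of_bounds:
  fixes a b :: "nat \<Rightarrow> real"
  assumes nn: "\<And>n. a n \<ge> 0" and b: "b \<longlonglongrightarrow> 0" and \<epsilon>: "\<epsilon> \<longlonglongrightarrow> 0" and M: "M \<ge> 0" "c \<ge> 0"
    and bound: "\<And>\<eta>. \<eta> > 0 \<Longrightarrow> \<exists>C. \<forall>n. a n \<le> M * (b n + C * \<epsilon> n + c * \<eta>)"
  shows "a \<longlonglongrightarrow> 0"
proof (rule LIMSEQ_I)
  fix e :: real assume e: "e > 0"
  \<comment> \<open>Makes the part that does not decay in n at most e / 2; the summand 1 covers the
    case M c = 0.\<close>
  define \<eta> where "\<eta> = e / (2 * (M * c + 1))"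
  have p: "M * c + 1 > 0" using mult_nonneg_nonneg[OF M] by linarith
  have \<eta>: "\<eta> > 0" unfolding \<eta>_def using e p by simp
  have "M * c * \<eta> \<le> (M * c + 1) * \<eta>" using \<eta> by simp
  also have "\<dots> = e / 2" unfolding \<eta>_def using p by (simp add: field_simps)
  finally have small: "M * c * \<eta> \<le> e / 2" .
  obtain C where C: "\<And>n. a n \<le> M * (b n + C * \<epsilon> n + c * \<eta>)" using bound[OF \<eta>] by blast
  have "(\<lambda>n. M * (b n + C * \<epsilon> n)) \<longlonglongrightarrow> M * (0 + C * 0)" by (intro tendsto_intros b \<epsilon>)
  then have "(\<lambda>n. M * (b n + C * \<epsilon> n)) \<longlonglongrightarrow> 0" by simp
  from LIMSEQ_D[OF this, of "e / 2"] e obtain N where N: "\<And>n. n \<ge> N \<Longrightarrow> norm (M * (b n + C * \<epsilon> n) - 0) < e / 2" by auto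
  show "\<exists>N. \<forall>n\<ge>N. norm (a n - 0) < e"
  proof (intro exI allI impI)
    fix n assume "N \<le> n"
    from N[OF this] have "M * (b n + C * \<epsilon> n) < e / 2" by simp
    moreover have "a n \<le> M * (b n + C * \<epsilon> n) + M * c * \<eta>" using C[of n] by (simp add: algebra_simps)
    ultimately show "norm (a n - 0) < e" using small nn[of n] by simp
  qed
qed

context transport_network
begin

section \<open>Passage to the limit of vanishing viscosity\<close>

lemma U_slice_L1: "i \<in> Inc \<union> Out \<Longrightarrow> L1 {0<..<L i} (\<lambda>x. U i (x, t))"
proof -
  assume i: "i \<in> Inc \<union> Out"
  obtain M where M: "\<And>x. \<bar>Q i x\<bar> \<le> M" using bounded_mono_diff_bounded[OF Q_bounded_mono_diff[OF i]] by blast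
  show ?thesis unfolding U_def fst_conv snd_conv
  proof (rule L1_bounded_borel)
    show "(\<lambda>x. Q i (t - x / vel i)) \<in> borel_measurable borel" using Q_borel[OF i] by measurable
  qed (rule M)
qed

lemma rectangle_distance:
  assumes i: "i \<in> Inc \<union> Out" and u: "L1 ({0<..<L i} \<times> {0<..<T}) u"
    "AE z in lborel. z \<in> {0<..<L i} \<times> {0<..<T} \<longrightarrow> u z = U i z"
    and wm: "set_borel_measurable lborel ({0<..<L i} \<times> {0<..}) w" and c: "c \<ge> 0"
    and sl: "\<And>t. t \<in> {0<..<T} \<Longrightarrow> L1 {0<..<L i} (\<lambda>x. w (x, t)) \<and> L1_norm {0<..<L i} (\<lambda>x. w (x, t) - U i (x, t)) \<le> c"
  shows "L1 ({0<..<L i} \<times> {0<..<T}) w" "L1_norm ({0<..<L i} \<times> {0<..<T}) (\<lambda>z. w z - u z) \<le> T * c"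
proof -
  let ?R = "{0<..<L i} \<times> {0<..<T}"
  have RS: "?R \<in> sets lborel" using borel_open[OF open_Times[OF open_greaterThanLessThan open_greaterThanLessThan]] by simp
  have wR: "set_borel_measurable lborel ?R w"
    by (rule set_borel_measurable_subset[OF wm RS]) auto
  have um: "(\<lambda>z. indicator ?R z *\<^sub>R U i z) \<in> borel_measurable lborel"
    using L1_measurable[OF U_L1[OF i]] unfolding set_borel_measurable_def .
  have "(\<lambda>z. indicator ?R z *\<^sub>R w z - indicator ?R z *\<^sub>R U i z) \<in> borel_measurable lborel"
    using wR um unfolding set_borel_measurable_def by (rule borel_measurable_diff)
  then have dm: "set_borel_measurable lborel ?R (\<lambda>z. w z - U i z)"
    unfolding set_borel_measurable_def by (simp only: scaleR_diff_right)
  have sl': "L1 {0<..<L i} (\<lambda>x. w (x, t) - U i (x, t)) \<and> L1_norm {0<..<L i} (\<lambda>x. w (x, t) - U i (x, t)) \<le> c" if "t \<in> {0<..<T}" for t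
    using sl[OF that] L1_diff[OF _ U_slice_L1[OF i]] by blast
  note R = L1_rectangle_bound[OF dm T c sl']
  have "set_integrable lborel ?R (\<lambda>z. (w z - U i z) + U i z)"
    using R(1) U_L1[OF i] unfolding L1_def by (rule set_integral_add)
  then show w1: "L1 ?R w" unfolding L1_def by simp
  have "L1_norm ?R (\<lambda>z. w z - u z) = L1_norm ?R (\<lambda>z. w z - U i z)"
    unfolding L1_norm_def
  proof (rule set_lborel_integral_cong_AE)
    show "set_borel_measurable lborel ?R (\<lambda>z. \<bar>w z - u z\<bar>)"
      using set_integrable_abs[OF L1_diff[OF w1 u(1), unfolded L1_def]] unfolding set_integrable_def set_borel_measurable_def
      by (rule borel_measurable_integrable)
    show "set_borel_measurable lborel ?R (\<lambda>z. \<bar>w z - U i z\<bar>)"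
      using set_integrable_abs[OF R(1)[unfolded L1_def]] unfolding set_integrable_def set_borel_measurable_def
      by (rule borel_measurable_integrable)
    show "AE z in lborel. z \<in> ?R \<longrightarrow> \<bar>w z - u z\<bar> = \<bar>w z - U i z\<bar>" using u(2) by eventually_elim simp
  qed
  then show "L1_norm ?R (\<lambda>z. w z - u z) \<le> T * c" using R(2) by simp
qed

text \<open>Outgoing arcs receive the boundary value 0 at this stage, since their inflow is added
  afterwards by \<open>smooth_transport\<close>.\<close>

lemma smooth_data:
  assumes \<eta>: "\<eta> > 0"
  shows "\<exists>p. (\<forall>i\<in>Inc \<union> Out. C2b (p i)) \<and> (\<forall>j\<in>Inc. \<forall>s\<ge>0. p j s = B j) \<and> (\<forall>i\<in>Out. \<forall>s\<ge>0. p i s = 0) \<and>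
    (\<forall>j\<in>Inc. \<forall>s\<le>- L j / vel j. p j s = 0) \<and>
    (\<forall>i\<in>Inc \<union> Out. L1_norm {0<..<L i} (\<lambda>x. p i (- x / vel i) - u0 i x) \<le> \<eta>)"
proof -
  have "\<forall>i\<in>Inc \<union> Out. \<exists>P. C2b P \<and> (\<forall>s\<ge>0. P s = (if i \<in> Inc then B i else 0)) \<and> (\<forall>s\<le>- L i / vel i. P s = 0) \<and> L1_norm {0<..<L i} (\<lambda>x. P (- x / vel i) - u0 i x) < \<eta>"
    using smooth_profile[OF u0L1 vpos Lpos \<eta>] by blast
  then obtain p where p: "\<forall>i\<in>Inc \<union> Out. C2b (p i) \<and> (\<forall>s\<ge>0. p i s = (if i \<in> Inc then B i else 0)) \<and> (\<forall>s\<le>- L i / vel i. p i s = 0) \<and> L1_norm {0<..<L i} (\<lambda>x. p i (- x / vel i) - u0 i x) < \<eta>"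
    unfolding bchoice_iff by blast
  have "\<forall>i\<in>Out. \<forall>s\<ge>0. p i s = 0" using p disj by auto
  moreover have "\<forall>j\<in>Inc. \<forall>s\<ge>0. p j s = B j" using p by simp
  ultimately show ?thesis using p less_imp_le by blast
qed

text \<open>Convergence in L^1 bounds the functions and admissibility bounds their derivatives, both
  independently of n; the traces at the outlets are then uniformly bounded, which yields the
  \<open>\<beta>\<close> of the profile estimate.\<close>

lemma admissible_trace_bound:
  assumes adm: "admissible_approx Inc Out L vel K B \<epsilon> u0 v"
  shows "\<exists>\<beta>\<ge>0. \<forall>n. \<forall>i\<in>Out. \<bar>bdry_trace {0<..<L i} (v n i) (L i)\<bar> \<le> \<beta>"
proof -
  from adm obtain C where W: "\<And>n i. i \<in> Inc \<union> Out \<Longrightarrow> W21 {0<..<L i} (v n i)"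
    and tend: "L1_tendsto (Inc \<union> Out) (\<lambda>i. {0<..<L i}) v u0"
    and C: "\<And>n. (\<Sum>i\<in>Inc \<union> Out. L1_norm {0<..<L i} (weak_deriv {0<..<L i} (v n i))) \<le> C"
    unfolding admissible_approx_def by blast
  define a where "a n = (\<Sum>i\<in>Inc \<union> Out. L1_norm {0<..<L i} (\<lambda>x. v n i x - u0 i x))" for n
  have "a \<longlonglongrightarrow> 0" using tend unfolding L1_tendsto_def a_def[abs_def] by blast
  then have "Bseq a" by (rule convergentI[THEN convergent_imp_Bseq])
  then obtain S where S: "\<And>n. \<bar>a n\<bar> \<le> S" unfolding Bseq_def real_norm_def by blast
  have vL: "\<And>n i. i \<in> Inc \<union> Out \<Longrightarrow> L1 {0<..<L i} (v n i)" using tend unfolding L1_tendsto_def by blast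
  define b where "b i = (S + L1_norm {0<..<L i} (u0 i)) / L i + C" for i
  have C0: "C \<ge> 0" using C[of 0] by (rule order_trans[OF sum_nonneg[OF L1_norm_nonneg]])
  have b0: "b i \<ge> 0" if i: "i \<in> Inc \<union> Out" for i
    unfolding b_def using C0 S[of 0] L1_norm_nonneg[of "{0<..<L i}" "u0 i"] Lpos[OF i] by (intro add_nonneg_nonneg divide_nonneg_pos) auto
  have bnd: "\<bar>bdry_trace {0<..<L i} (v n i) (L i)\<bar> \<le> b i" if i: "i \<in> Inc \<union> Out" for i n
  proof -
    have "L1_norm {0<..<L i} (v n i) = L1_norm {0<..<L i} (\<lambda>x. (v n i x - u0 i x) + u0 i x)" by simp
    also have "\<dots> \<le> L1_norm {0<..<L i} (\<lambda>x. v n i x - u0 i x) + L1_norm {0<..<L i} (u0 i)"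
      by (rule L1_norm_triangle[OF L1_diff[OF vL[OF i] u0L1[OF i]] u0L1[OF i]])
    also have "L1_norm {0<..<L i} (\<lambda>x. v n i x - u0 i x) \<le> a n"
      unfolding a_def by (rule member_le_sum[OF i _ fin]) (rule L1_norm_nonneg)
    also have "a n \<le> S" using S[of n] by simp
    finally have 1: "L1_norm {0<..<L i} (v n i) / L i \<le> (S + L1_norm {0<..<L i} (u0 i)) / L i"
      using Lpos[OF i] by (simp add: divide_right_mono)
    have "L1_norm {0<..<L i} (weak_deriv {0<..<L i} (v n i)) \<le> (\<Sum>i\<in>Inc \<union> Out. L1_norm {0<..<L i} (weak_deriv {0<..<L i} (v n i)))"
      by (rule member_le_sum[OF i _ fin]) (rule L1_norm_nonneg)
    then have 2: "L1_norm {0<..<L i} (weak_deriv {0<..<L i} (v n i)) \<le> C" using C[of n] by linarith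
    show ?thesis unfolding b_def using W21_trace_bound[OF W[OF i] Lpos[OF i], of n] 1 2 by linarith
  qed
  show ?thesis
  proof (intro exI[of _ "\<Sum>i\<in>Inc \<union> Out. b i"] conjI allI ballI)
    show "0 \<le> sum b (Inc \<union> Out)" using b0 by (rule sum_nonneg)
    fix n i assume "i \<in> Out"
    then have i: "i \<in> Inc \<union> Out" by simp
    have "b i \<le> sum b (Inc \<union> Out)" by (rule member_le_sum[OF i _ fin]) (use b0 in auto)
    then show "\<bar>bdry_trace {0<..<L i} (v n i) (L i)\<bar> \<le> sum b (Inc \<union> Out)" using bnd[OF i, of n] by linarith
  qed
qed

text \<open>The matrix \<open>c\<close> is the response of the node: \<open>nI\<close> and
  \<open>nO\<close> say that the node values \<open>\<omega> f\<close> solve the limiting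
  transmission system for every vector f of incoming fluxes, and \<open>cO\<close> that outgoing
  arcs receive the prescribed share. Besides symmetry and sign of \<open>K\<close> nothing else
  about the coefficients enters, so their choice is left to linear algebra.\<close>

theorem vanishing_viscosity_limit:
  fixes K c :: "nat \<Rightarrow> nat \<Rightarrow> real"
  defines "\<omega> \<equiv> \<lambda>f i. \<Sum>j\<in>Inc. c i j * f j"
  assumes \<gamma>: "\<And>i j. i \<in> Out \<Longrightarrow> j \<in> Inc \<Longrightarrow> \<gamma> i j \<ge> 0"
    and K: "\<And>i j. i \<in> Inc \<union> Out \<Longrightarrow> j \<in> Inc \<union> Out \<Longrightarrow> K i j = K j i"
      "\<And>i j. i \<in> Inc \<union> Out \<Longrightarrow> j \<in> Inc \<union> Out \<Longrightarrow> i \<noteq> j \<Longrightarrow> K i j \<ge> 0"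
    and cO: "\<And>i j. i \<in> Out \<Longrightarrow> j \<in> Inc \<Longrightarrow> c i j = \<gamma> i j / vel i"
    and nI: "\<And>f i. i \<in> Inc \<Longrightarrow> - f i = (\<Sum>j\<in>Inc \<union> Out. K i j * (\<omega> f j - \<omega> f i))"
    and nO: "\<And>f i. i \<in> Out \<Longrightarrow> (\<Sum>j\<in>Inc. \<gamma> i j * f j) = (\<Sum>j\<in>Inc \<union> Out. K i j * (\<omega> f j - \<omega> f i))"
    and \<epsilon>: "\<And>n. \<epsilon> n > 0" "\<epsilon> \<longlonglongrightarrow> 0" and adm: "admissible_approx Inc Out L vel K B \<epsilon> u0 v"
    and w: "\<And>n. solves_parabolic Inc Out L vel K B (\<epsilon> n) (v n) (w n)"
    and u: "solves_transport Inc Out L vel \<gamma> B u0 T u"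
  shows "L1_tendsto (Inc \<union> Out) (\<lambda>i. {0<..<L i} \<times> {0<..<T}) w u"
proof -
  let ?I = "Inc \<union> Out" and ?R = "\<lambda>i. {0<..<L i} \<times> {0<..<T}"
  have uL: "L1 (?R i) (u i)" if "i \<in> ?I" for i using u that unfolding solves_transport_def BV_def by blast
  note uU = transport_solution_unique[OF u]
  have tend: "L1_tendsto ?I (\<lambda>i. {0<..<L i}) v u0" using adm unfolding admissible_approx_def by blast
  have vL: "L1 {0<..<L i} (v n i)" if "i \<in> ?I" for i n using tend that unfolding L1_tendsto_def by blast
  have wm: "set_borel_measurable lborel ({0<..<L i} \<times> {0<..}) (w n i)" if "i \<in> ?I" for i n
    using w[of n] that unfolding solves_parabolic_def by blast
  have wL: "L1 {0<..<L i} (\<lambda>x. w n i (x, t))" if "i \<in> ?I" "t \<ge> 0" for i n t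
  proof -
    have "W21 {0<..<L i} (\<lambda>x. w n i (x, t))"
      using w[of n] that unfolding solves_parabolic_def C0_W21_def by blast
    then show ?thesis unfolding W21_def is_weak_deriv_def by blast
  qed
  obtain \<beta> where \<beta>: "\<beta> \<ge> 0" "\<And>n i. i \<in> Out \<Longrightarrow> \<bar>bdry_trace {0<..<L i} (v n i) (L i)\<bar> \<le> \<beta>"
    using admissible_trace_bound[OF adm] by blast
  let ?\<Gamma> = "\<Sum>i\<in>Out. \<Sum>j\<in>Inc. \<gamma> i j" and ?m = "real (card ?I)"
  have \<Gamma>: "?\<Gamma> \<ge> 0" using \<gamma> by (intro sum_nonneg) auto
  define a where "a n = (\<Sum>i\<in>?I. L1_norm (?R i) (\<lambda>z. w n i z - u i z))" for n
  have key: "(\<forall>n. \<forall>i\<in>?I. L1 (?R i) (w n i)) \<and> (\<exists>C. \<forall>n. a n \<le> (?m * T) * (L1_dist_network ?I L (v n) u0 + C * \<epsilon> n + (2 * ?m + ?\<Gamma>) * \<eta>))"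
    if \<eta>: "\<eta> > 0" for \<eta>
  proof -
    from smooth_data[OF \<eta>] obtain p where p: "\<And>i. i \<in> ?I \<Longrightarrow> C2b (p i)" and pB: "\<And>j s. j \<in> Inc \<Longrightarrow> s \<ge> 0 \<Longrightarrow> p j s = B j"
      and pO: "\<And>i s. i \<in> Out \<Longrightarrow> s \<ge> 0 \<Longrightarrow> p i s = 0" and p0: "\<And>j s. j \<in> Inc \<Longrightarrow> s \<le> - L j / vel j \<Longrightarrow> p j s = 0"
      and pu: "\<And>i. i \<in> ?I \<Longrightarrow> L1_norm {0<..<L i} (\<lambda>x. p i (- x / vel i) - u0 i x) \<le> \<eta>"
      by blast
    \<comment> \<open>The flux delivered to the node by arc j at time t; \<open>W\<close> below is
      the node response to it and inherits its smoothness in time by linearity.\<close>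
    define f where "f t j = vel j * p j (1 * t + - (L j / vel j))" for t j
    define P where "P = smooth_transport p"
    define W where "W i t = \<omega> (f t) i" for i t
    have fC: "C2b (\<lambda>t. f t j)" if "j \<in> Inc" for j
      unfolding f_def by (rule C2b_cmult, rule C2b_affine, rule p) (use that in simp)
    have PC: "C2b (P i)" if i: "i \<in> ?I" for i
    proof -
      have "C2b (smooth_inflow p i)" unfolding smooth_inflow_def[abs_def]
        by (rule C2b_cmult, rule C2b_sum, rule C2b_cmult, rule fC[unfolded f_def])
      then show ?thesis unfolding P_def smooth_transport_def[abs_def]
        by (rule C2b_add[OF p[OF i] C2b_cmult])
    qed
    have WC: "C2b (W i)" for i
      unfolding W_def[abs_def] \<omega>_def by (rule C2b_sum, rule C2b_cmult, rule fC)
    have Pinc: "P i s = p i s" if "i \<in> Inc" for i s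
      using that disj by (auto simp: P_def smooth_transport_def)
    have Pout: "vel i * P i t = (\<Sum>j\<in>Inc. \<gamma> i j * f t j)" if i: "i \<in> Out" and t: "t > 0" for i t
      using i t pO[OF i, of t] vpos[of i] by (simp add: P_def smooth_transport_def smooth_inflow_def f_def)
    have PW: "W i t = P i t" if i: "i \<in> Out" and t: "t > 0" for i t
    proof -
      have "W i t = (\<Sum>j\<in>Inc. \<gamma> i j * f t j / vel i)" unfolding W_def \<omega>_def by (rule sum.cong) (simp_all add: cO[OF i])
      also have "\<dots> = P i t" unfolding sum_divide_distrib[symmetric] Pout[OF i t, symmetric] using vpos[of i] i by simp
      finally show ?thesis .
    qed
    have nd: "orient Inc i * (- vel i * P i (t - node Inc L i / vel i)) = (\<Sum>j\<in>?I. K i j * (W j t - W i t))"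
      if i: "i \<in> ?I" and t: "t > 0" for i t
    proof (cases "i \<in> Inc")
      case True
      have "orient Inc i * (- vel i * P i (t - node Inc L i / vel i)) = - f t i"
        using True by (simp add: orient_def node_def Pinc f_def)
      then show ?thesis unfolding W_def using nI[OF True, of "f t"] by simp
    next
      case False
      then have iO: "i \<in> Out" using i by simp
      have "orient Inc i * (- vel i * P i (t - node Inc L i / vel i)) = vel i * P i t"
        using False by (simp add: orient_def node_def)
      then show ?thesis unfolding W_def using nO[OF iO, of "f t"] Pout[OF iO t] by simp
    qed
    have PB: "P i t = B i" if "i \<in> Inc" "t > 0" for i t using Pinc[OF that(1)] pB[OF that(1), of t] that(2) by simp
    have "T \<ge> 0" using T by simp
    from viscous_profile_estimate[OF fin disj Lpos vpos K PC WC PB PW nd this \<beta>(1)]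
    obtain C where C: "\<And>eps v w t. 0 < eps \<and> (\<forall>i\<in>?I. L1 {0<..<L i} (v i)) \<and> solves_parabolic Inc Out L vel K B eps v w \<and>
      (\<forall>i\<in>Out. \<bar>bdry_trace {0<..<L i} (v i) (L i)\<bar> \<le> \<beta>) \<and> 0 \<le> t \<and> t \<le> T \<Longrightarrow>
      L1_dist_network ?I L (\<lambda>i x. w i (x, t)) (\<lambda>i x. P i (t - x / vel i)) \<le> L1_dist_network ?I L v (\<lambda>i x. P i (0 - x / vel i)) + C * eps"
      by blast
    have PL: "L1 {0<..<L i} (\<lambda>x. P i (t - x / vel i))" if i: "i \<in> ?I" for i t
    proof -
      obtain M where "\<And>x. \<bar>P i x\<bar> \<le> M" using C2b_bounded[OF PC[OF i]] by blast
      moreover have "(\<lambda>x. P i (t - x / vel i)) \<in> borel_measurable borel" using C2b_borel[OF PC[OF i]] by measurable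
      ultimately show ?thesis by (intro L1_bounded_borel)
    qed
    have P0: "L1_dist_network ?I L u0 (\<lambda>i x. P i (0 - x / vel i)) \<le> ?m * \<eta>"
    proof -
      have "L1_dist_network ?I L u0 (\<lambda>i x. P i (0 - x / vel i)) \<le> (\<Sum>i\<in>?I. \<eta>)"
        unfolding L1_dist_network_def
      proof (rule sum_mono)
        fix i assume i: "i \<in> ?I"
        have "L1_norm {0<..<L i} (\<lambda>x. u0 i x - P i (0 - x / vel i)) = L1_norm {0<..<L i} (\<lambda>x. p i (- x / vel i) - u0 i x)"
        proof (rule L1_norm_cong)
          fix x assume "x \<in> {0<..<L i}"
          then have "- x / vel i \<le> 0" using vpos[OF i] by simp
          from smooth_transport_initial[of p, OF p0 this] have "P i (- x / vel i) = p i (- x / vel i)" unfolding P_def .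
          then show "\<bar>u0 i x - P i (0 - x / vel i)\<bar> = \<bar>p i (- x / vel i) - u0 i x\<bar>" by simp
        qed
        then show "L1_norm {0<..<L i} (\<lambda>x. u0 i x - P i (0 - x / vel i)) \<le> \<eta>" using pu[OF i] by simp
      qed
      then show ?thesis by simp
    qed
    \<comment> \<open>One \<open>?m * \<eta>\<close> is the error of the smooth data at time 0; the
      remaining \<open>(?m + ?\<Gamma>) * \<eta>\<close> is the deviation of the smooth profile from
      \<open>U\<close> at time t.\<close>
    define D where "D n = L1_dist_network ?I L (v n) u0 + C * \<epsilon> n + (2 * ?m + ?\<Gamma>) * \<eta>" for n
    have slice: "L1_dist_network ?I L (\<lambda>i x. w n i (x, t)) (\<lambda>i x. U i (x, t)) \<le> D n" if t: "t \<in> {0<..<T}" for n t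
    proof -
      have t0: "t \<ge> 0" "t \<le> T" using t by auto
      have "L1_dist_network ?I L (\<lambda>i x. w n i (x, t)) (\<lambda>i x. U i (x, t))
        \<le> L1_dist_network ?I L (\<lambda>i x. w n i (x, t)) (\<lambda>i x. P i (t - x / vel i)) + L1_dist_network ?I L (\<lambda>i x. P i (t - x / vel i)) (\<lambda>i x. U i (x, t))"
        by (rule L1_dist_network_triangle[OF wL[OF _ t0(1)] PL U_slice_L1])
      moreover have "L1_dist_network ?I L (\<lambda>i x. w n i (x, t)) (\<lambda>i x. P i (t - x / vel i)) \<le> L1_dist_network ?I L (v n) (\<lambda>i x. P i (0 - x / vel i)) + C * \<epsilon> n"
        by (rule C) (use \<epsilon>(1) vL w \<beta>(2) t0 in blast)
      moreover have "L1_dist_network ?I L (v n) (\<lambda>i x. P i (0 - x / vel i)) \<le> L1_dist_network ?I L (v n) u0 + L1_dist_network ?I L u0 (\<lambda>i x. P i (0 - x / vel i))"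
        by (rule L1_dist_network_triangle[OF vL u0L1 PL])
      moreover have "L1_dist_network ?I L (\<lambda>i x. P i (t - x / vel i)) (\<lambda>i x. U i (x, t)) \<le> (?m + ?\<Gamma>) * \<eta>"
        unfolding P_def by (rule smooth_transport_deviation[OF \<gamma> p pB pO p0 pu t0(1)])
      ultimately show ?thesis unfolding D_def using P0 by (simp add: algebra_simps)
    qed
    have D0: "D n \<ge> 0" for n
    proof -
      have "T / 2 \<in> {0<..<T}" using T by simp
      from slice[OF this, of n] show ?thesis
        unfolding L1_dist_network_def by (rule order_trans[OF sum_nonneg[OF L1_norm_nonneg]])
    qed
    have comp: "L1_norm {0<..<L i} (\<lambda>x. w n i (x, t) - U i (x, t)) \<le> D n" if i: "i \<in> ?I" and t: "t \<in> {0<..<T}" for i n t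
    proof -
      have "L1_norm {0<..<L i} (\<lambda>x. w n i (x, t) - U i (x, t)) \<le> L1_dist_network ?I L (\<lambda>i x. w n i (x, t)) (\<lambda>i x. U i (x, t))"
        unfolding L1_dist_network_def by (rule member_le_sum[OF i _ fin]) (rule L1_norm_nonneg)
      then show ?thesis using slice[OF t, of n] by linarith
    qed
    have R: "L1 (?R i) (w n i)" "L1_norm (?R i) (\<lambda>z. w n i z - u i z) \<le> T * D n" if i: "i \<in> ?I" for i n
    proof -
      have "L1 {0<..<L i} (\<lambda>x. w n i (x, t)) \<and> L1_norm {0<..<L i} (\<lambda>x. w n i (x, t) - U i (x, t)) \<le> D n" if "t \<in> {0<..<T}" for t
        using wL[OF i, of t n] comp[OF i that] that by simp
      note dist = rectangle_distance[OF i uL[OF i] uU[OF i] wm[OF i] D0 this]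
      show "L1 (?R i) (w n i)" by (rule dist(1))
      show "L1_norm (?R i) (\<lambda>z. w n i z - u i z) \<le> T * D n" by (rule dist(2))
    qed
    have "a n \<le> (?m * T) * D n" for n
    proof -
      have "a n \<le> (\<Sum>i\<in>?I. T * D n)" unfolding a_def by (rule sum_mono) (rule R(2))
      then show ?thesis by simp
    qed
    then show ?thesis using R(1) unfolding D_def by blast
  qed
  have "a \<longlonglongrightarrow> 0"
  proof (rule tendsto_zero_of_bounds)
    show "a n \<ge> 0" for n unfolding a_def by (rule sum_nonneg) (rule L1_norm_nonneg)
    show "(\<lambda>n. L1_dist_network ?I L (v n) u0) \<longlonglongrightarrow> 0"
      using tend unfolding L1_tendsto_def L1_dist_network_def by blast
    show "\<exists>C. \<forall>n. a n \<le> (?m * T) * (L1_dist_network ?I L (v n) u0 + C * \<epsilon> n + (2 * ?m + ?\<Gamma>) * \<eta>)" if "\<eta> > 0" for \<eta>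
      using key[OF that] by blast
  qed (use \<epsilon>(2) T \<Gamma> in auto)
  \<comment> \<open>The integrability of \<open>w n i\<close> on the rectangle comes out of the
    estimate for any smoothing parameter; 1 is an arbitrary choice.\<close>
  then show ?thesis unfolding L1_tendsto_def a_def[abs_def] using key[of 1] uL by simp
qed

end

section \<open>Choice of the coefficients and conclusion\<close>

theorem mainTheorem4:
  fixes m :: nat and Inc Out :: "nat set" and L vel :: "nat \<Rightarrow> real"
    and h1 h2 :: nat and \<gamma> :: "nat \<Rightarrow> nat \<Rightarrow> real"
  assumes "Inc \<union> Out = {1..m}" and "Inc \<inter> Out = {}" and "Inc \<noteq> {}"
    and "Out = {h1, h2}" and "h1 \<noteq> h2"
    and "\<And>i. i \<in> {1..m} \<Longrightarrow> L i > 0"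
    and "\<And>i. i \<in> {1..m} \<Longrightarrow> vel i > 0"
    and "\<And>j. j \<in> Inc \<Longrightarrow> 0 < \<gamma> h1 j \<and> \<gamma> h1 j < 1"
    and "\<And>j. j \<in> Inc \<Longrightarrow> \<gamma> h2 j = 1 - \<gamma> h1 j"
  shows "\<exists>k0>0. \<forall>k. 0 < k \<and> k < k0 \<longrightarrow>
    (\<exists>\<kappa> :: nat \<Rightarrow> real. (\<forall>i\<in>Inc. \<kappa> i > 0) \<and>
      (\<forall>K :: nat \<Rightarrow> nat \<Rightarrow> real.
        (\<forall>i\<in>{1..m}. \<forall>j\<in>{1..m}. K i j = K j i) \<and>
        (\<forall>i\<in>{1..m}. K i i \<ge> 0) \<and>
        (\<forall>i\<in>Inc. K i h1 = \<kappa> i \<and> K i h2 = k) \<and>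
        (\<forall>i\<in>Inc. \<forall>j\<in>Inc. i \<noteq> j \<longrightarrow> K i j = 0) \<and>
        (\<forall>i\<in>Out. \<forall>j\<in>Out. i \<noteq> j \<longrightarrow> K i j = 0) \<longrightarrow>
        (\<forall>(u0 :: nat \<Rightarrow> real \<Rightarrow> real) (B :: nat \<Rightarrow> real) (T :: real).
          (\<forall>i\<in>{1..m}. BV {0<..<L i} (u0 i)) \<and> T > 0 \<longrightarrow>
          (\<exists>u. solves_transport Inc Out L vel \<gamma> B u0 T u) \<and>
          (\<forall>u \<epsilon> v w.
            solves_transport Inc Out L vel \<gamma> B u0 T u \<and>
            decseq \<epsilon> \<and> (\<forall>n. \<epsilon> n > 0) \<and> \<epsilon> \<longlonglongrightarrow> 0 \<and>
            admissible_approx Inc Out L vel K B \<epsilon> u0 v \<and>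
            (\<forall>n. solves_parabolic Inc Out L vel K B (\<epsilon> n) (v n) (w n)) \<longrightarrow>
            L1_tendsto {1..m} (\<lambda>i. {0<..<L i} \<times> {0<..<T}) w u))))"
  (is "\<exists>k0>0. \<forall>k. 0 < k \<and> k < k0 \<longrightarrow> (\<exists>\<kappa>. ?pos \<kappa> \<and> (\<forall>K. ?coefficients k \<kappa> K \<longrightarrow> ?limit K))")
proof -
  have mem: "Inc \<subseteq> {1..m}" "h1 \<in> {1..m}" "h2 \<in> {1..m}" and hO: "h1 \<notin> Inc" "h2 \<notin> Inc" using assms(1,2,4) by auto
  have finI: "finite Inc" using finite_subset[OF mem(1)] by simp
  have sumI: "(\<Sum>j\<in>Inc \<union> Out. F j) = (\<Sum>j\<in>Inc. F j) + F h1 + F h2" for F :: "nat \<Rightarrow> real"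
  proof -
    have "(\<Sum>j\<in>Inc \<union> Out. F j) = (\<Sum>j\<in>Inc. F j) + (\<Sum>j\<in>Out. F j)"
      by (rule sum.union_disjoint) (use finI assms(2,4) in auto)
    then show ?thesis using assms(4,5) by simp
  qed
  have vh: "vel h1 > 0" "vel h2 > 0" using assms(7) mem by auto
  \<comment> \<open>The threshold depends only on \<open>Inc\<close>, \<open>\<gamma> h1\<close> and
    the two outgoing speeds, so it is fixed before the matrix K and all data.\<close>
  obtain k0 where k0: "k0 > 0" and k: "\<And>k. 0 < k \<and> k < k0 \<Longrightarrow> \<exists>\<kappa>. (\<forall>i\<in>Inc. \<kappa> i > 0) \<and>
    (\<forall>f w1 w2. w1 = (\<Sum>j\<in>Inc. \<gamma> h1 j * f j) / vel h1 \<longrightarrow> w2 = (\<Sum>j\<in>Inc. (1 - \<gamma> h1 j) * f j) / vel h2 \<longrightarrow>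
      (\<Sum>j\<in>Inc. \<kappa> j * ((f j + \<kappa> j * w1 + k * w2) / (\<kappa> j + k) - w1)) = (\<Sum>j\<in>Inc. \<gamma> h1 j * f j) \<and>
      (\<Sum>j\<in>Inc. k * ((f j + \<kappa> j * w1 + k * w2) / (\<kappa> j + k) - w2)) = (\<Sum>j\<in>Inc. (1 - \<gamma> h1 j) * f j))"
    using node_coefficients[OF finI vh, of "\<gamma> h1"] assms(8) by blast
  show ?thesis
  proof (intro exI[of _ k0] conjI allI impI k0)
    fix k :: real assume k_: "0 < k \<and> k < k0"
    obtain \<kappa> where \<kappa>: "\<And>i. i \<in> Inc \<Longrightarrow> \<kappa> i > 0" and bal: "\<And>f w1 w2. w1 = (\<Sum>j\<in>Inc. \<gamma> h1 j * f j) / vel h1 \<Longrightarrow> w2 = (\<Sum>j\<in>Inc. (1 - \<gamma> h1 j) * f j) / vel h2 \<Longrightarrow>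
      (\<Sum>j\<in>Inc. \<kappa> j * ((f j + \<kappa> j * w1 + k * w2) / (\<kappa> j + k) - w1)) = (\<Sum>j\<in>Inc. \<gamma> h1 j * f j) \<and>
      (\<Sum>j\<in>Inc. k * ((f j + \<kappa> j * w1 + k * w2) / (\<kappa> j + k) - w2)) = (\<Sum>j\<in>Inc. (1 - \<gamma> h1 j) * f j)"
      using k[OF k_] by blast
    have kp: "k > 0" using k_ by simp
    have limit: "?limit K" if Kc: "?coefficients k \<kappa> K" for K
    proof (intro allI impI)
      fix u0 :: "nat \<Rightarrow> real \<Rightarrow> real" and B :: "nat \<Rightarrow> real" and T :: real
      assume bv: "(\<forall>i\<in>{1..m}. BV {0<..<L i} (u0 i)) \<and> T > 0"
      have Ksym: "K i j = K j i" if "i \<in> Inc \<union> Out" "j \<in> Inc \<union> Out" for i j using Kc that unfolding assms(1) by blast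
      have KI: "K i h1 = \<kappa> i" "K i h2 = k" if "i \<in> Inc" for i using Kc that by auto
      have KO: "K h1 i = \<kappa> i" "K h2 i = k" if "i \<in> Inc" for i
        using Ksym[of h1 i] Ksym[of h2 i] KI[OF that] that assms(4) by auto
      have KII: "K i j = 0" if "i \<in> Inc" "j \<in> Inc" "i \<noteq> j" for i j using Kc that by blast
      have KOO: "K i j = 0" if "i \<in> Out" "j \<in> Out" "i \<noteq> j" for i j using Kc that by blast
      have Knn: "K i j \<ge> 0" if "i \<in> Inc \<union> Out" "j \<in> Inc \<union> Out" "i \<noteq> j" for i j
      proof (cases "i \<in> Inc")
        case True
        then show ?thesis using that KI[OF True] KII[OF True, of j] \<kappa>[OF True] kp assms(4) by (cases "j \<in> Inc") auto
      next
        case False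
        then have "i \<in> Out" using that by simp
        then show ?thesis using that KO[of j] KOO[of i j] \<kappa>[of j] kp assms(4) by (cases "j \<in> Inc") auto
      qed
      \<comment> \<open>The explicit solution is built from pointwise values, so each BV datum is
        first replaced by a difference of bounded monotone functions equal to it almost everywhere
        on its arc.\<close>
      have "\<forall>i\<in>{1..m}. \<exists>F. bounded_mono_diff F \<and> (AE x in lborel. x \<in> {0<..<L i} \<longrightarrow> u0 i x = F x)"
      proof
        fix i assume i: "i \<in> {1..m}"
        have "0 \<le> L i" using assms(6)[OF i] by simp
        from BV_mono_difference[OF bspec[OF conjunct1[OF bv] i] this]
        obtain M1 M2 C where M: "mono M1" "mono M2" "\<forall>x. \<bar>M1 x\<bar> \<le> C \<and> \<bar>M2 x\<bar> \<le> C"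
          "AE x in lborel. x \<in> {0<..<L i} \<longrightarrow> u0 i x = M1 x - M2 x" by blast
        have "bounded_mono_diff (\<lambda>x. M1 x - M2 x)" by (rule bounded_mono_diffI[OF M(1,2)]) (use M(3) in auto)
        then show "\<exists>F. bounded_mono_diff F \<and> (AE x in lborel. x \<in> {0<..<L i} \<longrightarrow> u0 i x = F x)" using M(4) by blast
      qed
      then obtain F where F: "\<forall>i\<in>{1..m}. bounded_mono_diff (F i) \<and> (AE x in lborel. x \<in> {0<..<L i} \<longrightarrow> u0 i x = F i x)"
        unfolding bchoice_iff by blast
      interpret transport_network Inc Out L vel \<gamma> B u0 F T
        by unfold_locales (use assms(2,6,7) bv F in \<open>auto simp: assms(1) BV_def\<close>)
      \<comment> \<open>On an incoming arc the limiting node equation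
        \<open>- f i = \<kappa> i * (w1 - w i) + k * (w2 - w i)\<close> is solved for the node
        value, with w1 and w2 the values prescribed on the two outgoing arcs; the Kronecker term
        carries the flux of the arc itself.\<close>
      define c where "c i j = (if i \<in> Inc then ((if j = i then 1 else 0) + \<kappa> i * (\<gamma> h1 j / vel h1) + k * (\<gamma> h2 j / vel h2)) / (\<kappa> i + k) else \<gamma> i j / vel i)" for i j
      let ?\<omega> = "\<lambda>f i. \<Sum>j\<in>Inc. c i j * f j"
      have \<omega>h: "?\<omega> f h1 = (\<Sum>j\<in>Inc. \<gamma> h1 j * f j) / vel h1" "?\<omega> f h2 = (\<Sum>j\<in>Inc. (1 - \<gamma> h1 j) * f j) / vel h2" for f
        using hO assms(9) by (simp_all add: c_def sum_divide_distrib)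
      have \<omega>i: "?\<omega> f i = (f i + \<kappa> i * ?\<omega> f h1 + k * ?\<omega> f h2) / (\<kappa> i + k)" if i: "i \<in> Inc" for f i
      proof -
        have "?\<omega> f i = (\<Sum>j\<in>Inc. ((if j = i then f j else 0) + \<kappa> i * (c h1 j * f j) + k * (c h2 j * f j)) / (\<kappa> i + k))"
        proof (rule sum.cong[OF refl])
          fix j
          have "c i j * f j = (((if j = i then 1 else 0) + \<kappa> i * c h1 j + k * c h2 j) * f j) / (\<kappa> i + k)"
            using i hO by (simp add: c_def)
          then show "c i j * f j = ((if j = i then f j else 0) + \<kappa> i * (c h1 j * f j) + k * (c h2 j * f j)) / (\<kappa> i + k)"
            by (simp add: distrib_right)
        qed
        also have "\<dots> = (f i + \<kappa> i * ?\<omega> f h1 + k * ?\<omega> f h2) / (\<kappa> i + k)"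
          unfolding sum_divide_distrib[symmetric] sum.distrib sum_distrib_left[symmetric] using i finI by simp
        finally show ?thesis .
      qed
      have nodeI: "- f i = (\<Sum>j\<in>Inc \<union> Out. K i j * (?\<omega> f j - ?\<omega> f i))" if i: "i \<in> Inc" for f i
      proof -
        have "(\<Sum>j\<in>Inc. K i j * (?\<omega> f j - ?\<omega> f i)) = 0"
        proof (rule sum.neutral, rule ballI)
          fix j assume "j \<in> Inc"
          then show "K i j * (?\<omega> f j - ?\<omega> f i) = 0" using KII[OF i, of j] by (cases "j = i") auto
        qed
        then have "(\<Sum>j\<in>Inc \<union> Out. K i j * (?\<omega> f j - ?\<omega> f i)) = \<kappa> i * (?\<omega> f h1 - ?\<omega> f i) + k * (?\<omega> f h2 - ?\<omega> f i)"
          unfolding sumI using KI[OF i] by simp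
        also have "\<dots> = \<kappa> i * ?\<omega> f h1 + k * ?\<omega> f h2 - (\<kappa> i + k) * ?\<omega> f i" by algebra
        also have "(\<kappa> i + k) * ?\<omega> f i = f i + \<kappa> i * ?\<omega> f h1 + k * ?\<omega> f h2"
          unfolding \<omega>i[OF i, of f] using \<kappa>[OF i] kp by simp
        finally show ?thesis by simp
      qed
      have nodeO: "(\<Sum>j\<in>Inc. \<gamma> i j * f j) = (\<Sum>j\<in>Inc \<union> Out. K i j * (?\<omega> f j - ?\<omega> f i))" if i: "i \<in> Out" for f i
      proof -
        \<comment> \<open>The balance is stated for the prescribed outgoing values with the incoming
          ones already eliminated; together with \<open>\<omega>i\<close> it is the pair of outgoing
          node equations.\<close>
        note balance = bal[OF \<omega>h, of f]
        have 1: "(\<Sum>j\<in>Inc \<union> Out. K h1 j * (?\<omega> f j - ?\<omega> f h1)) = (\<Sum>j\<in>Inc. \<gamma> h1 j * f j)"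
        proof -
          have "(\<Sum>j\<in>Inc. K h1 j * (?\<omega> f j - ?\<omega> f h1)) = (\<Sum>j\<in>Inc. \<kappa> j * ((f j + \<kappa> j * ?\<omega> f h1 + k * ?\<omega> f h2) / (\<kappa> j + k) - ?\<omega> f h1))"
            by (rule sum.cong[OF refl]) (simp only: KO \<omega>i)
          then show ?thesis unfolding sumI using conjunct1[OF balance] KOO[of h1 h2] assms(4,5) by simp
        qed
        have 2: "(\<Sum>j\<in>Inc \<union> Out. K h2 j * (?\<omega> f j - ?\<omega> f h2)) = (\<Sum>j\<in>Inc. \<gamma> h2 j * f j)"
        proof -
          have "(\<Sum>j\<in>Inc. K h2 j * (?\<omega> f j - ?\<omega> f h2)) = (\<Sum>j\<in>Inc. k * ((f j + \<kappa> j * ?\<omega> f h1 + k * ?\<omega> f h2) / (\<kappa> j + k) - ?\<omega> f h2))"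
            by (rule sum.cong[OF refl]) (simp only: KO \<omega>i)
          moreover have "(\<Sum>j\<in>Inc. (1 - \<gamma> h1 j) * f j) = (\<Sum>j\<in>Inc. \<gamma> h2 j * f j)"
            by (rule sum.cong[OF refl]) (simp only: assms(9))
          ultimately show ?thesis unfolding sumI using conjunct2[OF balance] KOO[of h2 h1] assms(4,5) by simp
        qed
        have "i = h1 \<or> i = h2" using i assms(4) by simp
        then show ?thesis
        proof
          assume h: "i = h1"
          show ?thesis unfolding h by (rule 1[symmetric])
        next
          assume h: "i = h2"
          show ?thesis unfolding h by (rule 2[symmetric])
        qed
      qed
      have \<gamma>nn: "\<gamma> i j \<ge> 0" if "i \<in> Out" "j \<in> Inc" for i j
        using that assms(4,8,9) by (auto intro: less_imp_le)
      have cOut: "c i j = \<gamma> i j / vel i" if "i \<in> Out" "j \<in> Inc" for i j using that assms(2) by (auto simp: c_def)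
      have "L1_tendsto {1..m} (\<lambda>i. {0<..<L i} \<times> {0<..<T}) w u"
        if "solves_transport Inc Out L vel \<gamma> B u0 T u \<and> decseq \<epsilon> \<and> (\<forall>n. \<epsilon> n > 0) \<and> \<epsilon> \<longlonglongrightarrow> 0 \<and>
          admissible_approx Inc Out L vel K B \<epsilon> u0 v \<and> (\<forall>n. solves_parabolic Inc Out L vel K B (\<epsilon> n) (v n) (w n))"
        for u \<epsilon> v w
        unfolding assms(1)[symmetric]
      proof (rule vanishing_viscosity_limit[where K = K and c = c and \<epsilon> = \<epsilon> and v = v])
        show "\<And>i j. i \<in> Out \<Longrightarrow> j \<in> Inc \<Longrightarrow> \<gamma> i j \<ge> 0" by (rule \<gamma>nn)
        show "\<And>i j. i \<in> Inc \<union> Out \<Longrightarrow> j \<in> Inc \<union> Out \<Longrightarrow> K i j = K j i" by (rule Ksym)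
        show "\<And>i j. i \<in> Inc \<union> Out \<Longrightarrow> j \<in> Inc \<union> Out \<Longrightarrow> i \<noteq> j \<Longrightarrow> K i j \<ge> 0" by (rule Knn)
        show "\<And>i j. i \<in> Out \<Longrightarrow> j \<in> Inc \<Longrightarrow> c i j = \<gamma> i j / vel i" by (rule cOut)
        show "\<And>f i. i \<in> Inc \<Longrightarrow> - f i = (\<Sum>j\<in>Inc \<union> Out. K i j * (?\<omega> f j - ?\<omega> f i))" by (rule nodeI)
        show "\<And>f i. i \<in> Out \<Longrightarrow> (\<Sum>j\<in>Inc. \<gamma> i j * f j) = (\<Sum>j\<in>Inc \<union> Out. K i j * (?\<omega> f j - ?\<omega> f i))" by (rule nodeO)
        show "solves_transport Inc Out L vel \<gamma> B u0 T u" "\<epsilon> \<longlonglongrightarrow> 0" "admissible_approx Inc Out L vel K B \<epsilon> u0 v"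
          using that by simp_all
        show "\<epsilon> n > 0" "solves_parabolic Inc Out L vel K B (\<epsilon> n) (v n) (w n)" for n using that by simp_all
      qed
      then show "(\<exists>u. solves_transport Inc Out L vel \<gamma> B u0 T u) \<and>
          (\<forall>u \<epsilon> v w.
            solves_transport Inc Out L vel \<gamma> B u0 T u \<and>
            decseq \<epsilon> \<and> (\<forall>n. \<epsilon> n > 0) \<and> \<epsilon> \<longlonglongrightarrow> 0 \<and>
            admissible_approx Inc Out L vel K B \<epsilon> u0 v \<and>
            (\<forall>n. solves_parabolic Inc Out L vel K B (\<epsilon> n) (v n) (w n)) \<longrightarrow>
            L1_tendsto {1..m} (\<lambda>i. {0<..<L i} \<times> {0<..<T}) w u)"
        using U_solves by blast
    qed
    show "\<exists>\<kappa>. ?pos \<kappa> \<and> (\<forall>K. ?coefficients k \<kappa> K \<longrightarrow> ?limit K)"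
    proof (rule exI[of _ \<kappa>], rule conjI)
      show "?pos \<kappa>" using \<kappa> by simp
      show "\<forall>K. ?coefficients k \<kappa> K \<longrightarrow> ?limit K" by (rule allI, rule impI, rule limit)
    qed
  qed
qed

end
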